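(* Let $m,n\ge 1$ be integers, let $1\le p_0<\infty$, and let $T$ be an $m$-linear operator with associated kernel $K$ on $\mathbb{R}^n$ satisfying the following two conditions. Boundedness: for all $p_0\le q_1,\ldots,q_m<\infty$ and $0<q<\infty$ with $\frac1{q_1}+\cdots+\frac1{q_m}=\frac1q$, $T$ extends to a bounded operator from $L^{q_1}(\mathbb{R}^n)\times\cdots\times L^{q_m}(\mathbb{R}^n)$ into weak $L^q$, $L^{q,\infty}(\mathbb{R}^n)$. Kernel regularity: there are $\delta_0>n/p_0$ and a constant $C_0>0$ such that, with $p_0'$ the conjugate exponent of $p_0$ (the left side being an essential supremum if $p_0=1$), $$\Big(\int_{S_{j_m}(Q)}\cdots\int_{S_{j_1}(Q)}|K(x,y_1,\ldots,y_m)-K(\overline x,y_1,\ldots,y_m)|^{p_0'}\,dy_1\cdots dy_m\Big)^{1/p_0'}\le C_0\,\frac{|x-\overline x|^{m(\delta_0-n/p_0)}}{|Q|^{m\delta_0/n}}\,2^{-m\delta_0 j_0}$$ for all balls $Q$, all $x,\overline x\in\frac12Q$ and all nonnegative integers $(j_1,\ldots,j_m)\ne(0,\ldots,0)$, where $j_0=\max_k j_k$, $S_j(Q)=2^jQ\setminus2^{j-1}Q$ for $j\ge1$, $S_0(Q)=Q$, and $\lambda Q$ is the ball concentric with $Q$ with radius multiplied by $\lambda$. Let $p_0<p_1,\ldots,p_m<\infty$, let $p$ be given by $\frac1p=\frac1{p_1}+\cdots+\frac1{p_m}$, and let $\vec\omega=(\omega_1,\ldots,\omega_m)\in A_{\vec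 P/p_0}$, where $\vec P/p_0=(p_1/p_0,\ldots,p_m/p_0)$. Put $v_{\vec\omega}=\prod_{j=1}^m\omega_j^{p/p_j}$. Then there is a constant $C$ such that $$\|T(\vec f)\|_{L^p(v_{\vec\omega})}\le C\prod_{j=1}^m\|f_j\|_{L^{p_j}(\omega_j)}$$ for all $\vec f=(f_1,\ldots,f_m)$ with each $f_j$ bounded, measurable, compactly supported and in $L^{p_j}(\omega_j)$ (so that $T$ extends to a bounded operator from $L^{p_1}(\omega_1)\times\cdots\times L^{p_m}(\omega_m)$ into $L^p(v_{\vec\omega})$).
   Context: Setting. $T$ is an $m$-linear operator initially defined on $\mathcal S(\mathbb{R}^n)\times\cdots\times\mathcal S(\mathbb{R}^n)$ with values in $\mathcal S'(\mathbb{R}^n)$. It has an associated kernel $K(x,y_1,\ldots,y_m)$, a function defined off the diagonal $x=y_1=\cdots=y_m$ in $(\mathbb{R}^n)^{m+1}$, such that $$T(f_1,\ldots,f_m)(x)=\int_{(\mathbb{R}^n)^m}K(x,y_1,\ldots,y_m)f_1(y_1)\cdots f_m(y_m)\,dy_1\cdots dy_m$$ for all $f_1,\ldots,f_m\in\mathcal S(\mathbb{R}^n)$ and all $x\notin\bigcap_{j=1}^m\operatorname{supp}f_j$. Multiple weights. A weight is a measurable function that is positive and finite a.e. For $\vec R=(r_1,\ldots,r_m)$ with $1\le r_j<\infty$, $\frac1r=\sum_j\frac1{r_j}$, and weights $\vec\omega=(\omega_1,\ldots,\omega_m)$, one says $\vec\omega\in A_{\vec R}$ if $$\sup_Q\Big(\frac1{|Q|}\int_Q\prod_{j=1}^m\omega_j^{r/r_j}\Big)^{1/r}\prod_{j=1}^m\Big(\frac1{|Q|}\int_Q\omega_j^{1-r_j'}\Big)^{1/r_j'}<\infty,$$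 the supremum being over all balls $Q$; when $r_j=1$ the $j$-th factor is understood as $(\inf_Q\omega_j)^{-1}$. Also $\|f\|_{L^p(v)}=(\int|f|^pv\,dx)^{1/p}$. $T(\vec f)$ for bounded compactly supported $f_j$ is defined through the assumed bounded extension of $T$ to $L^{q_1}(\mathbb{R}^n)\times\cdots\times L^{q_m}(\mathbb{R}^n)$, $p_0\le q_j<\infty$. *)

theory Defs
  imports "HOL-Analysis.Analysis" "HOL-Probability.Essential_Supremum"
begin

text \<open>
  Throughout, \<open>n = CARD('n)\<close>, \<open>m = CARD('m)\<close>, and an \<open>m\<close>-tuple is a function on \<^typ>\<open>'m\<close>.
  Functions are complex-valued and are not identified when they agree almost everywhere.
\<close>

section \<open>Schwartz functions and tempered distributions\<close>

definition partial_deriv :: "'n::finite \<Rightarrow> (real^'n \<Rightarrow> complex) \<Rightarrow> real^'n \<Rightarrow> complex" where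
  "partial_deriv i f x = frechet_derivative f (at x) (axis i 1)"

fun iter_partial :: "'n::finite list \<Rightarrow> (real^'n \<Rightarrow> complex) \<Rightarrow> real^'n \<Rightarrow> complex" where
  "iter_partial [] f = f"
| "iter_partial (i # is) f = partial_deriv i (iter_partial is f)"

definition smooth :: "(real^'n::finite \<Rightarrow> complex) \<Rightarrow> bool" where
  "smooth f \<longleftrightarrow> (\<forall>is x. iter_partial is f differentiable (at x))"

definition schwartz :: "(real^'n::finite \<Rightarrow> complex) set" where
  "schwartz = {f. smooth f \<and>
     (\<forall>N is. bdd_above (range (\<lambda>x. (1 + norm x) ^ N * norm (iter_partial is f x))))}"

definition schwartz_norm :: "nat \<Rightarrow> (real^'n::finite \<Rightarrow> complex) \<Rightarrow> real" where
  "schwartz_norm N f =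
     (\<Sum>is | length is \<le> N. SUP x. (1 + norm x) ^ N * norm (iter_partial is f x))"

text \<open>A functional is a total function, but only its values on \<^term>\<open>schwartz\<close> matter.\<close>

definition tempered_distribution :: "((real^'n::finite \<Rightarrow> complex) \<Rightarrow> complex) \<Rightarrow> bool" where
  "tempered_distribution L \<longleftrightarrow>
     (\<forall>\<phi>\<in>schwartz. \<forall>\<psi>\<in>schwartz. \<forall>a b.
        L (\<lambda>x. a * \<phi> x + b * \<psi> x) = a * L \<phi> + b * L \<psi>) \<and>
     (\<exists>N C. \<forall>\<phi>\<in>schwartz. norm (L \<phi>) \<le> C * schwartz_norm N \<phi>)"

definition supp :: "(real^'n::finite \<Rightarrow> complex) \<Rightarrow> (real^'n) set" where
  "supp f = closure {x. f x \<noteq> 0}"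

section \<open>Multilinear operators with an associated kernel\<close>

text \<open>
  The filter states where values are compared: for \<open>principal schwartz\<close> the values are
  functionals on Schwartz functions, for \<open>ae_filter lebesgue\<close> they are functions modulo null sets.
\<close>

definition multilinear_on ::
  "'z filter \<Rightarrow> ('m \<Rightarrow> ('a \<Rightarrow> complex) set) \<Rightarrow> (('m \<Rightarrow> 'a \<Rightarrow> complex) \<Rightarrow> 'z \<Rightarrow> complex) \<Rightarrow> bool" where
  "multilinear_on F X T \<longleftrightarrow>
     (\<forall>f k u v a b. (\<forall>j. f j \<in> X j) \<longrightarrow> u \<in> X k \<longrightarrow> v \<in> X k \<longrightarrow>
        (\<forall>\<^sub>F z in F. T (f(k := \<lambda>x. a * u x + b * v x)) z = a * T (f(k := u)) z + b * T (f(k := v)) z))"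

definition multilinear_schwartz_operator ::
  "(('m \<Rightarrow> real^'n::finite \<Rightarrow> complex) \<Rightarrow> (real^'n \<Rightarrow> complex) \<Rightarrow> complex) \<Rightarrow> bool" where
  "multilinear_schwartz_operator T \<longleftrightarrow>
     (\<forall>f. (\<forall>j. f j \<in> schwartz) \<longrightarrow> tempered_distribution (T f)) \<and>
     multilinear_on (principal schwartz) (\<lambda>_. schwartz) T"

text \<open>Lebesgue measure on the \<open>m\<close>-fold product of \<^typ>\<open>real^'n\<close>.\<close>

definition lebesgue_tuple :: "('m::finite \<Rightarrow> real^'n::finite) measure" where
  "lebesgue_tuple = completion (\<Pi>\<^sub>M j\<in>UNIV. lborel)"

definition kernel_integral ::
  "(real^'n::finite \<Rightarrow> ('m::finite \<Rightarrow> real^'n) \<Rightarrow> complex) \<Rightarrow> ('m \<Rightarrow> real^'n \<Rightarrow> complex) \<Rightarrow> real^'n \<Rightarrow> complex" where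
  "kernel_integral K f x = (LINT y|lebesgue_tuple. K x y * (\<Prod>j\<in>UNIV. f j (y j)))"

text \<open>
  Since \<open>T f\<close> is a distribution, the kernel representation off the common support means that the
  restriction of \<open>T f\<close> to this open set is the function \<open>kernel_integral K f\<close>. The values of
  \<open>K\<close> on the diagonal \<open>x = y\<^sub>1 = \<dots> = y\<^sub>m\<close> are irrelevant: each section of it is a null set.
\<close>

definition has_kernel ::
  "(('m::finite \<Rightarrow> real^'n::finite \<Rightarrow> complex) \<Rightarrow> (real^'n \<Rightarrow> complex) \<Rightarrow> complex) \<Rightarrow>
   (real^'n \<Rightarrow> ('m \<Rightarrow> real^'n) \<Rightarrow> complex) \<Rightarrow> bool" where
  "has_kernel T K \<longleftrightarrow>
     (\<forall>x. K x \<in> borel_measurable lebesgue_tuple) \<and>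
     (\<forall>f. (\<forall>j. f j \<in> schwartz) \<longrightarrow>
        (\<forall>x. x \<notin> (\<Inter>j. supp (f j)) \<longrightarrow>
           integrable lebesgue_tuple (\<lambda>y. K x y * (\<Prod>j\<in>UNIV. f j (y j)))) \<and>
        (\<forall>\<phi>\<in>schwartz. compact (supp \<phi>) \<and> supp \<phi> \<inter> (\<Inter>j. supp (f j)) = {} \<longrightarrow>
           integrable lebesgue (\<lambda>x. kernel_integral K f x * \<phi> x) \<and>
           T f \<phi> = (LINT x|lebesgue. kernel_integral K f x * \<phi> x)))"

section \<open>Lebesgue and weak Lebesgue spaces\<close>

text \<open>Only used for exponents \<open>a > 0\<close>.\<close>

definition ennpowr :: "ennreal \<Rightarrow> real \<Rightarrow> ennreal" (infixr \<open>ennpowr\<close> 80) where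
  "x ennpowr a = (if x = \<infinity> then \<infinity> else ennreal (enn2real x powr a))"

definition wlp_norm :: "real \<Rightarrow> (real^'n::finite \<Rightarrow> real) \<Rightarrow> (real^'n \<Rightarrow> complex) \<Rightarrow> ennreal" where
  "wlp_norm p w f = (\<integral>\<^sup>+x. ennreal (norm (f x) powr p) * ennreal (w x) \<partial>lebesgue) ennpowr (1 / p)"

definition wlp :: "real \<Rightarrow> (real^'n::finite \<Rightarrow> real) \<Rightarrow> (real^'n \<Rightarrow> complex) set" where
  "wlp p w = {f \<in> borel_measurable lebesgue. wlp_norm p w f < \<infinity>}"

abbreviation lp_norm :: "real \<Rightarrow> (real^'n::finite \<Rightarrow> complex) \<Rightarrow> ennreal" where
  "lp_norm p \<equiv> wlp_norm p (\<lambda>_. 1)"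

abbreviation lp :: "real \<Rightarrow> (real^'n::finite \<Rightarrow> complex) set" where
  "lp p \<equiv> wlp p (\<lambda>_. 1)"

definition weak_lp_norm :: "real \<Rightarrow> (real^'n::finite \<Rightarrow> complex) \<Rightarrow> ennreal" where
  "weak_lp_norm q g =
     (SUP t\<in>{0<..}. ennreal t * emeasure lebesgue {x. norm (g x) > t} ennpowr (1 / q))"

text \<open>
  \<open>U\<close> is a bounded extension of \<open>T\<close> from the product of the spaces \<open>lp (qs j)\<close> into weak \<open>L\<^sup>q\<close>.
  That \<open>U\<close> extends \<open>T\<close> means that, for Schwartz \<open>f\<close>, the function \<open>U f\<close> is
  the distribution \<open>T f\<close>.
\<close>

definition weak_extension ::
  "(('m::finite \<Rightarrow> real^'n::finite \<Rightarrow> complex) \<Rightarrow> (real^'n \<Rightarrow> complex) \<Rightarrow> complex) \<Rightarrow>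
   ('m \<Rightarrow> real) \<Rightarrow> real \<Rightarrow>
   (('m \<Rightarrow> real^'n \<Rightarrow> complex) \<Rightarrow> real^'n \<Rightarrow> complex) \<Rightarrow> bool" where
  "weak_extension T qs q U \<longleftrightarrow>
     multilinear_on (ae_filter lebesgue) (\<lambda>j. lp (qs j)) U \<and>
     (\<exists>C::real. \<forall>f. (\<forall>j. f j \<in> lp (qs j)) \<longrightarrow>
        U f \<in> borel_measurable lebesgue \<and>
        weak_lp_norm q (U f) \<le> ennreal C * (\<Prod>j\<in>UNIV. lp_norm (qs j) (f j))) \<and>
     (\<forall>f. (\<forall>j. f j \<in> schwartz) \<longrightarrow>
        (\<forall>\<phi>\<in>schwartz. integrable lebesgue (\<lambda>x. U f x * \<phi> x) \<and>
           T f \<phi> = (LINT x|lebesgue. U f x * \<phi> x)))"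

definition admissible_exponents :: "real \<Rightarrow> ('m::finite \<Rightarrow> real) \<Rightarrow> real \<Rightarrow> bool" where
  "admissible_exponents p0 qs q \<longleftrightarrow>
     (\<forall>j. p0 \<le> qs j) \<and> 0 < q \<and> (\<Sum>j\<in>UNIV. 1 / qs j) = 1 / q"

section \<open>Kernel regularity\<close>

definition annulus :: "real^'n::finite \<Rightarrow> real \<Rightarrow> nat \<Rightarrow> (real^'n) set" where
  "annulus c \<rho> j = (if j = 0 then ball c \<rho> else ball c (2 ^ j * \<rho>) - ball c (2 ^ (j - 1) * \<rho>))"

text \<open>The norm in \<open>L\<^sup>r(A)\<close>, where \<open>r\<close> is the conjugate exponent of \<open>p0\<close>.\<close>

definition conj_norm_on ::
  "real \<Rightarrow> ('m::finite \<Rightarrow> real^'n::finite) set \<Rightarrow> (('m \<Rightarrow> real^'n) \<Rightarrow> complex) \<Rightarrow> ennreal" where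
  "conj_norm_on p0 A g =
     (if p0 = 1 then esssup (restrict_space lebesgue_tuple A) (\<lambda>y. ennreal (norm (g y)))
      else let r = p0 / (p0 - 1) in
        (\<integral>\<^sup>+y\<in>A. ennreal (norm (g y) powr r) \<partial>lebesgue_tuple) ennpowr (1 / r))"

definition kernel_regularity ::
  "real \<Rightarrow> real \<Rightarrow> real \<Rightarrow> (real^'n::finite \<Rightarrow> ('m::finite \<Rightarrow> real^'n) \<Rightarrow> complex) \<Rightarrow> bool" where
  "kernel_regularity p0 \<delta> C K \<longleftrightarrow>
     (\<forall>c \<rho> x x' js. 0 < \<rho> \<longrightarrow> x \<in> ball c (\<rho> / 2) \<longrightarrow> x' \<in> ball c (\<rho> / 2) \<longrightarrow> js \<noteq> (\<lambda>_. 0) \<longrightarrow>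
        conj_norm_on p0 {y. \<forall>k. y k \<in> annulus c \<rho> (js k)} (\<lambda>y. K x y - K x' y)
        \<le> ennreal (let m = real CARD('m); n = real CARD('n) in
             C * (dist x x' powr (m * (\<delta> - n / p0)) / measure lebesgue (ball c \<rho>) powr (m * \<delta> / n))
               * 2 powr (- (m * \<delta> * real (Max (range js))))))"

section \<open>Multiple weights\<close>

text \<open>Weights are finite almost everywhere, so real values lose nothing.\<close>

definition weight :: "(real^'n::finite \<Rightarrow> real) \<Rightarrow> bool" where
  "weight w \<longleftrightarrow> w \<in> borel_measurable lebesgue \<and> (AE x in lebesgue. 0 < w x)"

definition ball_average :: "real^'n::finite \<Rightarrow> real \<Rightarrow> (real^'n \<Rightarrow> real) \<Rightarrow> ennreal" where
  "ball_average c \<rho> g = (\<integral>\<^sup>+x\<in>ball c \<rho>. ennreal (g x) \<partial>lebesgue) / emeasure lebesgue (ball c \<rho>)"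

text \<open>For \<open>R = 1\<close> the factor is the inverse of the essential infimum of \<open>w\<close> on the ball.\<close>

definition dual_weight_factor :: "real^'n::finite \<Rightarrow> real \<Rightarrow> real \<Rightarrow> (real^'n \<Rightarrow> real) \<Rightarrow> ennreal" where
  "dual_weight_factor c \<rho> R w =
     (if R = 1 then inverse (Liminf (ae_filter (restrict_space lebesgue (ball c \<rho>))) (\<lambda>x. ennreal (w x)))
      else let R' = R / (R - 1) in ball_average c \<rho> (\<lambda>x. w x powr (1 - R')) ennpowr (1 / R'))"

definition multi_weight :: "('m::finite \<Rightarrow> real) \<Rightarrow> ('m \<Rightarrow> real^'n::finite \<Rightarrow> real) \<Rightarrow> bool" where
  "multi_weight R w \<longleftrightarrow> (\<forall>j. 1 \<le> R j) \<and> (\<forall>j. weight (w j)) \<and>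
     (let r = 1 / (\<Sum>j\<in>UNIV. 1 / R j) in
      (SUP (c, \<rho>)\<in>UNIV \<times> {0<..}.
         ball_average c \<rho> (\<lambda>x. \<Prod>j\<in>UNIV. w j x powr (r / R j)) ennpowr (1 / r)
         * (\<Prod>j\<in>UNIV. dual_weight_factor c \<rho> (R j) (w j))) < \<infinity>)"

definition bounded_compact_support :: "(real^'n::finite \<Rightarrow> complex) set" where
  "bounded_compact_support =
     {f \<in> borel_measurable lebesgue. bounded (range f) \<and> compact (supp f)}"

end

(*
  Sparse domination. For a cube Q of a dyadic grid let F_Q be the operator applied to the inputs cut
  off to a dilate Q* of Q, and let a_Q be the product of the L^p0 averages of the inputs over Q*.
  By the weak type bound and the weak (1,1) bound for maximal functions, F_Q and all averages over
  larger balls are bounded by a multiple of a_Q off an open set W that is small compared with Q. Let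
  P be a maximal dyadic subcube of Q of which W fills more than half. The parent of P then contains
  a point off W, and kernel regularity bounds the oscillation of F_Q - F_P on P by a multiple of
  a_Q, since the inputs of F_Q and F_P differ only away from P. So F_Q <= c a_Q + F_P on such cubes,
  F_Q <= c a_Q elsewhere on Q, and the cubes P cover at most a quarter of Q. Iteration dominates
  F_Q by a sum of c a_P over a chain of nested cubes.

  The multiple weight condition turns a_Q^p v(Q) into a product of averages with respect to the
  dual measures sigma_j = omega_j^(1 - r_j'), to which Carleson embedding and Hoelder's inequality
  apply. The condition also makes v and every sigma_j comparable on a ball and on any subset of
  proportional Lebesgue measure, so that they are doubling and the chain sums can be summed in
  L^p(v) for all p > 0. The extension to all of L^p1(omega_1) x ... x L^pm(omega_m) is by density.
*)
theory Submission
  imports Defs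
begin

section \<open>Smooth bump functions\<close>

text \<open>On Schwartz inputs the operator yields a distribution, described by the kernel only off
  the common support, while the stopping argument needs pointwise values on rough, cut-off inputs.
  The bridge is density: an input that vanishes on a ball is approximated by smooth functions
  vanishing there; for these the extension is a.e. the kernel integral on the ball, and a.e. limits
  carry the oscillation bound over. Hence the bump functions and the quantitative continuity of weak
  extensions.

  The argument runs for the extension at q_j = p0, q = p0/m. It reaches the others because two
  extensions agree on smooth inputs, and so a.e. on bounded inputs of compact support.

  Since p may be below 1, p-th powers are integrated throughout instead of using duality or a norm
  on L^p(v).

  The point off W in the stopping step has to be good for F_P too: W fills at most half of the
  parent of P and the bad set of F_P has measure at most |P|/32, so such a point exists. The dilates
  are balls of radius 5 sqrt(n) times the side, so that half of the ball of P contains the parent of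
  P.\<close>

fun diff_times :: "nat \<Rightarrow> (real^'n::finite \<Rightarrow> complex) \<Rightarrow> bool" where
 "diff_times 0 f \<longleftrightarrow> True"
| "diff_times (Suc k) f \<longleftrightarrow>
   (\<forall>x. f differentiable (at x)) \<and> (\<forall>i. diff_times k (partial_deriv i f))"

lemma iter_partial_append: "iter_partial (is @ [i]) f = iter_partial is (partial_deriv i f)"
 by (induction "is") auto

lemma diff_times_iter_partial:
 "diff_times (Suc (length is)) f \<Longrightarrow> iter_partial is f differentiable (at x)"
proof (induction "is" arbitrary: f rule: rev_induct)
 case (snoc i "is")
 then have "diff_times (Suc (length is)) (partial_deriv i f)"
  by simp
 then show ?case
  using snoc.IH iter_partial_append by metis
qed simp

text \<open>\<open>iter_partial\<close> adds new derivatives on the outside, which does not combine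
  with the product rule. \<open>diff_times\<close> peels them off from the inside, so closure
  properties follow by induction on the order with the function arbitrary.\<close>

lemma smooth_iff_diff_times: "smooth f \<longleftrightarrow> (\<forall>k. diff_times k f)"
proof
 assume *: "smooth f"
 have "smooth f \<Longrightarrow> diff_times k f" for k
 proof (induction k arbitrary: f)
  case (Suc k)
  have "f differentiable (at x)" for x
   using Suc.prems unfolding smooth_def by (metis iter_partial.simps(1))
  moreover have "smooth (partial_deriv i f)" for i
   using Suc.prems unfolding smooth_def by (metis iter_partial_append)
  ultimately show ?case
   using Suc.IH by simp
 qed simp
 with * show "\<forall>k. diff_times k f" by blast
next
 assume "\<forall>k. diff_times k f"
 then show "smooth f"
  unfolding smooth_def using diff_times_iter_partial by blast
qed

lemma diff_times_Suc_imp: "diff_times (Suc k) f \<Longrightarrow> diff_times k f"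
 by (induction k arbitrary: f) auto

lemma partial_deriv_eqI:
 "(f has_derivative f') (at x) \<Longrightarrow> partial_deriv i f x = f' (axis i 1)"
 unfolding partial_deriv_def using frechet_derivative_at by metis

lemma partial_deriv_add:
 assumes "\<And>x. f differentiable (at x)" "\<And>x. g differentiable (at x)"
 shows "partial_deriv i (\<lambda>x. f x + g x) = (\<lambda>x. partial_deriv i f x + partial_deriv i g x)"
proof
 fix x
 have "((\<lambda>x. f x + g x) has_derivative
   (\<lambda>h. frechet_derivative f (at x) h + frechet_derivative g (at x) h)) (at x)"
  using assms by (intro derivative_intros) (simp_all add: frechet_derivative_works[symmetric])
 then show "partial_deriv i (\<lambda>x. f x + g x) x = partial_deriv i f x + partial_deriv i g x"
  by (subst partial_deriv_eqI) (auto simp: partial_deriv_def)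
qed

lemma partial_deriv_mult:
 assumes "\<And>x. f differentiable (at x)" "\<And>x. g differentiable (at x)"
 shows "partial_deriv i (\<lambda>x. f x * g x) = (\<lambda>x. f x * partial_deriv i g x + partial_deriv i f x * g x)"
proof
 fix x
 have "((\<lambda>x. f x * g x) has_derivative
   (\<lambda>h. f x * frechet_derivative g (at x) h + frechet_derivative f (at x) h * g x)) (at x)"
  using assms by (intro derivative_intros) (simp_all add: frechet_derivative_works[symmetric])
 then show "partial_deriv i (\<lambda>x. f x * g x) x = f x * partial_deriv i g x + partial_deriv i f x * g x"
  by (subst partial_deriv_eqI) (auto simp: partial_deriv_def)
qed

lemma diff_times_add: "diff_times k f \<Longrightarrow> diff_times k g \<Longrightarrow> diff_times k (\<lambda>x. f x + g x)"
 by (induction k arbitrary: f g) (auto simp: partial_deriv_add)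

lemma diff_times_mult: "diff_times k f \<Longrightarrow> diff_times k g \<Longrightarrow> diff_times k (\<lambda>x. f x * g x)"
proof (induction k arbitrary: f g)
 case (Suc k)
 have "diff_times k (partial_deriv i (\<lambda>x. f x * g x))" for i
 proof -
  have "diff_times k (\<lambda>x. f x * partial_deriv i g x + partial_deriv i f x * g x)"
   using Suc.prems Suc.IH diff_times_Suc_imp by (intro diff_times_add Suc.IH) auto
  then show ?thesis
   using Suc.prems by (simp add: partial_deriv_mult)
 qed
 then show ?case
  using Suc.prems by (auto intro: differentiable_mult)
qed simp

lemma smooth_add: "smooth f \<Longrightarrow> smooth g \<Longrightarrow> smooth (\<lambda>x. f x + g x)"
 by (simp add: smooth_iff_diff_times diff_times_add)

lemma smooth_mult: "smooth f \<Longrightarrow> smooth g \<Longrightarrow> smooth (\<lambda>x. f x * g x)"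
 by (simp add: smooth_iff_diff_times diff_times_mult)

lemma smooth_const: "smooth (\<lambda>x::real^'n::finite. c)"
proof -
 have "diff_times k (\<lambda>x::real^'n. c)" for k c
 proof (induction k arbitrary: c)
  case (Suc k)
  have "partial_deriv i (\<lambda>x::real^'n. c) = (\<lambda>x. 0)" for i
   by (rule ext, subst partial_deriv_eqI[OF has_derivative_const]) auto
  then show ?case
   using Suc by simp
 qed simp
 then show ?thesis
  by (simp add: smooth_iff_diff_times)
qed

lemma smooth_prod: "finite I \<Longrightarrow> (\<And>i. i \<in> I \<Longrightarrow> smooth (f i)) \<Longrightarrow> smooth (\<lambda>x. \<Prod>i\<in>I. f i x)"
 by (induction I rule: finite_induct) (auto simp: smooth_const intro: smooth_mult)

text \<open>Coinduction principle: a class of differentiable functions that is stable under partial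
  derivatives never leaves itself. It spares an explicit formula for the higher derivatives of the
  exponential germ.\<close>

lemma smooth_coinduct:
 assumes "f \<in> X" "\<And>g x. g \<in> X \<Longrightarrow> g differentiable (at x)"
  "\<And>g i. g \<in> X \<Longrightarrow> partial_deriv i g \<in> X"
 shows "smooth f"
proof -
 have "f \<in> X \<Longrightarrow> diff_times k f" for k
  using assms(2,3) by (induction k arbitrary: f) auto
 then show ?thesis
  using assms(1) by (simp add: smooth_iff_diff_times)
qed

lemma smooth_iter_partial: "smooth f \<Longrightarrow> smooth (iter_partial is f)"
proof -
 assume *: "smooth f"
 have "iter_partial js (iter_partial is f) = iter_partial (js @ is) f" for js
  by (induction js) auto
 then show ?thesis
  using * by (simp add: smooth_def)
qed

lemma smooth_continuous_on: "smooth f \<Longrightarrow> continuous_on UNIV f"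
 unfolding smooth_def
 by (metis differentiable_imp_continuous_on differentiable_on_def differentiable_within_subset iter_partial.simps(1) top_greatest)

lemma iter_partial_zero_off_closed:
 fixes f :: "real^'n::finite \<Rightarrow> complex"
 assumes "closed S" "\<And>x. x \<notin> S \<Longrightarrow> f x = 0" "x \<notin> S"
 shows "iter_partial is f x = 0"
 using assms(3)
proof (induction "is" arbitrary: x)
 case (Cons i "is")
 have "(iter_partial is f has_derivative (\<lambda>h. 0)) (at x)"
 proof (rule has_derivative_transform_within_open[where s = "- S"])
  show "((\<lambda>x. 0) has_derivative (\<lambda>h. 0)) (at x)"
   by (rule has_derivative_const)
 qed (use assms(1) Cons in auto)
 then show ?case
  by (simp add: partial_deriv_eqI)
qed (use assms in auto)

lemma smooth_compact_imp_schwartz: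
 fixes f :: "real^'n::finite \<Rightarrow> complex"
 assumes "smooth f" "compact S" "\<And>x. x \<notin> S \<Longrightarrow> f x = 0"
 shows "f \<in> schwartz"
proof -
 have "bdd_above (range (\<lambda>x. (1 + norm x) ^ N * norm (iter_partial is f x)))" for N "is"
 proof -
  let ?g = "\<lambda>x. (1 + norm x) ^ N * norm (iter_partial is f x)"
  have "continuous_on S ?g"
   using smooth_continuous_on[OF smooth_iter_partial[OF assms(1)]]
   by (intro continuous_intros) (auto intro: continuous_on_subset)
  then have "compact (?g ` S)"
   using assms(2) compact_continuous_image by blast
  then obtain B where B: "\<And>x. x \<in> S \<Longrightarrow> ?g x \<le> B"
   using bounded_imp_bdd_above[OF compact_imp_bounded] unfolding bdd_above_def by fast
  have "?g x \<le> max B 0" for x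
  proof (cases "x \<in> S")
   case False
   then show ?thesis
    using iter_partial_zero_off_closed[OF compact_imp_closed[OF assms(2)] assms(3)] by simp
  qed (use B in force)
  then show ?thesis
   unfolding bdd_above_def by blast
 qed
 then show ?thesis
  using assms(1) by (simp add: schwartz_def)
qed

section \<open>Flat exponential germs and bump functions on boxes\<close>

definition exp_germ :: "real \<Rightarrow> real poly \<Rightarrow> real \<Rightarrow> real" where
 "exp_germ \<epsilon> p x = (if 0 < x then poly p (1 / x) * exp (- \<epsilon> / x) else 0)"

lemma poly_mult_exp_tendsto_0:
 assumes "0 < (\<epsilon>::real)"
 shows "((\<lambda>y. poly p y * exp (- \<epsilon> * y)) \<longlongrightarrow> 0) at_top"
proof -
 have mono: "((\<lambda>y. y ^ k * exp (- \<epsilon> * y)) \<longlongrightarrow> 0) at_top" for k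
 proof -
  have "filterlim (\<lambda>y. \<epsilon> * y) at_top at_top"
   using filterlim_tendsto_pos_mult_at_top[OF tendsto_const assms filterlim_ident] by simp
  then have "((\<lambda>y. (\<epsilon> * y) ^ k / exp (\<epsilon> * y)) \<longlongrightarrow> 0) at_top"
   using filterlim_compose[OF tendsto_power_div_exp_0] by blast
  then have "((\<lambda>y. (1 / \<epsilon>^k) * ((\<epsilon> * y) ^ k / exp (\<epsilon> * y))) \<longlongrightarrow> (1/\<epsilon>^k) * 0) at_top"
   by (intro tendsto_intros)
  then show ?thesis
   using assms by (simp add: power_mult_distrib exp_minus field_simps)
 qed
 have "((\<lambda>y. \<Sum>i\<le>degree p. coeff p i * (y ^ i * exp (- \<epsilon> * y))) \<longlongrightarrow> (\<Sum>i\<le>degree p. coeff p i * 0)) at_top"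
  by (intro tendsto_intros mono)
 then show ?thesis
  by (simp add: poly_altdef sum_distrib_right mult.assoc)
qed

text \<open>With y = 1/x, differentiation sends p(y) exp(-\<epsilon> y) to y^2 (\<epsilon> p -
  p')(y) exp(-\<epsilon> y); the polynomial \<open>[:0,0,1:]\<close> is y^2. The family of germs
  with polynomial factor is therefore closed under derivatives. Only the origin needs a
  limit.\<close>

lemma exp_germ_deriv:
 assumes "0 < \<epsilon>"
 shows "(exp_germ \<epsilon> p has_real_derivative exp_germ \<epsilon> ([:0,0,1:] * (smult \<epsilon> p - pderiv p)) x) (at x)"
proof -
 consider "x > 0" | "x < 0" | "x = 0" by linarith
 then show ?thesis
 proof cases
  case 1
  have "((\<lambda>x. poly p (1 / x) * exp (- \<epsilon> / x)) has_real_derivative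
    exp_germ \<epsilon> ([:0,0,1:] * (smult \<epsilon> p - pderiv p)) x) (at x)"
  proof -
   have inv: "((\<lambda>x. 1 / x) has_real_derivative (- ((1 / x)^2))) (at x)"
    using 1 by (auto intro!: derivative_eq_intros simp: power2_eq_square)
   have inv': "((\<lambda>x. - \<epsilon> / x) has_real_derivative (\<epsilon> * (1 / x)^2)) (at x)"
    using 1 by (auto intro!: derivative_eq_intros simp: power2_eq_square)
   show ?thesis
    by (rule DERIV_cong[OF DERIV_mult[OF DERIV_chain2[OF poly_DERIV inv, of p] DERIV_chain2[OF DERIV_exp inv']]])
      (use 1 in \<open>simp add: exp_germ_def power2_eq_square algebra_simps\<close>)
  qed
  then show ?thesis
   by (rule has_field_derivative_transform_within_open[where S = "{0<..}"]) (use 1 in \<open>auto simp: exp_germ_def\<close>)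
 next
  case 2
  have "((\<lambda>x. 0) has_real_derivative 0) (at x)"
   by simp
  then have "(exp_germ \<epsilon> p has_real_derivative 0) (at x)"
   by (rule has_field_derivative_transform_within_open[where S = "{..<0}"]) (use 2 in \<open>auto simp: exp_germ_def\<close>)
  then show ?thesis
   using 2 by (simp add: exp_germ_def)
 next
  case 3
  have "((\<lambda>h. exp_germ \<epsilon> p h / h) \<longlongrightarrow> 0) (at_right 0)"
  proof -
   \<comment> \<open>The difference quotient at 0 divides by h = 1/y, which costs one more factor y;
     the exponential absorbs it.\<close>
   have "((\<lambda>y. poly ([:0,1:] * p) y * exp (- \<epsilon> * y)) \<longlongrightarrow> 0) at_top"
    using poly_mult_exp_tendsto_0[OF assms] .
   from filterlim_compose[OF this filterlim_inverse_at_top_right]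
   have "((\<lambda>h. poly ([:0,1:] * p) (inverse h) * exp (- \<epsilon> * inverse h)) \<longlongrightarrow> 0) (at_right 0)" .
   then show ?thesis
   proof (rule Lim_transform_eventually)
    show "\<forall>\<^sub>F h in at_right 0. poly ([:0,1:] * p) (inverse h) * exp (- \<epsilon> * inverse h) = exp_germ \<epsilon> p h / h"
     unfolding eventually_at_filter by (rule always_eventually) (auto simp: exp_germ_def field_simps)
   qed
  qed
  moreover have "((\<lambda>h. exp_germ \<epsilon> p h / h) \<longlongrightarrow> 0) (at_left 0)"
  proof (rule Lim_transform_eventually[OF tendsto_const])
   show "\<forall>\<^sub>F h in at_left 0. 0 = exp_germ \<epsilon> p h / h"
    unfolding eventually_at_filter by (rule always_eventually) (auto simp: exp_germ_def)
  qed
  ultimately have "((\<lambda>h. exp_germ \<epsilon> p h / h) \<longlongrightarrow> 0) (at 0)"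
   using filterlim_split_at by blast
  then show ?thesis
   using 3 by (simp add: DERIV_def exp_germ_def)
 qed
qed

text \<open>The coinductive class contains scalar multiples because differentiation in direction j
  produces the factor s times the (i,j) entry of the identity matrix, besides the new
  polynomial.\<close>

lemma smooth_exp_germ:
 fixes i :: "'n::finite"
 assumes "0 < \<epsilon>"
 shows "smooth (\<lambda>x::real^'n. complex_of_real (exp_germ \<epsilon> p (s * (x $ i) + a)))"
proof (rule smooth_coinduct[where X = "range (\<lambda>(c, p) (x::real^'n). complex_of_real (c * exp_germ \<epsilon> p (s * (x $ i) + a)))"])
 show "(\<lambda>x. complex_of_real (exp_germ \<epsilon> p (s * (x $ i) + a))) \<in>
   range (\<lambda>(c, p) (x::real^'n). complex_of_real (c * exp_germ \<epsilon> p (s * (x $ i) + a)))"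
  by (rule range_eqI[where x = "(1, p)"]) auto
next
 fix g :: "real^'n \<Rightarrow> complex" assume "g \<in> range (\<lambda>(c, p) (x::real^'n). complex_of_real (c * exp_germ \<epsilon> p (s * (x $ i) + a)))"
 then obtain c p where g: "g = (\<lambda>x. complex_of_real (c * exp_germ \<epsilon> p (s * (x $ i) + a)))"
  by auto
 let ?q = "[:0,0,1:] * (smult \<epsilon> p - pderiv p)"
 have *: "(g has_derivative (\<lambda>h. complex_of_real (c * (exp_germ \<epsilon> ?q (s * (x $ i) + a) * (s * (h $ i)))))) (at x)" for x
 proof -
  have "((\<lambda>x::real^'n. s * (x $ i) + a) has_derivative (\<lambda>h. s * (h $ i))) (at x)"
   by (auto intro!: derivative_eq_intros bounded_linear.has_derivative[OF bounded_linear_vec_nth])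
  from has_derivative_compose[OF this exp_germ_deriv[OF assms, of p, unfolded has_field_derivative_def]]
  show ?thesis
   unfolding g by (intro has_derivative_of_real has_derivative_mult_right)
 qed
 show "g differentiable (at x)" for x
  using * differentiableI by blast
 fix j
 have "partial_deriv j g = (\<lambda>x. complex_of_real (c * s * (axis j 1 $ i) * exp_germ \<epsilon> ?q (s * (x $ i) + a)))"
  by (rule ext, subst partial_deriv_eqI[OF *]) (simp add: ac_simps)
 then show "partial_deriv j g \<in> range (\<lambda>(c, p) (x::real^'n). complex_of_real (c * exp_germ \<epsilon> p (s * (x $ i) + a)))"
  by (auto intro!: range_eqI[where x = "(c * s * (axis j 1 $ i), ?q)"])
qed

text \<open>Two germs per coordinate, one for each face, make the product positive exactly on the
  open box. The parameter \<epsilon> serves as approximation parameter: for \<epsilon> to 0 the bump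
  tends to the indicator of the box while staying below 1.\<close>

definition box_bump :: "real \<Rightarrow> real^'n::finite \<Rightarrow> real^'n \<Rightarrow> real^'n \<Rightarrow> real" where
 "box_bump \<epsilon> a b x = (\<Prod>i\<in>UNIV. exp_germ \<epsilon> 1 (x $ i - a $ i) * exp_germ \<epsilon> 1 (b $ i - x $ i))"

lemma exp_germ_1_bounds: "0 < \<epsilon> \<Longrightarrow> 0 \<le> exp_germ \<epsilon> 1 x \<and> exp_germ \<epsilon> 1 x \<le> 1"
 by (auto simp: exp_germ_def)

lemma box_bump_bounds: "0 < \<epsilon> \<Longrightarrow> 0 \<le> box_bump \<epsilon> a b x" "0 < \<epsilon> \<Longrightarrow> box_bump \<epsilon> a b x \<le> 1"
 unfolding box_bump_def
 by (auto intro!: prod_nonneg prod_le_1 mult_nonneg_nonneg mult_le_one simp: exp_germ_1_bounds)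

lemma box_bump_eq_0: "x \<notin> box a b \<Longrightarrow> box_bump \<epsilon> a b x = 0"
proof -
 assume "x \<notin> box a b"
 then obtain i where "\<not> (a $ i < x $ i \<and> x $ i < b $ i)"
  by (auto simp: mem_box_cart)
 then have "exp_germ \<epsilon> 1 (x $ i - a $ i) * exp_germ \<epsilon> 1 (b $ i - x $ i) = 0"
  by (auto simp: exp_germ_def)
 then show ?thesis
  unfolding box_bump_def by (intro prod_zero) auto
qed

lemma box_bump_pos: "x \<in> box a b \<Longrightarrow> 0 < box_bump \<epsilon> a b x"
 unfolding box_bump_def mem_box_cart by (auto simp: exp_germ_def intro!: prod_pos)

lemma box_bump_smooth:
 assumes "0 < \<epsilon>"
 shows "smooth (\<lambda>x. complex_of_real (box_bump \<epsilon> a b x))"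
proof -
 have "smooth (\<lambda>x. \<Prod>i\<in>UNIV. complex_of_real (exp_germ \<epsilon> 1 (1 * (x $ i) + (- a $ i))) *
   complex_of_real (exp_germ \<epsilon> 1 ((-1) * (x $ i) + b $ i)))"
  by (intro smooth_prod smooth_mult smooth_exp_germ assms) auto
 then show ?thesis
  by (simp add: box_bump_def)
qed

lemma box_bump_schwartz:
 assumes "0 < \<epsilon>"
 shows "(\<lambda>x. complex_of_real (box_bump \<epsilon> a b x)) \<in> schwartz"
 by (rule smooth_compact_imp_schwartz[of _ "cbox a b"])
   (use box_bump_smooth[OF assms] box_bump_eq_0 box_subset_cbox[of a b] in \<open>fastforce+\<close>)

lemma box_bump_tendsto:
 "(\<lambda>k. box_bump (1 / Suc k) a b x) \<longlonglongrightarrow> indicator (box a b) x"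
proof (cases "x \<in> box a b")
 case True
 have "(\<lambda>k. 1 / real (Suc k)) \<longlonglongrightarrow> 0"
  using LIMSEQ_inverse_real_of_nat by (simp only: inverse_eq_divide)
 note lim = this
 then have *: "(\<lambda>k. exp (- (1 / real (Suc k)) / y)) \<longlonglongrightarrow> exp (- 0 / y)" if "y \<noteq> 0" for y
  by (intro tendsto_intros that)
 have "(\<lambda>k. \<Prod>i\<in>UNIV. exp (- (1 / Suc k) / (x $ i - a $ i)) * exp (- (1 / Suc k) / (b $ i - x $ i)))
   \<longlonglongrightarrow> (\<Prod>i\<in>(UNIV::'a set). exp (- 0 / (x $ i - a $ i)) * exp (- 0 / (b $ i - x $ i)))"
 proof (intro tendsto_intros lim)
  fix i
  show "x $ i - a $ i \<noteq> 0" "b $ i - x $ i \<noteq> 0"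
   using True by (simp_all add: mem_box_cart less_imp_neq[THEN not_sym])
 qed
 then show ?thesis
  using True by (simp add: box_bump_def mem_box_cart exp_germ_def)
next
 case False
 then show ?thesis
  by (simp add: box_bump_eq_0)
qed

section \<open>Density of test functions\<close>

text \<open>Vanishing off W is demanded pointwise and compactness of the support in the whole space.
  With W the complement of a closed ball this gives exactly smooth inputs that vanish on the
  ball.\<close>

definition test_functions :: "(real^'n::finite) set \<Rightarrow> (real^'n \<Rightarrow> complex) set" where
 "test_functions W = {\<phi>. smooth \<phi> \<and> (\<exists>S. compact S \<and> (\<forall>x. x \<notin> S \<longrightarrow> \<phi> x = 0)) \<and> (\<forall>x. x \<notin> W \<longrightarrow> \<phi> x = 0)}"

lemma test_functions_schwartz: "\<phi> \<in> test_functions W \<Longrightarrow> \<phi> \<in> schwartz"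
 unfolding test_functions_def using smooth_compact_imp_schwartz by blast

lemma test_functions_measurable: "\<phi> \<in> test_functions W \<Longrightarrow> \<phi> \<in> borel_measurable borel"
 unfolding test_functions_def
 by (auto intro: borel_measurable_continuous_onI smooth_continuous_on)

lemma test_functions_measurable_lebesgue: "\<phi> \<in> test_functions W \<Longrightarrow> \<phi> \<in> borel_measurable lebesgue"
 using measurable_completion[of \<phi> lborel borel] test_functions_measurable[of \<phi> W] by simp

lemma test_functions_add: "\<phi> \<in> test_functions W \<Longrightarrow> \<psi> \<in> test_functions W \<Longrightarrow> (\<lambda>x. \<phi> x + \<psi> x) \<in> test_functions W"
 unfolding test_functions_def
proof (clarsimp simp: smooth_add)
 fix S S' assume "compact S" "\<forall>x. x \<notin> S \<longrightarrow> \<phi> x = 0" "compact S'" "\<forall>x. x \<notin> S' \<longrightarrow> \<psi> x = 0"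
 then show "\<exists>S. compact S \<and> (\<forall>x. x \<notin> S \<longrightarrow> \<phi> x + \<psi> x = 0)"
  by (intro exI[of _ "S \<union> S'"]) auto
qed

lemma test_functions_scale: "\<phi> \<in> test_functions W \<Longrightarrow> (\<lambda>x. c * \<phi> x) \<in> test_functions W"
 unfolding test_functions_def by (auto intro: smooth_mult smooth_const)

lemma test_functions_bounded_compact_support:
 assumes "\<phi> \<in> test_functions W"
 shows "\<phi> \<in> bounded_compact_support"
proof -
 obtain S where S: "compact S" "\<And>x. x \<notin> S \<Longrightarrow> \<phi> x = 0" and sm: "smooth \<phi>"
  using assms unfolding test_functions_def by blast
 have "bounded (\<phi> ` S)"
  using compact_continuous_image[OF continuous_on_subset[OF smooth_continuous_on[OF sm]] S(1)]
  by (simp add: compact_imp_bounded)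
 moreover have "range \<phi> \<subseteq> insert 0 (\<phi> ` S)"
  using S(2) by blast
 ultimately have "bounded (range \<phi>)"
  by (meson bounded_insert bounded_subset)
 moreover have "supp \<phi> \<subseteq> S"
  unfolding supp_def using S compact_imp_closed by (intro closure_minimal) auto
 then have "compact (supp \<phi>)"
  by (metis S(1) closed_closure compact_Int_closed inf.absorb_iff2 supp_def)
 ultimately show ?thesis
  using test_functions_measurable_lebesgue[OF assms] by (simp add: bounded_compact_support_def)
qed

section \<open>A distance that controls all Lebesgue norms with exponents between 1 and Q\<close>

definition modulus :: "real \<Rightarrow> complex \<Rightarrow> real" where
 "modulus Q z = norm z + norm z powr Q"

text \<open>The integrand |z| + |z|^Q dominates |z|^q for every q between 1 and Q, the first summand
  for |z| at most 1 and the second otherwise. One approximating sequence thus works for all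
  exponents of a tuple, and for two tuples of exponents at once.\<close>

definition ldist :: "real \<Rightarrow> (real^'n::finite \<Rightarrow> complex) \<Rightarrow> (real^'n \<Rightarrow> complex) \<Rightarrow> ennreal" where
 "ldist Q f g = (\<integral>\<^sup>+x. ennreal (modulus Q (f x - g x)) \<partial>lebesgue)"

lemma modulus_nonneg [simp]: "0 \<le> modulus Q z"
 by (simp add: modulus_def)

lemma modulus_0 [simp]: "modulus Q 0 = 0"
 by (simp add: modulus_def)

lemma modulus_1 [simp]: "modulus Q 1 = 2" "modulus Q (-1) = 2"
 by (simp_all add: modulus_def)

lemma modulus_measurable [measurable]: "modulus Q \<in> borel_measurable borel"
 unfolding modulus_def by measurable

lemma powr_add_le:
 assumes "0 \<le> (a::real)" "0 \<le> b" "0 \<le> p"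
 shows "(a + b) powr p \<le> 2 powr p * (a powr p + b powr p)"
proof -
 have "(a + b) powr p \<le> (2 * max a b) powr p"
  using assms by (intro powr_mono2) auto
 also have "\<dots> = 2 powr p * max a b powr p"
  using assms by (simp add: powr_mult)
 also have "\<dots> \<le> 2 powr p * (a powr p + b powr p)"
  by (intro mult_left_mono) (auto simp: max_def)
 finally show ?thesis .
qed

lemma modulus_mono: "1 \<le> Q \<Longrightarrow> norm a \<le> norm b \<Longrightarrow> modulus Q a \<le> modulus Q b"
 unfolding modulus_def by (intro add_mono powr_mono2) auto

lemma modulus_add_le:
 assumes "1 \<le> Q"
 shows "modulus Q (a + b) \<le> 2 powr Q * (modulus Q a + modulus Q b)"
proof -
 have "norm (a + b) \<le> norm a + norm b"
  by (rule norm_triangle_ineq)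
 moreover have "norm (a + b) powr Q \<le> 2 powr Q * (norm a powr Q + norm b powr Q)"
  using powr_mono2[of Q "norm (a + b)" "norm a + norm b"] powr_add_le[of "norm a" "norm b" Q] assms
  by (smt (verit) norm_ge_zero norm_triangle_ineq)
 moreover have "1 * (norm a + norm b) \<le> 2 powr Q * (norm a + norm b)"
  using assms by (intro mult_right_mono ge_one_powr_ge_zero) auto
 ultimately show ?thesis
  unfolding modulus_def by (simp add: distrib_left)
qed

lemma modulus_mult_le: "modulus Q (a * b) \<le> modulus Q a * modulus Q b"
 unfolding modulus_def norm_mult
 by (simp add: powr_mult algebra_simps)

lemma ldist_add:
 assumes "1 \<le> Q" and [measurable]: "f \<in> borel_measurable lebesgue" "f' \<in> borel_measurable lebesgue"
  "g \<in> borel_measurable lebesgue" "g' \<in> borel_measurable lebesgue"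
 shows "ldist Q (\<lambda>x. f x + f' x) (\<lambda>x. g x + g' x) \<le> ennreal (2 powr Q) * (ldist Q f g + ldist Q f' g')"
proof -
 have "ennreal (modulus Q (f x + f' x - (g x + g' x)))
   \<le> ennreal (2 powr Q) * (ennreal (modulus Q (f x - g x)) + ennreal (modulus Q (f' x - g' x)))" for x
  using modulus_add_le[OF assms(1), of "f x - g x" "f' x - g' x"]
  by (simp flip: ennreal_plus ennreal_mult add: algebra_simps)
 then have "ldist Q (\<lambda>x. f x + f' x) (\<lambda>x. g x + g' x) \<le> (\<integral>\<^sup>+x. ennreal (2 powr Q) * (ennreal (modulus Q (f x - g x)) + ennreal (modulus Q (f' x - g' x))) \<partial>lebesgue)"
  unfolding ldist_def by (intro nn_integral_mono)
 also have "\<dots> = ennreal (2 powr Q) * (ldist Q f g + ldist Q f' g')"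
  unfolding ldist_def by (subst nn_integral_cmult, measurable, subst nn_integral_add) auto
 finally show ?thesis .
qed

lemma ldist_triangle:
 assumes "1 \<le> Q" and [measurable]: "f \<in> borel_measurable lebesgue"
  "g \<in> borel_measurable lebesgue" "h \<in> borel_measurable lebesgue"
 shows "ldist Q f h \<le> ennreal (2 powr Q) * (ldist Q f g + ldist Q g h)"
proof -
 have "ldist Q f h = ldist Q (\<lambda>x. (f x - g x) + g x) (\<lambda>x. 0 + h x)"
  by simp
 also have "\<dots> \<le> ennreal (2 powr Q) * (ldist Q (\<lambda>x. f x - g x) (\<lambda>x. 0) + ldist Q g h)"
  by (rule ldist_add) (use assms in auto)
 finally show ?thesis
  by (simp add: ldist_def)
qed

lemma ldist_scale:
 assumes [measurable]: "f \<in> borel_measurable lebesgue" "g \<in> borel_measurable lebesgue"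
 shows "ldist Q (\<lambda>x. c * f x) (\<lambda>x. c * g x) \<le> ennreal (modulus Q c) * ldist Q f g"
proof -
 have "ldist Q (\<lambda>x. c * f x) (\<lambda>x. c * g x) \<le> (\<integral>\<^sup>+x. ennreal (modulus Q c) * ennreal (modulus Q (f x - g x)) \<partial>lebesgue)"
  unfolding ldist_def right_diff_distrib[symmetric]
  by (intro nn_integral_mono) (simp flip: ennreal_mult add: modulus_mult_le ennreal_leI)
 also have "\<dots> = ennreal (modulus Q c) * ldist Q f g"
  unfolding ldist_def by (rule nn_integral_cmult) measurable
 finally show ?thesis .
qed

definition test_approx :: "real \<Rightarrow> (real^'n::finite) set \<Rightarrow> (real^'n \<Rightarrow> complex) \<Rightarrow> bool" where
 "test_approx Q W f \<longleftrightarrow> f \<in> borel_measurable lebesgue \<and>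
   (\<forall>e>0. \<exists>\<phi>\<in>test_functions W. ldist Q f \<phi> \<le> ennreal e)"

lemma test_function_test_approx: "\<phi> \<in> test_functions W \<Longrightarrow> test_approx Q W \<phi>"
 unfolding test_approx_def using test_functions_measurable_lebesgue[of \<phi> W]
 by (intro conjI allI impI bexI[of _ \<phi>]) (simp_all add: ldist_def)

lemma test_approx_limit:
 assumes "1 \<le> Q" "f \<in> borel_measurable lebesgue"
  and "\<And>e. 0 < e \<Longrightarrow> \<exists>g. test_approx Q W g \<and> ldist Q f g \<le> ennreal e"
 shows "test_approx Q W f"
 unfolding test_approx_def
proof (intro conjI allI impI assms(2))
 fix e :: real assume "0 < e"
 \<comment> \<open>The quasi-triangle inequality of \<open>ldist\<close> has the constant 2^Q, and
   two errors d are added.\<close>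
 define d where "d = e / (2 * 2 powr Q)"
 have d: "0 < d"
  using \<open>0 < e\<close> by (simp add: d_def)
 obtain g where g: "test_approx Q W g" "ldist Q f g \<le> ennreal d"
  using assms(3)[OF d] by blast
 then obtain \<phi> where \<phi>: "\<phi> \<in> test_functions W" "ldist Q g \<phi> \<le> ennreal d"
  using d by (auto simp: test_approx_def)
 have "ldist Q f \<phi> \<le> ennreal (2 powr Q) * (ennreal d + ennreal d)"
  using ldist_triangle[OF assms(1,2), of g \<phi>] g \<phi> test_functions_measurable_lebesgue[OF \<phi>(1)]
  by (smt (verit) add_mono mult_left_mono order_trans test_approx_def zero_le)
 also have "\<dots> = ennreal e"
  using d by (simp flip: ennreal_plus ennreal_mult add: d_def field_simps)
 finally show "\<exists>\<phi>\<in>test_functions W. ldist Q f \<phi> \<le> ennreal e"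
  using \<phi>(1) by blast
qed

lemma test_approx_limit_seq:
 assumes "1 \<le> Q" "f \<in> borel_measurable lebesgue" "\<And>n::nat. test_approx Q W (g n)"
  "(\<lambda>n. ldist Q f (g n)) \<longlonglongrightarrow> 0"
 shows "test_approx Q W f"
proof (rule test_approx_limit[OF assms(1,2)])
 fix e :: real assume "0 < e"
 then have "\<forall>\<^sub>F n in sequentially. ldist Q f (g n) < ennreal e"
  by (intro order_tendstoD[OF assms(4)]) simp
 then obtain n where "ldist Q f (g n) < ennreal e"
  by (auto simp: eventually_sequentially)
 then show "\<exists>g. test_approx Q W g \<and> ldist Q f g \<le> ennreal e"
  using assms(3)[of n] less_imp_le by blast
qed

lemma test_approx_add:
 assumes "1 \<le> Q" "test_approx Q W f" "test_approx Q W f'"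
 shows "test_approx Q W (\<lambda>x. f x + f' x)"
 unfolding test_approx_def
proof (intro conjI allI impI)
 show "(\<lambda>x. f x + f' x) \<in> borel_measurable lebesgue"
  using assms by (auto simp: test_approx_def)
 fix e :: real assume "0 < e"
 define d where "d = e / (2 * 2 powr Q)"
 have d: "0 < d"
  using \<open>0 < e\<close> by (simp add: d_def)
 obtain \<phi> \<phi>' where \<phi>: "\<phi> \<in> test_functions W" "ldist Q f \<phi> \<le> ennreal d"
   "\<phi>' \<in> test_functions W" "ldist Q f' \<phi>' \<le> ennreal d"
  using assms(2,3) d unfolding test_approx_def by meson
 have "ldist Q (\<lambda>x. f x + f' x) (\<lambda>x. \<phi> x + \<phi>' x) \<le> ennreal (2 powr Q) * (ldist Q f \<phi> + ldist Q f' \<phi>')"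
  by (rule ldist_add) (use assms \<phi> test_functions_measurable_lebesgue in \<open>auto simp: test_approx_def\<close>)
 also have "\<dots> \<le> ennreal (2 powr Q) * (ennreal d + ennreal d)"
  using \<phi> by (intro mult_left_mono add_mono) auto
 also have "\<dots> = ennreal e"
  using d by (simp flip: ennreal_plus ennreal_mult add: d_def field_simps)
 finally show "\<exists>\<phi>\<in>test_functions W. ldist Q (\<lambda>x. f x + f' x) \<phi> \<le> ennreal e"
  using test_functions_add[OF \<phi>(1,3)] by blast
qed

lemma test_approx_scale:
 assumes "test_approx Q W f"
 shows "test_approx Q W (\<lambda>x. c * f x)"
 unfolding test_approx_def
proof (intro conjI allI impI)
 show "(\<lambda>x. c * f x) \<in> borel_measurable lebesgue"
  using assms by (auto simp: test_approx_def)
 fix e :: real assume "0 < e"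
 define d where "d = e / (modulus Q c + 1)"
 have d: "0 < d"
  using \<open>0 < e\<close> by (simp add: d_def add_nonneg_pos)
 obtain \<phi> where \<phi>: "\<phi> \<in> test_functions W" "ldist Q f \<phi> \<le> ennreal d"
  using assms d unfolding test_approx_def by meson
 have "ldist Q (\<lambda>x. c * f x) (\<lambda>x. c * \<phi> x) \<le> ennreal (modulus Q c) * ldist Q f \<phi>"
  by (rule ldist_scale) (use assms \<phi> test_functions_measurable_lebesgue in \<open>auto simp: test_approx_def\<close>)
 also have "\<dots> \<le> ennreal (modulus Q c) * ennreal d"
  using \<phi> by (intro mult_left_mono) auto
 also have "\<dots> = ennreal (modulus Q c * d)"
  using d by (simp add: ennreal_mult)
 also have "modulus Q c * d \<le> e"
 proof -
  have "modulus Q c * d \<le> (modulus Q c + 1) * d"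
   using d by (simp add: distrib_right)
  also have "\<dots> = e"
   unfolding d_def using modulus_nonneg[of Q c] by (simp del: modulus_nonneg)
  finally show ?thesis .
 qed
 finally show "\<exists>\<phi>\<in>test_functions W. ldist Q (\<lambda>x. c * f x) \<phi> \<le> ennreal e"
  using test_functions_scale[OF \<phi>(1)] ennreal_leI by (meson order_trans)
qed

lemma test_approx_zero: "test_approx Q W (\<lambda>x. 0)"
 unfolding test_approx_def
proof (intro conjI allI impI bexI)
 show "(\<lambda>x. 0) \<in> test_functions W"
  by (auto simp: test_functions_def smooth_const)
qed (auto simp: ldist_def)

lemma test_approx_sum:
 "finite I \<Longrightarrow> 1 \<le> Q \<Longrightarrow> (\<And>i. i \<in> I \<Longrightarrow> test_approx Q W (f i)) \<Longrightarrow> test_approx Q W (\<lambda>x. \<Sum>i\<in>I. f i x)"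
 by (induction I rule: finite_induct) (auto intro: test_approx_zero test_approx_add)

lemma test_approx_cong_AE:
 assumes "test_approx Q W f" "AE x in lebesgue. f x = g x" "g \<in> borel_measurable lebesgue"
 shows "test_approx Q W g"
proof -
 have "ldist Q g \<phi> = ldist Q f \<phi>" for \<phi>
  unfolding ldist_def using assms(2) by (intro nn_integral_cong_AE) (auto elim: eventually_mono)
 then show ?thesis
  using assms by (simp add: test_approx_def)
qed

lemma ldist_dominated:
 fixes f :: "real^'n::finite \<Rightarrow> complex"
 assumes "1 \<le> Q" and [measurable]: "f \<in> borel_measurable lebesgue" "\<And>k::nat. g k \<in> borel_measurable lebesgue"
  "S \<in> sets lebesgue" and S: "emeasure lebesgue S < \<infinity>"
  and bound: "\<And>k x. norm (f x - g k x) \<le> B * indicator S x"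
  and lim: "\<And>x. (\<lambda>k. g k x) \<longlonglongrightarrow> f x"
 shows "(\<lambda>k. ldist Q f (g k)) \<longlonglongrightarrow> 0"
proof -
 have "(\<lambda>k. \<integral>\<^sup>+x. ennreal (modulus Q (f x - g k x)) \<partial>lebesgue) \<longlonglongrightarrow> (\<integral>\<^sup>+x. 0 \<partial>(lebesgue :: (real^'n) measure))"
 proof (rule nn_integral_dominated_convergence[where w = "\<lambda>x. ennreal (modulus Q (of_real B)) * indicator S x"])
  have "modulus Q (f x - g k x) \<le> modulus Q (of_real B) * indicator S x" for x k
   using bound[of x k] modulus_mono[OF assms(1), of "f x - g k x" "of_real B"]
   by (cases "x \<in> S") auto
  then have "ennreal (modulus Q (f x - g k x)) \<le> ennreal (modulus Q (of_real B)) * indicator S x" for x k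
   by (metis ennreal_indicator ennreal_leI ennreal_mult'' indicator_pos_le)
  then show "AE x in lebesgue. ennreal (modulus Q (f x - g k x)) \<le> ennreal (modulus Q (of_real B)) * indicator S x" for k
   by simp
  show "(\<integral>\<^sup>+x. ennreal (modulus Q (of_real B)) * indicator S x \<partial>lebesgue) < \<infinity>"
   using S by (simp add: nn_integral_cmult_indicator ennreal_mult_less_top)
  have "(\<lambda>k. modulus Q (f x - g k x)) \<longlonglongrightarrow> 0" for x
  proof -
   have "(\<lambda>k. norm (f x - g k x)) \<longlonglongrightarrow> 0"
    using tendsto_diff[OF tendsto_const[of "f x"] lim[of x]] tendsto_norm_zero by force
   then have "(\<lambda>k. norm (f x - g k x) + norm (f x - g k x) powr Q) \<longlonglongrightarrow> 0 + 0"
    using tendsto_powr'[of _ 0 sequentially "\<lambda>_. Q" Q] assms(1) by (intro tendsto_add) auto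
   then show ?thesis
    by (simp add: modulus_def)
  qed
  then show "AE x in lebesgue. (\<lambda>k. ennreal (modulus Q (f x - g k x))) \<longlonglongrightarrow> 0"
   using tendsto_ennrealI by fastforce
 qed measurable
 then show ?thesis
  by (simp add: ldist_def)
qed

lemma box_bump_test_functions:
 assumes "0 < \<epsilon>" "box a b \<subseteq> W"
 shows "(\<lambda>x. complex_of_real (box_bump \<epsilon> a b x)) \<in> test_functions W"
 unfolding test_functions_def
proof (intro CollectI conjI exI[of _ "cbox a b"] allI impI box_bump_smooth assms)
 show "complex_of_real (box_bump \<epsilon> a b x) = 0" if "x \<notin> cbox a b" for x
  using that box_subset_cbox[of a b] box_bump_eq_0[of x a b \<epsilon>] by (auto simp del: mem_box_cart)
 show "complex_of_real (box_bump \<epsilon> a b x) = 0" if "x \<notin> W" for x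
  using that assms(2) box_bump_eq_0[of x a b \<epsilon>] by auto
qed (rule compact_cbox)

lemma emeasure_box_finite: "emeasure lebesgue (box a (b::real^'n::finite)) < \<infinity>"
 by (metis emeasure_bounded_finite emeasure_completion bounded_box infinity_ennreal_def lmeasurable_box fmeasurableD2 top.not_eq_extremum)

lemma test_approx_box:
 assumes "1 \<le> Q" "box a b \<subseteq> W"
 shows "test_approx Q W (indicator (box a b))"
proof (rule test_approx_limit_seq[OF assms(1)])
 fix k :: nat
 have "(\<lambda>x. complex_of_real (box_bump (1 / Suc k) a b x)) \<in> test_functions W"
  using assms(2) by (intro box_bump_test_functions) auto
 then show "test_approx Q W (\<lambda>x. complex_of_real (box_bump (1 / Suc k) a b x))"
  by (rule test_function_test_approx)
next
 show "(\<lambda>k. ldist Q (indicator (box a b)) (\<lambda>x. complex_of_real (box_bump (1 / Suc k) a b x))) \<longlonglongrightarrow> 0"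
 proof (rule ldist_dominated[OF assms(1), where S = "box a b" and B = 1])
  show "(\<lambda>x. complex_of_real (box_bump (1 / Suc k) a b x)) \<in> borel_measurable lebesgue" for k
   by (rule test_functions_measurable_lebesgue[of _ UNIV], rule box_bump_test_functions) auto
  show "cmod (indicator (box a b) x - complex_of_real (box_bump (1 / Suc k) a b x)) \<le> 1 * indicator (box a b) x" for k x
  proof (cases "x \<in> box a b")
   case True
   then have "cmod (indicator (box a b) x - complex_of_real (box_bump (1 / Suc k) a b x)) = \<bar>1 - box_bump (1 / Suc k) a b x\<bar>"
    by (metis indicator_simps(1) norm_of_real of_real_1 of_real_diff)
   then show ?thesis
    using True box_bump_bounds[of "1 / Suc k" a b x] by simp
  qed (simp add: box_bump_eq_0)
  show "(\<lambda>k. complex_of_real (box_bump (1 / Suc k) a b x)) \<longlonglongrightarrow> indicator (box a b) x" for x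
   using tendsto_of_real[OF box_bump_tendsto[of a b x], where 'a = complex]
   by (cases "x \<in> box a b") simp_all
  show "emeasure lebesgue (box a b) < \<infinity>"
   by (rule emeasure_box_finite)
  show "box a b \<in> sets lebesgue"
   by simp
  then show "indicator (box a b) \<in> borel_measurable lebesgue"
   by (rule borel_measurable_indicator)
 qed
next
 show "indicator (box a b) \<in> borel_measurable lebesgue"
  by (rule borel_measurable_indicator) simp
qed

text \<open>The indicators of the partial unions converge pointwise and are dominated by the
  indicator of the whole union, which has finite measure.\<close>

lemma test_approx_UN:
 fixes A :: "nat \<Rightarrow> (real^'n::finite) set"
 assumes Q: "1 \<le> Q" and A: "\<And>N. test_approx Q W (indicator (\<Union>i<N. A i))" "\<And>i. A i \<in> sets lebesgue"
  and fin: "emeasure lebesgue (\<Union>i. A i) < \<infinity>"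
 shows "test_approx Q W (indicator (\<Union>i. A i))"
proof -
 have sets: "(\<Union>i. A i) \<in> sets lebesgue" "(\<Union>i<k. A i) \<in> sets lebesgue" for k
  using A(2) by auto
 note meas = sets[THEN borel_measurable_indicator]
 have "(\<lambda>N. ldist Q (indicator (\<Union>i. A i)) (indicator (\<Union>i<N. A i))) \<longlonglongrightarrow> 0"
 proof (rule ldist_dominated[OF Q meas sets(1) fin, where B = 1])
  show "cmod (indicator (\<Union>i. A i) x - indicator (\<Union>i<k. A i) x) \<le> 1 * indicator (\<Union>i. A i) x" for k x
   by (cases "x \<in> (\<Union>i<k. A i)"; cases "x \<in> (\<Union>i. A i)") auto
  show "(\<lambda>k. indicator (\<Union>i<k. A i) x) \<longlonglongrightarrow> (indicator (\<Union>i. A i) x :: complex)" for x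
   by (rule LIMSEQ_indicator_UN)
 qed
 then show ?thesis
  by (rule test_approx_limit_seq[OF Q meas(1) A(1)])
qed

lemma box_Int_box_is_box: "\<exists>e f. box a b \<inter> box c d = box e (f :: real^'n::finite)"
 unfolding box_Int_box by blast

lemma Int_stable_box: "Int_stable (range (\<lambda>(a, b). box a b :: (real^'n::finite) set))"
proof (rule Int_stableI)
 fix X Y assume "X \<in> range (\<lambda>(a, b). box a b :: (real^'n::finite) set)" "Y \<in> range (\<lambda>(a, b). box a b :: (real^'n::finite) set)"
 then obtain a b c d where "X = box a b" "Y = box c d"
  by auto
 then have "\<exists>e f. X \<inter> Y = box e f"
  by (simp add: box_Int_box_is_box)
 then show "X \<inter> Y \<in> range (\<lambda>(a, b). box a b :: (real^'n::finite) set)"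
  by auto
qed

text \<open>Dynkin's argument: open boxes are stable under intersection and generate the Borel sets.
  Intersecting with one fixed box keeps all measures finite and all sets inside W.\<close>

lemma test_approx_borel_in_box:
 fixes W :: "(real^'n::finite) set"
 assumes Q: "1 \<le> Q" and W: "box a b \<subseteq> W" and A: "A \<in> sets borel"
 shows "test_approx Q W (indicator (A \<inter> box a b))"
proof -
 have sub: "range (\<lambda>(a, b). box a b :: (real^'n) set) \<subseteq> Pow UNIV"
  by blast
 have "A \<in> sigma_sets UNIV (range (\<lambda>(a, b). box a b))"
  using A unfolding borel_eq_box by simp
 with Int_stable_box sub show ?thesis
 proof (induction rule: sigma_sets_induct_disjoint)
  case (basic A)
  then obtain c d where cd: "A = box c d"
   by auto
  obtain e f where ef: "A \<inter> box a b = box e f"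
   unfolding cd using box_Int_box_is_box[of c d a b] by blast
  then have "box e f \<subseteq> W"
   using W by blast
  then show ?case
   unfolding ef by (rule test_approx_box[OF Q])
 next
  case empty
  then show ?case
   using test_approx_zero by simp
 next
  case (compl A)
  have "indicator ((UNIV - A) \<inter> box a b) = (\<lambda>x. indicator (box a b) x + (-1) * indicator (A \<inter> box a b) x :: complex)"
   by (auto simp: indicator_def)
  then show ?case
   using test_approx_add[OF Q test_approx_box[OF Q W] test_approx_scale[OF compl(2), of "-1"]] by simp
 next
  case (union A)
  have sets: "A i \<in> sets lebesgue" for i
  proof -
   have "A i \<in> sets borel"
    using union(2) unfolding borel_eq_box by auto
   then show ?thesis by auto
  qed
  have "test_approx Q W (indicator (\<Union>i<N. A i \<inter> box a b))" for N
  proof -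
   have "indicator (\<Union>i<N. A i \<inter> box a b) = (\<lambda>x. \<Sum>i<N. indicator (A i \<inter> box a b) x :: complex)"
    using union(1) by (intro ext indicator_UN_disjoint) (auto simp: disjoint_family_on_def)
   then show ?thesis
    using test_approx_sum[OF _ Q union(3), of "{..<N}"] by simp
  qed
  then have "test_approx Q W (indicator (\<Union>i. A i \<inter> box a b))"
  proof (rule test_approx_UN[OF Q])
   have "(\<Union>i. A i \<inter> box a b) \<subseteq> box a b"
    by blast
   then show "emeasure lebesgue (\<Union>i. A i \<inter> box a b) < \<infinity>"
    by (rule le_less_trans[OF emeasure_mono emeasure_box_finite]) simp
   show "A i \<inter> box a b \<in> sets lebesgue" for i
    by (intro sets.Int sets) simp
  qed
  then show ?case
   by (simp only: UN_extend_simps)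
 qed
qed

text \<open>Up to a null set A is Borel, and W is a countable union of boxes, so A is exhausted by
  Borel pieces that lie in single boxes.\<close>

lemma test_approx_lebesgue_set:
 fixes W :: "(real^'n::finite) set"
 assumes Q: "1 \<le> Q" and W: "open W" and A: "A \<in> sets lebesgue" "A \<subseteq> W" "emeasure lebesgue A < \<infinity>"
 shows "test_approx Q W (indicator A)"
proof -
 obtain S N N' where S: "S \<in> sets lborel" "A = S \<union> N" "N \<subseteq> N'" "N' \<in> null_sets lborel"
  using A(1) by (auto elim: sets_completionE)
 obtain D where D: "\<Union>D = W" "countable D" "\<And>X. X \<in> D \<Longrightarrow> \<exists>a b. X = box a b"
  by (rule open_countable_Union_open_box[OF W]) auto
 \<comment> \<open>The degenerate box is empty; inserting it makes the countable family non-empty,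
   so that it can be enumerated by the natural numbers.\<close>
 define E where "E = from_nat_into (insert (box 0 0) D)"
 have E: "range E = insert (box 0 0) D"
  unfolding E_def by (rule range_from_nat_into) (use D in auto)
 have SE: "(\<Union>i. S \<inter> E i) = S"
 proof -
  have "S \<subseteq> \<Union>(range E)"
   using A(2) S(2) D(1) E by auto
  then show ?thesis by blast
 qed
 have Eb: "\<exists>a b. E i = box a b \<and> box a b \<subseteq> W" for i
 proof -
  have "E i \<in> insert (box 0 0) D"
   using E by blast
  moreover have "box 0 (0::real^'n) = {}"
   by simp
  ultimately consider "E i = box 0 0" "box 0 (0::real^'n) = {}" | "E i \<in> D" by blast
  then show ?thesis
  proof cases
   case 1
   then show ?thesis by blast
  next
   case 2
   then show ?thesis using D(1) D(3)[OF 2] by blast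
  qed
 qed
 have [measurable]: "E i \<in> sets borel" "S \<in> sets borel" for i
  using Eb[of i] S(1) by auto
 have "test_approx Q W (indicator (\<Union>i<N. S \<inter> E i))" for N
 proof (induction N)
  case 0
  then show ?case
   using test_approx_zero by (simp add: indicator_def)
 next
  case (Suc N)
  obtain a b where ab: "E N = box a b" "box a b \<subseteq> W"
   using Eb by blast
  \<comment> \<open>Only the part of the next piece not yet covered is added. It is disjoint from
    the rest, so indicators add up, and it is still a Borel subset of one box.\<close>
  have "test_approx Q W (indicator ((S - (\<Union>i<N. S \<inter> E i)) \<inter> E N))"
   unfolding ab(1) by (rule test_approx_borel_in_box[OF Q ab(2)]) measurable
  from test_approx_add[OF Q Suc this]
  show ?case
  proof (rule back_subst[where P = "test_approx Q W"], intro ext)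
   fix x
   show "indicator (\<Union>i<N. S \<inter> E i) x + indicator ((S - (\<Union>i<N. S \<inter> E i)) \<inter> E N) x
     = (indicator (\<Union>i<Suc N. S \<inter> E i) x :: complex)"
    by (simp add: lessThan_Suc indicator_def)
  qed
 qed
 then have "test_approx Q W (indicator (\<Union>i. S \<inter> E i))"
 proof (rule test_approx_UN[OF Q])
  show "emeasure lebesgue (\<Union>i. S \<inter> E i) < \<infinity>"
   unfolding SE using S(2) A by (metis Un_upper1 emeasure_mono le_less_trans)
  show "S \<inter> E i \<in> sets lebesgue" for i
   by simp
 qed
 then have "test_approx Q W (indicator S)"
  unfolding SE .
 moreover have "AE x in lebesgue. x \<notin> N'"
  using S(4) by (intro AE_not_in) (auto simp: null_sets_completionI)
 then have "AE x in lebesgue. (indicator S x :: complex) = indicator A x"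
  by eventually_elim (use S in \<open>auto simp: indicator_def\<close>)
 ultimately show ?thesis
  by (rule test_approx_cong_AE) (use A in auto)
qed

text \<open>Simple functions bounded by 2|f| converge to f. The bound forces them to vanish where f
  does, so their non-zero level sets lie in W and in the support of f, hence have finite
  measure.\<close>

proposition test_functions_dense:
 fixes W :: "(real^'n::finite) set"
 assumes Q: "1 \<le> Q" and W: "open W" and f: "f \<in> bounded_compact_support" "\<And>x. x \<notin> W \<Longrightarrow> f x = 0"
 shows "test_approx Q W f"
proof -
 have fm [measurable]: "f \<in> borel_measurable lebesgue"
  using f by (simp add: bounded_compact_support_def)
 define S where "S = supp f"
 have S: "compact S" "\<And>x. x \<notin> S \<Longrightarrow> f x = 0"
  using f closure_subset[of "{x. f x \<noteq> 0}"] by (auto simp: bounded_compact_support_def S_def supp_def)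
 obtain B where B: "\<And>x. norm (f x) \<le> B"
  using f by (auto simp: bounded_compact_support_def bounded_iff)
 have Sl: "S \<in> sets lebesgue" "emeasure lebesgue S < \<infinity>"
  using S lmeasurable_compact[OF S(1)] by (auto simp: fmeasurable_def)
 obtain F where F: "\<And>i. simple_function lebesgue (F i)" "\<And>x. (\<lambda>i. F i x) \<longlonglongrightarrow> f x"
   "\<And>i x. dist (F i x) 0 \<le> 2 * dist (f x) 0"
  using borel_measurable_implies_sequence_metric[OF fm, of 0] by auto
 have Fm [measurable]: "F i \<in> borel_measurable lebesgue" for i
  using F(1) borel_measurable_simple_function by blast
 have F0: "F i x = 0" if "f x = 0" for i x
  using F(3)[of i x] that by simp
 have "test_approx Q W (F i)" for i
 proof -
  have fin: "finite (range (F i))"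
   using F(1)[of i] by (simp add: simple_function_def)
  have "test_approx Q W (\<lambda>x. \<Sum>y\<in>range (F i) - {0}. y * indicator (F i -` {y}) x)"
  proof (intro test_approx_sum[OF _ Q] test_approx_scale test_approx_lebesgue_set[OF Q W])
   fix y assume y: "y \<in> range (F i) - {0}"
   show "F i -` {y} \<in> sets lebesgue"
    using F(1)[of i] y by (auto simp: simple_function_def)
   show "F i -` {y} \<subseteq> W"
    using y F0 f(2) by auto
   have "F i -` {y} \<subseteq> S"
    using y F0 S(2) by auto
   then show "emeasure lebesgue (F i -` {y}) < \<infinity>"
    using Sl by (metis emeasure_mono le_less_trans)
  qed (use fin in auto)
  moreover have "(\<lambda>x. \<Sum>y\<in>range (F i) - {0}. y * indicator (F i -` {y}) x) = F i"
  proof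
   fix x
   have "(\<Sum>y\<in>range (F i) - {0}. y * indicator (F i -` {y}) x) = (\<Sum>y\<in>range (F i). if y = F i x then y else 0)"
    using fin by (intro sum.mono_neutral_cong_left) (auto simp: indicator_def)
   then show "(\<Sum>y\<in>range (F i) - {0}. y * indicator (F i -` {y}) x) = F i x"
    using fin by simp
  qed
  ultimately show ?thesis by simp
 qed
 then show ?thesis
 proof (rule test_approx_limit_seq[OF Q fm])
  show "(\<lambda>i. ldist Q f (F i)) \<longlonglongrightarrow> 0"
  proof (rule ldist_dominated[OF Q fm Fm Sl])
   show "cmod (f x - F k x) \<le> (3 * B) * indicator S x" for k x
   proof (cases "x \<in> S")
    case True
    have "cmod (f x - F k x) \<le> cmod (f x) + cmod (F k x)"
     by (rule norm_triangle_ineq4)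
    then show ?thesis
     using F(3)[of k x] B[of x] True by simp
   next
    case False
    then show ?thesis using S(2) F0 by simp
   qed
  qed (rule F(2))
 qed
qed

section \<open>Lebesgue norms with extended values\<close>

lemma ennpowr_ennreal: "0 \<le> c \<Longrightarrow> ennreal c ennpowr a = ennreal (c powr a)"
 by (simp add: ennpowr_def)

lemma ennpowr_mono:
 assumes "x \<le> y" "0 \<le> a"
 shows "x ennpowr a \<le> y ennpowr a"
proof (cases y)
 case (real r)
 with assms(1) obtain s where "x = ennreal s" "0 \<le> s" "s \<le> r"
  by (cases x) (auto simp: top_unique)
 then show ?thesis
  using real assms(2) by (simp add: ennpowr_ennreal powr_mono2 ennreal_leI)
qed (simp add: ennpowr_def)

lemma ennpowr_less_top: "x ennpowr a < \<infinity> \<longleftrightarrow> x < \<infinity>"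
 by (cases x) (simp_all add: ennpowr_def)

lemma wlp_norm_le:
 assumes "(\<integral>\<^sup>+x. ennreal (norm (f x) powr p) * ennreal (w x) \<partial>lebesgue) \<le> ennreal c" "0 \<le> c" "0 < p"
 shows "wlp_norm p w f \<le> ennreal (c powr (1 / p))"
 unfolding wlp_norm_def using ennpowr_mono[OF assms(1), of "1 / p"] assms(2,3) by (simp add: ennpowr_ennreal)

lemma wlp_norm_eq_real:
 assumes "wlp_norm p w f < \<infinity>" "0 < p"
 obtains c where "0 \<le> c" "wlp_norm p w f = ennreal c"
  "(\<integral>\<^sup>+x. ennreal (norm (f x) powr p) * ennreal (w x) \<partial>lebesgue) = ennreal (c powr p)"
proof -
 obtain b where b: "0 \<le> b" "(\<integral>\<^sup>+x. ennreal (norm (f x) powr p) * ennreal (w x) \<partial>lebesgue) = ennreal b"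
  using assms(1) unfolding wlp_norm_def ennpowr_less_top by (cases "(\<integral>\<^sup>+x. ennreal (norm (f x) powr p) * ennreal (w x) \<partial>lebesgue)") auto
 have "wlp_norm p w f = ennreal (b powr (1 / p))"
  unfolding wlp_norm_def using b by (simp add: ennpowr_ennreal)
 moreover have "(b powr (1 / p)) powr p = b"
  using assms(2) b(1) by (simp add: powr_powr)
 ultimately show ?thesis
  using that[of "b powr (1 / p)"] b(2) by simp
qed

lemma weak_lp_normD:
 assumes "weak_lp_norm q g \<le> ennreal c" "0 \<le> c" "0 < t" "0 < q"
 shows "emeasure lebesgue {x. norm (g x) > t} \<le> ennreal ((c / t) powr q)"
proof -
 let ?E = "emeasure lebesgue {x. norm (g x) > t}"
 have le: "ennreal t * ?E ennpowr (1 / q) \<le> ennreal c"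
  using assms(1,3) unfolding weak_lp_norm_def by (meson SUP_le_iff greaterThan_iff)
 have "?E \<noteq> \<infinity>"
  using le assms(3) by (auto simp: ennpowr_def ennreal_mult_top top_unique)
 then obtain b where b: "?E = ennreal b" "0 \<le> b"
  by (cases ?E) auto
 have "t * b powr (1 / q) \<le> c"
  using le assms b by (simp add: ennpowr_ennreal flip: ennreal_mult)
 then have "b powr (1 / q) \<le> c / t"
  using assms(3) by (simp add: field_simps)
 then have "(b powr (1 / q)) powr q \<le> (c / t) powr q"
  using assms(4) by (intro powr_mono2) auto
 then show ?thesis
  using b assms(4) by (simp add: powr_powr ennreal_leI)
qed

lemma lp_norm_ldist:
 assumes "1 \<le> q" "q \<le> R" "ldist R f g \<le> ennreal d" "0 \<le> d"
 shows "lp_norm q (\<lambda>x. f x - g x) \<le> ennreal (d powr (1 / q))"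
proof (rule wlp_norm_le)
 have "norm z powr q \<le> modulus R z" for z
 proof (cases "norm z \<le> 1")
  case True
  then have "norm z powr q \<le> norm z powr 1"
   using assms(1) by (intro powr_mono') auto
  then show ?thesis
   by (simp add: modulus_def add_increasing2)
 next
  case False
  then have "norm z powr q \<le> norm z powr R"
   using assms(2) by (intro powr_mono) auto
  then show ?thesis
   by (simp add: modulus_def add_increasing)
 qed
 then have "(\<integral>\<^sup>+x. ennreal (norm (f x - g x) powr q) * ennreal 1 \<partial>lebesgue) \<le> ldist R f g"
  unfolding ldist_def by (intro nn_integral_mono) (simp add: ennreal_leI)
 then show "(\<integral>\<^sup>+x. ennreal (norm (f x - g x) powr q) * ennreal 1 \<partial>lebesgue) \<le> ennreal d"
  using assms(3) by simp
qed (use assms in auto)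

lemma bounded_compact_supportE:
 assumes "f \<in> bounded_compact_support"
 obtains B S where "f \<in> borel_measurable lebesgue" "0 \<le> B" "\<And>x. norm (f x) \<le> B"
  "compact S" "\<And>x. x \<notin> S \<Longrightarrow> f x = 0"
proof -
 obtain B where B: "\<And>x. norm (f x) \<le> B"
  using assms by (auto simp: bounded_compact_support_def bounded_iff)
 show ?thesis
 proof (rule that[of B "supp f"])
  show "0 \<le> B"
   using B norm_ge_zero order_trans by blast
  show "f x = 0" if "x \<notin> supp f" for x
   using that closure_subset[of "{x. f x \<noteq> 0}"] by (auto simp: supp_def)
 qed (use assms B in \<open>auto simp: bounded_compact_support_def\<close>)
qed

lemma bounded_compact_supportI:
 assumes "f \<in> borel_measurable lebesgue" "\<And>x. norm (f x) \<le> B" "bounded S" "\<And>x. x \<notin> S \<Longrightarrow> f x = 0"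
 shows "f \<in> bounded_compact_support"
proof -
 have "supp f \<subseteq> closure S"
  unfolding supp_def using assms(4) by (intro closure_mono) auto
 then have "bounded (supp f)"
  using assms(3) bounded_closure bounded_subset by blast
 moreover have "closed (supp f)"
  by (simp add: supp_def)
 ultimately show ?thesis
  using assms(1,2) by (auto simp: bounded_compact_support_def bounded_iff compact_eq_bounded_closed)
qed

lemma bounded_compact_support_le:
 assumes "f \<in> bounded_compact_support" "g \<in> borel_measurable lebesgue" "\<And>x. norm (g x) \<le> norm (f x)"
 shows "g \<in> bounded_compact_support"
proof -
 obtain B S where *: "\<And>x. norm (f x) \<le> B" "compact S" "\<And>x. x \<notin> S \<Longrightarrow> f x = 0"
  using bounded_compact_supportE[OF assms(1)] by metis
 show ?thesis
 proof (rule bounded_compact_supportI[OF assms(2) _ compact_imp_bounded[OF *(2)]])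
  show "norm (g x) \<le> B" for x
   using * assms(3) order_trans by blast
  show "g x = 0" if "x \<notin> S" for x
   using *(3)[OF that] assms(3)[of x] by simp
 qed
qed

lemma bounded_compact_support_lincomb:
 assumes "f \<in> bounded_compact_support" "g \<in> bounded_compact_support"
 shows "(\<lambda>x. a * f x + b * g x) \<in> bounded_compact_support"
proof -
 obtain B S where *: "f \<in> borel_measurable lebesgue" "\<And>x. norm (f x) \<le> B" "compact S" "\<And>x. x \<notin> S \<Longrightarrow> f x = 0"
  using bounded_compact_supportE[OF assms(1)] by metis
 obtain B' S' where **: "g \<in> borel_measurable lebesgue" "\<And>x. norm (g x) \<le> B'" "compact S'" "\<And>x. x \<notin> S' \<Longrightarrow> g x = 0"
  using bounded_compact_supportE[OF assms(2)] by metis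
 show ?thesis
 proof (rule bounded_compact_supportI)
  show "norm (a * f x + b * g x) \<le> norm a * B + norm b * B'" for x
   by (rule norm_triangle_mono) (simp_all add: norm_mult mult_left_mono * **)
  show "bounded (S \<union> S')"
   using * ** compact_imp_bounded by blast
 qed (use * ** in auto)
qed

lemma bounded_compact_support_nn_integral:
 assumes "f \<in> bounded_compact_support" "0 < p"
 shows "(\<integral>\<^sup>+x. ennreal (norm (f x) powr p) \<partial>lebesgue) < \<infinity>"
proof -
 obtain B S where *: "0 \<le> B" "\<And>x. norm (f x) \<le> B" "compact S" "\<And>x. x \<notin> S \<Longrightarrow> f x = 0"
  using bounded_compact_supportE[OF assms(1)] by metis
 have "ennreal (norm (f x) powr p) \<le> ennreal (B powr p) * indicator S x" for x
  using *(1) *(2)[of x] *(4)[of x] assms(2)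
  by (cases "x \<in> S") (auto intro!: ennreal_leI powr_mono2)
 then have "(\<integral>\<^sup>+x. ennreal (norm (f x) powr p) \<partial>lebesgue) \<le> (\<integral>\<^sup>+x. ennreal (B powr p) * indicator S x \<partial>lebesgue)"
  by (intro nn_integral_mono)
 also have "\<dots> = ennreal (B powr p) * emeasure lebesgue S"
  using lmeasurable_compact[OF *(3)] by (intro nn_integral_cmult_indicator) (simp add: fmeasurable_def)
 also have "\<dots> < \<infinity>"
  using lmeasurable_compact[OF *(3)] by (simp add: fmeasurable_def ennreal_mult_less_top del: emeasure_completion)
 finally show ?thesis .
qed

lemma bounded_compact_support_lp:
 assumes "f \<in> bounded_compact_support" "0 < p"
 shows "f \<in> lp p"
 using bounded_compact_support_nn_integral[OF assms] assms(1)
 by (simp add: wlp_def wlp_norm_def ennpowr_less_top[simplified] bounded_compact_support_def)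

section \<open>Locally integrable functions are determined by test functions\<close>

text \<open>Testing with the set where the function is positive shows that it is a.e. at most 0; the
  same applies to its negative.\<close>

lemma AE_eq_0_of_set_integrals:
 fixes f :: "'a \<Rightarrow> real"
 assumes f: "integrable M f" and 0: "\<And>A. A \<in> sets M \<Longrightarrow> (LINT x|M. indicator A x * f x) = 0"
 shows "AE x in M. f x = 0"
proof -
 have *: "AE x in M. g x \<le> 0" if g: "integrable M g" "\<And>A. A \<in> sets M \<Longrightarrow> (LINT x|M. indicator A x * g x) = 0" for g :: "'a \<Rightarrow> real"
 proof -
  have [measurable]: "g \<in> borel_measurable M"
   using g(1) by auto
  let ?A = "{x \<in> space M. 0 < g x}"
  have "AE x in M. indicator ?A x * g x = 0"
  proof (subst integral_nonneg_eq_0_iff_AE[symmetric])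
   show "integrable M (\<lambda>x. indicator ?A x * g x)"
    using integrable_mult_indicator[OF _ g(1), of ?A] by simp
   show "AE x in M. 0 \<le> indicator ?A x * g x"
    by (auto simp: indicator_def)
  qed (simp add: g(2))
  then show ?thesis
   by (rule AE_mp) (auto intro!: AE_I2 simp: indicator_def split: if_splits)
 qed
 have "AE x in M. f x \<le> 0"
  by (rule *) (use f 0 in auto)
 moreover have "AE x in M. - f x \<le> 0"
  by (rule *) (use f 0 in auto)
 ultimately show ?thesis
  by eventually_elim simp
qed

text \<open>The sets with vanishing integral form a Dynkin system that contains the boxes. Null sets
  lead on to Lebesgue sets, and real and imaginary parts are treated separately.\<close>

lemma AE_eq_0_of_box_integrals:
 fixes f :: "real^'n::finite \<Rightarrow> complex"
 assumes f: "integrable lebesgue f" and 0: "\<And>a b. (LINT x|lebesgue. indicator (box a b) x *\<^sub>R f x) = 0"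
 shows "AE x in lebesgue. f x = 0"
proof -
 have int: "integrable lebesgue (\<lambda>x. indicator A x *\<^sub>R f x)" if "A \<in> sets lebesgue" for A
  using integrable_mult_indicator[OF that f] .
 have borel: "(LINT x|lebesgue. indicator A x *\<^sub>R f x) = 0" if "A \<in> sets borel" for A
 proof -
  \<comment> \<open>The complement step of the Dynkin system needs the integral over the whole
    space, obtained from boxes that exhaust it.\<close>
  have univ: "(LINT x|lebesgue. f x) = 0"
  proof -
   define b where "b = (\<lambda>k::nat. (\<chi> i::'n. real k))"
   have "(\<lambda>k. LINT x|lebesgue. indicator (box (- b k) (b k)) x *\<^sub>R f x) \<longlonglongrightarrow> (LINT x|lebesgue. f x)"
   proof (rule integral_dominated_convergence[where w = "\<lambda>x. norm (f x)"])
    show "AE x in lebesgue. (\<lambda>k. indicator (box (- b k) (b k)) x *\<^sub>R f x) \<longlonglongrightarrow> f x"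
    proof (rule AE_I2)
     fix x :: "real^'n"
     obtain N where N: "norm x < real N"
      using reals_Archimedean2 by blast
     have "x \<in> box (- b k) (b k)" if "k \<ge> N" for k
      unfolding mem_box_cart
     proof
      fix i
      have "\<bar>x $ i\<bar> < real k"
       using component_le_norm_cart[of x i] N that by linarith
      then show "(- b k) $ i < x $ i \<and> x $ i < b k $ i"
       by (auto simp: b_def)
     qed
     then have "\<forall>\<^sub>F k in sequentially. indicator (box (- b k) (b k)) x *\<^sub>R f x = f x"
      unfolding eventually_sequentially by (intro exI[of _ N]) simp
     then show "(\<lambda>k. indicator (box (- b k) (b k)) x *\<^sub>R f x) \<longlonglongrightarrow> f x"
      by (rule tendsto_eventually)
    qed
    show "AE x in lebesgue. norm (indicator (box (- b k) (b k)) x *\<^sub>R f x) \<le> norm (f x)" for k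
     by (simp add: indicator_def)
    show "(\<lambda>x. indicator (box (- b k) (b k)) x *\<^sub>R f x) \<in> borel_measurable lebesgue" for k
     by (rule borel_measurable_integrable[OF int]) simp
   qed (use f in auto)
   then show ?thesis
    by (simp add: 0 LIMSEQ_const_iff)
  qed
  have sub: "range (\<lambda>(a, b). box a b :: (real^'n) set) \<subseteq> Pow UNIV"
   by blast
  have "A \<in> sigma_sets UNIV (range (\<lambda>(a, b). box a b))"
   using that unfolding borel_eq_box by simp
  with Int_stable_box sub show ?thesis
  proof (induction rule: sigma_sets_induct_disjoint)
   case (basic A)
   then show ?case
    using 0 by auto
  next
   case (compl A)
   have A: "A \<in> sets lebesgue"
    using compl(1) by (simp add: borel_eq_box[symmetric] sets_completionI_sets flip: sets_measure_of)
      (metis borel_eq_box sets_completionI_sets sets_lborel sets_measure_of sub)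
   have "(LINT x|lebesgue. indicator (UNIV - A) x *\<^sub>R f x) = (LINT x|lebesgue. f x - indicator A x *\<^sub>R f x)"
    by (intro Bochner_Integration.integral_cong) (auto simp: indicator_def)
   then show ?case
    using Bochner_Integration.integral_diff[OF f int[OF A]] univ compl(2) by simp
  next
   case (union A)
   have A: "A i \<in> sets lebesgue" for i
   proof -
    have "A i \<in> sets borel"
     using union(2) unfolding borel_eq_box by auto
    then show ?thesis by auto
   qed
   have "(LINT x|lebesgue. indicator (\<Union>i. A i) x *\<^sub>R f x) = (\<Sum>i. LINT x|lebesgue. indicator (A i) x *\<^sub>R f x)"
    using lebesgue_integral_countable_add[of A lebesgue f] union(1) A f
    by (auto simp: set_lebesgue_integral_def set_integrable_def disjoint_family_on_def intro!: int sets.countable_UN')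
   then show ?case
    by (simp add: union(3))
  qed simp
 qed
 have leb: "(LINT x|lebesgue. indicator A x *\<^sub>R f x) = 0" if A: "A \<in> sets lebesgue" for A
 proof -
  obtain S N N' where S: "S \<in> sets lborel" "A = S \<union> N" "N \<subseteq> N'" "N' \<in> null_sets lborel"
   using A by (auto elim: sets_completionE)
  have "AE x in lebesgue. x \<notin> N'"
   using S(4) by (intro AE_not_in null_sets_completionI)
  then have "AE x in lebesgue. indicator A x *\<^sub>R f x = indicator S x *\<^sub>R f x"
   by eventually_elim (use S in \<open>auto simp: indicator_def\<close>)
  then have "(LINT x|lebesgue. indicator A x *\<^sub>R f x) = (LINT x|lebesgue. indicator S x *\<^sub>R f x)"
   using S(1) A int by (intro integral_cong_AE) (auto intro!: borel_measurable_integrable[OF int])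
  then show ?thesis
   using borel S(1) by simp
 qed
 have "AE x in lebesgue. Re (f x) = 0"
 proof (rule AE_eq_0_of_set_integrals)
  fix A :: "(real^'n) set" assume A: "A \<in> sets lebesgue"
  have "(LINT x|lebesgue. Re (indicator A x *\<^sub>R f x)) = Re (LINT x|lebesgue. indicator A x *\<^sub>R f x)"
   using int[OF A] by (rule integral_Re)
  then show "(LINT x|lebesgue. indicator A x * Re (f x)) = 0"
   by (simp add: leb[OF A])
 qed (use f in simp)
 moreover have "AE x in lebesgue. Im (f x) = 0"
 proof (rule AE_eq_0_of_set_integrals)
  fix A :: "(real^'n) set" assume A: "A \<in> sets lebesgue"
  have "(LINT x|lebesgue. Im (indicator A x *\<^sub>R f x)) = Im (LINT x|lebesgue. indicator A x *\<^sub>R f x)"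
   using int[OF A] by (rule integral_Im)
  then show "(LINT x|lebesgue. indicator A x * Im (f x)) = 0"
   by (simp add: leb[OF A])
 qed (use f in simp)
 ultimately show ?thesis
  by eventually_elim (simp add: complex_eq_iff)
qed

lemma open_Union_countable_cboxes:
 fixes W :: "(real^'n::finite) set"
 assumes "open W"
 shows "\<exists>D. \<Union>D = W \<and> countable D \<and> (\<forall>X\<in>D. X \<subseteq> W \<and> (\<exists>c e. X = cbox c e))"
proof (rule open_countable_Union_open_cbox[OF assms])
 fix D assume "countable D" "D \<subseteq> Pow W" "\<And>X. X \<in> D \<Longrightarrow> \<exists>a b. X = cbox a b" "\<Union>D = W"
 then show ?thesis
  by (intro exI[of _ D] conjI ballI) auto
qed

text \<open>Fundamental lemma of the calculus of variations. Local integrability of d is extracted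
  from the products with bumps: on a closed box inside an open one the larger bump is bounded below
  and can be divided out. Letting \<epsilon> tend to 0 in the bumps of smaller boxes then gives all
  box integrals.\<close>

lemma AE_eq_0_of_bumps:
 fixes d :: "real^'n::finite \<Rightarrow> complex"
 assumes W: "open W"
  and int: "\<And>a b \<epsilon>. 0 < \<epsilon> \<Longrightarrow> cbox a b \<subseteq> W \<Longrightarrow> integrable lebesgue (\<lambda>x. d x * of_real (box_bump \<epsilon> a b x))"
  and 0: "\<And>a b \<epsilon>. 0 < \<epsilon> \<Longrightarrow> cbox a b \<subseteq> W \<Longrightarrow> (LINT x|lebesgue. d x * of_real (box_bump \<epsilon> a b x)) = 0"
 shows "AE x in lebesgue. x \<in> W \<longrightarrow> d x = 0"
proof -
 have box0: "AE x in lebesgue. indicator (box a b) x * (d x * of_real (box_bump 1 a b x)) = 0" if ab: "cbox a b \<subseteq> W" for a b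
 proof -
  have sub0: "AE x in lebesgue. indicator (cbox c e) x *\<^sub>R d x = 0" if ce: "cbox c e \<subseteq> box a b" for c e
  proof -
   let ?d = "\<lambda>x. indicator (cbox c e) x *\<^sub>R d x"
   have cont: "continuous_on UNIV (\<lambda>x. box_bump 1 a b x)"
    using smooth_continuous_on[OF box_bump_smooth[of 1 a b]] continuous_on_Re by fastforce
   \<comment> \<open>The positive minimum of the bump on the compact box \<open>cbox c e\<close>;
     the value 1 serves if that box is empty.\<close>
   obtain m where m: "0 < m" "\<And>x. x \<in> cbox c e \<Longrightarrow> m \<le> box_bump 1 a b x"
   proof (cases "cbox c e = {}")
    case False
    then obtain y where "y \<in> cbox c e" "\<And>x. x \<in> cbox c e \<Longrightarrow> box_bump 1 a b y \<le> box_bump 1 a b x"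
     using continuous_attains_inf[of "cbox c e" "box_bump 1 a b"] continuous_on_subset[OF cont] by auto
    then show ?thesis
     using that[of "box_bump 1 a b y"] box_bump_pos[of y a b 1] ce by blast
   qed (use that[of 1] in auto)
   have u: "integrable lebesgue (\<lambda>x. d x * of_real (box_bump 1 a b x))"
    using int[OF _ ab] by simp
   have inte: "integrable lebesgue ?d"
   proof (rule Bochner_Integration.integrable_bound[OF integrable_mult_right[OF u, of "of_real (1 / m)"]])
    have "(\<lambda>x. indicator (cbox c e) x *\<^sub>R ((d x * of_real (box_bump 1 a b x)) * of_real (1 / box_bump 1 a b x))) \<in> borel_measurable lebesgue"
    proof -
     have "box_bump 1 a b \<in> borel_measurable lebesgue"
      using measurable_completion[of "box_bump 1 a b" lborel borel] borel_measurable_continuous_onI[OF cont] by simp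
     then show ?thesis
      by (intro borel_measurable_scaleR borel_measurable_times borel_measurable_indicator borel_measurable_integrable[OF u]) (auto intro!: borel_measurable_of_real borel_measurable_divide)
    qed
    then show "?d \<in> borel_measurable lebesgue"
    proof (rule back_subst[where P = "\<lambda>f. f \<in> borel_measurable lebesgue"])
     show "(\<lambda>x. indicator (cbox c e) x *\<^sub>R ((d x * of_real (box_bump 1 a b x)) * of_real (1 / box_bump 1 a b x))) = ?d"
     proof
      fix x
      show "indicator (cbox c e) x *\<^sub>R ((d x * of_real (box_bump 1 a b x)) * of_real (1 / box_bump 1 a b x)) = ?d x"
       using m(1) m(2)[of x] by (cases "x \<in> cbox c e") (auto simp del: mem_box_cart)
     qed
    qed
    show "AE x in lebesgue. norm (?d x) \<le> norm (of_real (1 / m) * (d x * of_real (box_bump 1 a b x)))"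
    proof (rule AE_I2)
     fix x
     show "norm (?d x) \<le> norm (of_real (1 / m) * (d x * of_real (box_bump 1 a b x)))"
     proof (cases "x \<in> cbox c e")
      case True
      have "norm (d x) * m \<le> norm (d x) * box_bump 1 a b x"
       using m(2)[OF True] by (intro mult_left_mono) auto
      then show ?thesis
       using True m(1) box_bump_bounds(1)[of 1 a b x] by (simp add: norm_mult norm_divide field_simps)
     qed simp
    qed
   qed
   show ?thesis
   proof (rule AE_eq_0_of_box_integrals[OF inte])
    fix p q :: "real^'n"
    obtain p' q' where pq: "box p q \<inter> box c e = box p' q'"
     using box_Int_box_is_box by blast
    have limint: "(\<lambda>k. LINT x|lebesgue. of_real (box_bump (1 / Suc k) p' q' x) * ?d x) \<longlonglongrightarrow> (LINT x|lebesgue. of_real (indicator (box p' q') x) * ?d x)"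
    proof (rule integral_dominated_convergence[where w = "\<lambda>x. norm (?d x)"])
     have [measurable]: "(\<lambda>x. complex_of_real (box_bump (1 / Suc k) p' q' x)) \<in> borel_measurable lebesgue" for k
      by (rule test_functions_measurable_lebesgue[of _ UNIV], rule box_bump_test_functions) auto
     show "(\<lambda>x. of_real (box_bump (1 / Suc k) p' q' x) * ?d x) \<in> borel_measurable lebesgue" for k
      by (intro borel_measurable_times borel_measurable_integrable[OF inte]) measurable
     show "(\<lambda>x. of_real (indicator (box p' q') x) * ?d x) \<in> borel_measurable lebesgue"
      using borel_measurable_integrable[OF integrable_mult_indicator[OF _ inte, of "box p' q'"]] by (simp add: scaleR_conv_of_real)
     show "AE x in lebesgue. (\<lambda>k. of_real (box_bump (1 / Suc k) p' q' x) * ?d x) \<longlonglongrightarrow> of_real (indicator (box p' q') x) * ?d x"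
      by (intro AE_I2 tendsto_mult tendsto_of_real box_bump_tendsto tendsto_const)
     show "AE x in lebesgue. norm (of_real (box_bump (1 / Suc k) p' q' x) * ?d x) \<le> norm (?d x)" for k
     proof (rule AE_I2)
      fix x
      have "\<bar>box_bump (1 / Suc k) p' q' x\<bar> * norm (?d x) \<le> 1 * norm (?d x)"
       using box_bump_bounds[of "1 / Suc k" p' q' x] by (intro mult_right_mono) auto
      then show "norm (of_real (box_bump (1 / Suc k) p' q' x) * ?d x) \<le> norm (?d x)"
       by (simp only: norm_mult norm_of_real mult_1)
     qed
    qed (use inte integrable_norm[OF inte] in auto)
    have eq: "of_real (box_bump \<epsilon> p' q' x) * ?d x = d x * of_real (box_bump \<epsilon> p' q' x)" for \<epsilon> x
    proof (cases "x \<in> box p' q'")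
     case True
     then have "x \<in> cbox c e"
      using pq box_subset_cbox[of c e] by blast
     then show ?thesis by simp
    next
     case False
     then show ?thesis
      by (simp add: box_bump_eq_0)
    qed
    \<comment> \<open>The hypothesis speaks of boxes whose closed box lies in W. For a non-empty
      open box the closed box is its closure, and this stays inside \<open>cbox c e\<close>.\<close>
    have z: "(LINT x|lebesgue. of_real (box_bump (1 / Suc k) p' q' x) * ?d x) = 0" for k
    proof (cases "box p' q' = {}")
     case True
     then show ?thesis
      by (simp add: box_bump_eq_0)
    next
     case False
     have "cbox p' q' = closure (box p' q')"
      using False by (simp add: closure_box)
     also have "\<dots> \<subseteq> closure (cbox c e)"
      using pq box_subset_cbox[of c e] by (intro closure_mono) blast
     also have "\<dots> \<subseteq> W"
      using ce ab box_subset_cbox[of a b] by auto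
     finally show ?thesis
      unfolding eq by (intro 0) auto
    qed
    have "(LINT x|lebesgue. of_real (indicator (box p' q') x) * ?d x) = 0"
     using limint unfolding z by (simp add: LIMSEQ_const_iff)
    moreover have "AE x in lebesgue. of_real (indicator (box p' q') x) * ?d x = indicator (box p q) x *\<^sub>R ?d x"
    proof -
     have "negligible (cbox c e - box c e)"
      by (rule negligible_frontier_interval)
     then have "AE x in lebesgue. x \<notin> cbox c e - box c e"
      by (intro AE_not_in) (simp add: negligible_iff_null_sets)
     then show ?thesis
     proof eventually_elim
      case (elim x)
      then show ?case
       unfolding pq[symmetric] by (auto simp: indicator_def scaleR_conv_of_real)
     qed
    qed
    then have "(LINT x|lebesgue. of_real (indicator (box p' q') x) * ?d x) = (LINT x|lebesgue. indicator (box p q) x *\<^sub>R ?d x)"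
    proof (rule integral_cong_AE[rotated 2])
     show "(\<lambda>x. of_real (indicator (box p' q') x) * ?d x) \<in> borel_measurable lebesgue"
      using borel_measurable_integrable[OF integrable_mult_indicator[OF _ inte, of "box p' q'"]] by (simp add: scaleR_conv_of_real)
     show "(\<lambda>x. indicator (box p q) x *\<^sub>R ?d x) \<in> borel_measurable lebesgue"
      by (rule borel_measurable_integrable[OF integrable_mult_indicator[OF _ inte, of "box p q"]]) simp
    qed
    ultimately show "(LINT x|lebesgue. indicator (box p q) x *\<^sub>R ?d x) = 0"
     by simp
   qed
  qed
  obtain D where D: "\<Union>D = box a b" "countable D" "\<And>X. X \<in> D \<Longrightarrow> X \<subseteq> box a b \<and> (\<exists>c e. X = cbox c e)"
   using open_Union_countable_cboxes[OF open_box[of a b]] by auto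
  have "AE x in lebesgue. \<forall>X\<in>D. x \<in> X \<longrightarrow> d x = 0"
   unfolding AE_ball_countable[OF D(2)]
  proof
   fix X assume "X \<in> D"
   then obtain c e where X: "X = cbox c e" "cbox c e \<subseteq> box a b"
    using D(3) by blast
   show "AE x in lebesgue. x \<in> X \<longrightarrow> d x = 0"
    using sub0[OF X(2)] by (rule AE_mp) (auto intro!: AE_I2 simp: X(1) indicator_def)
  qed
  then show ?thesis
  proof eventually_elim
   case (elim x)
   then show ?case
    using D(1) by (cases "x \<in> box a b") (auto simp del: mem_box_cart)
  qed
 qed
 obtain D where D: "\<Union>D = W" "countable D" "\<And>X. X \<in> D \<Longrightarrow> X \<subseteq> W \<and> (\<exists>c e. X = cbox c e)"
  using open_Union_countable_cboxes[OF W] by auto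
 have "AE x in lebesgue. \<forall>X\<in>D. x \<in> X \<longrightarrow> d x = 0"
  unfolding AE_ball_countable[OF D(2)]
 proof
  fix X assume "X \<in> D"
  then obtain c e where X: "X = cbox c e" "cbox c e \<subseteq> W"
   using D(3) by blast
  have "negligible (cbox c e - box c e)"
   by (rule negligible_frontier_interval)
  then have "AE x in lebesgue. x \<notin> cbox c e - box c e"
   by (intro AE_not_in) (simp add: negligible_iff_null_sets)
  then show "AE x in lebesgue. x \<in> X \<longrightarrow> d x = 0"
   using box0[OF X(2)]
  proof eventually_elim
   case (elim x)
   then show ?case
    using X(1) box_bump_pos[of x c e 1] by (auto simp: indicator_def split: if_splits)
  qed
 qed
 then show ?thesis
  by eventually_elim (use D(1) in blast)
qed

section \<open>Continuity and uniqueness of weak extensions\<close>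

lemma sets_superlevel [simp]:
 fixes g :: "real^'n::finite \<Rightarrow> complex"
 assumes [measurable]: "g \<in> borel_measurable lebesgue"
 shows "{x. c < norm (g x)} \<in> sets lebesgue"
proof -
 have "{x \<in> space lebesgue. c < norm (g x)} \<in> sets lebesgue"
  by measurable
 then show ?thesis
  by simp
qed

lemma weak_extension_diff:
 assumes U: "weak_extension T qs q U" and pos: "\<And>j. 0 < qs j"
  and f: "\<And>j. f j \<in> bounded_compact_support"
  and u: "u \<in> bounded_compact_support" and v: "v \<in> bounded_compact_support"
 shows "AE x in lebesgue. U (f(k := u)) x - U (f(k := v)) x = U (f(k := \<lambda>x. u x - v x)) x"
proof -
 have "AE x in lebesgue. U (f(k := \<lambda>x. 1 * u x + (-1) * v x)) x = 1 * U (f(k := u)) x + (-1) * U (f(k := v)) x"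
  using U f u v bounded_compact_support_lp[OF _ pos] unfolding weak_extension_def multilinear_on_def by blast
 then show ?thesis
  by eventually_elim simp
qed

lemma weak_extension_measurable:
 assumes "weak_extension T qs q U" "\<And>j. 0 < qs j" "\<And>j. f j \<in> bounded_compact_support"
 shows "U f \<in> borel_measurable lebesgue"
proof -
 have "\<forall>j. f j \<in> lp (qs j)"
  using assms bounded_compact_support_lp by blast
 then show ?thesis
  using assms(1) unfolding weak_extension_def by blast
qed

lemma weak_extension_schwartz:
 assumes "weak_extension T qs q U" "\<forall>j. f j \<in> schwartz" "\<psi> \<in> schwartz"
 shows "integrable lebesgue (\<lambda>x. U f x * \<psi> x)" "T f \<psi> = (LINT x|lebesgue. U f x * \<psi> x)"
 using assms unfolding weak_extension_def by simp_all

lemma weak_extension_bound: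
 fixes U :: "('m::finite \<Rightarrow> real^'n::finite \<Rightarrow> complex) \<Rightarrow> real^'n \<Rightarrow> complex"
 assumes U: "weak_extension T qs q U" and pos: "\<And>j. 0 < qs j" and q: "0 < q"
 obtains C where "0 \<le> C"
  "\<And>f. (\<And>j. f j \<in> bounded_compact_support) \<Longrightarrow> U f \<in> borel_measurable lebesgue"
  "\<And>f c t. (\<And>j. f j \<in> bounded_compact_support) \<Longrightarrow> (\<And>j. 0 \<le> c j) \<Longrightarrow>
    (\<And>j. lp_norm (qs j) (f j) \<le> ennreal (c j)) \<Longrightarrow> 0 < t \<Longrightarrow>
    emeasure lebesgue {x. norm (U f x) > t} \<le> ennreal ((C * (\<Prod>j\<in>UNIV. c j) / t) powr q)"
proof -
 obtain C where C: "\<And>f. (\<And>j. f j \<in> lp (qs j)) \<Longrightarrow> U f \<in> borel_measurable lebesgue \<and>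
    weak_lp_norm q (U f) \<le> ennreal C * (\<Prod>j\<in>UNIV. lp_norm (qs j) (f j))"
  using U unfolding weak_extension_def by blast
 note lp = bounded_compact_support_lp[OF _ pos]
 show ?thesis
 proof (rule that[of "max C 0"])
  fix f :: "'m \<Rightarrow> real^'n \<Rightarrow> complex" and c and t :: real
  assume f: "\<And>j. f j \<in> bounded_compact_support" and c: "\<And>j. 0 \<le> c j" "\<And>j. lp_norm (qs j) (f j) \<le> ennreal (c j)"
   and t: "0 < t"
  have "weak_lp_norm q (U f) \<le> ennreal C * (\<Prod>j\<in>UNIV. lp_norm (qs j) (f j))"
   using C[of f] lp f by blast
  also have "\<dots> \<le> ennreal (max C 0) * (\<Prod>j\<in>UNIV. ennreal (c j))"
   by (intro mult_mono prod_mono_ennreal c) (auto intro: ennreal_leI)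
  also have "\<dots> = ennreal (max C 0 * (\<Prod>j\<in>UNIV. c j))"
   using c(1) by (simp add: prod_ennreal ennreal_mult prod_nonneg)
  finally show "emeasure lebesgue {x. norm (U f x) > t} \<le> ennreal ((max C 0 * (\<Prod>j\<in>UNIV. c j) / t) powr q)"
   by (rule weak_lp_normD) (use t q c(1) in \<open>auto intro!: mult_nonneg_nonneg prod_nonneg\<close>)
 next
  show "U f \<in> borel_measurable lebesgue" if "\<And>j. f j \<in> bounded_compact_support" for f
   using C[of f] lp[OF that] by blast
 qed simp
qed

text \<open>Continuity in measure. The entries of f are replaced by those of g one after another; by
  multilinearity each replacement changes the value by the operator at a tuple with one small entry
  and all others bounded, and the weak type bound applies to it.\<close>

lemma weak_extension_stable:
 fixes f :: "'m::finite \<Rightarrow> real^'n::finite \<Rightarrow> complex"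
 assumes U: "weak_extension T qs q U" and qs: "\<And>j. 1 \<le> qs j" "\<And>j. qs j \<le> R" and q: "0 < q"
  and f: "\<And>j. f j \<in> bounded_compact_support"
  and e: "0 < \<epsilon>"
 shows "\<exists>\<delta>>0. \<forall>g. (\<forall>j. g j \<in> bounded_compact_support \<and> ldist R (f j) (g j) \<le> ennreal \<delta>) \<longrightarrow>
  emeasure lebesgue {x. norm (U g x - U f x) > \<epsilon>} \<le> ennreal \<epsilon>"
proof -
 have pos: "0 < qs j" for j
  using qs(1)[of j] by simp
 obtain C where C: "0 \<le> C"
  "\<And>f. (\<And>j. f j \<in> bounded_compact_support) \<Longrightarrow> U f \<in> borel_measurable lebesgue"
  "\<And>f c t. (\<And>j. f j \<in> bounded_compact_support) \<Longrightarrow> (\<And>j. 0 \<le> c j) \<Longrightarrow>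
    (\<And>j. lp_norm (qs j) (f j) \<le> ennreal (c j)) \<Longrightarrow> 0 < t \<Longrightarrow>
    emeasure lebesgue {x. norm (U f x) > t} \<le> ennreal ((C * (\<Prod>j\<in>UNIV. c j) / t) powr q)"
  by (rule weak_extension_bound[OF U pos q]) blast
 have "\<exists>M\<ge>0. lp_norm (qs j) (f j) = ennreal M" for j
 proof -
  have "lp_norm (qs j) (f j) < \<infinity>"
   using bounded_compact_support_lp[OF f[of j] pos[of j]] by (simp add: wlp_def)
  then show ?thesis
   by (rule wlp_norm_eq_real[OF _ pos]) blast
 qed
 then obtain M where M: "\<And>j. 0 \<le> M j" "\<And>j. lp_norm (qs j) (f j) = ennreal (M j)"
  by metis
 \<comment> \<open>A common bound for the norms of f_j and of every g_j at distance at most 1: the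
   second summand is the quasi-triangle bound for g_j, the first covers f_j itself.\<close>
 define N where "N j = M j + (2 powr qs j * (M j powr qs j + 1)) powr (1 / qs j)" for j
 have N0: "0 \<le> N j" for j
  using M(1)[of j] by (simp add: N_def)
 have gN: "lp_norm (qs j) g \<le> ennreal (N j)" if g: "g \<in> bounded_compact_support" "ldist R (f j) g \<le> ennreal 1" for g j
 proof -
  have fi: "(\<integral>\<^sup>+x. ennreal (norm (f j x) powr qs j) \<partial>lebesgue) = ennreal (M j powr qs j)"
  proof -
   have "lp_norm (qs j) (f j) < \<infinity>"
    by (simp add: M(2))
   then obtain c where "0 \<le> c" "lp_norm (qs j) (f j) = ennreal c"
    "(\<integral>\<^sup>+x. ennreal (norm (f j x) powr qs j) * ennreal 1 \<partial>lebesgue) = ennreal (c powr qs j)"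
    by (rule wlp_norm_eq_real[OF _ pos])
   moreover from this have "c = M j"
    using M[of j] by simp
   ultimately show ?thesis
    by simp
  qed
  have di: "(\<integral>\<^sup>+x. ennreal (norm (f j x - g x) powr qs j) \<partial>lebesgue) \<le> ennreal 1"
  proof -
   have "lp_norm (qs j) (\<lambda>x. f j x - g x) \<le> ennreal (1 powr (1 / qs j))"
    by (rule lp_norm_ldist[OF qs g(2)]) simp
   then have le: "lp_norm (qs j) (\<lambda>x. f j x - g x) \<le> ennreal 1"
    by simp
   then have "lp_norm (qs j) (\<lambda>x. f j x - g x) < \<infinity>"
    by (rule le_less_trans) simp
   then obtain c where c: "0 \<le> c" "lp_norm (qs j) (\<lambda>x. f j x - g x) = ennreal c"
    "(\<integral>\<^sup>+x. ennreal (norm (f j x - g x) powr qs j) * ennreal 1 \<partial>lebesgue) = ennreal (c powr qs j)"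
    by (rule wlp_norm_eq_real[OF _ pos])
   have "c powr qs j \<le> 1 powr qs j"
    using c le pos[of j] by (intro powr_mono2) auto
   then show ?thesis
    using c(3) by (simp add: ennreal_leI)
  qed
  have [measurable]: "f j \<in> borel_measurable lebesgue" "g \<in> borel_measurable lebesgue"
   using f g(1) by (auto simp: bounded_compact_support_def)
  have "lp_norm (qs j) g \<le> ennreal ((2 powr qs j * (M j powr qs j + 1)) powr (1 / qs j))"
  proof (rule wlp_norm_le)
   have "norm (g x) powr qs j \<le> 2 powr qs j * (norm (f j x) powr qs j + norm (f j x - g x) powr qs j)" for x
   proof -
    have "norm (g x) \<le> norm (f j x) + norm (f j x - g x)"
     using norm_triangle_ineq4[of "f j x" "f j x - g x"] by simp
    then have "norm (g x) powr qs j \<le> (norm (f j x) + norm (f j x - g x)) powr qs j"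
     using pos[of j] by (intro powr_mono2) auto
    also have "\<dots> \<le> 2 powr qs j * (norm (f j x) powr qs j + norm (f j x - g x) powr qs j)"
     using pos[of j] by (intro powr_add_le) auto
    finally show ?thesis .
   qed
   then have "(\<integral>\<^sup>+x. ennreal (norm (g x) powr qs j) * ennreal 1 \<partial>lebesgue) \<le>
     (\<integral>\<^sup>+x. ennreal (2 powr qs j) * (ennreal (norm (f j x) powr qs j) + ennreal (norm (f j x - g x) powr qs j)) \<partial>lebesgue)"
    by (intro nn_integral_mono) (simp flip: ennreal_mult ennreal_plus add: ennreal_leI)
   also have "\<dots> = ennreal (2 powr qs j) * ((\<integral>\<^sup>+x. ennreal (norm (f j x) powr qs j) \<partial>lebesgue) + (\<integral>\<^sup>+x. ennreal (norm (f j x - g x) powr qs j) \<partial>lebesgue))"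
    by (subst nn_integral_cmult, measurable, subst nn_integral_add) auto
   also have "\<dots> \<le> ennreal (2 powr qs j) * (ennreal (M j powr qs j) + ennreal 1)"
    unfolding fi by (intro mult_left_mono add_left_mono di) auto
   also have "\<dots> = ennreal (2 powr qs j * (M j powr qs j + 1))"
    using ennreal_plus[of "M j powr qs j" 1] by (simp add: ennreal_mult)
   finally show "(\<integral>\<^sup>+x. ennreal (norm (g x) powr qs j) * ennreal 1 \<partial>lebesgue) \<le> ennreal (2 powr qs j * (M j powr qs j + 1))" .
  qed (use pos[of j] in auto)
  also have "\<dots> \<le> ennreal (N j)"
   using M(1)[of j] by (intro ennreal_leI) (simp add: N_def)
  finally show ?thesis .
 qed
 have fN: "lp_norm (qs j) (f j) \<le> ennreal (N j)" for j
  unfolding M(2) by (intro ennreal_leI) (simp add: N_def)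
 define mix where "mix S g = (\<lambda>j. if j \<in> S then g j else f j)" for S :: "'m set" and g :: "'m \<Rightarrow> real^'n \<Rightarrow> complex"
 have mix_bcs: "mix S g j \<in> bounded_compact_support" if "\<forall>j. g j \<in> bounded_compact_support" for S g j
  using that f by (simp add: mix_def)
 have "\<forall>\<epsilon>>0. \<exists>\<delta>>0. \<forall>g. (\<forall>j. g j \<in> bounded_compact_support \<and> ldist R (f j) (g j) \<le> ennreal \<delta>) \<longrightarrow>
  emeasure lebesgue {x. norm (U (mix S g) x - U f x) > \<epsilon>} \<le> ennreal \<epsilon>" if "finite S" for S
  using that
 proof (induction S rule: finite_induct)
  case empty
  show ?case
   by (intro allI impI exI[of _ 1]) (simp add: mix_def)
 next
  case (insert k S)
  show ?case
  proof (intro allI impI)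
   fix \<epsilon> :: real assume e: "0 < \<epsilon>"
   obtain d1 where d1: "0 < d1" "\<And>g. (\<forall>j. g j \<in> bounded_compact_support \<and> ldist R (f j) (g j) \<le> ennreal d1) \<Longrightarrow>
     emeasure lebesgue {x. norm (U (mix S g) x - U f x) > \<epsilon> / 2} \<le> ennreal (\<epsilon> / 2)"
    using insert.IH e by (meson half_gt_zero)
   define D where "D = C * (\<Prod>j\<in>UNIV - {k}. N j)"
   have D: "0 \<le> D"
    unfolding D_def using C(1) N0 by (intro mult_nonneg_nonneg prod_nonneg) auto
   \<comment> \<open>Chosen so that D s / (\<epsilon> / 2) is at most (\<epsilon> / 2)^(1/q); its
     q-th power is the weak type bound. D + 1 keeps the quotient meaningful for D = 0.\<close>
   define s where "s = (\<epsilon> / 2) powr (1 / q) * (\<epsilon> / 2) / (D + 1)"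
   have s: "0 < s"
    unfolding s_def using e D by simp
   define d2 where "d2 = s powr qs k"
   have d2: "0 < d2" "d2 powr (1 / qs k) = s"
    using s pos[of k] by (simp_all add: d2_def powr_powr)
   define d where "d = min 1 (min d1 d2)"
   show "\<exists>\<delta>>0. \<forall>g. (\<forall>j. g j \<in> bounded_compact_support \<and> ldist R (f j) (g j) \<le> ennreal \<delta>) \<longrightarrow>
     emeasure lebesgue {x. norm (U (mix (insert k S) g) x - U f x) > \<epsilon>} \<le> ennreal \<epsilon>"
   proof (intro exI[of _ d] conjI allI impI)
    show "0 < d"
     using d1 d2 by (simp add: d_def)
    fix g assume g: "\<forall>j. g j \<in> bounded_compact_support \<and> ldist R (f j) (g j) \<le> ennreal d"
    have gb: "\<And>j. g j \<in> bounded_compact_support"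
     using g by blast
    have gd: "ldist R (f j) (g j) \<le> ennreal c" if "d \<le> c" for c j
     using g ennreal_leI[OF that] order_trans by blast
    have "d \<le> 1" "d \<le> d1" "d \<le> d2"
     by (auto simp: d_def)
    note g' = gb this[THEN gd]
    let ?h = "(mix S g)(k := \<lambda>x. f k x - g k x)"
    have mb: "mix S g j \<in> bounded_compact_support" for j
     using mix_bcs[of g S j] g'(1) by simp
    have hb: "?h j \<in> bounded_compact_support" for j
     using mix_bcs[of g S j] g'(1) bounded_compact_support_lincomb[OF f[of k] g'(1)[of k], of 1 "-1"] by simp
    have "emeasure lebesgue {x. norm (U ?h x) > \<epsilon> / 2} \<le> ennreal ((C * (\<Prod>j\<in>UNIV. (N(k := s)) j) / (\<epsilon> / 2)) powr q)"
    proof (rule C(3)[OF hb])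
     fix j
     show "0 \<le> (N(k := s)) j"
      using N0[of j] s by simp
     show "lp_norm (qs j) (?h j) \<le> ennreal ((N(k := s)) j)"
     proof (cases "j = k")
      case True
      then show ?thesis
       using lp_norm_ldist[OF qs(1)[of k] qs(2)[of k] g'(4)[of k]] d2 by simp
     next
      case False
      then show ?thesis
       using gN[OF g'(1,2)] fN by (simp add: mix_def)
     qed
    qed (use e in simp)
    also have "(\<Prod>j\<in>UNIV. (N(k := s)) j) = s * (\<Prod>j\<in>UNIV - {k}. N j)"
     by (subst prod.remove[of _ k]) (auto intro!: prod.cong)
    also have "C * (s * (\<Prod>j\<in>UNIV - {k}. N j)) / (\<epsilon> / 2) = D * (s / (\<epsilon> / 2))"
     by (simp add: D_def)
    also have "s / (\<epsilon> / 2) = (\<epsilon> / 2) powr (1 / q) / (D + 1)"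
    proof -
     have "X * Y / Z / Y = X / Z" if "Y \<noteq> 0" for X Y Z :: real
      using that by simp
     note cancel = this
     show ?thesis
      unfolding s_def by (rule cancel) (use e in simp)
    qed
    also have "D * ((\<epsilon> / 2) powr (1 / q) / (D + 1)) = D / (D + 1) * (\<epsilon> / 2) powr (1 / q)"
     by simp
    also have "ennreal ((D / (D + 1) * (\<epsilon> / 2) powr (1 / q)) powr q) \<le> ennreal ((1 * (\<epsilon> / 2) powr (1 / q)) powr q)"
     using D q by (intro ennreal_leI powr_mono2 mult_right_mono) auto
    also have "(1 * (\<epsilon> / 2) powr (1 / q)) powr q = \<epsilon> / 2"
     using q e by (simp add: powr_powr)
    finally have step: "emeasure lebesgue {x. norm (U ?h x) > \<epsilon> / 2} \<le> ennreal (\<epsilon> / 2)" .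
    have [measurable]: "U (mix S g) \<in> borel_measurable lebesgue" "U f \<in> borel_measurable lebesgue"
      "U ?h \<in> borel_measurable lebesgue" "U (mix (insert k S) g) \<in> borel_measurable lebesgue"
     using C(2) hb f mix_bcs g'(1) by blast+
    have eqs: "(mix S g)(k := f k) = mix S g" "(mix S g)(k := g k) = mix (insert k S) g"
     using insert.hyps by (auto simp: mix_def fun_eq_iff)
    have "AE x in lebesgue. U ((mix S g)(k := f k)) x - U ((mix S g)(k := g k)) x = U ?h x"
     by (rule weak_extension_diff[OF U pos mb f gb])
    then have ae: "AE x in lebesgue. U (mix S g) x - U (mix (insert k S) g) x = U ?h x"
     unfolding eqs .
    have "emeasure lebesgue {x. norm (U (mix (insert k S) g) x - U f x) > \<epsilon>}
      \<le> emeasure lebesgue ({x. norm (U (mix S g) x - U f x) > \<epsilon> / 2} \<union> {x. norm (U ?h x) > \<epsilon> / 2})"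
    proof (rule emeasure_mono_AE)
     show "AE x in lebesgue. x \<in> {x. norm (U (mix (insert k S) g) x - U f x) > \<epsilon>} \<longrightarrow>
       x \<in> {x. norm (U (mix S g) x - U f x) > \<epsilon> / 2} \<union> {x. norm (U ?h x) > \<epsilon> / 2}"
      using ae
     proof eventually_elim
      case (elim x)
      have "norm (U (mix (insert k S) g) x - U f x) \<le> norm (U (mix S g) x - U f x) + norm (U (mix S g) x - U (mix (insert k S) g) x)"
       using norm_triangle_ineq4[of "U (mix S g) x - U f x" "U (mix S g) x - U (mix (insert k S) g) x"] by simp
      then show ?case
       unfolding elim by auto
     qed
    qed (intro sets.Un sets_superlevel borel_measurable_diff; measurable)
    also have "\<dots> \<le> emeasure lebesgue {x. norm (U (mix S g) x - U f x) > \<epsilon> / 2} + emeasure lebesgue {x. norm (U ?h x) > \<epsilon> / 2}"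
     by (intro emeasure_subadditive sets_superlevel borel_measurable_diff) measurable
    also have "\<dots> \<le> ennreal (\<epsilon> / 2) + ennreal (\<epsilon> / 2)"
     by (intro add_mono step d1(2)) (use g' in auto)
    also have "\<dots> = ennreal \<epsilon>"
     using e by (simp flip: ennreal_plus)
    finally show "emeasure lebesgue {x. norm (U (mix (insert k S) g) x - U f x) > \<epsilon>} \<le> ennreal \<epsilon>" .
   qed
  qed
 qed
 note all = this
 have "mix UNIV g = g" for g
  by (simp add: mix_def)
 with all[of UNIV] show ?thesis
  using e by simp
qed

text \<open>Borel-Cantelli: the exceptional sets have summable measures, so almost every point lies
  in only finitely many of them.\<close>

lemma AE_tendsto_of_summable_exceptions:
 fixes g :: "nat \<Rightarrow> real^'n::finite \<Rightarrow> complex"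
 assumes [measurable]: "\<And>k. g k \<in> borel_measurable lebesgue" "h \<in> borel_measurable lebesgue"
  and e: "\<And>k. emeasure lebesgue {x. norm (g k x - h x) > (1/2) ^ k} \<le> ennreal ((1/2) ^ k)"
 shows "AE x in lebesgue. (\<lambda>k. g k x) \<longlonglongrightarrow> h x"
proof -
 have fin: "emeasure lebesgue {x. norm (g k x - h x) > (1/2) ^ k} < \<infinity>" for k
  using e[of k] by (rule le_less_trans) simp
 have "AE x in lebesgue. eventually (\<lambda>k. x \<in> space lebesgue - {x. norm (g k x - h x) > (1/2) ^ k}) sequentially"
 proof (rule borel_cantelli_AE1)
  show "summable (\<lambda>k. measure lebesgue {x. norm (g k x - h x) > (1/2) ^ k})"
  proof (rule summable_comparison_test_ev[OF always_eventually, of _ "\<lambda>k. (1/2) ^ k"])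
   have "measure lebesgue {x. norm (g k x - h x) > (1/2) ^ k} \<le> (1/2) ^ k" for k
    using e[of k] unfolding measure_def by (simp add: enn2real_leI)
   then show "\<forall>k. norm (measure lebesgue {x. norm (g k x - h x) > (1/2) ^ k}) \<le> (1/2) ^ k"
    by simp
  qed (simp add: summable_geometric)
 qed (use fin in \<open>auto intro!: sets_superlevel borel_measurable_diff assms\<close>)
 then show ?thesis
 proof eventually_elim
  case (elim x)
  then have "\<forall>\<^sub>F k in sequentially. norm (g k x - h x) \<le> (1/2) ^ k"
   by (rule eventually_mono) auto
  then have "(\<lambda>k. g k x - h x) \<longlonglongrightarrow> 0"
   by (rule Lim_null_comparison) (rule LIMSEQ_power_zero, simp)
  then show ?case
   by (simp add: LIM_zero_iff)
 qed
qed

text \<open>Continuity in measure at the rate (1/2)^k gives a.e. convergence along the whole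
  sequence. Both extensions are served by the same test functions, which is what a comparison of the
  two requires; the sets W j let the approximants vanish where f does.\<close>

lemma weak_extension_approx:
 fixes f :: "'m::finite \<Rightarrow> real^'n::finite \<Rightarrow> complex"
 assumes U: "weak_extension T qs q U" "\<And>j. 1 \<le> qs j" "\<And>j. qs j \<le> R" "0 < q"
  and U': "weak_extension T qs' q' U'" "\<And>j. 1 \<le> qs' j" "\<And>j. qs' j \<le> R" "0 < q'"
  and f: "\<And>j. f j \<in> bounded_compact_support" and W: "\<And>j. open (W j)" "\<And>j x. x \<notin> W j \<Longrightarrow> f j x = 0"
 obtains \<phi> :: "nat \<Rightarrow> 'm \<Rightarrow> real^'n \<Rightarrow> complex" where "\<And>k j. \<phi> k j \<in> test_functions (W j)"
  "\<And>k j. ldist R (f j) (\<phi> k j) \<le> ennreal ((1/2) ^ k)"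
  "AE x in lebesgue. (\<lambda>k. U (\<phi> k) x) \<longlonglongrightarrow> U f x"
  "AE x in lebesgue. (\<lambda>k. U' (\<phi> k) x) \<longlonglongrightarrow> U' f x"
proof -
 have R: "1 \<le> R"
  using U(2,3) order_trans by blast
 have "\<exists>\<phi>. (\<forall>j. \<phi> j \<in> test_functions (W j) \<and> ldist R (f j) (\<phi> j) \<le> ennreal ((1/2) ^ k)) \<and>
   emeasure lebesgue {x. norm (U \<phi> x - U f x) > (1/2) ^ k} \<le> ennreal ((1/2) ^ k) \<and>
   emeasure lebesgue {x. norm (U' \<phi> x - U' f x) > (1/2) ^ k} \<le> ennreal ((1/2) ^ k)" for k :: nat
 proof -
  have e: "0 < (1/2 :: real) ^ k"
   by simp
  obtain d1 where d1: "0 < d1" "\<forall>g. (\<forall>j. g j \<in> bounded_compact_support \<and> ldist R (f j) (g j) \<le> ennreal d1) \<longrightarrow>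
    emeasure lebesgue {x. norm (U g x - U f x) > (1/2) ^ k} \<le> ennreal ((1/2) ^ k)"
   using weak_extension_stable[where f = f, OF U f e] by (elim exE conjE) (rule that; assumption)
  obtain d2 where d2: "0 < d2" "\<forall>g. (\<forall>j. g j \<in> bounded_compact_support \<and> ldist R (f j) (g j) \<le> ennreal d2) \<longrightarrow>
    emeasure lebesgue {x. norm (U' g x - U' f x) > (1/2) ^ k} \<le> ennreal ((1/2) ^ k)"
   using weak_extension_stable[where f = f, OF U' f e] by (elim exE conjE) (rule that; assumption)
  define d where "d = min ((1/2) ^ k) (min d1 d2)"
  have d: "0 < d" "d \<le> (1/2) ^ k" "d \<le> d1" "d \<le> d2"
   using d1 d2 by (auto simp: d_def)
  have "\<exists>\<phi>\<in>test_functions (W j). ldist R (f j) \<phi> \<le> ennreal d" for j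
   using test_functions_dense[OF R W(1)[of j] f[of j] W(2)] d(1) unfolding test_approx_def by blast
  then obtain \<phi> where \<phi>: "\<And>j. \<phi> j \<in> test_functions (W j)" "\<And>j. ldist R (f j) (\<phi> j) \<le> ennreal d"
   by metis
  have "ldist R (f j) (\<phi> j) \<le> ennreal ((1/2) ^ k)" "ldist R (f j) (\<phi> j) \<le> ennreal d1" "ldist R (f j) (\<phi> j) \<le> ennreal d2" for j
   using \<phi>(2)[of j] d by (meson ennreal_leI order_trans)+
  note d = this
  have b: "\<phi> j \<in> bounded_compact_support" for j
   using \<phi>(1) by (rule test_functions_bounded_compact_support)
  show ?thesis
   using d1(2)[rule_format, of \<phi>] d2(2)[rule_format, of \<phi>] d b \<phi>(1) by (intro exI[of _ \<phi>]) simp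
 qed
 from choice[OF allI, OF this] obtain \<phi> where "\<forall>k. (\<forall>j. \<phi> k j \<in> test_functions (W j) \<and> ldist R (f j) (\<phi> k j) \<le> ennreal ((1/2) ^ k)) \<and>
   emeasure lebesgue {x. norm (U (\<phi> k) x - U f x) > (1/2) ^ k} \<le> ennreal ((1/2) ^ k) \<and>
   emeasure lebesgue {x. norm (U' (\<phi> k) x - U' f x) > (1/2) ^ k} \<le> ennreal ((1/2) ^ k)" ..
 then have \<phi>: "\<And>k j. \<phi> k j \<in> test_functions (W j)" "\<And>k j. ldist R (f j) (\<phi> k j) \<le> ennreal ((1/2) ^ k)"
   "\<And>k. emeasure lebesgue {x. norm (U (\<phi> k) x - U f x) > (1/2) ^ k} \<le> ennreal ((1/2) ^ k)"
   "\<And>k. emeasure lebesgue {x. norm (U' (\<phi> k) x - U' f x) > (1/2) ^ k} \<le> ennreal ((1/2) ^ k)"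
  by simp_all
 have bcs: "\<phi> k j \<in> bounded_compact_support" for k j
  using \<phi>(1) by (rule test_functions_bounded_compact_support)
 have pos: "0 < qs j" "0 < qs' j" for j
  using U(2)[of j] U'(2)[of j] by simp_all
 have m: "U f \<in> borel_measurable lebesgue" "U' f \<in> borel_measurable lebesgue"
   "U (\<phi> k) \<in> borel_measurable lebesgue" "U' (\<phi> k) \<in> borel_measurable lebesgue" for k
  using weak_extension_measurable[OF U(1) pos(1), of f] weak_extension_measurable[OF U'(1) pos(2), of f]
   weak_extension_measurable[OF U(1) pos(1), of "\<phi> k"] weak_extension_measurable[OF U'(1) pos(2), of "\<phi> k"] f bcs
  by simp_all
 show ?thesis
 proof (rule that[of \<phi>])
  show "AE x in lebesgue. (\<lambda>k. U (\<phi> k) x) \<longlonglongrightarrow> U f x"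
   by (rule AE_tendsto_of_summable_exceptions[OF m(3) m(1) \<phi>(3)])
  show "AE x in lebesgue. (\<lambda>k. U' (\<phi> k) x) \<longlonglongrightarrow> U' f x"
   by (rule AE_tendsto_of_summable_exceptions[OF m(4) m(2) \<phi>(4)])
 qed (rule \<phi>(1) \<phi>(2))+
qed

text \<open>On test functions both extensions represent the same distribution, so they agree a.e. by
  testing with bumps. A common approximating sequence passes this to the limit.\<close>

lemma weak_extension_unique:
 fixes f :: "'m::finite \<Rightarrow> real^'n::finite \<Rightarrow> complex"
 assumes p0: "1 \<le> p0" and U: "weak_extension T qs q U" "admissible_exponents p0 qs q"
  and U': "weak_extension T qs' q' U'" "admissible_exponents p0 qs' q'"
  and f: "\<And>j. f j \<in> bounded_compact_support"
 shows "AE x in lebesgue. U f x = U' f x"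
proof -
 \<comment> \<open>One distance \<open>ldist R\<close> has to control the norms for both tuples of
   exponents.\<close>
 define R where "R = Max (range qs \<union> range qs')"
 have R: "qs j \<le> R" "qs' j \<le> R" for j
  unfolding R_def by (intro Max_ge; simp)+
 have ge: "1 \<le> qs j" "1 \<le> qs' j" "0 < q" "0 < q'" for j
  using U(2) U'(2) p0 by (auto simp: admissible_exponents_def intro: order_trans)
 obtain \<phi> where \<phi>: "\<And>k j. \<phi> k j \<in> test_functions UNIV"
  "AE x in lebesgue. (\<lambda>k. U (\<phi> k) x) \<longlonglongrightarrow> U f x"
  "AE x in lebesgue. (\<lambda>k. U' (\<phi> k) x) \<longlonglongrightarrow> U' f x"
 proof (rule weak_extension_approx[where f = f and W = "\<lambda>_. UNIV", OF U(1) ge(1) R(1) ge(3) U'(1) ge(2) R(2) ge(4) f])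
  fix \<phi> :: "nat \<Rightarrow> 'm \<Rightarrow> real^'n \<Rightarrow> complex"
  assume "\<And>k j. \<phi> k j \<in> test_functions UNIV"
   "AE x in lebesgue. (\<lambda>k. U (\<phi> k) x) \<longlonglongrightarrow> U f x" "AE x in lebesgue. (\<lambda>k. U' (\<phi> k) x) \<longlonglongrightarrow> U' f x"
  then show ?thesis
   by (rule that)
 qed auto
 have "AE x in lebesgue. U (\<phi> k) x = U' (\<phi> k) x" for k
 proof -
  have s: "\<forall>j. \<phi> k j \<in> schwartz"
   using test_functions_schwartz[OF \<phi>(1)] by blast
  have "AE x in lebesgue. x \<in> UNIV \<longrightarrow> U (\<phi> k) x - U' (\<phi> k) x = 0"
  proof (rule AE_eq_0_of_bumps)
   fix a b :: "real^'n" and \<epsilon> :: real assume "0 < \<epsilon>"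
   note b = box_bump_schwartz[OF this, of a b]
   note i = weak_extension_schwartz[OF U(1) s b] weak_extension_schwartz[OF U'(1) s b]
   show "integrable lebesgue (\<lambda>x. (U (\<phi> k) x - U' (\<phi> k) x) * of_real (box_bump \<epsilon> a b x))"
    unfolding left_diff_distrib by (intro Bochner_Integration.integrable_diff i)
   show "(LINT x|lebesgue. (U (\<phi> k) x - U' (\<phi> k) x) * of_real (box_bump \<epsilon> a b x)) = 0"
    unfolding left_diff_distrib Bochner_Integration.integral_diff[OF i(1) i(3)] i(2,4)[symmetric] by simp
  qed simp
  then show ?thesis
   by simp
 qed
 then have "AE x in lebesgue. \<forall>k. U (\<phi> k) x = U' (\<phi> k) x"
  by (simp add: AE_all_countable)
 with \<phi>(2,3) show ?thesis
 proof eventually_elim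
  case (elim x)
  then show ?case
   using LIMSEQ_unique by fastforce
 qed
qed

section \<open>Maximal function estimates for doubling measures\<close>

lemma emeasure_UN_le_count_space:
 assumes C: "countable C" and A: "\<And>i. i \<in> C \<Longrightarrow> A i \<in> sets M"
 shows "emeasure M (\<Union>i\<in>C. A i) \<le> (\<integral>\<^sup>+i. emeasure M (A i) \<partial>count_space C)"
proof -
 have "emeasure M (\<Union>i\<in>C. A i) = (\<integral>\<^sup>+x. indicator (\<Union>i\<in>C. A i) x \<partial>M)"
  using A C by (intro nn_integral_indicator[symmetric] sets.countable_UN') auto
 also have "\<dots> \<le> (\<integral>\<^sup>+x. (\<integral>\<^sup>+i. indicator (A i) x \<partial>count_space C) \<partial>M)"
 proof (intro nn_integral_mono)
  fix x
  show "indicator (\<Union>i\<in>C. A i) x \<le> (\<integral>\<^sup>+i. indicator (A i) x \<partial>count_space C)"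
  proof (cases "x \<in> (\<Union>i\<in>C. A i)")
   case True
   then obtain i where i: "i \<in> C" "x \<in> A i" by blast
   then show ?thesis
    using nn_integral_ge_point[OF i(1), of "\<lambda>i. indicator (A i) x"] True by simp
  qed simp
 qed
 also have "\<dots> = (\<integral>\<^sup>+i. (\<integral>\<^sup>+x. indicator (A i) x \<partial>M) \<partial>count_space C)"
  using A C by (intro nn_integral_count_space_nn_integral) auto
 also have "\<dots> = (\<integral>\<^sup>+i. emeasure M (A i) \<partial>count_space C)"
  using A by (intro nn_integral_cong) auto
 finally show ?thesis .
qed

text \<open>Vitali's covering lemma selects disjoint balls whose fivefold dilates still cover.
  Doubling removes the dilation, and disjointness lets the \<nu>-measures add up. The bound B on the
  radii is the hypothesis of that lemma.\<close>

lemma weak_maximal_inequality: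
 fixes \<mu> \<nu> :: "(real^'n::finite) measure"
 assumes sets: "sets \<mu> = sets lebesgue" "sets \<nu> = sets lebesgue"
  and r: "\<And>i. i \<in> K \<Longrightarrow> 0 < r i \<and> r i \<le> B"
  and doubling: "\<And>c \<rho>. 0 < \<rho> \<Longrightarrow> emeasure \<mu> (ball c (5 * \<rho>)) \<le> D * emeasure \<mu> (ball c \<rho>)"
  and le: "\<And>i. i \<in> K \<Longrightarrow> t * emeasure \<mu> (ball (a i) (r i)) \<le> emeasure \<nu> (ball (a i) (r i))"
 shows "t * emeasure \<mu> (\<Union>i\<in>K. ball (a i) (r i)) \<le> D * emeasure \<nu> UNIV"
proof -
 have ballm: "ball c \<rho> \<in> sets \<mu>" "ball c \<rho> \<in> sets \<nu>" for c \<rho>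
  by (simp_all add: sets)
 obtain C where C: "countable C" "C \<subseteq> K"
   "pairwise (\<lambda>i j. disjnt (ball (a i) (r i)) (ball (a j) (r j))) C"
   "(\<Union>i\<in>K. ball (a i) (r i)) \<subseteq> (\<Union>i\<in>C. ball (a i) (5 * r i))"
  by (rule Vitali_covering_lemma_balls[OF subset_refl r])
 have "t * emeasure \<mu> (\<Union>i\<in>K. ball (a i) (r i)) \<le> t * emeasure \<mu> (\<Union>i\<in>C. ball (a i) (5 * r i))"
  using C(1,4) ballm by (intro mult_left_mono emeasure_mono) auto
 also have "\<dots> \<le> t * (\<integral>\<^sup>+i. emeasure \<mu> (ball (a i) (5 * r i)) \<partial>count_space C)"
  by (intro mult_left_mono emeasure_UN_le_count_space C ballm) auto
 also have "\<dots> \<le> t * (\<integral>\<^sup>+i. D * emeasure \<mu> (ball (a i) (r i)) \<partial>count_space C)"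
  using C(2) r by (intro mult_left_mono nn_integral_mono doubling) auto
 also have "\<dots> = (\<integral>\<^sup>+i. D * (t * emeasure \<mu> (ball (a i) (r i))) \<partial>count_space C)"
  by (subst nn_integral_cmult[symmetric]) (auto simp: ac_simps)
 also have "\<dots> \<le> (\<integral>\<^sup>+i. D * emeasure \<nu> (ball (a i) (r i)) \<partial>count_space C)"
  using C(2) by (intro nn_integral_mono mult_left_mono le) auto
 also have "\<dots> = D * (\<integral>\<^sup>+i. emeasure \<nu> (ball (a i) (r i)) \<partial>count_space C)"
  by (rule nn_integral_cmult) simp
 also have "(\<integral>\<^sup>+i. emeasure \<nu> (ball (a i) (r i)) \<partial>count_space C) = emeasure \<nu> (\<Union>i\<in>C. ball (a i) (r i))"
  using C ballm by (intro emeasure_UN_countable[symmetric]) (auto simp: disjoint_family_on_def pairwise_def disjnt_def)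
 also have "D * \<dots> \<le> D * emeasure \<nu> UNIV"
  by (intro mult_left_mono emeasure_mono) (auto simp: sets)
 finally show ?thesis .
qed

lemma dyadic_scale_real:
 assumes "0 < (\<alpha>::real)"
 obtains k :: int where "2 powr of_int k < \<alpha>" "\<alpha> \<le> 2 powr (of_int k + 1)"
proof -
 define k where "k = \<lceil>log 2 \<alpha>\<rceil> - 1"
 have "of_int k < log 2 \<alpha>" "log 2 \<alpha> \<le> of_int k + 1"
  unfolding k_def by linarith+
 then have "2 powr of_int k < 2 powr (log 2 \<alpha>)" "2 powr (log 2 \<alpha>) \<le> 2 powr (of_int k + 1)"
  by simp_all
 then show ?thesis
  using that[of k] assms by simp
qed

lemma geometric_sum_int:
 fixes s :: real and K :: int
 assumes s: "0 < s"
 shows "(\<integral>\<^sup>+k. ennreal (2 powr (of_int k * s)) * indicator {..K} k \<partial>count_space UNIV)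
   = ennreal (2 powr (of_int K * s) / (1 - 2 powr (- s)))"
proof -
 have bij: "bij_betw (\<lambda>i::nat. K - int i) UNIV {..K}"
  by (rule bij_betwI[where g = "\<lambda>k. nat (K - k)"]) auto
 have "(\<integral>\<^sup>+k. ennreal (2 powr (of_int k * s)) * indicator {..K} k \<partial>count_space UNIV) = (\<integral>\<^sup>+k. ennreal (2 powr (of_int k * s)) \<partial>count_space {..K})"
  by (rule nn_integral_count_space_indicator[symmetric]) simp
 also have "\<dots> = (\<integral>\<^sup>+i. ennreal (2 powr (of_int (K - int i) * s)) \<partial>count_space UNIV)"
  using nn_integral_bij_count_space[OF bij, of "\<lambda>k. ennreal (2 powr (of_int k * s))"] by simp
 also have "\<dots> = (\<Sum>i. ennreal (2 powr (of_int (K - int i) * s)))"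
  by (rule nn_integral_count_space_nat)
 also have "\<dots> = ennreal (2 powr (of_int K * s) / (1 - 2 powr (- s)))"
 proof (rule suminf_ennreal_eq)
  have lt: "norm (2 powr (- s)) < 1"
   using s by (simp add: powr_less_one)
  have "2 powr (of_int (K - int i) * s) = 2 powr (of_int K * s) * (2 powr (- s)) ^ i" for i
   by (simp add: powr_add[symmetric] powr_powr flip: powr_realpow) (simp add: algebra_simps)
  moreover have "(\<lambda>i. 2 powr (of_int K * s) * (2 powr (- s)) ^ i) sums (2 powr (of_int K * s) * (1 / (1 - 2 powr (- s))))"
   by (intro sums_mult geometric_sums lt)
  ultimately show "(\<lambda>i. 2 powr (of_int (K - int i) * s)) sums (2 powr (of_int K * s) / (1 - 2 powr (- s)))"
   by simp
 qed simp
 finally show ?thesis .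
qed

text \<open>
 The maximal function is never formed: the dyadic level sets of the averages are controlled by
 the weak type inequality applied to the part of \<open>h\<close> above the level.
\<close>

proposition carleson_embedding:
 fixes \<mu> :: "(real^'n::finite) measure" and h :: "real^'n \<Rightarrow> real"
 assumes sets: "sets \<mu> = sets lebesgue"
  and doubling: "\<And>c \<rho>. 0 < \<rho> \<Longrightarrow> emeasure \<mu> (ball c (5 * \<rho>)) \<le> D * emeasure \<mu> (ball c \<rho>)"
  and fin: "\<And>c \<rho>. emeasure \<mu> (ball c \<rho>) < \<infinity>"
  and h: "h \<in> borel_measurable lebesgue" "\<And>x. 0 \<le> h x"
  and I: "countable I" and E: "\<And>i. i \<in> I \<Longrightarrow> E i \<in> sets lebesgue" "disjoint_family_on E I"
   "\<And>i. i \<in> I \<Longrightarrow> E i \<subseteq> ball (a i) (\<rho> i)" and \<rho>: "\<And>i. i \<in> I \<Longrightarrow> 0 < \<rho> i \<and> \<rho> i \<le> B"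
  and \<alpha>: "\<And>i. i \<in> I \<Longrightarrow> 0 \<le> \<alpha> i"
   "\<And>i. i \<in> I \<Longrightarrow> ennreal (\<alpha> i) * emeasure \<mu> (ball (a i) (\<rho> i)) \<le> (\<integral>\<^sup>+x\<in>ball (a i) (\<rho> i). ennreal (h x) \<partial>\<mu>)"
  and r: "1 < r"
 shows "(\<integral>\<^sup>+i. ennreal (\<alpha> i powr r) * emeasure \<mu> (E i) \<partial>count_space I)
  \<le> ennreal (4 powr r / (1 - 2 powr (1 - r))) * D * (\<integral>\<^sup>+x. ennreal (h x powr r) \<partial>\<mu>)"
proof -
 have spc: "space \<mu> = UNIV"
  using sets_eq_imp_space_eq[OF sets] by simp
 have meq: "borel_measurable \<mu> = (borel_measurable lebesgue :: (real^'n \<Rightarrow> ennreal) set)"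
   "borel_measurable \<mu> = (borel_measurable lebesgue :: (real^'n \<Rightarrow> real) set)"
  using measurable_cong_sets[OF sets refl] by blast+
 have hm [measurable]: "h \<in> borel_measurable \<mu>"
  using h(1) meq by simp
 have ballm [measurable]: "ball c s \<in> sets \<mu>" for c s
  by (simp add: sets)
 have Em: "E i \<in> sets \<mu>" if "i \<in> I" for i
  using E(1)[OF that] sets by simp
 \<comment> \<open>The balls whose average exceeds 2^k; they replace the superlevel set of a maximal
   function.\<close>
 define J where "J k = {i \<in> I. 2 powr of_int k < \<alpha> i}" for k :: int
 \<comment> \<open>The measure with density h above half the level. On a ball with average above 2^k
   the part of h below 2^(k-1) contributes at most half of 2^k \<mu>(B), which is cancelled because
   \<mu>(B) is finite.\<close>
 define \<nu> where "\<nu> k = density \<mu> (\<lambda>x. ennreal (h x) * indicator {x. 2 powr (of_int k - 1) < h x} x)" for k :: int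
 have level: "emeasure \<mu> (\<Union>i\<in>J k. ball (a i) (\<rho> i)) \<le> ennreal (2 powr (1 - of_int k)) * D * (\<integral>\<^sup>+x. ennreal (h x) * indicator {x. 2 powr (of_int k - 1) < h x} x \<partial>\<mu>)" for k
 proof -
  have "ennreal (2 powr (of_int k - 1)) * emeasure \<mu> (\<Union>i\<in>J k. ball (a i) (\<rho> i)) \<le> D * emeasure (\<nu> k) UNIV"
  proof (rule weak_maximal_inequality[OF sets _ _ doubling])
   show "sets (\<nu> k) = sets lebesgue"
    by (simp add: \<nu>_def sets)
   show "0 < \<rho> i \<and> \<rho> i \<le> B" if "i \<in> J k" for i
    using \<rho> that by (simp add: J_def)
   fix i assume i: "i \<in> J k"
   let ?b = "ball (a i) (\<rho> i)"
   let ?m = "emeasure \<mu> ?b"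
   have ii: "i \<in> I" "2 powr of_int k < \<alpha> i"
    using i by (auto simp: J_def)
   have "ennreal (2 powr (of_int k - 1)) * ?m + ennreal (2 powr (of_int k - 1)) * ?m = ennreal (2 powr of_int k) * ?m"
    by (simp flip: distrib_right ennreal_plus add: powr_diff)
   also have "\<dots> \<le> ennreal (\<alpha> i) * ?m"
    using ii by (intro mult_right_mono ennreal_leI) auto
   also have "\<dots> \<le> (\<integral>\<^sup>+x\<in>?b. ennreal (h x) \<partial>\<mu>)"
    by (rule \<alpha>(2)[OF ii(1)])
   also have "\<dots> \<le> (\<integral>\<^sup>+x. (ennreal (h x) * indicator {x. 2 powr (of_int k - 1) < h x} x) * indicator ?b x + ennreal (2 powr (of_int k - 1)) * indicator ?b x \<partial>\<mu>)"
    by (intro nn_integral_mono) (auto simp: indicator_def not_less intro: ennreal_leI)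
   also have "\<dots> = emeasure (\<nu> k) ?b + ennreal (2 powr (of_int k - 1)) * ?m"
    unfolding \<nu>_def by (subst nn_integral_add) (auto simp: emeasure_density nn_integral_cmult_indicator)
   finally show "ennreal (2 powr (of_int k - 1)) * ?m \<le> emeasure (\<nu> k) ?b"
    using fin[of "a i" "\<rho> i"] by (auto simp: ennreal_add_left_cancel_le add.commute[of "emeasure (\<nu> k) ?b"] ennreal_mult_eq_top_iff)
  qed
  also have "emeasure (\<nu> k) UNIV = (\<integral>\<^sup>+x. ennreal (h x) * indicator {x. 2 powr (of_int k - 1) < h x} x \<partial>\<mu>)"
   unfolding \<nu>_def by (subst emeasure_density) (use sets.top[of \<mu>] spc in auto)
  finally have "ennreal (2 powr (1 - of_int k)) * (ennreal (2 powr (of_int k - 1)) * emeasure \<mu> (\<Union>i\<in>J k. ball (a i) (\<rho> i)))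
    \<le> ennreal (2 powr (1 - of_int k)) * (D * (\<integral>\<^sup>+x. ennreal (h x) * indicator {x. 2 powr (of_int k - 1) < h x} x \<partial>\<mu>))"
   by (rule mult_left_mono) simp
  moreover have "ennreal (2 powr (1 - of_int k)) * ennreal (2 powr (of_int k - 1)) = 1"
   by (simp flip: ennreal_mult powr_add)
  ultimately show ?thesis
   by (simp add: mult.assoc[symmetric])
 qed
 have "(\<integral>\<^sup>+i. ennreal (\<alpha> i powr r) * emeasure \<mu> (E i) \<partial>count_space I)
   \<le> (\<integral>\<^sup>+i. (\<integral>\<^sup>+k. ennreal (2 powr ((of_int k + 1) * r)) * (indicator (J k) i * emeasure \<mu> (E i)) \<partial>count_space (UNIV :: int set)) \<partial>count_space I)"
 proof (intro nn_integral_mono)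
  fix i assume "i \<in> space (count_space I)"
  then have i: "i \<in> I" by simp
  show "ennreal (\<alpha> i powr r) * emeasure \<mu> (E i) \<le> (\<integral>\<^sup>+k. ennreal (2 powr ((of_int k + 1) * r)) * (indicator (J k) i * emeasure \<mu> (E i)) \<partial>count_space (UNIV :: int set))"
  proof (cases "\<alpha> i = 0")
   case False
   then have "0 < \<alpha> i"
    using \<alpha>(1)[OF i] by simp
   then obtain k :: int where k: "2 powr of_int k < \<alpha> i" "\<alpha> i \<le> 2 powr (of_int k + 1)"
    by (rule dyadic_scale_real)
   have "\<alpha> i powr r \<le> (2 powr (of_int k + 1)) powr r"
    using k \<alpha>(1)[OF i] r by (intro powr_mono2) auto
   then have "ennreal (\<alpha> i powr r) * emeasure \<mu> (E i) \<le> ennreal (2 powr ((of_int k + 1) * r)) * (indicator (J k) i * emeasure \<mu> (E i))"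
    using i k by (auto simp: J_def powr_powr intro!: mult_right_mono ennreal_leI)
   also have "\<dots> \<le> (\<integral>\<^sup>+k. ennreal (2 powr ((of_int k + 1) * r)) * (indicator (J k) i * emeasure \<mu> (E i)) \<partial>count_space (UNIV :: int set))"
    using nn_integral_ge_point[of k UNIV "\<lambda>k. ennreal (2 powr ((of_int k + 1) * r)) * (indicator (J k) i * emeasure \<mu> (E i))"] by simp
   finally show ?thesis .
  qed simp
 qed
 also have "\<dots> = (\<integral>\<^sup>+k. (\<integral>\<^sup>+i. ennreal (2 powr ((of_int k + 1) * r)) * (indicator (J k) i * emeasure \<mu> (E i)) \<partial>count_space I) \<partial>count_space (UNIV :: int set))"
  by (rule nn_integral_count_space_nn_integral) auto
 also have "\<dots> \<le> (\<integral>\<^sup>+k. ennreal (2 powr ((of_int k + 1) * r)) * (ennreal (2 powr (1 - of_int k)) * D * (\<integral>\<^sup>+x. ennreal (h x) * indicator {x. 2 powr (of_int k - 1) < h x} x \<partial>\<mu>)) \<partial>count_space (UNIV :: int set))"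
 proof (intro nn_integral_mono)
  fix k :: int
  have JI: "J k \<subseteq> I"
   by (auto simp: J_def)
  have "(\<integral>\<^sup>+i. indicator (J k) i * emeasure \<mu> (E i) \<partial>count_space I) = (\<integral>\<^sup>+i. emeasure \<mu> (E i) \<partial>count_space (J k))"
  proof -
   have "(\<integral>\<^sup>+i. indicator (J k) i * emeasure \<mu> (E i) \<partial>count_space I) = (\<integral>\<^sup>+i. indicator (J k) i * emeasure \<mu> (E i) \<partial>count_space (J k))"
    using JI by (intro nn_integral_count_space_eq) auto
   also have "\<dots> = (\<integral>\<^sup>+i. emeasure \<mu> (E i) \<partial>count_space (J k))"
    by (intro nn_integral_cong) simp
   finally show ?thesis .
  qed
  also have "\<dots> = emeasure \<mu> (\<Union>i\<in>J k. E i)"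
   using JI E Em I by (intro emeasure_UN_countable[symmetric]) (auto intro: countable_subset disjoint_family_on_mono)
  also have "\<dots> \<le> emeasure \<mu> (\<Union>i\<in>J k. ball (a i) (\<rho> i))"
   using E(3) JI I by (intro emeasure_mono sets.countable_UN') (auto intro: countable_subset)
  also note level[of k]
  finally show "(\<integral>\<^sup>+i. ennreal (2 powr ((of_int k + 1) * r)) * (indicator (J k) i * emeasure \<mu> (E i)) \<partial>count_space I)
    \<le> ennreal (2 powr ((of_int k + 1) * r)) * (ennreal (2 powr (1 - of_int k)) * D * (\<integral>\<^sup>+x. ennreal (h x) * indicator {x. 2 powr (of_int k - 1) < h x} x \<partial>\<mu>))"
   by (subst nn_integral_cmult) (auto intro: mult_left_mono)
 qed
 also have "\<dots> = (\<integral>\<^sup>+k. (\<integral>\<^sup>+x. D * (ennreal (2 powr ((of_int k + 1) * r)) * ennreal (2 powr (1 - of_int k)) * (ennreal (h x) * indicator {x. 2 powr (of_int k - 1) < h x} x)) \<partial>\<mu>) \<partial>count_space (UNIV :: int set))"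
  by (intro nn_integral_cong, subst nn_integral_cmult, measurable, subst nn_integral_cmult, measurable) (simp add: ac_simps)
 also have "\<dots> = (\<integral>\<^sup>+x. (\<integral>\<^sup>+k. D * (ennreal (2 powr ((of_int k + 1) * r)) * ennreal (2 powr (1 - of_int k)) * (ennreal (h x) * indicator {x. 2 powr (of_int k - 1) < h x} x)) \<partial>count_space (UNIV :: int set)) \<partial>\<mu>)"
  by (rule nn_integral_count_space_nn_integral[symmetric]) auto
 also have "\<dots> \<le> (\<integral>\<^sup>+x. D * (ennreal (4 powr r / (1 - 2 powr (1 - r))) * ennreal (h x powr r)) \<partial>\<mu>)"
 proof (intro nn_integral_mono)
  fix x
  have "(\<integral>\<^sup>+k. ennreal (2 powr ((of_int k + 1) * r)) * ennreal (2 powr (1 - of_int k)) * (ennreal (h x) * indicator {x. 2 powr (of_int k - 1) < h x} x) \<partial>count_space (UNIV :: int set))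
    \<le> ennreal (4 powr r / (1 - 2 powr (1 - r))) * ennreal (h x powr r)"
  proof (cases "h x = 0")
   case False
   then have hx: "0 < h x"
    using h(2)[of x] by simp
   \<comment> \<open>At a fixed point only the levels k at most k0 + 1 satisfy 2^(k-1) < h x. The
     terms are multiples of 2^(k(r-1)), and since r > 1 their sum is controlled by the last one;
     this is where the constant 1 / (1 - 2^(1-r)) comes from.\<close>
   then obtain k0 :: int where k0: "2 powr of_int k0 < h x" "h x \<le> 2 powr (of_int k0 + 1)"
    by (rule dyadic_scale_real)
   have "(\<integral>\<^sup>+k. ennreal (2 powr ((of_int k + 1) * r)) * ennreal (2 powr (1 - of_int k)) * (ennreal (h x) * indicator {x. 2 powr (of_int k - 1) < h x} x) \<partial>count_space (UNIV :: int set))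
     \<le> (\<integral>\<^sup>+k. ennreal (2 powr (r + 1) * h x) * (ennreal (2 powr (of_int k * (r - 1))) * indicator {..k0 + 1} k) \<partial>count_space (UNIV :: int set))"
   proof (intro nn_integral_mono)
    fix k :: int
    have eq: "(2::real) powr ((of_int k + 1) * r) * 2 powr (1 - of_int k) = 2 powr (r + 1) * 2 powr (of_int k * (r - 1))"
     by (simp add: powr_add[symmetric] algebra_simps)
    have "k \<le> k0 + 1" if "2 powr (of_int k - 1) < h x"
    proof -
     have "2 powr (of_int k - 1) < (2::real) powr (of_int k0 + 1)"
      using that k0(2) by linarith
     then have "real_of_int (k - 1) < real_of_int (k0 + 1)"
      by simp
     then show ?thesis by linarith
    qed
    then show "ennreal (2 powr ((of_int k + 1) * r)) * ennreal (2 powr (1 - of_int k)) * (ennreal (h x) * indicator {x. 2 powr (of_int k - 1) < h x} x)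
      \<le> ennreal (2 powr (r + 1) * h x) * (ennreal (2 powr (of_int k * (r - 1))) * indicator {..k0 + 1} k)"
     using hx arg_cong[OF eq, of "\<lambda>z. z * h x"]
     by (auto simp: indicator_def mult_ac simp flip: ennreal_mult)
   qed
   also have "\<dots> = ennreal (2 powr (r + 1) * h x) * (\<integral>\<^sup>+k. ennreal (2 powr (of_int k * (r - 1))) * indicator {..k0 + 1} k \<partial>count_space (UNIV :: int set))"
    by (rule nn_integral_cmult) simp
   also have "\<dots> = ennreal (2 powr (r + 1) * h x) * ennreal (2 powr ((of_int k0 + 1) * (r - 1)) / (1 - 2 powr (- (r - 1))))"
    using r by (subst geometric_sum_int) auto
   also have "\<dots> = ennreal (2 powr (r + 1) * h x * (2 powr ((of_int k0 + 1) * (r - 1)) / (1 - 2 powr (1 - r))))"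
    using hx by (simp flip: ennreal_mult')
   also have "\<dots> \<le> ennreal (4 powr r / (1 - 2 powr (1 - r)) * h x powr r)"
   proof (rule ennreal_leI)
    have pos: "0 < 1 - 2 powr (1 - r)"
     using r by (simp add: powr_less_one)
    have "2 powr ((of_int k0 + 1) * (r - 1)) = 2 powr (r - 1) * (2 powr of_int k0) powr (r - 1)"
     by (simp add: powr_powr powr_add[symmetric] algebra_simps)
    also have "\<dots> \<le> 2 powr (r - 1) * h x powr (r - 1)"
     using k0 r by (intro mult_left_mono powr_mono2) auto
    finally have "2 powr (r + 1) * h x * 2 powr ((of_int k0 + 1) * (r - 1)) \<le> 2 powr (r + 1) * h x * (2 powr (r - 1) * h x powr (r - 1))"
     using hx by (intro mult_left_mono) auto
    also have "\<dots> = (2 powr (r + 1) * 2 powr (r - 1)) * (h x * h x powr (r - 1))"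
     by simp
    also have "2 powr (r + 1) * 2 powr (r - 1) = 4 powr r"
     using powr_powr[of 2 2 r] by (simp flip: powr_add add: mult.commute)
    also have "h x * h x powr (r - 1) = h x powr r"
     using hx by (simp add: powr_mult_base)
    finally show "2 powr (r + 1) * h x * (2 powr ((of_int k0 + 1) * (r - 1)) / (1 - 2 powr (1 - r))) \<le> 4 powr r / (1 - 2 powr (1 - r)) * h x powr r"
     using pos by (simp add: divide_right_mono)
   qed
   also have "\<dots> = ennreal (4 powr r / (1 - 2 powr (1 - r))) * ennreal (h x powr r)"
    by (rule ennreal_mult'') simp
   finally show ?thesis .
  qed simp
  then show "(\<integral>\<^sup>+k. D * (ennreal (2 powr ((of_int k + 1) * r)) * ennreal (2 powr (1 - of_int k)) * (ennreal (h x) * indicator {x. 2 powr (of_int k - 1) < h x} x)) \<partial>count_space (UNIV :: int set))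
    \<le> D * (ennreal (4 powr r / (1 - 2 powr (1 - r))) * ennreal (h x powr r))"
   by (subst nn_integral_cmult) (auto intro: mult_left_mono)
 qed
 also have "\<dots> = ennreal (4 powr r / (1 - 2 powr (1 - r))) * D * (\<integral>\<^sup>+x. ennreal (h x powr r) \<partial>\<mu>)"
  by (subst nn_integral_cmult, measurable, subst nn_integral_cmult, measurable) (simp add: ac_simps)
 finally show ?thesis .
qed

section \<open>The generalized Hoelder inequality\<close>

text \<open>Convexity of the exponential at the logarithms of the x_i. A vanishing x_i has no
  logarithm, but makes the product zero.\<close>

lemma weighted_AM_GM:
 fixes x \<theta> :: "'i \<Rightarrow> real"
 assumes I: "finite I" and \<theta>: "\<And>i. i \<in> I \<Longrightarrow> 0 < \<theta> i" "(\<Sum>i\<in>I. \<theta> i) = 1" and x: "\<And>i. i \<in> I \<Longrightarrow> 0 \<le> x i"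
 shows "(\<Prod>i\<in>I. x i powr \<theta> i) \<le> (\<Sum>i\<in>I. \<theta> i * x i)"
proof (cases "\<exists>i\<in>I. x i = 0")
 case True
 then have "(\<Prod>i\<in>I. x i powr \<theta> i) = 0"
  using I by (intro prod_zero) auto
 also have "0 \<le> (\<Sum>i\<in>I. \<theta> i * x i)"
  using \<theta>(1) x by (intro sum_nonneg mult_nonneg_nonneg) (auto intro: less_imp_le)
 finally show ?thesis .
next
 case False
 then have pos: "0 < x i" if "i \<in> I" for i
  using x[OF that] that by force
 have "(\<Prod>i\<in>I. x i powr \<theta> i) = (\<Prod>i\<in>I. exp (\<theta> i *\<^sub>R ln (x i)))"
  using pos by (intro prod.cong) (force simp: powr_def)+
 also have "\<dots> = exp (\<Sum>i\<in>I. \<theta> i *\<^sub>R ln (x i))"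
  using I by (simp add: exp_sum)
 also have "\<dots> \<le> (\<Sum>i\<in>I. \<theta> i * exp (ln (x i)))"
 proof (rule convex_on_sum[OF I])
  show "I \<noteq> {}"
   using \<theta>(2) by auto
  show "convex_on UNIV (exp :: real \<Rightarrow> real)"
   by (rule exp_convex)
 qed (use \<theta> in \<open>auto intro: less_imp_le\<close>)
 also have "\<dots> = (\<Sum>i\<in>I. \<theta> i * x i)"
  using pos by (intro sum.cong) auto
 finally show ?thesis .
qed

text \<open>After division of each f_i by c_i, the weighted inequality of means holds pointwise and
  integrates to the sum of the \<theta>_i, which is 1. Upper bounds c_i in place of the integrals
  keep everything real-valued.\<close>

proposition Holder_prod:
 fixes f :: "'i \<Rightarrow> 'a \<Rightarrow> real"
 assumes I: "finite I" and \<theta>: "\<And>i. i \<in> I \<Longrightarrow> 0 < \<theta> i" "(\<Sum>i\<in>I. \<theta> i) = 1"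
  and f: "\<And>i. i \<in> I \<Longrightarrow> f i \<in> borel_measurable M" "\<And>i x. i \<in> I \<Longrightarrow> 0 \<le> f i x"
  and c: "\<And>i. i \<in> I \<Longrightarrow> 0 \<le> c i" "\<And>i. i \<in> I \<Longrightarrow> (\<integral>\<^sup>+x. ennreal (f i x) \<partial>M) \<le> ennreal (c i)"
 shows "(\<integral>\<^sup>+x. ennreal (\<Prod>i\<in>I. f i x powr \<theta> i) \<partial>M) \<le> ennreal (\<Prod>i\<in>I. c i powr \<theta> i)"
proof (cases "\<exists>i\<in>I. c i = 0")
 case True
 then obtain i where i: "i \<in> I" "c i = 0" by blast
 then have "(\<integral>\<^sup>+x. ennreal (f i x) \<partial>M) = 0"
  using c(2)[OF i(1)] by simp
 then have "AE x in M. ennreal (f i x) = 0"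
  using f(1)[OF i(1)] by (subst (asm) nn_integral_0_iff_AE) auto
 then have "AE x in M. ennreal (\<Prod>i\<in>I. f i x powr \<theta> i) = 0"
 proof eventually_elim
  case (elim x)
  then have "f i x powr \<theta> i = 0"
   using f(2)[OF i(1), of x] by simp
  then have "(\<Prod>i\<in>I. f i x powr \<theta> i) = 0"
   using I i(1) by (intro prod_zero) blast+
  then show ?case by simp
 qed
 then have "(\<integral>\<^sup>+x. ennreal (\<Prod>i\<in>I. f i x powr \<theta> i) \<partial>M) = (\<integral>\<^sup>+x. 0 \<partial>M)"
  by (rule nn_integral_cong_AE)
 then show ?thesis by simp
next
 case False
 then have pos: "0 < c i" if "i \<in> I" for i
  using c(1)[OF that] that by force
 have P: "0 < (\<Prod>i\<in>I. c i powr \<theta> i)"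
  using pos by (intro prod_pos) force
 have "(\<Prod>i\<in>I. f i x powr \<theta> i) \<le> (\<Prod>i\<in>I. c i powr \<theta> i) * (\<Sum>i\<in>I. \<theta> i / c i * f i x)" for x
 proof -
  have "(\<Prod>i\<in>I. f i x powr \<theta> i) = (\<Prod>i\<in>I. c i powr \<theta> i * (f i x / c i) powr \<theta> i)"
  proof (rule prod.cong[OF refl])
   fix i assume i: "i \<in> I"
   have "(c i * (f i x / c i)) powr \<theta> i = c i powr \<theta> i * (f i x / c i) powr \<theta> i"
    using pos[OF i] f(2)[OF i, of x] by (intro powr_mult)
   moreover have "c i * (f i x / c i) = f i x"
    using pos[OF i] by simp
   ultimately show "f i x powr \<theta> i = c i powr \<theta> i * (f i x / c i) powr \<theta> i"
    by (simp only:)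
  qed
  also have "\<dots> = (\<Prod>i\<in>I. c i powr \<theta> i) * (\<Prod>i\<in>I. (f i x / c i) powr \<theta> i)"
   by (rule prod.distrib)
  also have "\<dots> \<le> (\<Prod>i\<in>I. c i powr \<theta> i) * (\<Sum>i\<in>I. \<theta> i * (f i x / c i))"
   using P pos f(2) by (intro mult_left_mono weighted_AM_GM I \<theta>) (auto intro: divide_nonneg_pos)
  finally show ?thesis by simp
 qed
 then have "(\<integral>\<^sup>+x. ennreal (\<Prod>i\<in>I. f i x powr \<theta> i) \<partial>M) \<le> (\<integral>\<^sup>+x. ennreal (\<Prod>i\<in>I. c i powr \<theta> i) * (\<Sum>i\<in>I. ennreal (\<theta> i / c i) * ennreal (f i x)) \<partial>M)"
 proof (intro nn_integral_mono)
  fix x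
  assume *: "\<And>x. (\<Prod>i\<in>I. f i x powr \<theta> i) \<le> (\<Prod>i\<in>I. c i powr \<theta> i) * (\<Sum>i\<in>I. \<theta> i / c i * f i x)"
  have "(\<Sum>i\<in>I. ennreal (\<theta> i / c i) * ennreal (f i x)) = (\<Sum>i\<in>I. ennreal (\<theta> i / c i * f i x))"
   using pos \<theta>(1) f(2) by (intro sum.cong ennreal_mult[symmetric]) (auto intro!: divide_nonneg_pos less_imp_le)
  also have "\<dots> = ennreal (\<Sum>i\<in>I. \<theta> i / c i * f i x)"
   using pos \<theta>(1) f(2) by (intro sum_ennreal mult_nonneg_nonneg) (auto intro!: divide_nonneg_pos less_imp_le)
  finally have "ennreal (\<Prod>i\<in>I. c i powr \<theta> i) * (\<Sum>i\<in>I. ennreal (\<theta> i / c i) * ennreal (f i x))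
    = ennreal ((\<Prod>i\<in>I. c i powr \<theta> i) * (\<Sum>i\<in>I. \<theta> i / c i * f i x))"
   using P by (simp add: ennreal_mult')
  then show "ennreal (\<Prod>i\<in>I. f i x powr \<theta> i) \<le> ennreal (\<Prod>i\<in>I. c i powr \<theta> i) * (\<Sum>i\<in>I. ennreal (\<theta> i / c i) * ennreal (f i x))"
   using *[of x] by (simp add: ennreal_leI)
 qed
 also have "\<dots> = ennreal (\<Prod>i\<in>I. c i powr \<theta> i) * (\<Sum>i\<in>I. ennreal (\<theta> i / c i) * (\<integral>\<^sup>+x. ennreal (f i x) \<partial>M))"
  using f(1) by (simp add: nn_integral_cmult nn_integral_sum)
 also have "\<dots> \<le> ennreal (\<Prod>i\<in>I. c i powr \<theta> i) * (\<Sum>i\<in>I. ennreal (\<theta> i))"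
 proof (intro mult_left_mono sum_mono)
  fix i assume i: "i \<in> I"
  have "ennreal (\<theta> i / c i) * (\<integral>\<^sup>+x. ennreal (f i x) \<partial>M) \<le> ennreal (\<theta> i / c i) * ennreal (c i)"
   by (intro mult_left_mono c(2)[OF i]) simp
  also have "\<dots> = ennreal (\<theta> i)"
   using pos[OF i] \<theta>(1)[OF i] by (simp flip: ennreal_mult)
  finally show "ennreal (\<theta> i / c i) * (\<integral>\<^sup>+x. ennreal (f i x) \<partial>M) \<le> ennreal (\<theta> i)" .
 qed simp
 also have "(\<Sum>i\<in>I. ennreal (\<theta> i)) = 1"
  using \<theta> by (subst sum_ennreal) (auto intro: less_imp_le)
 finally show ?thesis by simp
qed

section \<open>Families of weights satisfying a Muckenhoupt condition\<close>

abbreviation weighted :: "('a::euclidean_space \<Rightarrow> real) \<Rightarrow> 'a measure" where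
 "weighted w \<equiv> density lebesgue (\<lambda>x. ennreal (w x))"

lemma AE_weighted:
 assumes "AE x in lebesgue. P x" "w \<in> borel_measurable lebesgue"
 shows "AE x in weighted w. P x"
 using assms by (subst AE_density) (auto elim: eventually_mono)

lemma measure_weighted_pos:
 fixes w :: "'a::euclidean_space \<Rightarrow> real"
 assumes w: "w \<in> borel_measurable lebesgue" "AE x in lebesgue. 0 < w x"
  and E: "E \<in> sets lebesgue" "0 < emeasure lebesgue E"
 shows "0 < emeasure (weighted w) E"
proof (rule ccontr)
 assume "\<not> 0 < emeasure (weighted w) E"
 then have "(\<integral>\<^sup>+x. ennreal (w x) * indicator E x \<partial>lebesgue) = 0"
  using w E by (simp add: emeasure_density not_less)
 then have "AE x in lebesgue. ennreal (w x) * indicator E x = 0"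
  using w E by (subst (asm) nn_integral_0_iff_AE) auto
 with w(2) have "AE x in lebesgue. x \<notin> E"
  by eventually_elim (auto simp: indicator_def split: if_splits)
 then have "emeasure lebesgue E = 0"
  using E(1) AE_iff_measurable[of E lebesgue "\<lambda>x. x \<notin> E"] by simp
 with E(2) show False by simp
qed

text \<open>
 By Hoelder's inequality \<open>|E| ^ m \<le> \<Prod> u\<^sub>i(E) ^ e\<^sub>i\<close>, so the Muckenhoupt condition on \<open>B\<close> forces each
 factor of the right-hand side to be comparable to the corresponding factor for \<open>B\<close>.
\<close>

proposition muckenhoupt_comparison:
 fixes u :: "'i \<Rightarrow> real^'n::finite \<Rightarrow> real"
 assumes I: "finite I" "k \<in> I" and e: "\<And>i. i \<in> I \<Longrightarrow> 0 < e i" "(\<Sum>i\<in>I. e i) = m" and m: "0 < m"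
  and u: "\<And>i. i \<in> I \<Longrightarrow> u i \<in> borel_measurable lebesgue" "\<And>i x. i \<in> I \<Longrightarrow> 0 \<le> u i x"
   "AE x in lebesgue. (\<Prod>i\<in>I. u i x powr e i) = 1"
  and fin: "\<And>i. i \<in> I \<Longrightarrow> emeasure (weighted (u i)) B < \<infinity>"
  and A: "(\<Prod>i\<in>I. measure (weighted (u i)) B powr e i) \<le> A * measure lebesgue B powr m" "0 \<le> A"
  and B: "B \<in> sets lebesgue" "emeasure lebesgue B < \<infinity>" "0 < measure lebesgue B"
  and E: "E \<in> sets lebesgue" "E \<subseteq> B" "0 < \<kappa>" "\<kappa> * measure lebesgue B \<le> measure lebesgue E"
 shows "measure (weighted (u k)) B \<le> (A * (1 / \<kappa>) powr m) powr (1 / e k) * measure (weighted (u k)) E"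
proof -
 have finE: "emeasure (weighted (u i)) E < \<infinity>" if "i \<in> I" for i
  using emeasure_mono[OF E(2), of "weighted (u i)"] B(1) fin[OF that] by (auto intro: le_less_trans)
 have mono: "measure (weighted (u i)) E \<le> measure (weighted (u i)) B" if "i \<in> I" for i
  using E B fin[OF that] by (intro measure_mono_fmeasurable) (auto simp: fmeasurable_def)
 have E0: "0 < measure lebesgue E"
  using E(3,4) B(3) mult_pos_pos[of \<kappa> "measure lebesgue B"] by linarith
 have "(\<integral>\<^sup>+x. ennreal (\<Prod>i\<in>I. (u i x * indicator E x) powr (e i / m)) \<partial>lebesgue) \<le> ennreal (\<Prod>i\<in>I. measure (weighted (u i)) E powr (e i / m))"
 proof (rule Holder_prod[OF I(1)])
  show "(\<Sum>i\<in>I. e i / m) = 1"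
   using e(2) m by (simp flip: sum_divide_distrib)
  show "(\<integral>\<^sup>+x. ennreal (u i x * indicator E x) \<partial>lebesgue) \<le> ennreal (measure (weighted (u i)) E)" if "i \<in> I" for i
  proof -
   have "(\<integral>\<^sup>+x. ennreal (u i x * indicator E x) \<partial>lebesgue) = emeasure (weighted (u i)) E"
    using u(1)[OF that] E(1) by (subst emeasure_density) (auto simp: ennreal_mult' ennreal_indicator mult.commute intro!: nn_integral_cong)
   then show ?thesis
    using finE[OF that] by (simp add: emeasure_eq_ennreal_measure less_top)
  qed
 qed (use e(1) m u(1,2) E(1) in auto)
 moreover have "(\<integral>\<^sup>+x. ennreal (\<Prod>i\<in>I. (u i x * indicator E x) powr (e i / m)) \<partial>lebesgue) = emeasure lebesgue E"
 proof -
  have "AE x in lebesgue. ennreal (\<Prod>i\<in>I. (u i x * indicator E x) powr (e i / m)) = indicator E x"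
   using u(3)
  proof eventually_elim
   case (elim x)
   show ?case
   proof (cases "x \<in> E")
    case True
    have "(\<Prod>i\<in>I. u i x powr (e i / m)) = (\<Prod>i\<in>I. (u i x powr e i) powr (1 / m))"
     by (intro prod.cong) (simp_all add: powr_powr)
    also have "\<dots> = (\<Prod>i\<in>I. u i x powr e i) powr (1 / m)"
     by (rule prod_powr_distrib[symmetric])
    finally show ?thesis
     using True elim by simp
   next
    case False
    then have "(\<Prod>i\<in>I. (u i x * indicator E x) powr (e i / m)) = 0"
     using I by (intro prod_zero) auto
    then show ?thesis
     using False by simp
   qed
  qed
  then have "(\<integral>\<^sup>+x. ennreal (\<Prod>i\<in>I. (u i x * indicator E x) powr (e i / m)) \<partial>lebesgue) = (\<integral>\<^sup>+x. indicator E x \<partial>lebesgue)"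
   by (rule nn_integral_cong_AE)
  then show ?thesis
   using E(1) by simp
 qed
 moreover have "emeasure lebesgue E = ennreal (measure lebesgue E)"
  using emeasure_mono[OF E(2) B(1)] B(2) by (intro emeasure_eq_ennreal_measure) (auto simp: less_top)
 ultimately have "measure lebesgue E \<le> (\<Prod>i\<in>I. measure (weighted (u i)) E powr (e i / m))"
  by (simp add: prod_nonneg)
 then have "measure lebesgue E powr m \<le> (\<Prod>i\<in>I. measure (weighted (u i)) E powr (e i / m)) powr m"
  using m by (intro powr_mono2) auto
 also have "\<dots> = (\<Prod>i\<in>I. measure (weighted (u i)) E powr e i)"
  using m by (subst prod_powr_distrib) (auto simp: powr_powr)
 finally have low: "measure lebesgue E powr m \<le> (\<Prod>i\<in>I. measure (weighted (u i)) E powr e i)" .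
 have Epos: "0 < measure (weighted (u i)) E" if "i \<in> I" for i
 proof (rule ccontr)
  assume "\<not> 0 < measure (weighted (u i)) E"
  then have "measure (weighted (u i)) E = 0"
   using measure_nonneg[of "weighted (u i)" E] by linarith
  then have "(\<Prod>i\<in>I. measure (weighted (u i)) E powr e i) = 0"
   using that I by (intro prod_zero) auto
  then show False
   using low E0 m by simp
 qed
 \<comment> \<open>The factor with index k is isolated. All other factors only grow from E to B, so
   after replacing |B| by |E| / \<kappa> they cancel from the inequality.\<close>
 define PB where "PB = (\<Prod>i\<in>I - {k}. measure (weighted (u i)) B powr e i)"
 define PE where "PE = (\<Prod>i\<in>I - {k}. measure (weighted (u i)) E powr e i)"
 have PE: "0 < PE" "PE \<le> PB"
  unfolding PE_def PB_def using Epos mono e(1)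
  by (auto intro!: prod_pos prod_mono powr_mono2 simp: less_imp_le) (metis less_irrefl)+
 have "measure (weighted (u k)) B powr e k * PE \<le> measure (weighted (u k)) B powr e k * PB"
  using PE by (intro mult_left_mono) auto
 also have "\<dots> = (\<Prod>i\<in>I. measure (weighted (u i)) B powr e i)"
  unfolding PB_def using I by (simp add: prod.remove)
 also have "\<dots> \<le> A * measure lebesgue B powr m"
  by (rule A(1))
 also have "\<dots> \<le> A * ((1 / \<kappa>) powr m * measure lebesgue E powr m)"
 proof (intro mult_left_mono A(2))
  have "measure lebesgue B \<le> 1 / \<kappa> * measure lebesgue E"
   using E(3,4) by (simp add: field_simps)
  then have "measure lebesgue B powr m \<le> (1 / \<kappa> * measure lebesgue E) powr m"
   using m by (intro powr_mono2) auto
  then show "measure lebesgue B powr m \<le> (1 / \<kappa>) powr m * measure lebesgue E powr m"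
   using E(3) by (subst (asm) powr_mult) auto
 qed
 also have "\<dots> \<le> A * ((1 / \<kappa>) powr m * (measure (weighted (u k)) E powr e k * PE))"
  using low A(2) unfolding PE_def using I by (intro mult_left_mono) (auto simp: prod.remove)
 finally have "measure (weighted (u k)) B powr e k * PE \<le> (A * (1 / \<kappa>) powr m * measure (weighted (u k)) E powr e k) * PE"
  by (simp add: mult.assoc)
 then have "measure (weighted (u k)) B powr e k \<le> A * (1 / \<kappa>) powr m * measure (weighted (u k)) E powr e k"
  using PE(1) by simp
 then have "(measure (weighted (u k)) B powr e k) powr (1 / e k) \<le> (A * (1 / \<kappa>) powr m * measure (weighted (u k)) E powr e k) powr (1 / e k)"
  using e(1)[OF I(2)] by (intro powr_mono2) auto
 then show ?thesis
  using e(1)[OF I(2)] A(2) by (simp add: powr_mult powr_powr)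
qed

section \<open>Oscillation of the operator away from the support\<close>

lemma sets_annulus [measurable, simp]: "annulus c \<rho> l \<in> sets borel"
 by (auto simp: annulus_def)

lemma annulus_subset_ball: "annulus c \<rho> l \<subseteq> ball c (2 ^ l * \<rho>)"
 by (auto simp: annulus_def)

text \<open>The least dilate that contains the point decides the annulus; it has index 0 only for
  points of the ball itself.\<close>

lemma annulus_cover:
 assumes "z \<in> ball c (2 ^ J * \<rho>)"
 obtains l where "l \<le> J" "z \<in> annulus c \<rho> l" "z \<notin> ball c \<rho> \<Longrightarrow> l \<noteq> 0"
proof -
 define l where "l = (LEAST l. z \<in> ball c (2 ^ l * \<rho>))"
 have l: "z \<in> ball c (2 ^ l * \<rho>)" "l \<le> J"
  unfolding l_def using assms LeastI[of "\<lambda>l. z \<in> ball c (2 ^ l * \<rho>)" J] Least_le[of "\<lambda>l. z \<in> ball c (2 ^ l * \<rho>)" J] by simp_all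
 have "z \<in> annulus c \<rho> l"
 proof (cases "l = 0")
  case False
  then have "z \<notin> ball c (2 ^ (l - 1) * \<rho>)"
   using not_less_Least[of "l - 1" "\<lambda>l. z \<in> ball c (2 ^ l * \<rho>)"] unfolding l_def by simp
  then show ?thesis
   using False l by (simp add: annulus_def)
 qed (use l in \<open>simp add: annulus_def\<close>)
 moreover have "l \<noteq> 0" if "z \<notin> ball c \<rho>"
  using that l by (cases l) auto
 ultimately show ?thesis
  by (intro that[of l] l)
qed

lemma sets_lebesgue_tuple_box:
 fixes S :: "'m::finite \<Rightarrow> (real^'n::finite) set"
 assumes "\<And>k. S k \<in> sets borel"
 shows "{y. \<forall>k. y k \<in> S k} \<in> sets lebesgue_tuple"
proof -
 have "PiE UNIV S \<in> sets (\<Pi>\<^sub>M j\<in>UNIV. lborel)"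
  using assms by (intro sets_PiM_I_finite) auto
 moreover have "PiE UNIV S = {y. \<forall>k. y k \<in> S k}"
  by (auto simp: PiE_UNIV_domain)
 ultimately show ?thesis
  unfolding lebesgue_tuple_def by (simp add: sets_completionI_sets)
qed

lemma measurable_lebesgue_tuple_prod:
 fixes g :: "'m::finite \<Rightarrow> real^'n::finite \<Rightarrow> real"
 assumes "\<And>k. g k \<in> borel_measurable borel"
 shows "(\<lambda>y. \<Prod>k\<in>UNIV. g k (y k)) \<in> borel_measurable lebesgue_tuple"
proof -
 have "(\<lambda>y. g k (y k)) \<in> borel_measurable (\<Pi>\<^sub>M j\<in>UNIV. lborel)" for k
  using assms by (intro measurable_compose[OF measurable_component_singleton, of k UNIV]) auto
 then have "(\<lambda>y. \<Prod>k\<in>UNIV. g k (y k)) \<in> borel_measurable (\<Pi>\<^sub>M j\<in>UNIV. lborel)"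
  by (intro borel_measurable_prod) auto
 then show ?thesis
  unfolding lebesgue_tuple_def by (rule measurable_completion)
qed

lemma nn_integral_lebesgue_tuple_prod:
 fixes S :: "'m::finite \<Rightarrow> (real^'n::finite) set" and g :: "'m \<Rightarrow> real^'n \<Rightarrow> ennreal"
 assumes S: "\<And>k. S k \<in> sets borel" and g: "\<And>k. g k \<in> borel_measurable borel"
 shows "(\<integral>\<^sup>+y. (\<Prod>k\<in>UNIV. g k (y k)) * indicator {y. \<forall>k. y k \<in> S k} y \<partial>lebesgue_tuple) =
   (\<Prod>k\<in>UNIV. \<integral>\<^sup>+x. g k x * indicator (S k) x \<partial>lebesgue)"
proof -
 interpret product_sigma_finite "\<lambda>_::'m. lborel :: (real^'n) measure"
  by standard
 have "(\<Prod>k\<in>UNIV. g k (y k)) * indicator {y. \<forall>k. y k \<in> S k} y = (\<Prod>k\<in>UNIV. g k (y k) * indicator (S k) (y k))" for y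
 proof (cases "\<forall>k. y k \<in> S k")
  case False
  then obtain k where "y k \<notin> S k" by blast
  then have "(\<Prod>k\<in>UNIV. g k (y k) * indicator (S k) (y k)) = 0"
   by (intro prod_zero bexI[of _ k]) auto
  then show ?thesis
   using False by simp
 qed simp
 then have "(\<integral>\<^sup>+y. (\<Prod>k\<in>UNIV. g k (y k)) * indicator {y. \<forall>k. y k \<in> S k} y \<partial>lebesgue_tuple) =
   (\<integral>\<^sup>+y. (\<Prod>k\<in>UNIV. g k (y k) * indicator (S k) (y k)) \<partial>(\<Pi>\<^sub>M j\<in>UNIV. lborel))"
  unfolding lebesgue_tuple_def by (simp add: nn_integral_completion)
 also have "\<dots> = (\<Prod>k\<in>UNIV. \<integral>\<^sup>+x. g k x * indicator (S k) x \<partial>lborel)"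
  using S g by (intro product_nn_integral_prod) auto
 finally show ?thesis
  by (simp add: nn_integral_completion)
qed

lemma le_of_ennpowr_le:
 assumes "x ennpowr (1 / r) \<le> ennreal N" "0 \<le> N" "0 < r"
 shows "x \<le> ennreal (N powr r)"
proof (cases x)
 case (real b)
 then have "b powr (1 / r) \<le> N"
  using assms by (simp add: ennpowr_ennreal)
 then have "(b powr (1 / r)) powr r \<le> N powr r"
  using assms by (intro powr_mono2) auto
 then show ?thesis
  using real assms by (simp add: powr_powr ennreal_leI)
next
 case top
 then show ?thesis
  using assms(1) by (simp add: ennpowr_def top_unique)
qed

text \<open>Hoelder's inequality on a product set with the conjugate pair p0', p0. The L^p0 norm of
  a tensor product factorizes by Tonelli. For p0 = 1 the essential supremum is pulled out
  instead.\<close>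

lemma conj_norm_Holder:
 fixes S :: "'m::finite \<Rightarrow> (real^'n::finite) set" and f :: "'m \<Rightarrow> real^'n \<Rightarrow> complex"
 assumes p0: "1 \<le> p0" and S: "\<And>k. S k \<in> sets borel" and f: "\<And>k. f k \<in> borel_measurable borel"
  and g: "g \<in> borel_measurable lebesgue_tuple"
  and N: "conj_norm_on p0 {y. \<forall>k. y k \<in> S k} g \<le> ennreal N" "0 \<le> N"
  and c: "\<And>k. 0 \<le> c k" "\<And>k. (\<integral>\<^sup>+x. ennreal (norm (f k x) powr p0) * indicator (S k) x \<partial>lebesgue) \<le> ennreal (c k)"
 shows "(\<integral>\<^sup>+y. ennreal (norm (g y) * (\<Prod>k\<in>UNIV. norm (f k (y k)))) * indicator {y. \<forall>k. y k \<in> S k} y \<partial>lebesgue_tuple)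
   \<le> ennreal (N * (\<Prod>k\<in>UNIV. c k powr (1 / p0)))"
proof -
 define A where "A = {y. \<forall>k. y k \<in> S k}"
 have A: "A \<in> sets lebesgue_tuple"
  unfolding A_def by (rule sets_lebesgue_tuple_box[OF S])
 have fp: "(\<lambda>x. norm (f k x) powr p0) \<in> borel_measurable borel" for k
  using f by measurable
 define P where "P y = (\<Prod>k\<in>UNIV. norm (f k (y k)) powr p0)" for y
 have Pm: "P \<in> borel_measurable lebesgue_tuple"
  unfolding P_def using fp by (intro measurable_lebesgue_tuple_prod[of "\<lambda>k x. norm (f k x) powr p0"])
 note [measurable] = A Pm g
 have P0: "0 \<le> P y" for y
  by (simp add: P_def prod_nonneg)
 have prodint: "(\<integral>\<^sup>+y. ennreal (P y) * indicator A y \<partial>lebesgue_tuple) \<le> ennreal (\<Prod>k\<in>UNIV. c k)"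
 proof -
  have "(\<integral>\<^sup>+y. ennreal (P y) * indicator A y \<partial>lebesgue_tuple)
    = (\<integral>\<^sup>+y. (\<Prod>k\<in>UNIV. ennreal (norm (f k (y k)) powr p0)) * indicator A y \<partial>lebesgue_tuple)"
   by (simp add: P_def prod_ennreal)
  also have "\<dots> = (\<Prod>k\<in>UNIV. \<integral>\<^sup>+x. ennreal (norm (f k x) powr p0) * indicator (S k) x \<partial>lebesgue)"
   unfolding A_def using S fp by (intro nn_integral_lebesgue_tuple_prod[of S "\<lambda>k x. ennreal (norm (f k x) powr p0)"]) auto
  also have "\<dots> \<le> (\<Prod>k\<in>UNIV. ennreal (c k))"
   using c by (intro prod_mono_ennreal) auto
  also have "\<dots> = ennreal (\<Prod>k\<in>UNIV. c k)"
   using c by (simp add: prod_ennreal)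
  finally show ?thesis .
 qed
 have "(\<integral>\<^sup>+y. ennreal (norm (g y) * (\<Prod>k\<in>UNIV. norm (f k (y k)))) * indicator A y \<partial>lebesgue_tuple)
   \<le> ennreal (N * (\<Prod>k\<in>UNIV. c k powr (1 / p0)))"
 proof (cases "p0 = 1")
  case True
  have "AE y in restrict_space lebesgue_tuple A. ennreal (norm (g y)) \<le> ennreal N"
   using esssup_AE[of "\<lambda>y. ennreal (norm (g y))" "restrict_space lebesgue_tuple A"] N(1) True
   unfolding conj_norm_on_def A_def by (auto elim!: eventually_mono intro: order_trans)
  then have "AE y in lebesgue_tuple. y \<in> A \<longrightarrow> norm (g y) \<le> N"
   using A N(2) by (simp add: AE_restrict_space_iff)
  then have "(\<integral>\<^sup>+y. ennreal (norm (g y) * (\<Prod>k\<in>UNIV. norm (f k (y k)))) * indicator A y \<partial>lebesgue_tuple)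
    \<le> (\<integral>\<^sup>+y. ennreal N * (ennreal (P y) * indicator A y) \<partial>lebesgue_tuple)"
  proof (intro nn_integral_mono_AE, eventually_elim)
   case (elim y)
   show ?case
   proof (cases "y \<in> A")
    case y: True
    have "norm (g y) * (\<Prod>k\<in>UNIV. norm (f k (y k))) \<le> N * P y"
     using elim y True N(2) unfolding P_def by (intro mult_mono) (auto intro: prod_nonneg)
    then show ?thesis
     using y N(2) P0[of y] by (simp add: ennreal_mult'[symmetric] ennreal_leI)
   qed simp
  qed
  also have "\<dots> = ennreal N * (\<integral>\<^sup>+y. ennreal (P y) * indicator A y \<partial>lebesgue_tuple)"
   by (intro nn_integral_cmult) measurable
  also have "\<dots> \<le> ennreal N * ennreal (\<Prod>k\<in>UNIV. c k)"
   by (intro mult_left_mono prodint) simp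
  also have "\<dots> = ennreal (N * (\<Prod>k\<in>UNIV. c k powr (1 / p0)))"
   using True c(1) N(2) by (simp add: ennreal_mult prod_nonneg)
  finally show ?thesis .
 next
  case False
  then have p1: "1 < p0"
   using p0 by simp
  define r where "r = p0 / (p0 - 1)"
  have r: "0 < r" "1 / r + 1 / p0 = 1"
   using p1 by (auto simp: r_def field_simps)
  have gN: "(\<integral>\<^sup>+y. ennreal (norm (g y) powr r) * indicator A y \<partial>lebesgue_tuple) \<le> ennreal (N powr r)"
   using N False unfolding conj_norm_on_def A_def[symmetric] r_def[symmetric] Let_def
   by (intro le_of_ennpowr_le r) auto
  \<comment> \<open>The two-function case of the general inequality: index 0 carries |g|^r with
    exponent 1/r for r = p0', index 1 the tensor product with exponent 1/p0.\<close>
  define F where "F i y = (if i = 0 then norm (g y) powr r else P y) * indicator A y" for i :: nat and y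
  define \<theta> where "\<theta> i = (if i = 0 then 1 / r else 1 / p0)" for i :: nat
  define cc where "cc i = (if i = 0 then N powr r else (\<Prod>k\<in>UNIV. c k))" for i :: nat
  have "(\<integral>\<^sup>+y. ennreal (\<Prod>i\<in>{0, 1}. F i y powr \<theta> i) \<partial>lebesgue_tuple) \<le> ennreal (\<Prod>i\<in>{0, 1::nat}. cc i powr \<theta> i)"
  proof (rule Holder_prod)
   fix i :: nat assume i: "i \<in> {0, 1}"
   show "F i \<in> borel_measurable lebesgue_tuple"
    unfolding F_def by (cases "i = 0"; simp)
   show "(\<integral>\<^sup>+y. ennreal (F i y) \<partial>lebesgue_tuple) \<le> ennreal (cc i)"
    using i gN prodint by (auto simp: F_def cc_def ennreal_mult'' ennreal_indicator)
  qed (use r p1 c P0 in \<open>auto simp: \<theta>_def F_def cc_def intro!: prod_nonneg mult_nonneg_nonneg\<close>)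
  moreover have e1: "(\<Prod>i\<in>{0, 1}. F i y powr \<theta> i) = norm (g y) * (\<Prod>k\<in>UNIV. norm (f k (y k))) * indicator A y" for y
  proof (cases "y \<in> A")
   case True
   have "P y powr (1 / p0) = (\<Prod>k\<in>UNIV. norm (f k (y k)))"
    using p1 by (simp add: P_def prod_powr_distrib powr_powr)
   then show ?thesis
    using True r(1) by (simp add: F_def \<theta>_def powr_powr)
  qed (use r p1 in \<open>simp add: F_def\<close>)
  moreover have e2: "(\<Prod>i\<in>{0, 1::nat}. cc i powr \<theta> i) = N * (\<Prod>k\<in>UNIV. c k powr (1 / p0))"
   using r(1) N(2) by (simp add: cc_def \<theta>_def powr_powr prod_powr_distrib)
  ultimately have "(\<integral>\<^sup>+y. ennreal (norm (g y) * (\<Prod>k\<in>UNIV. norm (f k (y k))) * indicator A y) \<partial>lebesgue_tuple)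
    \<le> ennreal (N * (\<Prod>k\<in>UNIV. c k powr (1 / p0)))"
   by (simp only: e1 e2)
  moreover have "ennreal (norm (g y) * (\<Prod>k\<in>UNIV. norm (f k (y k))) * indicator A y) = ennreal (norm (g y) * (\<Prod>k\<in>UNIV. norm (f k (y k)))) * indicator A y" for y
   by (simp add: indicator_def)
  ultimately show ?thesis
   by (simp only:)
 qed
 then show ?thesis
  by (simp add: A_def)
qed

lemma measure_ball_vec: "0 \<le> \<rho> \<Longrightarrow> measure lebesgue (ball c \<rho> :: (real^'n::finite) set) = unit_ball_vol CARD('n) * \<rho> ^ CARD('n)"
 by (simp add: content_ball)

text \<open>Scale invariance of the kernel condition: the powers of \<rho> cancel because m
  (\<delta> - n/p0) + m n/p0 = m \<delta>. What remains in each index l_k is a geometric term of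
  ratio 2^(-(\<delta> - n/p0)), less than 1 when \<delta> > n/p0.\<close>

lemma kernel_sum_algebra:
 fixes A :: "'m::finite \<Rightarrow> real" and l :: "'m \<Rightarrow> nat"
 assumes \<rho>: "0 < \<rho>" and V: "0 < V" and n: "0 < n" and p0: "0 < p0" and A: "\<And>k. 0 \<le> A k"
 shows "\<rho> powr (real CARD('m) * (\<delta> - real n / p0)) / (V * \<rho> ^ n) powr (real CARD('m) * \<delta> / real n)
   * (\<Prod>k\<in>UNIV. 2 powr (- (\<delta> * real (l k)))) * (\<Prod>k\<in>UNIV. (A k * (V * (2 ^ l k * \<rho>) ^ n)) powr (1 / p0))
  = V powr (real CARD('m) / p0 - real CARD('m) * \<delta> / real n) * (\<Prod>k\<in>UNIV. A k powr (1 / p0))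
   * (\<Prod>k\<in>UNIV. (2 powr (- (\<delta> - real n / p0))) ^ l k)"
proof -
 define m where "m = real CARD('m)"
 have 1: "(V * \<rho> ^ n) powr (m * \<delta> / real n) = V powr (m * \<delta> / real n) * \<rho> powr (m * \<delta>)"
  using \<rho> V n by (simp add: powr_mult powr_powr flip: powr_realpow)
 have 2: "(A k * (V * (2 ^ l k * \<rho>) ^ n)) powr (1 / p0) = A k powr (1 / p0) * (V powr (1 / p0) * \<rho> powr (real n / p0)) * 2 powr (real (l k) * (real n / p0))" for k
 proof -
  have "(2 ^ l k * \<rho>) ^ n = 2 powr (real (l k) * real n) * \<rho> powr real n"
   using \<rho> by (simp add: power_mult_distrib powr_realpow powr_powr[symmetric])
  then show ?thesis
   using \<rho> V A[of k] by (simp add: powr_mult powr_powr)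
 qed
 have 3: "(\<Prod>k\<in>(UNIV::'m set). V powr (1 / p0) * \<rho> powr (real n / p0)) = V powr (m / p0) * \<rho> powr (m * (real n / p0))"
 proof -
  have "(V powr (1 / p0)) ^ CARD('m) = V powr (m / p0)"
   using V by (simp add: m_def powr_powr mult.commute flip: powr_realpow)
  moreover have "(\<rho> powr (real n / p0)) ^ CARD('m) = \<rho> powr (m * (real n / p0))"
   using \<rho> by (simp add: m_def powr_powr mult.commute flip: powr_realpow)
  ultimately show ?thesis
   by (simp add: power_mult_distrib)
 qed
 have 4: "(\<Prod>k\<in>UNIV. 2 powr (- (\<delta> * real (l k)))) * (\<Prod>k\<in>UNIV. 2 powr (real (l k) * (real n / p0)))
   = (\<Prod>k\<in>UNIV. (2 powr (- (\<delta> - real n / p0))) ^ l k)"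
  by (simp add: prod.distrib[symmetric] powr_add[symmetric] powr_powr algebra_simps flip: powr_realpow)
 have 5: "\<rho> powr (m * (\<delta> - real n / p0)) * \<rho> powr (m * (real n / p0)) = \<rho> powr (m * \<delta>)"
  by (simp add: powr_add[symmetric] algebra_simps)
 have "\<rho> powr (m * (\<delta> - real n / p0)) / (V * \<rho> ^ n) powr (m * \<delta> / real n)
   * (\<Prod>k\<in>UNIV. 2 powr (- (\<delta> * real (l k)))) * (\<Prod>k\<in>UNIV. (A k * (V * (2 ^ l k * \<rho>) ^ n)) powr (1 / p0))
  = (\<rho> powr (m * (\<delta> - real n / p0)) * \<rho> powr (m * (real n / p0))) / \<rho> powr (m * \<delta>) * (V powr (m / p0) / V powr (m * \<delta> / real n))
   * (\<Prod>k\<in>UNIV. A k powr (1 / p0)) * ((\<Prod>k\<in>UNIV. 2 powr (- (\<delta> * real (l k)))) * (\<Prod>k\<in>UNIV. 2 powr (real (l k) * (real n / p0))))"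
  unfolding 1 2 prod.distrib[of "\<lambda>k. A k powr (1 / p0) * (V powr (1 / p0) * \<rho> powr (real n / p0))"]
   prod.distrib[of "\<lambda>k. A k powr (1 / p0)"] 3 by (simp add: mult_ac)
 also have "\<dots> = V powr (m / p0 - m * \<delta> / real n) * (\<Prod>k\<in>UNIV. A k powr (1 / p0)) * (\<Prod>k\<in>UNIV. (2 powr (- (\<delta> - real n / p0))) ^ l k)"
  unfolding 4 5 using \<rho> by (simp add: powr_diff)
 finally show ?thesis
  unfolding m_def .
qed

text \<open>The power of the volume of the unit ball comes from expressing measures of balls by
  radii; the last factor is the sum of the geometric series over the annuli, once for each of the m
  variables.\<close>

definition oscillation_const :: "nat \<Rightarrow> nat \<Rightarrow> real \<Rightarrow> real \<Rightarrow> real \<Rightarrow> real" where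
 "oscillation_const m n p0 \<delta> C = C * unit_ball_vol n powr (m / p0 - m * \<delta> / n) * (1 / (1 - 2 powr (- (\<delta> - n / p0)))) ^ m"

text \<open>The space of y is cut into products of annuli. The input that vanishes on the ball
  removes the product of the innermost balls, the one tuple of indices about which the regularity
  condition says nothing. On the others Hoelder's inequality leaves summable terms.\<close>

lemma kernel_integral_oscillation:
 fixes K :: "real^'n::finite \<Rightarrow> ('m::finite \<Rightarrow> real^'n) \<Rightarrow> complex" and \<phi> :: "'m \<Rightarrow> real^'n \<Rightarrow> complex"
 assumes p0: "1 \<le> p0" and K: "has_kernel T K" and reg: "kernel_regularity p0 \<delta> C K" and C: "0 < C"
  and \<delta>: "real CARD('n) / p0 < \<delta>" and \<rho>: "0 < \<rho>"
  and \<phi>: "\<And>k. \<phi> k \<in> test_functions UNIV" and k0: "\<And>y. y \<in> ball c \<rho> \<Longrightarrow> \<phi> k0 y = 0"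
  and A: "\<And>k. 0 \<le> A k" "\<And>k R. \<rho> \<le> R \<Longrightarrow> (\<integral>\<^sup>+x. ennreal (norm (\<phi> k x) powr p0) * indicator (ball c R) x \<partial>lebesgue) \<le> ennreal (A k * measure lebesgue (ball c R))"
  and x: "x \<in> ball c (\<rho> / 2)" "x' \<in> ball c (\<rho> / 2)"
 shows "norm (kernel_integral K \<phi> x - kernel_integral K \<phi> x') \<le> oscillation_const CARD('m) CARD('n) p0 \<delta> C * (\<Prod>k\<in>UNIV. A k powr (1 / p0))"
proof -
 define n where "n = CARD('n)"
 define m where "m = CARD('m)"
 define V where "V = unit_ball_vol n"
 have n: "0 < n" and V: "0 < V"
  by (auto simp: n_def V_def)
 have \<delta>0: "0 < \<delta>"
  using \<delta> p0 by (meson divide_nonneg_pos le_less_trans less_le_trans of_nat_0_le_iff zero_less_one)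
 have meas: "measure lebesgue (ball c R) = V * R ^ n" if "0 \<le> R" for R
  using measure_ball_vec[OF that, of c] by (simp add: V_def n_def)
 \<comment> \<open>The kernel integral is known to converge off the common support; the half ball is
   disjoint from the support of the input with index k0.\<close>
 have bx: "b \<notin> (\<Inter>j. supp (\<phi> j))" if "b \<in> ball c (\<rho> / 2)" for b
 proof -
  have "supp (\<phi> k0) \<subseteq> - ball c \<rho>"
   unfolding supp_def using k0 by (intro closure_minimal) auto
  then show ?thesis
   using that \<rho> by auto
 qed
 have sch: "\<forall>j. \<phi> j \<in> schwartz"
  using test_functions_schwartz[OF \<phi>] by blast
 have Km: "K b \<in> borel_measurable lebesgue_tuple" for b
  using K by (simp add: has_kernel_def)
 have int: "integrable lebesgue_tuple (\<lambda>y. K b y * (\<Prod>j\<in>UNIV. \<phi> j (y j)))" if "b \<in> ball c (\<rho> / 2)" for b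
  using K sch bx[OF that] by (simp add: has_kernel_def)
 have "\<exists>S. compact S \<and> (\<forall>x. x \<notin> S \<longrightarrow> \<phi> k x = 0)" for k
  using \<phi>[of k] by (simp add: test_functions_def)
 then obtain S where S: "\<And>k. compact (S k)" "\<And>k x. x \<notin> S k \<Longrightarrow> \<phi> k x = 0"
  by metis
 have "bounded (\<Union>k. S k)"
  by (intro bounded_UN finite ballI compact_imp_bounded S(1))
 then obtain B where "(\<Union>k. S k) \<subseteq> ball c B"
  using bounded_subset_ballD by blast
 then have B: "dist c y < B" if "y \<in> S k" for k y
 proof -
  have "y \<in> ball c B"
   using that \<open>(\<Union>k. S k) \<subseteq> ball c B\<close> by blast
  then show ?thesis
   by simp
 qed
 \<comment> \<open>Compact supports fit into one dilate, so finitely many annuli suffice.\<close>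
 obtain J :: nat where J: "B / \<rho> < 2 ^ J"
  using real_arch_pow[of 2 "B / \<rho>"] by auto
 have JS: "y \<in> ball c (2 ^ J * \<rho>)" if "\<phi> k y \<noteq> 0" for k y
 proof -
  have "dist c y < B"
   using B S(2) that by blast
  also have "B < 2 ^ J * \<rho>"
   using J \<rho> by (simp add: field_simps)
  finally show ?thesis by simp
 qed
 define JJ where "JJ = {js :: 'm \<Rightarrow> nat. (\<forall>k. js k \<le> J) \<and> js \<noteq> (\<lambda>_. 0)}"
 define G where "G y = ennreal (norm (K x y - K x' y) * (\<Prod>k\<in>UNIV. norm (\<phi> k (y k))))" for y
 define D where "D js = {y :: 'm \<Rightarrow> real^'n. \<forall>k. y k \<in> annulus c \<rho> (js k)}" for js
 have JJsub: "JJ \<subseteq> PiE UNIV (\<lambda>_. {..J})"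
  by (auto simp: JJ_def PiE_UNIV_domain)
 have finPi: "finite (PiE (UNIV::'m set) (\<lambda>_. {..J}))"
  by (intro finite_PiE) auto
 have finJJ: "finite JJ"
  using JJsub finPi finite_subset by blast
 have Gm: "G \<in> borel_measurable lebesgue_tuple"
 proof -
  have "(\<lambda>y. \<Prod>k\<in>UNIV. norm (\<phi> k (y k))) \<in> borel_measurable lebesgue_tuple"
   using test_functions_measurable[OF \<phi>] by (intro measurable_lebesgue_tuple_prod[of "\<lambda>k x. norm (\<phi> k x)"]) measurable
  then show ?thesis
   unfolding G_def using Km by measurable
 qed
 have Dm: "D js \<in> sets lebesgue_tuple" for js
  unfolding D_def by (rule sets_lebesgue_tuple_box) simp
 have cover: "G y \<le> (\<Sum>js\<in>JJ. G y * indicator (D js) y)" for y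
 proof (cases "(\<Prod>k\<in>UNIV. norm (\<phi> k (y k))) = 0")
  case False
  then have nz: "\<phi> k (y k) \<noteq> 0" for k
   by (simp add: prod_zero_iff)
  have "\<exists>l\<le>J. y k \<in> annulus c \<rho> l \<and> (y k \<notin> ball c \<rho> \<longrightarrow> l \<noteq> 0)" for k
   by (rule annulus_cover[OF JS[OF nz[of k]]]) blast
  then obtain js where js: "\<And>k. js k \<le> J" "\<And>k. y k \<in> annulus c \<rho> (js k)" "\<And>k. y k \<notin> ball c \<rho> \<Longrightarrow> js k \<noteq> 0"
   by metis
  have "y k0 \<notin> ball c \<rho>"
   using nz[of k0] k0 by blast
  then have "js \<noteq> (\<lambda>_. 0)"
   using js(3)[of k0] by auto
  then have "js \<in> JJ"
   using js by (simp add: JJ_def)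
  moreover have "G y = G y * indicator (D js) y"
   using js(2) by (simp add: D_def)
  ultimately show ?thesis
   using member_le_sum[of js JJ "\<lambda>js. G y * indicator (D js) y"] finJJ by simp
 next
  case True
  then have "G y = 0"
   unfolding G_def by (simp only: mult_zero_right ennreal_0)
  then show ?thesis
   by simp
 qed
 define q where "q = 2 powr (- (\<delta> - n / p0))"
 have q: "0 < q" "q < 1"
  using \<delta> by (auto simp: q_def n_def intro!: powr_less_one)
 define c1 where "c1 = C * V powr (m / p0 - m * \<delta> / n) * (\<Prod>k\<in>UNIV. A k powr (1 / p0))"
 have c1: "0 \<le> c1"
  unfolding c1_def using C by (intro mult_nonneg_nonneg prod_nonneg) auto
 have term_le: "(\<integral>\<^sup>+y. G y * indicator (D js) y \<partial>lebesgue_tuple) \<le> ennreal (c1 * (\<Prod>k\<in>UNIV. q ^ js k))" if js: "js \<in> JJ" for js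
 proof -
  define N where "N = C * (dist x x' powr (m * (\<delta> - n / p0)) / measure lebesgue (ball c \<rho>) powr (m * \<delta> / n)) * 2 powr (- (m * \<delta> * real (Max (range js))))"
  have N0: "0 \<le> N"
   unfolding N_def using C by auto
  have "conj_norm_on p0 (D js) (\<lambda>y. K x y - K x' y) \<le> ennreal N"
   using reg \<rho> x js unfolding kernel_regularity_def D_def N_def m_def n_def JJ_def Let_def by simp
  then have "(\<integral>\<^sup>+y. G y * indicator (D js) y \<partial>lebesgue_tuple) \<le> ennreal (N * (\<Prod>k\<in>UNIV. (A k * (V * (2 ^ js k * \<rho>) ^ n)) powr (1 / p0)))"
   unfolding G_def D_def
  proof (intro conj_norm_Holder[OF p0])
   show "(\<lambda>y. K x y - K x' y) \<in> borel_measurable lebesgue_tuple"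
    using Km by measurable
   show "\<phi> k \<in> borel_measurable borel" for k
    by (rule test_functions_measurable[OF \<phi>])
   fix k
   have ge: "\<rho> \<le> 2 ^ js k * \<rho>"
    using \<rho> mult_right_mono[of 1 "2 ^ js k" \<rho>] by simp
   have "(\<integral>\<^sup>+x. ennreal (norm (\<phi> k x) powr p0) * indicator (annulus c \<rho> (js k)) x \<partial>lebesgue)
     \<le> (\<integral>\<^sup>+x. ennreal (norm (\<phi> k x) powr p0) * indicator (ball c (2 ^ js k * \<rho>)) x \<partial>lebesgue)"
    using annulus_subset_ball[of c \<rho> "js k"] by (intro nn_integral_mono mult_left_mono) (auto simp: indicator_def)
   also have "\<dots> \<le> ennreal (A k * measure lebesgue (ball c (2 ^ js k * \<rho>)))"
    by (rule A(2)[OF ge])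
   also have "measure lebesgue (ball c (2 ^ js k * \<rho>)) = V * (2 ^ js k * \<rho>) ^ n"
    using \<rho> by (intro meas) simp
   finally show "(\<integral>\<^sup>+x. ennreal (norm (\<phi> k x) powr p0) * indicator (annulus c \<rho> (js k)) x \<partial>lebesgue) \<le> ennreal (A k * (V * (2 ^ js k * \<rho>) ^ n))" .
   show "0 \<le> A k * (V * (2 ^ js k * \<rho>) ^ n)"
    using A(1) V \<rho> by (intro mult_nonneg_nonneg) auto
  qed (auto simp: N0)
  also have "\<dots> \<le> ennreal (c1 * (\<Prod>k\<in>UNIV. q ^ js k))"
  proof (rule ennreal_leI)
   define P where "P = (\<Prod>k\<in>UNIV. (A k * (V * (2 ^ js k * \<rho>) ^ n)) powr (1 / p0))"
   have P: "0 \<le> P"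
    unfolding P_def by (intro prod_nonneg) auto
   \<comment> \<open>The decay is given in terms of the largest index. Replacing m times the maximum
     by the sum of all indices weakens it, but splits the m-fold sum into a product of single
     series.\<close>
   have "2 powr (- (m * \<delta> * real (Max (range js)))) \<le> (\<Prod>k\<in>UNIV. 2 powr (- (\<delta> * real (js k))))"
   proof -
    have "(\<Sum>k\<in>UNIV. real (js k)) \<le> (\<Sum>k\<in>(UNIV::'m set). real (Max (range js)))"
     by (intro sum_mono of_nat_mono Max_ge) auto
    then have "\<delta> * (\<Sum>k\<in>UNIV. real (js k)) \<le> \<delta> * (m * real (Max (range js)))"
     using \<delta>0 by (intro mult_left_mono) (auto simp: m_def)
    then have "2 powr (- (m * \<delta> * real (Max (range js)))) \<le> 2 powr (- (\<delta> * (\<Sum>k\<in>UNIV. real (js k))))"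
     by (simp add: algebra_simps)
    also have "\<dots> = (\<Prod>k\<in>UNIV. 2 powr (- (\<delta> * real (js k))))"
     by (simp add: powr_sum sum_distrib_left sum_negf[symmetric])
    finally show ?thesis .
   qed
   moreover have "dist x x' powr (m * (\<delta> - n / p0)) \<le> \<rho> powr (m * (\<delta> - n / p0))"
   proof (intro powr_mono2)
    show "dist x x' \<le> \<rho>"
     using x dist_triangle3[of x x' c] by simp
   qed (use \<delta> in \<open>auto simp: n_def\<close>)
   ultimately have "N * P \<le> (C * (\<rho> powr (m * (\<delta> - n / p0)) / measure lebesgue (ball c \<rho>) powr (m * \<delta> / n)) * (\<Prod>k\<in>UNIV. 2 powr (- (\<delta> * real (js k))))) * P"
    unfolding N_def using C P by (intro mult_right_mono mult_mono mult_left_mono divide_right_mono) (auto intro!: prod_nonneg)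
   also have "\<dots> = C * (\<rho> powr (m * (\<delta> - n / p0)) / (V * \<rho> ^ n) powr (m * \<delta> / n) * (\<Prod>k\<in>UNIV. 2 powr (- (\<delta> * real (js k)))) * P)"
    using meas[of \<rho>] \<rho> by simp
   also have "\<dots> = C * (V powr (m / p0 - m * \<delta> / n) * (\<Prod>k\<in>UNIV. A k powr (1 / p0)) * (\<Prod>k\<in>UNIV. q ^ js k))"
    unfolding P_def m_def q_def using p0 by (subst kernel_sum_algebra[OF \<rho> V n _ A(1)]) auto
   finally show "N * (\<Prod>k\<in>UNIV. (A k * (V * (2 ^ js k * \<rho>) ^ n)) powr (1 / p0)) \<le> c1 * (\<Prod>k\<in>UNIV. q ^ js k)"
    unfolding P_def c1_def by (simp add: ac_simps)
  qed
  finally show ?thesis .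
 qed
 have sumle: "(\<Sum>js\<in>JJ. c1 * (\<Prod>k\<in>UNIV. q ^ js k)) \<le> c1 * (1 / (1 - q)) ^ m"
 proof -
  have "(\<Sum>js\<in>JJ. c1 * (\<Prod>k\<in>UNIV. q ^ js k)) \<le> (\<Sum>js\<in>PiE (UNIV::'m set) (\<lambda>_. {..J}). c1 * (\<Prod>k\<in>UNIV. q ^ js k))"
   using q c1 by (intro sum_mono2 finPi JJsub mult_nonneg_nonneg prod_nonneg) auto
  also have "\<dots> = c1 * (\<Prod>k\<in>(UNIV::'m set). \<Sum>l\<le>J. q ^ l)"
   by (subst prod_sum_PiE) (simp_all add: sum_distrib_left)
  also have "\<dots> \<le> c1 * (1 / (1 - q)) ^ m"
  proof (intro mult_left_mono c1)
   have "(\<Sum>l\<le>J. q ^ l) = (1 - q ^ Suc J) / (1 - q)"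
    using q by (simp add: sum_gp0)
   also have "\<dots> \<le> 1 / (1 - q)"
    using q by (intro divide_right_mono) auto
   finally have "(\<Sum>l\<le>J. q ^ l) ^ m \<le> (1 / (1 - q)) ^ m"
    using q by (intro power_mono sum_nonneg) auto
   then show "(\<Prod>k\<in>(UNIV::'m set). \<Sum>l\<le>J. q ^ l) \<le> (1 / (1 - q)) ^ m"
    by (simp add: m_def)
  qed
  finally show ?thesis .
 qed
 have "kernel_integral K \<phi> x - kernel_integral K \<phi> x' = (LINT y|lebesgue_tuple. K x y * (\<Prod>j\<in>UNIV. \<phi> j (y j)) - K x' y * (\<Prod>j\<in>UNIV. \<phi> j (y j)))"
  unfolding kernel_integral_def using int x by (intro Bochner_Integration.integral_diff[symmetric]) auto
 then have "ennreal (norm (kernel_integral K \<phi> x - kernel_integral K \<phi> x')) \<le> (\<integral>\<^sup>+y. G y \<partial>lebesgue_tuple)"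
  using integral_norm_bound_ennreal[OF Bochner_Integration.integrable_diff[OF int[OF x(1)] int[OF x(2)]]]
  by (simp add: G_def left_diff_distrib[symmetric] norm_mult prod_norm)
 also have "\<dots> \<le> (\<integral>\<^sup>+y. (\<Sum>js\<in>JJ. G y * indicator (D js) y) \<partial>lebesgue_tuple)"
  by (intro nn_integral_mono cover)
 also have "\<dots> = (\<Sum>js\<in>JJ. \<integral>\<^sup>+y. G y * indicator (D js) y \<partial>lebesgue_tuple)"
  by (intro nn_integral_sum borel_measurable_times_ennreal borel_measurable_indicator Gm Dm)
 also have "\<dots> \<le> (\<Sum>js\<in>JJ. ennreal (c1 * (\<Prod>k\<in>UNIV. q ^ js k)))"
  by (intro sum_mono term_le)
 also have "\<dots> = ennreal (\<Sum>js\<in>JJ. c1 * (\<Prod>k\<in>UNIV. q ^ js k))"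
  using c1 q by (intro sum_ennreal mult_nonneg_nonneg prod_nonneg) auto
 also have "\<dots> \<le> ennreal (c1 * (1 / (1 - q)) ^ m)"
  by (intro ennreal_leI sumle)
 finally have "norm (kernel_integral K \<phi> x - kernel_integral K \<phi> x') \<le> c1 * (1 / (1 - q)) ^ m"
  using c1 q by (subst (asm) ennreal_le_iff) auto
 also have "\<dots> = oscillation_const CARD('m) CARD('n) p0 \<delta> C * (\<Prod>k\<in>UNIV. A k powr (1 / p0))"
  by (simp add: oscillation_const_def c1_def q_def V_def m_def n_def)
 finally show ?thesis .
qed

section \<open>Trees of nested sets\<close>

fun generation :: "('q \<Rightarrow> 'q set) \<Rightarrow> 'q \<Rightarrow> nat \<Rightarrow> 'q set" where
 "generation ch q 0 = {q}"
| "generation ch q (Suc d) = (\<Union>q'\<in>generation ch q d. ch q')"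

lemma generation_Suc': "generation ch q (Suc d) = (\<Union>q'\<in>ch q. generation ch q' d)"
 by (induction d) auto

lemma generation_add: "generation ch q (i + d) = (\<Union>q'\<in>generation ch q i. generation ch q' d)"
 by (induction d) auto

lemma countable_generation: "(\<And>q. countable (ch q)) \<Longrightarrow> countable (generation ch q d)"
 by (induction d) auto

lemma borel_measurable_nn_integral_count_space:
 fixes f :: "'i \<Rightarrow> 'a \<Rightarrow> ennreal"
 assumes I: "countable I" and f: "\<And>i. i \<in> I \<Longrightarrow> f i \<in> borel_measurable M"
 shows "(\<lambda>x. \<integral>\<^sup>+i. f i x \<partial>count_space I) \<in> borel_measurable M"
proof (cases "finite I")
 case True
 then have "(\<lambda>x. \<integral>\<^sup>+i. f i x \<partial>count_space I) = (\<lambda>x. \<Sum>i\<in>I. f i x)"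
  by (simp add: nn_integral_count_space_finite)
 then show ?thesis
  using f by simp
next
 case False
 note bij = bij_betw_from_nat_into[OF I False]
 have "(\<lambda>x. \<integral>\<^sup>+i. f i x \<partial>count_space I) = (\<lambda>x. \<Sum>n. f (from_nat_into I n) x)"
  unfolding nn_integral_count_space_nat[symmetric]
  by (intro ext nn_integral_bij_count_space[OF bij, symmetric])
 moreover have "from_nat_into I n \<in> I" for n
  using False by (intro from_nat_into) auto
 ultimately show ?thesis
  using f by simp
qed

lemma sets_UN_generation:
 assumes "\<And>q. countable (ch q)" "\<And>q. X q \<in> sets M"
 shows "(\<Union>a\<in>generation ch q d. X a) \<in> sets M"
 using assms countable_generation[of ch q d] by (intro sets.countable_UN') auto

lemma generation_subset:
 assumes "\<And>q q'. q' \<in> ch q \<Longrightarrow> X q' \<subseteq> X q" "q' \<in> generation ch q d"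
 shows "X q' \<subseteq> X q"
 using assms(2)
proof (induction d arbitrary: q')
 case (Suc d)
 then obtain q'' where "q'' \<in> generation ch q d" "q' \<in> ch q''"
  by auto
 then show ?case
  using Suc.IH assms(1) by blast
qed simp

lemma disjoint_generation:
 assumes sub: "\<And>q q'. q' \<in> ch q \<Longrightarrow> X q' \<subseteq> X q" and disj: "\<And>q. disjoint_family_on X (ch q)"
 shows "disjoint_family_on X (generation ch q d)"
proof (induction d)
 case (Suc d)
 show ?case
  unfolding disjoint_family_on_def
 proof (intro ballI impI)
  fix a b assume "a \<in> generation ch q (Suc d)" "b \<in> generation ch q (Suc d)" "a \<noteq> b"
  then obtain a' b' where *: "a' \<in> generation ch q d" "a \<in> ch a'" "b' \<in> generation ch q d" "b \<in> ch b'"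
   by auto
  show "X a \<inter> X b = {}"
  proof (cases "a' = b'")
   case True
   then show ?thesis
    using disj[of a'] * \<open>a \<noteq> b\<close> by (simp add: disjoint_family_on_def)
  next
   case False
   then have "X a' \<inter> X b' = {}"
    using Suc * by (simp add: disjoint_family_on_def)
   then show ?thesis
    using sub[OF *(2)] sub[OF *(4)] by blast
  qed
 qed
qed (simp add: disjoint_family_on_def)

text \<open>The ancestor in generation i of a cell through the point also contains the point;
  disjointness within that generation identifies it with q'.\<close>

lemma generation_inter:
 assumes sub: "\<And>q q'. q' \<in> ch q \<Longrightarrow> X q' \<subseteq> X q" and disj: "\<And>q. disjoint_family_on X (ch q)"
  and q: "q' \<in> generation ch q i"
 shows "X q' \<inter> (\<Union>a\<in>generation ch q (i + d). X a) \<subseteq> (\<Union>a\<in>generation ch q' d. X a)"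
proof
 fix x assume "x \<in> X q' \<inter> (\<Union>a\<in>generation ch q (i + d). X a)"
 then obtain a q'' where *: "x \<in> X q'" "q'' \<in> generation ch q i" "a \<in> generation ch q'' d" "x \<in> X a"
  unfolding generation_add by auto
 have "X a \<subseteq> X q''"
  using generation_subset[of ch X a q'' d] sub *(3) by simp
 then have "q'' = q'"
  using disjoint_generation[of ch X q i] sub disj q * unfolding disjoint_family_on_def by blast
 then show "x \<in> (\<Union>a\<in>generation ch q' d. X a)"
  using * by blast
qed

lemma emeasure_generation_le:
 assumes cnt: "\<And>q. countable (ch q)" and sets: "\<And>q. X q \<in> sets M"
  and disj: "\<And>q. disjoint_family_on X (ch q)"
  and \<theta>: "\<And>q. emeasure M (\<Union>q'\<in>ch q. X q') \<le> \<theta> * emeasure M (X q)"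
 shows "emeasure M (\<Union>a\<in>generation ch q d. X a) \<le> \<theta> ^ d * emeasure M (X q)"
proof (induction d arbitrary: q)
 case (Suc d)
 have "emeasure M (\<Union>a\<in>generation ch q (Suc d). X a) = emeasure M (\<Union>q'\<in>ch q. \<Union>a\<in>generation ch q' d. X a)"
  unfolding generation_Suc' by simp
 also have "\<dots> \<le> (\<integral>\<^sup>+q'. emeasure M (\<Union>a\<in>generation ch q' d. X a) \<partial>count_space (ch q))"
  by (intro emeasure_UN_le_count_space cnt sets_UN_generation sets)
 also have "\<dots> \<le> (\<integral>\<^sup>+q'. \<theta> ^ d * emeasure M (X q') \<partial>count_space (ch q))"
  by (intro nn_integral_mono Suc)
 also have "\<dots> = \<theta> ^ d * (\<integral>\<^sup>+q'. emeasure M (X q') \<partial>count_space (ch q))"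
  by (rule nn_integral_cmult) simp
 also have "(\<integral>\<^sup>+q'. emeasure M (X q') \<partial>count_space (ch q)) = emeasure M (\<Union>q'\<in>ch q. X q')"
  by (intro emeasure_UN_countable[symmetric] cnt sets disj)
 also have "\<theta> ^ d * \<dots> \<le> \<theta> ^ d * (\<theta> * emeasure M (X q))"
  by (intro mult_left_mono \<theta>) simp
 finally show ?case
  by (simp add: ac_simps)
qed simp

text \<open>
 Weighting the terms of a chain geometrically from its last element replaces duality in the estimate
 of sparse sums and works for all exponents \<open>p > 0\<close> at once.
\<close>

lemma chain_sum_powr_le:
 fixes \<alpha> :: "nat \<Rightarrow> real"
 assumes \<alpha>: "\<And>i. 0 \<le> \<alpha> i" and p: "0 < p" and s: "1 < s"
 shows "(\<Sum>i\<le>N. \<alpha> i) powr p \<le> (1 / (1 - s powr (- 1 / p))) powr p * (\<Sum>i\<le>N. \<alpha> i powr p * s ^ (N - i))"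
proof -
 \<comment> \<open>Then t^p = 1/s, so weights s^j on p-th powers correspond to weights t^(-j) on the
   terms themselves.\<close>
 define t where "t = s powr (- 1 / p)"
 have t: "0 < t" "t < 1"
  using s p by (auto simp: t_def intro!: powr_less_one)
 \<comment> \<open>The terms relative to the geometric profile t^(N-i). If M is the largest ratio,
   the whole sum is at most M times a geometric series, and M^p is a single term of the right-hand
   side.\<close>
 define \<beta> where "\<beta> i = \<alpha> i / t ^ (N - i)" for i
 have fin: "finite (\<beta> ` {..N})" "\<beta> ` {..N} \<noteq> {}"
  by auto
 define M where "M = Max (\<beta> ` {..N})"
 have "M \<in> \<beta> ` {..N}"
  unfolding M_def by (rule Max_in[OF fin])
 then obtain k where k: "k \<le> N" "M = \<beta> k"
  by auto
 have "\<alpha> i \<le> M * t ^ (N - i)" if "i \<le> N" for i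
 proof -
  have "\<beta> i \<le> M"
   unfolding M_def using that by (intro Max_ge fin) auto
  then show ?thesis
   using t by (simp add: \<beta>_def field_simps)
 qed
 then have "(\<Sum>i\<le>N. \<alpha> i) \<le> (\<Sum>i\<le>N. M * t ^ (N - i))"
  by (intro sum_mono) auto
 also have "\<dots> = M * (\<Sum>i\<le>N. t ^ i)"
  by (simp add: sum_distrib_left[symmetric] sum.nat_diff_reindex[of "\<lambda>i. t ^ i" "Suc N", simplified lessThan_Suc_atMost diff_Suc_Suc])
 also have "\<dots> \<le> M * (1 / (1 - t))"
 proof (intro mult_left_mono)
  have "(\<Sum>i\<le>N. t ^ i) = (1 - t ^ Suc N) / (1 - t)"
   using t by (simp add: sum_gp0)
  also have "\<dots> \<le> 1 / (1 - t)"
   using t by (intro divide_right_mono) auto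
  finally show "(\<Sum>i\<le>N. t ^ i) \<le> 1 / (1 - t)" .
  show "0 \<le> M"
   using k \<alpha> t by (simp add: \<beta>_def)
 qed
 finally have "(\<Sum>i\<le>N. \<alpha> i) powr p \<le> (M * (1 / (1 - t))) powr p"
  using p \<alpha> by (intro powr_mono2 sum_nonneg) auto
 also have "\<dots> = (1 / (1 - t)) powr p * M powr p"
  using t k \<alpha>[of k] by (subst powr_mult) (auto simp: \<beta>_def)
 also have "M powr p = \<alpha> k powr p * s ^ (N - k)"
 proof -
  have "t ^ (N - k) = s powr (- (N - k) / p)"
   using s t by (simp add: t_def powr_powr flip: powr_realpow)
  then have "(t ^ (N - k)) powr p = s powr (- (N - k))"
   using p by (simp add: powr_powr)
  then have "(t ^ (N - k)) powr p = 1 / s ^ (N - k)"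
   using s by (simp add: powr_minus powr_realpow divide_inverse)
  then show ?thesis
   using k(2) t \<alpha>[of k] by (simp add: \<beta>_def powr_divide)
 qed
 also have "(1 / (1 - t)) powr p * \<dots> \<le> (1 / (1 - t)) powr p * (\<Sum>i\<le>N. \<alpha> i powr p * s ^ (N - i))"
  using k(1) s by (intro mult_left_mono member_le_sum) auto
 finally show ?thesis
  by (simp add: t_def)
qed

text \<open>Weighting a chain by s^(N-i) costs a power of s for each generation below i that the
  chain still visits. The points with d further generations below a cell q' have measure at most
  \<theta>^d M(X q'), and s \<theta> < 1 makes the loss summable.\<close>

proposition tree_sum_bound:
 fixes X :: "'q \<Rightarrow> 'a set" and a :: "'q \<Rightarrow> real"
 assumes cnt: "\<And>q. countable (ch q)" and sets: "\<And>q. X q \<in> sets M"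
  and sub: "\<And>q q'. q' \<in> ch q \<Longrightarrow> X q' \<subseteq> X q" and disj: "\<And>q. disjoint_family_on X (ch q)"
  and \<theta>: "\<And>q. emeasure M (\<Union>q'\<in>ch q. X q') \<le> ennreal \<theta> * emeasure M (X q)" "0 < \<theta>" "\<theta> < 1"
  and a: "\<And>q. 0 \<le> a q" and p: "0 < p" and G: "\<And>x. 0 \<le> G x"
  and dom: "AE x in M. x \<in> X q \<longrightarrow> (\<exists>N qs. (\<forall>i\<le>N. qs i \<in> generation ch q i \<and> x \<in> X (qs i)) \<and> G x \<le> (\<Sum>i\<le>N. a (qs i)))"
 shows "(\<integral>\<^sup>+x. ennreal (G x powr p) * indicator (X q) x \<partial>M) \<le>
   ennreal ((1 / (1 - ((1 + 1 / \<theta>) / 2) powr (- 1 / p))) powr p * (2 / (1 - \<theta>))) *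
   (\<Sum>i. (\<integral>\<^sup>+q'. ennreal (a q' powr p) * emeasure M (X q') \<partial>count_space (generation ch q i)))"
proof -
 \<comment> \<open>The midpoint of 1 and 1/\<theta>: it exceeds 1, as geometric weights require,
   while s \<theta> = (1 + \<theta>)/2 stays below 1.\<close>
 define s where "s = (1 + 1 / \<theta>) / 2"
 have s: "1 < s" "s * \<theta> = (1 + \<theta>) / 2"
  using \<theta>(2,3) by (auto simp: s_def field_simps)
 define Y where "Y i = (\<Union>b\<in>generation ch q i. X b)" for i
 have Y: "Y i \<in> sets M" for i
  unfolding Y_def by (intro sets_UN_generation cnt sets)
 define b where "b i x = (\<integral>\<^sup>+q'. ennreal (a q' powr p) * indicator (X q') x \<partial>count_space (generation ch q i))" for i x
 define C where "C = (1 / (1 - s powr (- 1 / p))) powr p"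
 have cg: "countable (generation ch q i)" for i
  by (intro countable_generation cnt)
 note [measurable] = sets Y
 have bm [measurable]: "b i \<in> borel_measurable M" for i
  unfolding b_def by (rule borel_measurable_nn_integral_count_space[OF cg]) measurable
 have "AE x in M. ennreal (G x powr p) * indicator (X q) x \<le> ennreal C * (\<Sum>i. \<Sum>d. ennreal (s ^ d) * (b i x * indicator (Y (i + d)) x))"
  using dom
 proof eventually_elim
  case (elim x)
  show ?case
  proof (cases "x \<in> X q")
   case True
   with elim obtain N qs where qs: "\<And>i. i \<le> N \<Longrightarrow> qs i \<in> generation ch q i \<and> x \<in> X (qs i)" and le: "G x \<le> (\<Sum>i\<le>N. a (qs i))"
    by blast
   have "G x powr p \<le> (\<Sum>i\<le>N. a (qs i)) powr p"
    using le G p by (intro powr_mono2) auto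
   also have "\<dots> \<le> C * (\<Sum>i\<le>N. a (qs i) powr p * s ^ (N - i))"
    unfolding C_def using chain_sum_powr_le[of "\<lambda>i. a (qs i)" p s N] a p s(1) by simp
   finally have "ennreal (G x powr p) \<le> ennreal (C * (\<Sum>i\<le>N. a (qs i) powr p * s ^ (N - i)))"
    by (rule ennreal_leI)
   also have "\<dots> = ennreal C * (\<Sum>i\<le>N. ennreal (a (qs i) powr p) * ennreal (s ^ (N - i)))"
   proof -
    have "ennreal (\<Sum>i\<le>N. a (qs i) powr p * s ^ (N - i)) = (\<Sum>i\<le>N. ennreal (a (qs i) powr p * s ^ (N - i)))"
     using s(1) by (intro sum_ennreal[symmetric]) auto
    also have "\<dots> = (\<Sum>i\<le>N. ennreal (a (qs i) powr p) * ennreal (s ^ (N - i)))"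
     using s(1) by (intro sum.cong refl ennreal_mult) auto
    finally have "ennreal (\<Sum>i\<le>N. a (qs i) powr p * s ^ (N - i)) = (\<Sum>i\<le>N. ennreal (a (qs i) powr p) * ennreal (s ^ (N - i)))" .
    moreover have "0 \<le> C"
     by (simp add: C_def)
    ultimately show ?thesis
     by (simp only: ennreal_mult')
   qed
   also have "\<dots> \<le> ennreal C * (\<Sum>i\<le>N. \<Sum>d. ennreal (s ^ d) * (b i x * indicator (Y (i + d)) x))"
   proof (intro mult_left_mono sum_mono)
    fix i assume "i \<in> {..N}"
    then have i: "i \<le> N" by simp
    \<comment> \<open>The length N of the chain depends on the point. It enters only through
      membership in generation N, so the sum over all d covers every possible length.\<close>
    have "x \<in> Y (i + (N - i))"
     using qs[of N] i by (auto simp: Y_def)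
    moreover have "ennreal (a (qs i) powr p) \<le> b i x"
     unfolding b_def using nn_integral_ge_point[of "qs i" "generation ch q i" "\<lambda>q'. ennreal (a q' powr p) * indicator (X q') x"] qs[OF i] by simp
    ultimately have "ennreal (a (qs i) powr p) * ennreal (s ^ (N - i)) \<le> ennreal (s ^ (N - i)) * (b i x * indicator (Y (i + (N - i))) x)"
     using mult_left_mono[of "ennreal (a (qs i) powr p)" "b i x" "ennreal (s ^ (N - i))"] by (simp add: mult.commute)
    also have "\<dots> \<le> (\<Sum>d. ennreal (s ^ d) * (b i x * indicator (Y (i + d)) x))"
     using sum_le_suminf[of "\<lambda>d. ennreal (s ^ d) * (b i x * indicator (Y (i + d)) x)" "{N - i}"] by simp
    finally show "ennreal (a (qs i) powr p) * ennreal (s ^ (N - i)) \<le> (\<Sum>d. ennreal (s ^ d) * (b i x * indicator (Y (i + d)) x))" .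
   qed simp
   also have "\<dots> \<le> ennreal C * (\<Sum>i. \<Sum>d. ennreal (s ^ d) * (b i x * indicator (Y (i + d)) x))"
    by (intro mult_left_mono sum_le_suminf) auto
   finally show ?thesis
    using True by simp
  qed simp
 qed
 then have "(\<integral>\<^sup>+x. ennreal (G x powr p) * indicator (X q) x \<partial>M) \<le> (\<integral>\<^sup>+x. ennreal C * (\<Sum>i. \<Sum>d. ennreal (s ^ d) * (b i x * indicator (Y (i + d)) x)) \<partial>M)"
  by (rule nn_integral_mono_AE)
 also have "\<dots> = ennreal C * (\<Sum>i. \<Sum>d. ennreal (s ^ d) * (\<integral>\<^sup>+x. b i x * indicator (Y (i + d)) x \<partial>M))"
  by (simp add: nn_integral_cmult nn_integral_suminf)
 also have "\<dots> \<le> ennreal C * (\<Sum>i. \<Sum>d. ennreal (s ^ d) * (ennreal (\<theta> ^ d) * (\<integral>\<^sup>+q'. ennreal (a q' powr p) * emeasure M (X q') \<partial>count_space (generation ch q i))))"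
 proof (intro mult_left_mono suminf_le)
  fix i d
  have "(\<integral>\<^sup>+x. b i x * indicator (Y (i + d)) x \<partial>M) = (\<integral>\<^sup>+x. (\<integral>\<^sup>+q'. ennreal (a q' powr p) * indicator (X q' \<inter> Y (i + d)) x \<partial>count_space (generation ch q i)) \<partial>M)"
   unfolding b_def by (intro nn_integral_cong, subst nn_integral_multc[symmetric]) (auto simp: indicator_inter_arith mult.assoc)
  also have "\<dots> = (\<integral>\<^sup>+q'. (\<integral>\<^sup>+x. ennreal (a q' powr p) * indicator (X q' \<inter> Y (i + d)) x \<partial>M) \<partial>count_space (generation ch q i))"
   by (rule nn_integral_count_space_nn_integral[OF cg]) measurable
  also have "\<dots> = (\<integral>\<^sup>+q'. ennreal (a q' powr p) * emeasure M (X q' \<inter> Y (i + d)) \<partial>count_space (generation ch q i))"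
   by (intro nn_integral_cong nn_integral_cmult_indicator) measurable
  also have "\<dots> \<le> (\<integral>\<^sup>+q'. ennreal (\<theta> ^ d) * (ennreal (a q' powr p) * emeasure M (X q')) \<partial>count_space (generation ch q i))"
  proof (intro nn_integral_mono)
   fix q' assume "q' \<in> space (count_space (generation ch q i))"
   then have q': "q' \<in> generation ch q i" by simp
   have "emeasure M (X q' \<inter> Y (i + d)) \<le> emeasure M (\<Union>c\<in>generation ch q' d. X c)"
    unfolding Y_def using generation_inter[of ch X q' q i d] sub disj q'
    by (intro emeasure_mono sets_UN_generation cnt sets) auto
   also have "\<dots> \<le> ennreal \<theta> ^ d * emeasure M (X q')"
    by (rule emeasure_generation_le[OF cnt sets disj \<theta>(1)])
   finally have "ennreal (a q' powr p) * emeasure M (X q' \<inter> Y (i + d)) \<le> ennreal (a q' powr p) * (ennreal \<theta> ^ d * emeasure M (X q'))"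
    by (rule mult_left_mono) simp
   then show "ennreal (a q' powr p) * emeasure M (X q' \<inter> Y (i + d)) \<le> ennreal (\<theta> ^ d) * (ennreal (a q' powr p) * emeasure M (X q'))"
    using \<theta>(2) by (simp add: ennreal_power ac_simps)
  qed
  also have "\<dots> = ennreal (\<theta> ^ d) * (\<integral>\<^sup>+q'. ennreal (a q' powr p) * emeasure M (X q') \<partial>count_space (generation ch q i))"
   by (rule nn_integral_cmult) simp
  finally show "(\<integral>\<^sup>+x. b i x * indicator (Y (i + d)) x \<partial>M) \<le>
    ennreal (\<theta> ^ d) * (\<integral>\<^sup>+q'. ennreal (a q' powr p) * emeasure M (X q') \<partial>count_space (generation ch q i))" .
 qed auto
 also have "\<dots> = ennreal C * (\<Sum>i. ennreal (2 / (1 - \<theta>)) * (\<integral>\<^sup>+q'. ennreal (a q' powr p) * emeasure M (X q') \<partial>count_space (generation ch q i)))"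
 proof -
  have "(\<Sum>d. ennreal (s ^ d) * ennreal (\<theta> ^ d)) = ennreal (2 / (1 - \<theta>))"
  proof -
   have eq: "ennreal (s ^ d) * ennreal (\<theta> ^ d) = ennreal (((1 + \<theta>) / 2) ^ d)" for d
    unfolding s(2)[symmetric] power_mult_distrib using s(1) \<theta>(2) by (simp add: ennreal_mult)
   show ?thesis
    unfolding eq
   proof (rule suminf_ennreal_eq)
    have "(\<lambda>d. ((1 + \<theta>) / 2) ^ d) sums (1 / (1 - (1 + \<theta>) / 2))"
     using \<theta> by (intro geometric_sums) auto
    also have "1 / (1 - (1 + \<theta>) / 2) = 2 / (1 - \<theta>)"
     using \<theta> by (simp add: field_simps)
    finally show "(\<lambda>d. ((1 + \<theta>) / 2) ^ d) sums (2 / (1 - \<theta>))" .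
   qed (use \<theta> in simp)
  qed
  then have "(\<Sum>d. ennreal (s ^ d) * (ennreal (\<theta> ^ d) * z)) = ennreal (2 / (1 - \<theta>)) * z" for z
   by (simp add: mult.assoc[symmetric] ennreal_suminf_multc)
  then show ?thesis by simp
 qed
 also have "\<dots> = ennreal C * ennreal (2 / (1 - \<theta>)) * (\<Sum>i. (\<integral>\<^sup>+q'. ennreal (a q' powr p) * emeasure M (X q') \<partial>count_space (generation ch q i)))"
  by (simp add: mult.assoc)
 also have "ennreal C * ennreal (2 / (1 - \<theta>)) = ennreal (C * (2 / (1 - \<theta>)))"
  using \<theta>(2,3) by (intro ennreal_mult[symmetric]) (auto simp: C_def)
 finally show ?thesis
  unfolding C_def s_def .
qed

text \<open>Induction on the number of generations that can still contain x: each step either stops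
  with a q or passes to the child through x and prepends q to its chain.\<close>

lemma tree_chain_domination:
 fixes F :: "'q \<Rightarrow> 'a \<Rightarrow> real"
 assumes step: "\<And>q. x \<in> X q \<Longrightarrow> (\<forall>q'\<in>ch q. x \<notin> X q') \<Longrightarrow> F q x \<le> a q"
   "\<And>q q'. x \<in> X q \<Longrightarrow> q' \<in> ch q \<Longrightarrow> x \<in> X q' \<Longrightarrow> F q x \<le> a q + F q' x"
  and x: "x \<in> X q" "x \<notin> (\<Union>b\<in>generation ch q (Suc d). X b)"
 shows "\<exists>N qs. (\<forall>i\<le>N. qs i \<in> generation ch q i \<and> x \<in> X (qs i)) \<and> F q x \<le> (\<Sum>i\<le>N. a (qs i))"
 using x
proof (induction d arbitrary: q)
 case 0
 then have "F q x \<le> a q"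
  by (intro step(1)) auto
 then show ?case
  using 0 by (intro exI[of _ 0] exI[of _ "\<lambda>_. q"]) auto
next
 case (Suc d)
 show ?case
 proof (cases "\<forall>q'\<in>ch q. x \<notin> X q'")
  case True
  then have "F q x \<le> a q"
   using Suc.prems by (intro step(1)) auto
  then show ?thesis
   using Suc.prems by (intro exI[of _ 0] exI[of _ "\<lambda>_. q"]) auto
 next
  case False
  then obtain q' where q': "q' \<in> ch q" "x \<in> X q'" by blast
  have "x \<notin> (\<Union>b\<in>generation ch q' (Suc d). X b)"
   using Suc.prems(2) q'(1) unfolding generation_Suc'[of ch q "Suc d"] by blast
  from Suc.IH[OF q'(2) this] obtain N qs where qs: "\<forall>i\<le>N. qs i \<in> generation ch q' i \<and> x \<in> X (qs i)" "F q' x \<le> (\<Sum>i\<le>N. a (qs i))"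
   by blast
  show ?thesis
  proof (intro exI[of _ "Suc N"] exI[of _ "case_nat q qs"] conjI allI impI)
   fix i assume i: "i \<le> Suc N"
   show "case_nat q qs i \<in> generation ch q i"
   proof (cases i)
    case (Suc j)
    then show ?thesis
     using qs(1) i q'(1) unfolding Suc generation_Suc' by auto
   qed simp
   show "x \<in> X (case_nat q qs i)"
    using qs(1) i Suc.prems(1) by (cases i) auto
  next
   have "F q x \<le> a q + F q' x"
    using step(2) Suc.prems(1) q' by blast
   also have "\<dots> \<le> a q + (\<Sum>i\<le>N. a (qs i))"
    using qs(2) by simp
   also have "\<dots> = (\<Sum>i\<le>Suc N. a (case_nat q qs i))"
    by (simp add: sum.atMost_Suc_shift del: sum.atMost_Suc)
   finally show "F q x \<le> (\<Sum>i\<le>Suc N. a (case_nat q qs i))" .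
  qed
 qed
qed

section \<open>Oscillation of weak extensions where an input vanishes\<close>

lemma weak_extension_eq_kernel_integral:
 fixes K :: "real^'n::finite \<Rightarrow> ('m::finite \<Rightarrow> real^'n) \<Rightarrow> complex" and \<phi> :: "'m \<Rightarrow> real^'n \<Rightarrow> complex"
 assumes K: "has_kernel T K" and U: "weak_extension T qs q U"
  and \<phi>: "\<And>k. \<phi> k \<in> test_functions UNIV" and k0: "\<And>y. y \<in> ball c \<rho> \<Longrightarrow> \<phi> k0 y = 0"
 shows "AE x in lebesgue. x \<in> ball c \<rho> \<longrightarrow> U \<phi> x - kernel_integral K \<phi> x = 0"
proof (rule AE_eq_0_of_bumps[OF open_ball])
 have s: "\<forall>j. \<phi> j \<in> schwartz"
  using test_functions_schwartz[OF \<phi>] by simp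
 fix a b :: "real^'n" and \<epsilon> :: real assume e: "0 < \<epsilon>" and ab: "cbox a b \<subseteq> ball c \<rho>"
 define \<psi> where "\<psi> = (\<lambda>x. complex_of_real (box_bump \<epsilon> a b x))"
 have \<psi>: "\<psi> \<in> schwartz"
  using box_bump_schwartz[OF e, of a b] by (simp add: \<psi>_def)
 have "supp \<psi> \<subseteq> cbox a b"
  unfolding supp_def
 proof (rule closure_minimal)
  show "{x. \<psi> x \<noteq> 0} \<subseteq> cbox a b"
   using box_bump_eq_0[of _ a b \<epsilon>] box_subset_cbox[of a b] unfolding \<psi>_def by fastforce
 qed (rule closed_cbox)
 moreover have "supp (\<phi> k0) \<subseteq> - ball c \<rho>"
  unfolding supp_def using k0 by (intro closure_minimal) auto
 ultimately have disj: "supp \<psi> \<inter> (\<Inter>j. supp (\<phi> j)) = {}"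
  using ab by blast
 have "compact (supp \<psi>)"
  using \<open>supp \<psi> \<subseteq> cbox a b\<close> bounded_subset[OF bounded_cbox] by (auto simp: compact_eq_bounded_closed supp_def)
 then have k: "integrable lebesgue (\<lambda>x. kernel_integral K \<phi> x * \<psi> x)" "T \<phi> \<psi> = (LINT x|lebesgue. kernel_integral K \<phi> x * \<psi> x)"
  using K s \<psi> disj unfolding has_kernel_def by simp_all
 note u = weak_extension_schwartz[OF U s \<psi>]
 have "integrable lebesgue (\<lambda>x. (U \<phi> x - kernel_integral K \<phi> x) * \<psi> x)"
  unfolding left_diff_distrib by (intro Bochner_Integration.integrable_diff u k)
 then show "integrable lebesgue (\<lambda>x. (U \<phi> x - kernel_integral K \<phi> x) * complex_of_real (box_bump \<epsilon> a b x))"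
  by (simp add: \<psi>_def)
 have "(LINT x|lebesgue. (U \<phi> x - kernel_integral K \<phi> x) * \<psi> x) = 0"
  unfolding left_diff_distrib Bochner_Integration.integral_diff[OF u(1) k(1)] u(2)[symmetric] k(2)[symmetric] by simp
 then show "(LINT x|lebesgue. (U \<phi> x - kernel_integral K \<phi> x) * complex_of_real (box_bump \<epsilon> a b x)) = 0"
  by (simp add: \<psi>_def)
qed

lemma set_nn_integral_ldist_le:
 assumes p: "1 \<le> p" and [measurable]: "f \<in> borel_measurable lebesgue" "g \<in> borel_measurable lebesgue" "B \<in> sets lebesgue"
 shows "(\<integral>\<^sup>+x. ennreal (norm (g x) powr p) * indicator B x \<partial>lebesgue) \<le>
   ennreal (2 powr p) * ((\<integral>\<^sup>+x. ennreal (norm (f x) powr p) * indicator B x \<partial>lebesgue) + ldist p f g)"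
proof -
 have "(\<integral>\<^sup>+x. ennreal (norm (g x) powr p) * indicator B x \<partial>lebesgue) \<le>
  (\<integral>\<^sup>+x. ennreal (2 powr p) * (ennreal (norm (f x) powr p) * indicator B x + ennreal (modulus p (f x - g x))) \<partial>lebesgue)"
 proof (intro nn_integral_mono)
  fix x
  have "norm (g x) \<le> norm (f x) + norm (f x - g x)"
   using norm_triangle_ineq4[of "f x" "f x - g x"] by simp
  then have "norm (g x) powr p \<le> (norm (f x) + norm (f x - g x)) powr p"
   using p by (intro powr_mono2) auto
  also have "\<dots> \<le> 2 powr p * (norm (f x) powr p + norm (f x - g x) powr p)"
   using p by (intro powr_add_le) auto
  also have "\<dots> \<le> 2 powr p * (norm (f x) powr p + modulus p (f x - g x))"
   by (intro mult_left_mono add_left_mono) (auto simp: modulus_def)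
  finally have "ennreal (norm (g x) powr p) \<le> ennreal (2 powr p * (norm (f x) powr p + modulus p (f x - g x)))"
   by (rule ennreal_leI)
  also have "\<dots> = ennreal (2 powr p) * (ennreal (norm (f x) powr p) + ennreal (modulus p (f x - g x)))"
   by (simp add: ennreal_mult)
  finally show "ennreal (norm (g x) powr p) * indicator B x \<le> ennreal (2 powr p) * (ennreal (norm (f x) powr p) * indicator B x + ennreal (modulus p (f x - g x)))"
   by (cases "x \<in> B") auto
 qed
 also have "\<dots> = ennreal (2 powr p) * ((\<integral>\<^sup>+x. ennreal (norm (f x) powr p) * indicator B x \<partial>lebesgue) + ldist p f g)"
  unfolding ldist_def by (subst nn_integral_cmult, measurable, subst nn_integral_add) auto
 finally show ?thesis .
qed

text \<open>Density and a.e. convergence transfer the estimate for kernel integrals of test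
  functions. The null set collects the points without convergence and those where some approximant
  differs from its kernel integral.\<close>

proposition weak_extension_oscillation:
 fixes K :: "real^'n::finite \<Rightarrow> ('m::finite \<Rightarrow> real^'n) \<Rightarrow> complex" and f :: "'m \<Rightarrow> real^'n \<Rightarrow> complex"
 assumes p0: "1 \<le> p0" and K: "has_kernel T K" and reg: "kernel_regularity p0 \<delta> C K" and C: "0 < C"
  and \<delta>: "real CARD('n) / p0 < \<delta>" and \<rho>: "0 < \<rho>" and U: "weak_extension T (\<lambda>_. p0) q U" and q: "0 < q"
  and f: "\<And>k. f k \<in> bounded_compact_support" and k0: "\<And>y. y \<in> cball c \<rho> \<Longrightarrow> f k0 y = 0"
  and A: "\<And>k. 0 < A k" "\<And>k R. \<rho> \<le> R \<Longrightarrow> (\<integral>\<^sup>+x. ennreal (norm (f k x) powr p0) * indicator (ball c R) x \<partial>lebesgue) \<le> ennreal (A k * measure lebesgue (ball c R))"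
 shows "\<exists>N\<in>null_sets lebesgue. \<forall>x\<in>ball c (\<rho> / 2) - N. \<forall>x'\<in>ball c (\<rho> / 2) - N.
  norm (U f x - U f x') \<le> oscillation_const CARD('m) CARD('n) p0 \<delta> C * (\<Prod>k\<in>UNIV. (2 powr (p0 + 1) * A k) powr (1 / p0))"
proof -
 \<comment> \<open>Only the input that vanishes on the ball is constrained. The complement of the
   closed ball is open, so the approximants can be made to vanish on the ball as well.\<close>
 define W where "W k = (if k = k0 then - cball c \<rho> else UNIV)" for k
 have W: "open (W k)" "y \<notin> W k \<Longrightarrow> f k y = 0" for k y
  using k0 by (auto simp: W_def split: if_splits)
 obtain \<phi> where \<phi>: "\<And>i k. \<phi> i k \<in> test_functions (W k)" "\<And>i k. ldist p0 (f k) (\<phi> i k) \<le> ennreal ((1/2) ^ i)"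
   "AE x in lebesgue. (\<lambda>i. U (\<phi> i) x) \<longlonglongrightarrow> U f x"
 proof (rule weak_extension_approx[where f = f and W = W, OF U p0 order_refl q U p0 order_refl q f W])
  fix \<phi> :: "nat \<Rightarrow> 'm \<Rightarrow> real^'n \<Rightarrow> complex"
  assume "\<And>i k. \<phi> i k \<in> test_functions (W k)" "\<And>i k. ldist p0 (f k) (\<phi> i k) \<le> ennreal ((1/2) ^ i)"
   "AE x in lebesgue. (\<lambda>i. U (\<phi> i) x) \<longlonglongrightarrow> U f x"
  then show ?thesis
   by (rule that)
 qed
 have \<phi>U: "\<phi> i k \<in> test_functions UNIV" for i k
  using \<phi>(1)[of i k] by (simp add: test_functions_def)
 have \<phi>0: "\<phi> i k0 y = 0" if "y \<in> ball c \<rho>" for i y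
  using \<phi>(1)[of i k0] that by (simp add: test_functions_def W_def)
 \<comment> \<open>The approximation error has to stay below A k times the measure of every ball of
   radius at least \<rho>. The smallest of these bounds, over the finitely many k, occurs at radius
   \<rho>.\<close>
 define \<eta> where "\<eta> = Min (range (\<lambda>k. A k * measure lebesgue (ball c \<rho>)))"
 have mpos: "0 < measure lebesgue (ball c \<rho>)"
  using \<rho> by (simp add: measure_ball_vec)
 have "0 < \<eta>"
  unfolding \<eta>_def using A(1) mpos by (subst Min_gr_iff) auto
 have \<eta>le: "\<eta> \<le> A k * measure lebesgue (ball c \<rho>)" for k
  unfolding \<eta>_def by (intro Min_le) auto
 obtain I where I: "(1/2::real) ^ I < \<eta>"
  using real_arch_pow_inv[OF \<open>0 < \<eta>\<close>, of "1/2"] by auto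
 have small: "ldist p0 (f k) (\<phi> i k) \<le> ennreal (A k * measure lebesgue (ball c R))" if "I \<le> i" "\<rho> \<le> R" for i k R
 proof -
  have "(1/2::real) ^ i \<le> (1/2) ^ I"
   using that by (intro power_decreasing) auto
  also have "\<dots> \<le> A k * measure lebesgue (ball c \<rho>)"
   using I \<eta>le[of k] by linarith
  also have "\<dots> \<le> A k * measure lebesgue (ball c R)"
  proof (rule mult_left_mono)
   show "measure lebesgue (ball c \<rho>) \<le> measure lebesgue (ball c R)"
    using that(2) \<rho> by (subst (1 2) measure_ball_vec) (auto intro!: mult_left_mono power_mono)
  qed (use A(1)[of k] in simp)
  finally show ?thesis
   using \<phi>(2)[of k i] ennreal_leI order_trans by blast
 qed
 \<comment> \<open>2^p0 from the quasi-triangle inequality, and a further 2 because the error is as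
   large as the bound for f itself.\<close>
 define A' where "A' k = 2 powr (p0 + 1) * A k" for k
 have A': "0 \<le> A' k" for k
  using A(1)[of k] by (simp add: A'_def)
 have \<phi>A: "(\<integral>\<^sup>+x. ennreal (norm (\<phi> i k x) powr p0) * indicator (ball c R) x \<partial>lebesgue) \<le> ennreal (A' k * measure lebesgue (ball c R))"
  if "I \<le> i" "\<rho> \<le> R" for i k R
 proof -
  have m: "0 \<le> A k * measure lebesgue (ball c R)"
   using A(1)[of k] by simp
  have "(\<integral>\<^sup>+x. ennreal (norm (\<phi> i k x) powr p0) * indicator (ball c R) x \<partial>lebesgue) \<le>
    ennreal (2 powr p0) * ((\<integral>\<^sup>+x. ennreal (norm (f k x) powr p0) * indicator (ball c R) x \<partial>lebesgue) + ldist p0 (f k) (\<phi> i k))"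
  proof (rule set_nn_integral_ldist_le[OF p0])
   show "f k \<in> borel_measurable lebesgue"
    using f[of k] by (simp add: bounded_compact_support_def)
   show "\<phi> i k \<in> borel_measurable lebesgue"
    by (rule test_functions_measurable_lebesgue[OF \<phi>(1)])
  qed simp
  also have "\<dots> \<le> ennreal (2 powr p0) * (ennreal (A k * measure lebesgue (ball c R)) + ennreal (A k * measure lebesgue (ball c R)))"
   using A(2)[OF that(2), of k] small[OF that, of k] by (intro mult_left_mono add_mono) auto
  also have "\<dots> = ennreal (2 powr p0 * (A k * measure lebesgue (ball c R) + A k * measure lebesgue (ball c R)))"
   unfolding ennreal_plus[OF m m, symmetric] using m by (intro ennreal_mult[symmetric]) auto
  also have "2 powr p0 * (A k * measure lebesgue (ball c R) + A k * measure lebesgue (ball c R)) = A' k * measure lebesgue (ball c R)"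
   unfolding A'_def by (simp add: powr_add)
  finally show ?thesis .
 qed
 define c0 where "c0 = oscillation_const CARD('m) CARD('n) p0 \<delta> C * (\<Prod>k\<in>UNIV. A' k powr (1 / p0))"
 have "AE x in lebesgue. x \<in> ball c \<rho> \<longrightarrow> U (\<phi> i) x - kernel_integral K (\<phi> i) x = 0" for i
  by (rule weak_extension_eq_kernel_integral[where \<phi> = "\<phi> i", OF K U \<phi>U \<phi>0])
 then have "AE x in lebesgue. \<forall>i. x \<in> ball c \<rho> \<longrightarrow> U (\<phi> i) x - kernel_integral K (\<phi> i) x = 0"
  unfolding AE_all_countable by (rule allI)
 with \<phi>(3) have "AE x in lebesgue. (\<lambda>i. U (\<phi> i) x) \<longlonglongrightarrow> U f x \<and> (x \<in> ball c \<rho> \<longrightarrow> (\<forall>i. U (\<phi> i) x = kernel_integral K (\<phi> i) x))"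
  by eventually_elim simp
 then obtain N where N: "N \<in> null_sets lebesgue" "{x \<in> space lebesgue. \<not> ((\<lambda>i. U (\<phi> i) x) \<longlonglongrightarrow> U f x \<and> (x \<in> ball c \<rho> \<longrightarrow> (\<forall>i. U (\<phi> i) x = kernel_integral K (\<phi> i) x)))} \<subseteq> N"
  unfolding eventually_ae_filter by blast
 have good: "(\<lambda>i. U (\<phi> i) x) \<longlonglongrightarrow> U f x" "\<And>i. U (\<phi> i) x = kernel_integral K (\<phi> i) x" if "x \<in> ball c (\<rho> / 2) - N" for x
 proof -
  have "x \<in> ball c \<rho>"
   using that \<rho> by auto
  moreover have "(\<lambda>i. U (\<phi> i) x) \<longlonglongrightarrow> U f x \<and> (x \<in> ball c \<rho> \<longrightarrow> (\<forall>i. U (\<phi> i) x = kernel_integral K (\<phi> i) x))"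
   using subsetD[OF N(2), of x] that by simp blast
  ultimately show "(\<lambda>i. U (\<phi> i) x) \<longlonglongrightarrow> U f x" "\<And>i. U (\<phi> i) x = kernel_integral K (\<phi> i) x"
   by blast+
 qed
 show ?thesis
 proof (intro bexI[OF _ N(1)] ballI)
  fix x x' assume x: "x \<in> ball c (\<rho> / 2) - N" and x': "x' \<in> ball c (\<rho> / 2) - N"
  have lim: "(\<lambda>i. norm (U (\<phi> i) x - U (\<phi> i) x')) \<longlonglongrightarrow> norm (U f x - U f x')"
   by (intro tendsto_norm tendsto_diff good(1) x x')
  have le: "norm (U (\<phi> i) x - U (\<phi> i) x') \<le> c0" if "I \<le> i" for i
   unfolding good(2)[OF x] good(2)[OF x'] c0_def
  proof (rule kernel_integral_oscillation[where \<phi> = "\<phi> i" and A = A', OF p0 K reg C \<delta> \<rho> \<phi>U \<phi>0 A'])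
   show "(\<integral>\<^sup>+x. ennreal (norm (\<phi> i k x) powr p0) * indicator (ball c R) x \<partial>lebesgue) \<le> ennreal (A' k * measure lebesgue (ball c R))" if "\<rho> \<le> R" for k R
    by (rule \<phi>A[OF \<open>I \<le> i\<close> that])
  qed (use x x' in auto)
  have "norm (U f x - U f x') \<le> c0"
   by (rule LIMSEQ_le_const2[OF lim]) (use le in blast)
  then show "norm (U f x - U f x') \<le> oscillation_const CARD('m) CARD('n) p0 \<delta> C * (\<Prod>k\<in>UNIV. (2 powr (p0 + 1) * A k) powr (1 / p0))"
   by (simp add: c0_def A'_def)
 qed
qed

text \<open>The inputs are truncated one at a time, each step being an instance of the previous estimate.\<close>

proposition truncation_oscillation:
 fixes K :: "real^'n::finite \<Rightarrow> ('m::finite \<Rightarrow> real^'n) \<Rightarrow> complex" and f :: "'m \<Rightarrow> real^'n \<Rightarrow> complex"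
 assumes p0: "1 \<le> p0" and K: "has_kernel T K" and reg: "kernel_regularity p0 \<delta> C K" and C: "0 < C"
  and \<delta>: "real CARD('n) / p0 < \<delta>" and \<rho>: "0 < \<rho>" and U: "weak_extension T (\<lambda>_. p0) q U" and q: "0 < q"
  and f: "\<And>k. f k \<in> bounded_compact_support"
  and A: "\<And>k. 0 < A k" "\<And>k R. \<rho> \<le> R \<Longrightarrow> (\<integral>\<^sup>+x. ennreal (norm (f k x) powr p0) * indicator (ball c R) x \<partial>lebesgue) \<le> ennreal (A k * measure lebesgue (ball c R))"
 shows "\<exists>N\<in>null_sets lebesgue. \<forall>x\<in>ball c (\<rho> / 2) - N. \<forall>x'\<in>ball c (\<rho> / 2) - N.
  norm ((U f x - U (\<lambda>k y. f k y * indicator (cball c \<rho>) y) x) - (U f x' - U (\<lambda>k y. f k y * indicator (cball c \<rho>) y) x'))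
  \<le> real CARD('m) * (oscillation_const CARD('m) CARD('n) p0 \<delta> C * (\<Prod>k\<in>UNIV. (2 powr (p0 + 1) * A k) powr (1 / p0)))"
proof -
 define c0 where "c0 = oscillation_const CARD('m) CARD('n) p0 \<delta> C * (\<Prod>k\<in>UNIV. (2 powr (p0 + 1) * A k) powr (1 / p0))"
 define g where "g k = (\<lambda>y. f k y * indicator (cball c \<rho>) y)" for k
 define mix where "mix S = (\<lambda>k. if k \<in> S then g k else f k)" for S
 have fm: "f k \<in> borel_measurable lebesgue" for k
  using f[of k] by (simp add: bounded_compact_support_def)
 have gm: "g k \<in> borel_measurable lebesgue" for k
  unfolding g_def by (intro borel_measurable_times fm borel_measurable_indicator) simp
 have gle: "norm (g k y) \<le> norm (f k y)" for k y
  by (simp add: g_def indicator_def)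
 have g: "g k \<in> bounded_compact_support" for k
  by (rule bounded_compact_support_le[OF f gm gle])
 have mixb: "mix S k \<in> bounded_compact_support" for S k
  using f g by (simp add: mix_def)
 have mixle: "norm (mix S k y) \<le> norm (f k y)" for S k y
  using gle by (simp add: mix_def)
 have main: "\<exists>N\<in>null_sets lebesgue. \<forall>x\<in>ball c (\<rho> / 2) - N. \<forall>x'\<in>ball c (\<rho> / 2) - N.
  norm ((U f x - U (mix S) x) - (U f x' - U (mix S) x')) \<le> real (card S) * c0" if "finite S" for S
  using that
 proof (induction S rule: finite_induct)
  case empty
  show ?case
   by (intro bexI[of _ "{}"]) (simp_all add: mix_def)
 next
  case (insert k0 S)
  \<comment> \<open>The tuple in which the entries in S are already truncated and entry k0 is the
    part of f outside the ball. Entry k0 vanishes on the ball, as the oscillation estimate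
    asks.\<close>
  define h where "h = (mix S)(k0 := \<lambda>y. f k0 y - g k0 y)"
  have dm: "(\<lambda>y. f k0 y - g k0 y) \<in> borel_measurable lebesgue"
   by (intro borel_measurable_diff fm gm)
  have dle: "norm (f k0 y - g k0 y) \<le> norm (f k0 y)" for y
   by (simp add: g_def indicator_def)
  have hle: "norm (h k y) \<le> norm (f k y)" for k y
   using mixle dle by (simp add: h_def)
  have hb: "h k \<in> bounded_compact_support" for k
   using mixb bounded_compact_support_le[OF f dm dle] by (simp add: h_def)
  have "\<exists>N\<in>null_sets lebesgue. \<forall>x\<in>ball c (\<rho> / 2) - N. \<forall>x'\<in>ball c (\<rho> / 2) - N. norm (U h x - U h x') \<le> c0"
   unfolding c0_def
  proof (rule weak_extension_oscillation[where f = h and A = A, OF p0 K reg C \<delta> \<rho> U q hb _ A(1)])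
   show "h k0 y = 0" if "y \<in> cball c \<rho>" for y
    using that by (simp add: h_def g_def)
   fix k and R :: real assume R: "\<rho> \<le> R"
   have "(\<integral>\<^sup>+x. ennreal (norm (h k x) powr p0) * indicator (ball c R) x \<partial>lebesgue) \<le> (\<integral>\<^sup>+x. ennreal (norm (f k x) powr p0) * indicator (ball c R) x \<partial>lebesgue)"
    using p0 hle by (intro nn_integral_mono mult_right_mono ennreal_leI powr_mono2) auto
   also have "\<dots> \<le> ennreal (A k * measure lebesgue (ball c R))"
    by (rule A(2)[OF R])
   finally show "(\<integral>\<^sup>+x. ennreal (norm (h k x) powr p0) * indicator (ball c R) x \<partial>lebesgue) \<le> ennreal (A k * measure lebesgue (ball c R))" .
  qed
  then obtain N1 where N1: "N1 \<in> null_sets lebesgue" "\<forall>x\<in>ball c (\<rho> / 2) - N1. \<forall>x'\<in>ball c (\<rho> / 2) - N1. norm (U h x - U h x') \<le> c0"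
   by (rule bexE)
  obtain N2 where N2: "N2 \<in> null_sets lebesgue" "\<forall>x\<in>ball c (\<rho> / 2) - N2. \<forall>x'\<in>ball c (\<rho> / 2) - N2.
    norm ((U f x - U (mix S) x) - (U f x' - U (mix S) x')) \<le> real (card S) * c0"
   using insert.IH by (rule bexE)
  have eqs: "(mix S)(k0 := f k0) = mix S" "(mix S)(k0 := g k0) = mix (insert k0 S)"
   using insert.hyps by (auto simp: mix_def fun_eq_iff)
  have "AE x in lebesgue. U ((mix S)(k0 := f k0)) x - U ((mix S)(k0 := g k0)) x = U ((mix S)(k0 := \<lambda>y. f k0 y - g k0 y)) x"
   using p0 by (intro weak_extension_diff[OF U _ mixb f g]) simp
  then have "AE x in lebesgue. U (mix S) x - U (mix (insert k0 S)) x = U h x"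
   unfolding eqs h_def .
  then obtain N3 where N3: "N3 \<in> null_sets lebesgue" "{x \<in> space lebesgue. \<not> (U (mix S) x - U (mix (insert k0 S)) x = U h x)} \<subseteq> N3"
   unfolding eventually_ae_filter by blast
  show ?case
  proof (intro bexI[of _ "N1 \<union> N2 \<union> N3"] ballI)
   show "N1 \<union> N2 \<union> N3 \<in> null_sets lebesgue"
    by (intro null_sets.Un N1 N2 N3)
   fix x x' assume x: "x \<in> ball c (\<rho> / 2) - (N1 \<union> N2 \<union> N3)" and x': "x' \<in> ball c (\<rho> / 2) - (N1 \<union> N2 \<union> N3)"
   have e: "U (mix (insert k0 S)) x = U (mix S) x - U h x" "U (mix (insert k0 S)) x' = U (mix S) x' - U h x'"
   proof -
    have "U (mix S) z - U (mix (insert k0 S)) z = U h z" if "z \<notin> N3" for z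
     using subsetD[OF N3(2), of z] that by auto
    from this[of x] this[of x'] show "U (mix (insert k0 S)) x = U (mix S) x - U h x" "U (mix (insert k0 S)) x' = U (mix S) x' - U h x'"
     using x x' by (simp_all add: algebra_simps)
   qed
   have a: "norm (U h x - U h x') \<le> c0" "norm ((U f x - U (mix S) x) - (U f x' - U (mix S) x')) \<le> real (card S) * c0"
    using N1(2) N2(2) x x' by blast+
   have "norm ((U f x - U (mix (insert k0 S)) x) - (U f x' - U (mix (insert k0 S)) x'))
     = norm (((U f x - U (mix S) x) - (U f x' - U (mix S) x')) + (U h x - U h x'))"
    unfolding e by (simp add: algebra_simps)
   also have "\<dots> \<le> real (card S) * c0 + c0"
    by (rule norm_triangle_mono[OF a(2) a(1)])
   also have "\<dots> = real (card (insert k0 S)) * c0"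
    using insert.hyps by (simp add: algebra_simps)
   finally show "norm ((U f x - U (mix (insert k0 S)) x) - (U f x' - U (mix (insert k0 S)) x')) \<le> real (card (insert k0 S)) * c0" .
  qed
 qed
 have "mix UNIV = (\<lambda>k y. f k y * indicator (cball c \<rho>) y)"
  by (simp add: mix_def g_def)
 with main[of UNIV] show ?thesis
  unfolding c0_def by simp
qed

section \<open>Dyadic cubes\<close>

type_synonym 'n cube_index = "nat \<times> (int, 'n) vec"

text \<open>The affine map of [-L, L) onto [0, 2^k). Cubes become sets of constant integer part, and
  inclusions between generations become integer division by powers of 2.\<close>

definition cube_coord :: "real \<Rightarrow> nat \<Rightarrow> real \<Rightarrow> real" where
 "cube_coord L k t = 2 ^ k * ((t + L) / (2 * L))"

text \<open>The cubes of generation \<open>k\<close> have side \<open>2 L / 2 ^ k\<close>; the cube of generation 0 with index 0 is \<open>[-L, L) ^ n\<close>.\<close>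

definition dyadic_cube :: "real \<Rightarrow> 'n::finite cube_index \<Rightarrow> (real^'n) set" where
 "dyadic_cube L P = {x. \<forall>i. \<lfloor>cube_coord L (fst P) (x $ i)\<rfloor> = snd P $ i}"

definition cube_side :: "real \<Rightarrow> 'n::finite cube_index \<Rightarrow> real" where
 "cube_side L P = 2 * L / 2 ^ fst P"

definition cube_center :: "real \<Rightarrow> 'n::finite cube_index \<Rightarrow> real^'n" where
 "cube_center L P = (\<chi> i. cube_side L P * (of_int (snd P $ i) + 1/2) - L)"

text \<open>The factor 5 serves two inclusions, with s the side of P. The parent lies within 2
  sqrt(n) s of the centre of P, inside the half ball of radius 2.5 sqrt(n) s on which oscillation is
  controlled. For a proper ancestor of side S, at least 2s, the ball of P stays within 3 sqrt(n) S
  of its centre, so the balls are nested.\<close>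

definition cube_radius :: "real \<Rightarrow> 'n::finite cube_index \<Rightarrow> real" where
 "cube_radius L P = 5 * sqrt CARD('n) * cube_side L P"

text \<open>Meaningful for generations above 0: natural subtraction leaves generation 0 where it is,
  and the facts about parents exclude it.\<close>

definition cube_parent :: "'n::finite cube_index \<Rightarrow> 'n cube_index" where
 "cube_parent P = (fst P - 1, \<chi> i. snd P $ i div 2)"

definition cube_at :: "real \<Rightarrow> nat \<Rightarrow> real^'n::finite \<Rightarrow> 'n cube_index" where
 "cube_at L k x = (k, \<chi> i. \<lfloor>cube_coord L k (x $ i)\<rfloor>)"

lemma mem_cube_at: "x \<in> dyadic_cube L (cube_at L k x)"
 by (simp add: dyadic_cube_def cube_at_def)

lemma fst_cube_at [simp]: "fst (cube_at L k x) = k"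
 by (simp add: cube_at_def)

lemma mem_dyadic_cube_iff: "x \<in> dyadic_cube L P \<longleftrightarrow> P = cube_at L (fst P) x"
 by (auto simp: dyadic_cube_def cube_at_def prod_eq_iff vec_eq_iff)

lemma cube_side_pos: "0 < L \<Longrightarrow> 0 < cube_side L P"
 by (simp add: cube_side_def)

lemma cube_radius_pos: "0 < L \<Longrightarrow> 0 < cube_radius L P"
 by (simp add: cube_radius_def cube_side_pos)

lemma mem_dyadic_cube_box:
 fixes P :: "'n::finite cube_index"
 assumes "0 < L"
 shows "x \<in> dyadic_cube L P \<longleftrightarrow>
  (\<forall>i. cube_center L P $ i - cube_side L P / 2 \<le> x $ i \<and> x $ i < cube_center L P $ i + cube_side L P / 2)"
proof -
 have "\<lfloor>cube_coord L (fst P) (x $ i)\<rfloor> = snd P $ i \<longleftrightarrow>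
   cube_center L P $ i - cube_side L P / 2 \<le> x $ i \<and> x $ i < cube_center L P $ i + cube_side L P / 2" for i
 proof -
  define u where "u = cube_coord L (fst P) (x $ i)"
  have e: "x $ i = cube_side L P * u - L"
   using assms by (simp add: u_def cube_side_def cube_coord_def field_simps)
  have s: "0 < cube_side L P"
   by (rule cube_side_pos[OF assms])
  have c: "cube_center L P $ i - cube_side L P / 2 = cube_side L P * of_int (snd P $ i) - L"
   "cube_center L P $ i + cube_side L P / 2 = cube_side L P * (of_int (snd P $ i) + 1) - L"
   by (simp_all add: cube_center_def algebra_simps)
  show ?thesis
   unfolding u_def[symmetric] c unfolding e using s by (simp add: floor_eq_iff)
 qed
 then show ?thesis
  by (simp add: dyadic_cube_def)
qed

lemma norm_le_sqrt_card:
 fixes v :: "real^'n::finite"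
 assumes "\<And>i. \<bar>v $ i\<bar> \<le> s"
 shows "norm v \<le> sqrt CARD('n) * s"
proof -
 have s: "0 \<le> s"
  using assms abs_ge_zero order_trans by blast
 have "norm v = sqrt (\<Sum>i\<in>UNIV. \<bar>v $ i\<bar>\<^sup>2)"
  by (simp add: norm_vec_def L2_set_def)
 also have "\<dots> \<le> sqrt (\<Sum>i\<in>(UNIV::'n set). s\<^sup>2)"
  using assms by (intro real_sqrt_le_mono sum_mono power_mono) auto
 also have "\<dots> = sqrt CARD('n) * s"
  using s by (simp add: real_sqrt_mult)
 finally show ?thesis .
qed

lemma dist_cube_center:
 fixes P :: "'n::finite cube_index"
 assumes "0 < L" "x \<in> dyadic_cube L P"
 shows "dist (cube_center L P) x \<le> sqrt CARD('n) * cube_side L P / 2"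
proof -
 have "\<bar>(cube_center L P - x) $ i\<bar> \<le> cube_side L P / 2" for i
 proof -
  have "cube_center L P $ i - cube_side L P / 2 \<le> x $ i" "x $ i < cube_center L P $ i + cube_side L P / 2"
   using assms(2) by (auto simp: mem_dyadic_cube_box[OF assms(1)])
  then show ?thesis
   unfolding vector_minus_component abs_le_iff by linarith
 qed
 from norm_le_sqrt_card[OF this] show ?thesis
  by (simp add: dist_norm)
qed

lemma cube_center_mem: "0 < L \<Longrightarrow> cube_center L P \<in> dyadic_cube L P"
 using cube_side_pos[of L P] by (simp add: mem_dyadic_cube_box)

lemma dyadic_cube_subset_ball:
 fixes P :: "'n::finite cube_index"
 assumes "0 < L"
 shows "dyadic_cube L P \<subseteq> ball (cube_center L P) (cube_radius L P)"
proof
 fix x assume "x \<in> dyadic_cube L P"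
 from dist_cube_center[OF assms this] have "dist (cube_center L P) x \<le> sqrt CARD('n) * cube_side L P / 2" .
 also have "\<dots> < cube_radius L P"
  using cube_side_pos[OF assms, of P] by (simp add: cube_radius_def)
 finally show "x \<in> ball (cube_center L P) (cube_radius L P)"
  by simp
qed

lemma sets_dyadic_cube [measurable]:
 assumes "0 < L"
 shows "dyadic_cube L P \<in> sets borel"
proof -
 have "dyadic_cube L P = (\<Inter>i. {x. x $ i \<ge> cube_center L P $ i - cube_side L P / 2} \<inter> {x. x $ i < cube_center L P $ i + cube_side L P / 2})"
  by (auto simp: mem_dyadic_cube_box[OF assms])
 also have "\<dots> \<in> sets borel"
  by (intro sets.finite_INT sets.Int borel_closed borel_open closed_halfspace_component_ge_cart open_halfspace_component_lt_cart) auto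
 finally show ?thesis .
qed

lemma sets_lebesgue_dyadic_cube: "0 < L \<Longrightarrow> dyadic_cube L P \<in> sets lebesgue"
 by (rule sets_completionI_sets) (simp add: sets_dyadic_cube)

lemma emeasure_dyadic_cube:
 fixes P :: "'n::finite cube_index"
 assumes L: "0 < L"
 shows "emeasure lebesgue (dyadic_cube L P) = ennreal (cube_side L P ^ CARD('n))"
proof -
 define a where "a = cube_center L P - (\<chi> i. cube_side L P / 2)"
 define b where "b = cube_center L P + (\<chi> i. cube_side L P / 2)"
 have ab: "b $ i - a $ i = cube_side L P" "a $ i \<le> b $ i" for i
  using cube_side_pos[OF L, of P] by (simp_all add: a_def b_def)
 have le: "\<forall>j\<in>Basis. a \<bullet> j \<le> b \<bullet> j"
  using ab(2) by (auto simp: Basis_vec_def inner_axis)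
 have prod: "(\<Prod>j\<in>Basis. (b - a) \<bullet> j) = cube_side L P ^ CARD('n)"
 proof -
  have "(\<Prod>j\<in>(Basis :: (real^'n) set). (b - a) \<bullet> j) = (\<Prod>j\<in>(Basis :: (real^'n) set). cube_side L P)"
   using ab(1) by (intro prod.cong) (auto simp: Basis_vec_def inner_axis)
  then show ?thesis by simp
 qed
 have sub: "box a b \<subseteq> dyadic_cube L P" "dyadic_cube L P \<subseteq> cbox a b"
  by (auto simp: mem_dyadic_cube_box[OF L] mem_box_cart a_def b_def less_imp_le)
 have c: "dyadic_cube L P \<in> sets lebesgue"
  by (rule sets_lebesgue_dyadic_cube[OF L])
 have eq: "emeasure lebesgue (box a b) = ennreal (cube_side L P ^ CARD('n))"
   "emeasure lebesgue (cbox a b) = ennreal (cube_side L P ^ CARD('n))"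
  using le prod by (simp_all add: emeasure_lborel_box_eq emeasure_lborel_cbox_eq)
 show ?thesis
 proof (rule antisym)
  show "emeasure lebesgue (dyadic_cube L P) \<le> ennreal (cube_side L P ^ CARD('n))"
   unfolding eq(2)[symmetric] by (rule emeasure_mono[OF sub(2)]) simp
  show "ennreal (cube_side L P ^ CARD('n)) \<le> emeasure lebesgue (dyadic_cube L P)"
   unfolding eq(1)[symmetric] by (rule emeasure_mono[OF sub(1) c])
 qed
qed

lemma measure_dyadic_cube:
 fixes P :: "'n::finite cube_index"
 assumes L: "0 < L"
 shows "measure lebesgue (dyadic_cube L P) = cube_side L P ^ CARD('n)"
 using emeasure_dyadic_cube[OF L, of P] cube_side_pos[OF L, of P] by (simp add: measure_def)

lemma floor_cube_coord_le:
 assumes "k \<le> k'"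
 shows "\<lfloor>cube_coord L k t\<rfloor> = \<lfloor>cube_coord L k' t\<rfloor> div 2 ^ (k' - k)"
proof -
 have "cube_coord L k t = cube_coord L k' t / of_int (2 ^ (k' - k))"
  using assms power_add[of "2::real" k "k' - k"] by (simp add: cube_coord_def)
 then show ?thesis
  using floor_divide_real_eq_div[of "2 ^ (k' - k)" "cube_coord L k' t"] by simp
qed

text \<open>The coarse index of a point is an integer quotient of its fine index, so points that
  share the fine cube share the coarse one.\<close>

lemma dyadic_cube_nested:
 assumes "fst P \<le> fst P'" "x \<in> dyadic_cube L P" "x \<in> dyadic_cube L P'"
 shows "dyadic_cube L P' \<subseteq> dyadic_cube L P"
proof
 fix y assume y: "y \<in> dyadic_cube L P'"
 have "\<lfloor>cube_coord L (fst P) (y $ i)\<rfloor> = snd P $ i" for i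
 proof -
  have "\<lfloor>cube_coord L (fst P) (y $ i)\<rfloor> = \<lfloor>cube_coord L (fst P') (y $ i)\<rfloor> div 2 ^ (fst P' - fst P)"
   by (rule floor_cube_coord_le[OF assms(1)])
  also have "\<dots> = \<lfloor>cube_coord L (fst P') (x $ i)\<rfloor> div 2 ^ (fst P' - fst P)"
   using y assms(3) by (simp add: dyadic_cube_def)
  also have "\<dots> = \<lfloor>cube_coord L (fst P) (x $ i)\<rfloor>"
   by (rule floor_cube_coord_le[OF assms(1), symmetric])
  also have "\<dots> = snd P $ i"
   using assms(2) by (simp add: dyadic_cube_def)
  finally show ?thesis .
 qed
 then show "y \<in> dyadic_cube L P"
  by (simp add: dyadic_cube_def)
qed

lemma dyadic_cube_eqI:
 assumes "fst P = fst P'" "x \<in> dyadic_cube L P" "x \<in> dyadic_cube L P'"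
 shows "P = P'"
 using assms by (metis mem_dyadic_cube_iff)

lemma fst_cube_parent [simp]: "fst (cube_parent P) = fst P - 1"
 by (simp add: cube_parent_def)

lemma dyadic_cube_subset_parent:
 assumes "0 < fst P"
 shows "dyadic_cube L P \<subseteq> dyadic_cube L (cube_parent P)"
proof
 fix x assume x: "x \<in> dyadic_cube L P"
 have "\<lfloor>cube_coord L (fst P - 1) (x $ i)\<rfloor> = snd P $ i div 2" for i
  using floor_cube_coord_le[of "fst P - 1" "fst P" L "x $ i"] x assms by (simp add: dyadic_cube_def)
 then show "x \<in> dyadic_cube L (cube_parent P)"
  by (simp add: dyadic_cube_def cube_parent_def)
qed

lemma cube_side_parent: "0 < fst P \<Longrightarrow> cube_side L (cube_parent P) = 2 * cube_side L P"
 by (cases "fst P") (simp_all add: cube_side_def)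

lemma cube_parent_subset_ball:
 fixes P :: "'n::finite cube_index"
 assumes L: "0 < L" and k: "0 < fst P"
 shows "dyadic_cube L (cube_parent P) \<subseteq> ball (cube_center L P) (cube_radius L P / 2)"
proof
 fix x assume x: "x \<in> dyadic_cube L (cube_parent P)"
 have c: "cube_center L P \<in> dyadic_cube L (cube_parent P)"
  using dyadic_cube_subset_parent[OF k] cube_center_mem[OF L] by blast
 have "dist (cube_center L P) x \<le> dist (cube_center L (cube_parent P)) (cube_center L P) + dist (cube_center L (cube_parent P)) x"
  by (rule dist_triangle3)
 also have "\<dots> \<le> sqrt CARD('n) * (2 * cube_side L P) / 2 + sqrt CARD('n) * (2 * cube_side L P) / 2"
  using dist_cube_center[OF L c] dist_cube_center[OF L x] unfolding cube_side_parent[OF k] by (rule add_mono)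
 also have "\<dots> < cube_radius L P / 2"
  using cube_side_pos[OF L, of P] by (simp add: cube_radius_def)
 finally show "x \<in> ball (cube_center L P) (cube_radius L P / 2)"
  by simp
qed

lemma cube_ball_mono:
 fixes P Q :: "'n::finite cube_index"
 assumes L: "0 < L" and k: "fst Q < fst P" and sub: "dyadic_cube L P \<subseteq> dyadic_cube L Q"
 shows "cball (cube_center L P) (cube_radius L P) \<subseteq> ball (cube_center L Q) (cube_radius L Q)"
proof
 fix x assume x: "x \<in> cball (cube_center L P) (cube_radius L P)"
 have "2 * cube_side L P \<le> cube_side L Q"
 proof -
  have "(2::real) ^ Suc (fst Q) \<le> 2 ^ fst P"
   using k by (intro power_increasing) auto
  then show ?thesis
   using L by (simp add: cube_side_def field_simps)
 qed
 then have s: "sqrt CARD('n) * (2 * cube_side L P) \<le> sqrt CARD('n) * cube_side L Q"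
  by (intro mult_left_mono) auto
 have "cube_center L P \<in> dyadic_cube L Q"
  using sub cube_center_mem[OF L] by blast
 then have "dist (cube_center L Q) x \<le> sqrt CARD('n) * cube_side L Q / 2 + cube_radius L P"
  using dist_cube_center[OF L, of "cube_center L P" Q] x dist_triangle[of "cube_center L Q" x "cube_center L P"] by simp
 also have "\<dots> < cube_radius L Q"
 proof -
  have "0 < sqrt CARD('n) * cube_side L Q"
   using cube_side_pos[OF L, of Q] by simp
  moreover have "sqrt CARD('n) * (2 * cube_side L P) = 2 * (sqrt CARD('n) * cube_side L P)"
   by simp
  ultimately show ?thesis
   using s unfolding cube_radius_def mult.assoc by linarith
 qed
 finally show "x \<in> ball (cube_center L Q) (cube_radius L Q)"
  by simp
qed

lemma small_dyadic_cube:
 fixes x :: "real^'n::finite"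
 assumes L: "0 < L" and W: "open W" "x \<in> W"
 obtains k where "k0 < k" "dyadic_cube L (cube_at L k x) \<subseteq> W"
proof -
 obtain e where e: "0 < e" "ball x e \<subseteq> W"
  using W open_contains_ball by blast
 obtain k1 :: nat where k1: "sqrt CARD('n) * (2 * L) / e < 2 ^ k1"
  using real_arch_pow[of 2 "sqrt CARD('n) * (2 * L) / e"] by auto
 define k where "k = Suc (k0 + k1)"
 have "(2::real) ^ k1 \<le> 2 ^ k"
  by (intro power_increasing) (auto simp: k_def)
 then have "sqrt CARD('n) * (2 * L) / e < 2 ^ k"
  using k1 by linarith
 then have small: "sqrt CARD('n) * cube_side L (cube_at L k x) < e"
  using e(1) by (simp add: cube_side_def field_simps)
 have "dyadic_cube L (cube_at L k x) \<subseteq> ball x e"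
 proof
  fix y assume y: "y \<in> dyadic_cube L (cube_at L k x)"
  have "dist x y \<le> dist (cube_center L (cube_at L k x)) x + dist (cube_center L (cube_at L k x)) y"
   by (rule dist_triangle3)
  also have "\<dots> \<le> sqrt CARD('n) * cube_side L (cube_at L k x)"
   using dist_cube_center[OF L mem_cube_at, of k x] dist_cube_center[OF L y] by simp
  finally show "y \<in> ball x e"
   using small by simp
 qed
 then show ?thesis
  using that[of k] e(2) by (auto simp: k_def)
qed

section \<open>Stopping cubes: maximal dyadic subcubes that W fills more than half\<close>

definition dense_subcube :: "real \<Rightarrow> (real^'n::finite) set \<Rightarrow> 'n cube_index \<Rightarrow> 'n cube_index \<Rightarrow> bool" where
 "dense_subcube L W Q P \<longleftrightarrow> fst Q < fst P \<and> dyadic_cube L P \<subseteq> dyadic_cube L Q \<and>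
   cube_side L P ^ CARD('n) / 2 < measure lebesgue (dyadic_cube L P \<inter> W)"

definition stopping_cubes :: "real \<Rightarrow> (real^'n::finite) set \<Rightarrow> 'n cube_index \<Rightarrow> 'n cube_index set" where
 "stopping_cubes L W Q = {P. dense_subcube L W Q P \<and>
   (\<forall>P'. dense_subcube L W Q P' \<longrightarrow> fst P' < fst P \<longrightarrow> \<not> dyadic_cube L P \<subseteq> dyadic_cube L P')}"

text \<open>Openness of W puts small dyadic cubes around x entirely inside W, so some cube through x
  is dense. The earliest generation in which this happens gives a maximal one.\<close>

lemma stopping_cubes_cover:
 fixes Q :: "'n::finite cube_index"
 assumes L: "0 < L" and W: "open W" "x \<in> W" "x \<in> dyadic_cube L Q"
 shows "\<exists>P\<in>stopping_cubes L W Q. x \<in> dyadic_cube L P"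
proof -
 define D where "D k \<longleftrightarrow> dense_subcube L W Q (cube_at L k x)" for k
 obtain k where k: "fst Q < k" "dyadic_cube L (cube_at L k x) \<subseteq> W"
  by (rule small_dyadic_cube[OF L W(1,2)])
 have "D k"
  unfolding D_def dense_subcube_def
 proof (intro conjI)
  show "dyadic_cube L (cube_at L k x) \<subseteq> dyadic_cube L Q"
   by (rule dyadic_cube_nested[OF _ W(3) mem_cube_at]) (use k in simp)
  have "dyadic_cube L (cube_at L k x) \<inter> W = dyadic_cube L (cube_at L k x)"
   using k(2) by blast
  then show "cube_side L (cube_at L k x) ^ CARD('n) / 2 < measure lebesgue (dyadic_cube L (cube_at L k x) \<inter> W)"
   using cube_side_pos[OF L, of "cube_at L k x"] by (simp only: measure_dyadic_cube[OF L]) simp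
 qed (use k in simp)
 define l where "l = (LEAST k. D k)"
 have l: "D l" "\<And>j. j < l \<Longrightarrow> \<not> D j"
  unfolding l_def by (rule LeastI[of D, OF \<open>D k\<close>], rule not_less_Least)
 have "cube_at L l x \<in> stopping_cubes L W Q"
  unfolding stopping_cubes_def
 proof (intro CollectI conjI allI impI notI)
  show "dense_subcube L W Q (cube_at L l x)"
   using l(1) by (simp add: D_def)
  fix P' assume P': "dense_subcube L W Q P'" "fst P' < fst (cube_at L l x)" "dyadic_cube L (cube_at L l x) \<subseteq> dyadic_cube L P'"
  then have "x \<in> dyadic_cube L P'"
   using mem_cube_at by blast
  then have "P' = cube_at L (fst P') x"
   by (simp add: mem_dyadic_cube_iff)
  then have "D (fst P')"
   using P'(1) by (simp add: D_def)
  then show False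
   using l(2)[of "fst P'"] P'(2) by simp
 qed
 then show ?thesis
  using mem_cube_at by blast
qed

lemma stopping_cubes_disjoint: "disjoint_family_on (dyadic_cube L) (stopping_cubes L W Q)"
 unfolding disjoint_family_on_def
proof (intro ballI impI)
 fix P P' assume P: "P \<in> stopping_cubes L W Q" "P' \<in> stopping_cubes L W Q" "P \<noteq> P'"
 show "dyadic_cube L P \<inter> dyadic_cube L P' = {}"
 proof (rule ccontr)
  assume "dyadic_cube L P \<inter> dyadic_cube L P' \<noteq> {}"
  then obtain x where x: "x \<in> dyadic_cube L P" "x \<in> dyadic_cube L P'" by blast
  have "fst P \<noteq> fst P'"
   using dyadic_cube_eqI[OF _ x] P(3) by blast
  then consider "fst P < fst P'" | "fst P' < fst P" by linarith
  then show False
  proof cases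
   case 1
   then have "dyadic_cube L P' \<subseteq> dyadic_cube L P"
    using dyadic_cube_nested[OF _ x] by simp
   then show False
    using P(1,2) 1 unfolding stopping_cubes_def by blast
  next
   case 2
   then have "dyadic_cube L P \<subseteq> dyadic_cube L P'"
    using dyadic_cube_nested[OF _ x(2,1)] by simp
   then show False
    using P(1,2) 2 unfolding stopping_cubes_def by blast
  qed
 qed
qed

text \<open>Each stopping cube has at most twice the measure of its intersection with W, and these
  intersections are disjoint.\<close>

lemma stopping_cubes_measure:
 fixes Q :: "'n::finite cube_index"
 assumes L: "0 < L" and W: "W \<in> sets lebesgue" "emeasure lebesgue W < \<infinity>"
 shows "emeasure lebesgue (\<Union>P\<in>stopping_cubes L W Q. dyadic_cube L P) \<le> 2 * emeasure lebesgue W"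
proof -
 have cnt: "countable (stopping_cubes L W Q)"
  by simp
 have cm: "dyadic_cube L P \<in> sets lebesgue" for P :: "'n cube_index"
  by (rule sets_lebesgue_dyadic_cube[OF L])
 have le: "emeasure lebesgue (dyadic_cube L P) \<le> 2 * emeasure lebesgue (dyadic_cube L P \<inter> W)" if "P \<in> stopping_cubes L W Q" for P
 proof -
  have "cube_side L P ^ CARD('n) \<le> 2 * measure lebesgue (dyadic_cube L P \<inter> W)"
   using that by (simp add: stopping_cubes_def dense_subcube_def)
  then have "emeasure lebesgue (dyadic_cube L P) \<le> ennreal (2 * measure lebesgue (dyadic_cube L P \<inter> W))"
   unfolding emeasure_dyadic_cube[OF L] by (rule ennreal_leI)
  also have "\<dots> = 2 * ennreal (measure lebesgue (dyadic_cube L P \<inter> W))"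
   by (simp add: ennreal_mult)
  also have "ennreal (measure lebesgue (dyadic_cube L P \<inter> W)) = emeasure lebesgue (dyadic_cube L P \<inter> W)"
  proof (rule emeasure_eq_ennreal_measure[symmetric])
   have "emeasure lebesgue (dyadic_cube L P \<inter> W) \<le> emeasure lebesgue W"
    using W by (intro emeasure_mono) auto
   then show "emeasure lebesgue (dyadic_cube L P \<inter> W) \<noteq> top"
    using W(2) by (auto simp: top_unique)
  qed
  finally show ?thesis .
 qed
 have "emeasure lebesgue (\<Union>P\<in>stopping_cubes L W Q. dyadic_cube L P) = (\<integral>\<^sup>+P. emeasure lebesgue (dyadic_cube L P) \<partial>count_space (stopping_cubes L W Q))"
  by (intro emeasure_UN_countable cm cnt stopping_cubes_disjoint)
 also have "\<dots> \<le> (\<integral>\<^sup>+P. 2 * emeasure lebesgue (dyadic_cube L P \<inter> W) \<partial>count_space (stopping_cubes L W Q))"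
  using le by (intro nn_integral_mono) simp
 also have "\<dots> = 2 * (\<integral>\<^sup>+P. emeasure lebesgue (dyadic_cube L P \<inter> W) \<partial>count_space (stopping_cubes L W Q))"
  by (rule nn_integral_cmult) simp
 also have "(\<integral>\<^sup>+P. emeasure lebesgue (dyadic_cube L P \<inter> W) \<partial>count_space (stopping_cubes L W Q)) = emeasure lebesgue (\<Union>P\<in>stopping_cubes L W Q. dyadic_cube L P \<inter> W)"
 proof (intro emeasure_UN_countable[symmetric] cnt sets.Int cm W)
  show "disjoint_family_on (\<lambda>P. dyadic_cube L P \<inter> W) (stopping_cubes L W Q)"
   using stopping_cubes_disjoint[of L W Q] unfolding disjoint_family_on_def by blast
 qed
 also have "2 * \<dots> \<le> 2 * emeasure lebesgue W"
  using W(1) by (intro mult_left_mono emeasure_mono) auto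
 finally show ?thesis .
qed

text \<open>By maximality the parent is not dense if it is a proper subcube of Q. Otherwise it is Q
  itself, for which the bound is the hypothesis.\<close>

lemma stopping_cube_parent:
 fixes Q :: "'n::finite cube_index"
 assumes L: "0 < L" and P: "P \<in> stopping_cubes L W Q"
  and Q: "measure lebesgue (dyadic_cube L Q \<inter> W) \<le> cube_side L Q ^ CARD('n) / 2"
 shows "measure lebesgue (dyadic_cube L (cube_parent P) \<inter> W) \<le> cube_side L (cube_parent P) ^ CARD('n) / 2"
proof -
 have d: "fst Q < fst P" "dyadic_cube L P \<subseteq> dyadic_cube L Q"
  using P by (auto simp: stopping_cubes_def dense_subcube_def)
 have c: "cube_center L P \<in> dyadic_cube L P" "cube_center L P \<in> dyadic_cube L (cube_parent P)" "cube_center L P \<in> dyadic_cube L Q"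
  using cube_center_mem[OF L, of P] dyadic_cube_subset_parent[of P L] d by auto
 show ?thesis
 proof (cases "fst Q = fst (cube_parent P)")
  case True
  then have "Q = cube_parent P"
   by (rule dyadic_cube_eqI[OF _ c(3,2)])
  then show ?thesis
   using Q by simp
 next
  case False
  then have lt: "fst Q < fst (cube_parent P)"
   using d by simp
  have "\<not> dense_subcube L W Q (cube_parent P)"
  proof
   assume "dense_subcube L W Q (cube_parent P)"
   moreover have "dense_subcube L W Q P' \<Longrightarrow> fst P' < fst P \<Longrightarrow> \<not> dyadic_cube L P \<subseteq> dyadic_cube L P'" for P'
    using P unfolding stopping_cubes_def by blast
   ultimately show False
    using dyadic_cube_subset_parent[of P L] d(1) by fastforce
  qed
  moreover have "dyadic_cube L (cube_parent P) \<subseteq> dyadic_cube L Q"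
   by (rule dyadic_cube_nested[OF _ c(3,2)]) (use lt in simp)
  ultimately show ?thesis
   using lt by (auto simp: dense_subcube_def)
 qed
qed

section \<open>Sparse domination\<close>

text \<open>W is the superlevel set of the uncentred maximal function of g at height s, written as a
  union of open balls. The measure bound is the weak (1,1) inequality, with 5^n as doubling constant
  of Lebesgue measure.\<close>

lemma open_maximal_set:
 fixes g :: "real^'n::finite \<Rightarrow> real"
 assumes g: "g \<in> borel_measurable lebesgue" and X: "(\<integral>\<^sup>+x. ennreal (g x) \<partial>lebesgue) \<le> ennreal X" "0 \<le> X" and s: "0 < s"
 defines "W \<equiv> \<Union>{ball c r | c r. 0 < r \<and> ennreal (s * measure lebesgue (ball c r)) < (\<integral>\<^sup>+x. ennreal (g x) * indicator (ball c r) x \<partial>lebesgue)}"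
 shows "open W" "emeasure lebesgue W \<le> ennreal (5 ^ CARD('n) * X / s)"
proof -
 show "open W"
  unfolding W_def by (intro open_Union) auto
 define n where "n = CARD('n)"
 define V where "V = unit_ball_vol n"
 have V: "0 < V"
  by (simp add: V_def)
 have n: "0 < n"
  by (simp add: n_def)
 have meas: "measure lebesgue (ball c r) = V * r ^ n" if "0 \<le> r" for c :: "real^'n" and r
  using measure_ball_vec[OF that, of c] by (simp add: V_def n_def)
 have emeas: "emeasure lebesgue (ball c r) = ennreal (V * r ^ n)" if "0 \<le> r" for c :: "real^'n" and r
  using that by (simp add: V_def n_def emeasure_ball)
 define K where "K = {(c, r). 0 < r \<and> ennreal (s * measure lebesgue (ball c r)) < (\<integral>\<^sup>+x. ennreal (g x) * indicator (ball c r) x \<partial>lebesgue)}"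
 have W: "W = (\<Union>i\<in>K. ball (fst i) (snd i))"
  unfolding W_def K_def by force
 have "ennreal s * emeasure lebesgue (\<Union>i\<in>K. ball (fst i) (snd i)) \<le> ennreal (5 ^ n) * emeasure (weighted g) UNIV"
 proof (rule weak_maximal_inequality)
  fix i assume "i \<in> K"
  then have i: "0 < snd i" "ennreal (s * measure lebesgue (ball (fst i) (snd i))) < (\<integral>\<^sup>+x. ennreal (g x) * indicator (ball (fst i) (snd i)) x \<partial>lebesgue)"
   by (auto simp: K_def split: prod.splits)
  have em: "emeasure (weighted g) (ball (fst i) (snd i)) = (\<integral>\<^sup>+x. ennreal (g x) * indicator (ball (fst i) (snd i)) x \<partial>lebesgue)"
   using g by (intro emeasure_density) auto
  show "ennreal s * emeasure lebesgue (ball (fst i) (snd i)) \<le> emeasure (weighted g) (ball (fst i) (snd i))"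
   unfolding em using i s V by (simp only: emeas meas less_imp_le flip: ennreal_mult')
  have "(\<integral>\<^sup>+x. ennreal (g x) * indicator (ball (fst i) (snd i)) x \<partial>lebesgue) \<le> (\<integral>\<^sup>+x. ennreal (g x) \<partial>lebesgue)"
   by (intro nn_integral_mono) (auto simp: indicator_def)
  then have "ennreal (s * (V * snd i ^ n)) < ennreal X"
   using i X(1) by (simp only: meas less_imp_le)
  moreover have "0 \<le> s * (V * snd i ^ n)"
   using s V i(1) by simp
  ultimately have "s * (V * snd i ^ n) < X"
   by (simp only: ennreal_less_iff)
  then have le: "snd i ^ n \<le> X / (s * V)"
   using s V by (simp add: field_simps)
  \<comment> \<open>A ball with average above s has measure below X / s, which bounds its radius as
    the covering lemma requires.\<close>
  show "0 < snd i \<and> snd i \<le> max 1 (X / (s * V))"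
  proof (cases "snd i \<le> 1")
   case False
   then have "snd i ^ 1 \<le> snd i ^ n"
    using n by (intro power_increasing) auto
   then show ?thesis
    using le i(1) by simp
  qed (use i in auto)
 next
  fix c :: "real^'n" and \<rho> :: real assume "0 < \<rho>"
  then have "emeasure lebesgue (ball c (5 * \<rho>)) = ennreal (V * (5 * \<rho>) ^ n)" "emeasure lebesgue (ball c \<rho>) = ennreal (V * \<rho> ^ n)"
   by (intro emeas; simp)+
  moreover have "V * (5 * \<rho>) ^ n = 5 ^ n * (V * \<rho> ^ n)"
   by (simp add: power_mult_distrib)
  ultimately show "emeasure lebesgue (ball c (5 * \<rho>)) \<le> ennreal (5 ^ n) * emeasure lebesgue (ball c \<rho>)"
   by (simp only: ennreal_mult' zero_le_power zero_le_numeral order_refl)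
 qed simp_all
 also have "emeasure (weighted g) UNIV = (\<integral>\<^sup>+x. ennreal (g x) \<partial>lebesgue)"
  using g by (subst emeasure_density) auto
 also have "ennreal (5 ^ n) * \<dots> \<le> ennreal (5 ^ n) * ennreal X"
  by (intro mult_left_mono X) simp
 finally have le: "ennreal s * emeasure lebesgue W \<le> ennreal (5 ^ n * X)"
  using X(2) by (simp add: W ennreal_mult)
 have "emeasure lebesgue W = ennreal (1 / s) * (ennreal s * emeasure lebesgue W)"
  using s by (simp add: mult.assoc[symmetric] flip: ennreal_mult)
 also have "\<dots> \<le> ennreal (1 / s) * ennreal (5 ^ n * X)"
  by (intro mult_left_mono le) simp
 also have "\<dots> = ennreal (5 ^ n * X / s)"
  using s X(2) by (simp flip: ennreal_mult)
 finally show "emeasure lebesgue W \<le> ennreal (5 ^ CARD('n) * X / s)"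
  by (simp add: n_def)
qed

abbreviation cube_ball :: "real \<Rightarrow> 'n::finite cube_index \<Rightarrow> (real^'n) set" where
 "cube_ball L P \<equiv> ball (cube_center L P) (cube_radius L P)"

abbreviation cube_cball :: "real \<Rightarrow> 'n::finite cube_index \<Rightarrow> (real^'n) set" where
 "cube_cball L P \<equiv> cball (cube_center L P) (cube_radius L P)"

text \<open>The cut-off uses closed balls, whose complement is open, as needed for approximation by
  test functions that vanish on the ball. Averages use open balls; the sphere between them is
  null.\<close>

definition localize :: "real \<Rightarrow> ('m \<Rightarrow> real^'n::finite \<Rightarrow> complex) \<Rightarrow> 'n cube_index \<Rightarrow> 'm \<Rightarrow> real^'n \<Rightarrow> complex" where
 "localize L f P = (\<lambda>k y. f k y * indicator (cube_cball L P) y)"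

definition mass :: "real \<Rightarrow> ('m \<Rightarrow> real^'n::finite \<Rightarrow> complex) \<Rightarrow> 'm \<Rightarrow> (real^'n) set \<Rightarrow> real" where
 "mass p f k S = measure (weighted (\<lambda>x. norm (f k x) powr p)) S"

definition cube_avg :: "real \<Rightarrow> real \<Rightarrow> ('m::finite \<Rightarrow> real^'n::finite \<Rightarrow> complex) \<Rightarrow> 'n cube_index \<Rightarrow> real" where
 "cube_avg L p f P = (\<Prod>k\<in>UNIV. (mass p f k (cube_ball L P) / measure lebesgue (cube_ball L P)) powr (1 / p))"

lemma cube_avg_nonneg: "0 \<le> cube_avg L p f P"
 unfolding cube_avg_def by (intro prod_nonneg) auto

lemma emeasure_weighted_eq_mass:
 assumes f: "f k \<in> bounded_compact_support" and p: "0 < p" and S: "S \<in> sets lebesgue"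
 shows "(\<integral>\<^sup>+x. ennreal (norm (f k x) powr p) * indicator S x \<partial>lebesgue) = ennreal (mass p f k S)"
proof -
 have m: "f k \<in> borel_measurable lebesgue"
  using f by (simp add: bounded_compact_support_def)
 have e: "emeasure (weighted (\<lambda>x. norm (f k x) powr p)) S = (\<integral>\<^sup>+x. ennreal (norm (f k x) powr p) * indicator S x \<partial>lebesgue)"
  using m S by (intro emeasure_density) auto
 have "(\<integral>\<^sup>+x. ennreal (norm (f k x) powr p) * indicator S x \<partial>lebesgue) \<le> (\<integral>\<^sup>+x. ennreal (norm (f k x) powr p) \<partial>lebesgue)"
  by (intro nn_integral_mono) (auto simp: indicator_def)
 also have "\<dots> < \<infinity>"
  by (rule bounded_compact_support_nn_integral[OF f p])
 finally have "emeasure (weighted (\<lambda>x. norm (f k x) powr p)) S \<noteq> top"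
  unfolding e by simp
 then show ?thesis
  unfolding e[symmetric] mass_def by (rule emeasure_eq_ennreal_measure)
qed

lemma localize_bounded_compact_support:
 assumes f: "f k \<in> bounded_compact_support"
 shows "localize L f P k \<in> bounded_compact_support"
proof (rule bounded_compact_support_le[OF f])
 have "f k \<in> borel_measurable lebesgue"
  using f by (simp add: bounded_compact_support_def)
 then show "localize L f P k \<in> borel_measurable lebesgue"
  unfolding localize_def by (intro borel_measurable_times borel_measurable_indicator) auto
 show "norm (localize L f P k x) \<le> norm (f k x)" for x
  by (simp add: localize_def indicator_def)
qed

lemma AE_notin_sphere: "AE x in lebesgue. (x :: real^'n::finite) \<notin> sphere c r"
proof -
 have "negligible (sphere c r)"
  by (rule negligible_sphere)
 then show ?thesis
  by (intro AE_not_in) (simp add: negligible_iff_null_sets)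
qed

lemma localize_nn_integral:
 assumes f: "f k \<in> bounded_compact_support" and p: "0 < p"
 shows "(\<integral>\<^sup>+x. ennreal (norm (localize L f P k x) powr p) \<partial>lebesgue) = ennreal (mass p f k (cube_ball L P))"
proof -
 have "AE x in lebesgue. ennreal (norm (localize L f P k x) powr p) = ennreal (norm (f k x) powr p) * indicator (cube_ball L P) x"
  using AE_notin_sphere[of "cube_center L P" "cube_radius L P"]
 proof eventually_elim
  case (elim x)
  then show ?case
   using p by (auto simp: localize_def indicator_def)
 qed
 then have "(\<integral>\<^sup>+x. ennreal (norm (localize L f P k x) powr p) \<partial>lebesgue) = (\<integral>\<^sup>+x. ennreal (norm (f k x) powr p) * indicator (cube_ball L P) x \<partial>lebesgue)"
  by (rule nn_integral_cong_AE)
 also have "\<dots> = ennreal (mass p f k (cube_ball L P))"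
  by (rule emeasure_weighted_eq_mass[where f = f and k = k, OF f p]) simp
 finally show ?thesis .
qed

lemma measure_cube_ball:
 fixes P :: "'n::finite cube_index"
 assumes "0 < L"
 shows "measure lebesgue (cube_ball L P) = unit_ball_vol CARD('n) * (5 * sqrt CARD('n)) ^ CARD('n) * cube_side L P ^ CARD('n)"
 using measure_ball_vec[OF less_imp_le[OF cube_radius_pos[OF assms, of P]], of "cube_center L P"]
 unfolding cube_radius_def by (simp add: power_mult_distrib)

text \<open>One extension at the exponents q_j = p0 is fixed: the stopping argument compares
  everything with L^p0 averages, so this is the weak type bound that matches them.\<close>

locale kernel_operator =
 fixes T :: "('m::finite \<Rightarrow> real^'n::finite \<Rightarrow> complex) \<Rightarrow> (real^'n \<Rightarrow> complex) \<Rightarrow> complex"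
  and K :: "real^'n \<Rightarrow> ('m \<Rightarrow> real^'n) \<Rightarrow> complex" and U p0 \<delta> C q
 assumes p0: "1 \<le> p0" and K: "has_kernel T K" and reg: "kernel_regularity p0 \<delta> C K" and C: "0 < C"
  and \<delta>: "real CARD('n) / p0 < \<delta>" and U: "weak_extension T (\<lambda>_. p0) q U"
  and q: "0 < q" "(\<Sum>k\<in>(UNIV::'m set). 1 / p0) = 1 / q"
begin

lemma p0_pos: "0 < p0"
 using p0 by simp

lemma q_eq: "real CARD('m) / p0 * q = 1"
 using q by (simp add: field_simps)

text \<open>The L^p0 norms of the localized inputs multiply to the product of averages times
  |B|^(m/p0) for the ball B of the cube. As q m/p0 = 1, the weak type bound at height C1 times that
  product is a fixed multiple of |B|.\<close>

lemma weak_type_localize: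
 "\<exists>C1>0. \<forall>f L P. (\<forall>k. f k \<in> bounded_compact_support) \<longrightarrow> 0 < L \<longrightarrow>
   emeasure lebesgue {x. norm (U (localize L f P) x) > C1 * cube_avg L p0 f P} \<le> ennreal (cube_side L P ^ CARD('n) / 32)"
proof -
 obtain D where D: "0 \<le> D"
  "\<And>f. (\<And>j. f j \<in> bounded_compact_support) \<Longrightarrow> U f \<in> borel_measurable lebesgue"
  "\<And>f c t. (\<And>j. f j \<in> bounded_compact_support) \<Longrightarrow> (\<And>j. 0 \<le> c j) \<Longrightarrow>
    (\<And>j. lp_norm p0 (f j) \<le> ennreal (c j)) \<Longrightarrow> 0 < t \<Longrightarrow>
    emeasure lebesgue {x. norm (U f x) > t} \<le> ennreal ((D * (\<Prod>j\<in>UNIV. c j) / t) powr q)"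
  by (rule weak_extension_bound[OF U p0_pos q(1)]) blast
 define \<beta> where "\<beta> = unit_ball_vol CARD('n) * (5 * sqrt CARD('n)) ^ CARD('n)"
 have \<beta>: "0 < \<beta>"
  by (simp add: \<beta>_def)
 \<comment> \<open>\<beta> is the ratio of the measures of ball and cube, and 32 the proportion that
   is needed later. D + 1 instead of D keeps C1 positive.\<close>
 define C1 where "C1 = (D + 1) * (32 * \<beta>) powr (1 / q)"
 have C1: "0 < C1"
  unfolding C1_def using D(1) \<beta> by simp
 show ?thesis
 proof (intro exI[of _ C1] conjI allI impI C1)
  fix f :: "'m \<Rightarrow> real^'n \<Rightarrow> complex" and L :: real and P :: "'n cube_index"
  assume f: "\<forall>k. f k \<in> bounded_compact_support" and L: "0 < L"
  define g where "g = localize L f P"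
  have g: "g k \<in> bounded_compact_support" for k
   unfolding g_def by (rule localize_bounded_compact_support) (use f in simp)
  have B2: "measure lebesgue (cube_ball L P) = \<beta> * cube_side L P ^ CARD('n)"
   unfolding measure_cube_ball[OF L] \<beta>_def ..
  have "0 < measure lebesgue (cube_ball L P)"
   unfolding B2 using \<beta> cube_side_pos[OF L, of P] by simp
  note B = this B2
  define B where "B = measure lebesgue (cube_ball L P)"
  define c where "c k = mass p0 f k (cube_ball L P) powr (1 / p0)" for k
  have mass0: "0 \<le> mass p0 f k S" for k S
   by (simp add: mass_def)
  have lpc: "lp_norm p0 (g k) \<le> ennreal (c k)" for k
   unfolding c_def
  proof (rule wlp_norm_le[OF _ mass0 p0_pos])
   show "(\<integral>\<^sup>+x. ennreal (norm (g k x) powr p0) * ennreal 1 \<partial>lebesgue) \<le> ennreal (mass p0 f k (cube_ball L P))"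
    using localize_nn_integral[of f k p0 L P] f p0_pos by (simp add: g_def)
  qed
  have cprod: "(\<Prod>k\<in>UNIV. c k) = cube_avg L p0 f P * B powr (real CARD('m) / p0)"
  proof -
   have "cube_avg L p0 f P = (\<Prod>k\<in>UNIV. c k / B powr (1 / p0))"
    unfolding cube_avg_def c_def B_def using mass0 B(1) by (simp add: powr_divide)
   also have "\<dots> = (\<Prod>k\<in>UNIV. c k) / (B powr (1 / p0)) ^ CARD('m)"
    by (simp add: prod_dividef)
   also have "(B powr (1 / p0)) ^ CARD('m) = B powr (real CARD('m) / p0)"
    using B(1) by (simp add: B_def powr_powr mult.commute flip: powr_realpow)
   finally show ?thesis
    using B(1) by (simp add: B_def)
  qed
  have weak: "emeasure lebesgue {x. norm (U g x) > t} \<le> ennreal ((D * (cube_avg L p0 f P * B powr (real CARD('m) / p0)) / t) powr q)" if "0 < t" for t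
   unfolding cprod[symmetric] by (rule D(3)[OF g _ lpc that]) (simp add: c_def)
  show "emeasure lebesgue {x. norm (U (localize L f P) x) > C1 * cube_avg L p0 f P} \<le> ennreal (cube_side L P ^ CARD('n) / 32)"
  proof (cases "cube_avg L p0 f P = 0")
   case True
   have Um: "U g \<in> borel_measurable lebesgue"
    by (rule D(2)[OF g])
   \<comment> \<open>The weak type bound cannot be used at height 0. It gives measure zero at every
     positive height, hence a value of 0 almost everywhere.\<close>
   have "emeasure lebesgue {x. norm (U g x) > t} = 0" if "0 < t" for t
    using weak[OF that] True q(1) by simp
   then have "AE x in lebesgue. norm (U g x) \<le> 1 / real (Suc i)" for i
    using Um by (subst AE_iff_measurable[OF sets_superlevel[OF Um, of "1 / real (Suc i)"]]) (auto simp: not_le)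
   then have "AE x in lebesgue. \<forall>i. norm (U g x) \<le> 1 / real (Suc i)"
    unfolding AE_all_countable by (rule allI)
   then have "AE x in lebesgue. \<not> (norm (U g x) > C1 * cube_avg L p0 f P)"
   proof eventually_elim
    case (elim x)
    show ?case
    proof
     assume "norm (U g x) > C1 * cube_avg L p0 f P"
     then have "0 < norm (U g x)"
      using True by simp
     then obtain i where "inverse (real (Suc i)) < norm (U g x)"
      using reals_Archimedean by blast
     then show False
      using elim[rule_format, of i] by (simp add: inverse_eq_divide)
    qed
   qed
   then have "emeasure lebesgue {x. norm (U g x) > C1 * cube_avg L p0 f P} = 0"
    by (subst (asm) AE_iff_measurable[OF sets_superlevel[OF Um, of "C1 * cube_avg L p0 f P"]]) (auto simp: not_le)
   then show ?thesis
    unfolding g_def by simp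
  next
   case False
   then have a: "0 < cube_avg L p0 f P"
    using cube_avg_nonneg[of L p0 f P] by simp
   have t: "0 < C1 * cube_avg L p0 f P"
    using a C1 by simp
   have "(D * (cube_avg L p0 f P * B powr (real CARD('m) / p0)) / (C1 * cube_avg L p0 f P)) powr q = (D / C1 * B powr (real CARD('m) / p0)) powr q"
    using a by simp
   also have "\<dots> = (D / C1) powr q * (B powr (real CARD('m) / p0)) powr q"
    using D(1) C1 by (intro powr_mult)
   also have "(B powr (real CARD('m) / p0)) powr q = B"
    unfolding powr_powr q_eq using B(1) by (simp add: B_def)
   also have "(D / C1) powr q \<le> (1 / (32 * \<beta>) powr (1 / q)) powr q"
   proof (rule powr_mono2)
    have "D / C1 = D / (D + 1) * (1 / (32 * \<beta>) powr (1 / q))"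
     by (simp add: C1_def)
    also have "\<dots> \<le> 1 * (1 / (32 * \<beta>) powr (1 / q))"
     using D(1) by (intro mult_right_mono) auto
    finally show "D / C1 \<le> 1 / (32 * \<beta>) powr (1 / q)"
     by simp
   qed (use q D C1 in auto)
   also have "(1 / (32 * \<beta>) powr (1 / q)) powr q = 1 / (32 * \<beta>)"
    using q(1) \<beta> by (simp add: powr_divide powr_powr)
   finally have "(D * (cube_avg L p0 f P * B powr (real CARD('m) / p0)) / (C1 * cube_avg L p0 f P)) powr q \<le> 1 / (32 * \<beta>) * B"
    using B(1) by (simp add: B_def)
   also have "\<dots> = cube_side L P ^ CARD('n) / 32"
    using B(2) \<beta> by (simp add: B_def)
   finally show ?thesis
    using weak[OF t] unfolding g_def by (meson ennreal_leI order_trans)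
  qed
 qed
qed

end

context kernel_operator
begin

abbreviation stopping_family :: "real \<Rightarrow> real \<Rightarrow> ('m \<Rightarrow> real^'n \<Rightarrow> complex) \<Rightarrow> 'n cube_index \<Rightarrow> 'n cube_index set \<Rightarrow> bool" where
 "stopping_family c L f Q ch \<equiv>
   (\<forall>P\<in>ch. fst Q < fst P \<and> dyadic_cube L P \<subseteq> dyadic_cube L Q) \<and>
   disjoint_family_on (dyadic_cube L) ch \<and>
   emeasure lebesgue (\<Union>P\<in>ch. dyadic_cube L P) \<le> ennreal (1/4) * emeasure lebesgue (dyadic_cube L Q) \<and>
   (AE x in lebesgue. (x \<in> dyadic_cube L Q \<longrightarrow> (\<forall>P\<in>ch. x \<notin> dyadic_cube L P) \<longrightarrow>
      norm (U (localize L f Q) x) \<le> c * cube_avg L p0 f Q) \<and>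
     (\<forall>P\<in>ch. x \<in> dyadic_cube L P \<longrightarrow>
      norm (U (localize L f Q) x) \<le> c * cube_avg L p0 f Q + norm (U (localize L f P) x)))"

text \<open>
 One step of the stopping-time construction. Off the exceptional open set \<open>W\<close> both \<open>U\<close> applied to the
 localized tuple and all its averages are controlled; the parent of a stopping cube \<open>P\<close> contains
 a point \<open>x'\<close> off \<open>W\<close> that is good for \<open>P\<close> too, and the oscillation estimate transfers the control from
 \<open>x'\<close> to \<open>P\<close>.
\<close>

proposition sparse_step:
 "\<exists>c>0. \<forall>f L Q. (\<forall>k. f k \<in> bounded_compact_support) \<longrightarrow> 0 < L \<longrightarrow>
  (\<exists>ch. stopping_family c L f Q ch)"
proof -
 obtain C1 where C1: "0 < C1" "\<And>f L P. (\<forall>k. f k \<in> bounded_compact_support) \<Longrightarrow> 0 < L \<Longrightarrow>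
   emeasure lebesgue {x. norm (U (localize L f P) x) > C1 * cube_avg L p0 f P} \<le> ennreal (cube_side L P ^ CARD('n) / 32)"
  using weak_type_localize by (elim exE conjE) (rule that, assumption, blast)
 define m where "m = real CARD('m)"
 have m: "0 < m"
  by (simp add: m_def)
 define \<beta> where "\<beta> = unit_ball_vol CARD('n) * (5 * sqrt CARD('n)) ^ CARD('n)"
 have \<beta>: "0 < \<beta>"
  by (simp add: \<beta>_def)
 \<comment> \<open>The height, relative to the average over the ball of Q, at which each of the m
   maximal sets has measure at most |Q| / (32 m): 5^n is the weak type constant and \<beta> the
   ratio of ball and cube.\<close>
 define \<Lambda> where "\<Lambda> = 5 ^ CARD('n) * \<beta> * m * 32"
 have \<Lambda>: "0 < \<Lambda>"
  unfolding \<Lambda>_def using \<beta> m by simp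
 \<comment> \<open>The truncation oscillation constant for averages bounded by \<Lambda> A k, with
   the product of the A k split off.\<close>
 define c2 where "c2 = m * (oscillation_const CARD('m) CARD('n) p0 \<delta> C * ((2 powr (p0 + 1) * \<Lambda>) powr (1 / p0)) ^ CARD('m))"
 define c3 where "c3 = (\<Lambda> powr (1 / p0)) ^ CARD('m)"
 \<comment> \<open>The three summands bound the value for Q at the good point, the value for P at
   that point, where the product of averages has grown by at most c3, and the oscillation between
   the two points.\<close>
 define c where "c = C1 + C1 * c3 + \<bar>c2\<bar>"
 have c3: "0 \<le> c3"
  by (simp add: c3_def)
 have c: "0 < c" "C1 \<le> c"
  using C1(1) c3 by (simp_all add: c_def add_pos_nonneg)
 have Um: "U g \<in> borel_measurable lebesgue" if "\<And>k. g k \<in> bounded_compact_support" for g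
  by (rule weak_extension_measurable[OF U p0_pos that])
 show ?thesis
 proof (intro exI[of _ c] conjI allI impI c(1))
  fix f :: "'m \<Rightarrow> real^'n \<Rightarrow> complex" and L :: real and Q :: "'n cube_index"
  assume f: "\<forall>k. f k \<in> bounded_compact_support" and L: "0 < L"
  define a where "a P = cube_avg L p0 f P" for P :: "'n cube_index"
  define F where "F P x = norm (U (localize L f P) x)" for P :: "'n cube_index" and x
  have loc: "localize L f P k \<in> bounded_compact_support" for P :: "'n cube_index" and k
   by (rule localize_bounded_compact_support) (use f in simp)
  have locU: "U (localize L f P) \<in> borel_measurable lebesgue" for P :: "'n cube_index"
   by (rule Um[OF loc])
  have weak: "emeasure lebesgue {x. F P x > C1 * a P} \<le> ennreal (cube_side L P ^ CARD('n) / 32)" for P :: "'n cube_index"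
   unfolding F_def a_def by (rule C1(2)[OF f L])
  have badm: "{x. F P x > t} \<in> sets lebesgue" for P :: "'n cube_index" and t
   unfolding F_def by (rule sets_superlevel[OF locU])
  have side: "0 < cube_side L P ^ CARD('n)" for P :: "'n cube_index"
   using cube_side_pos[OF L, of P] by simp
  have Bm: "measure lebesgue (cube_ball L P) = \<beta> * cube_side L P ^ CARD('n)" for P :: "'n cube_index"
   by (simp only: measure_cube_ball[OF L] \<beta>_def)
  have Bpos: "0 < measure lebesgue (cube_ball L P)" for P :: "'n cube_index"
   unfolding Bm using \<beta> side[of P] by simp
  have cubem: "dyadic_cube L P \<in> sets lebesgue" for P :: "'n cube_index"
   by (rule sets_lebesgue_dyadic_cube[OF L])
  define s where "s = cube_side L Q ^ CARD('n)"
  have s: "0 < s"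
   using side[of Q] by (simp add: s_def)
  have "\<exists>ch. (\<forall>P\<in>ch. fst Q < fst P \<and> dyadic_cube L P \<subseteq> dyadic_cube L Q) \<and>
   disjoint_family_on (dyadic_cube L) ch \<and>
   emeasure lebesgue (\<Union>P\<in>ch. dyadic_cube L P) \<le> ennreal (1/4) * emeasure lebesgue (dyadic_cube L Q) \<and>
   (AE x in lebesgue. (x \<in> dyadic_cube L Q \<longrightarrow> (\<forall>P\<in>ch. x \<notin> dyadic_cube L P) \<longrightarrow> F Q x \<le> c * a Q) \<and>
     (\<forall>P\<in>ch. x \<in> dyadic_cube L P \<longrightarrow> F Q x \<le> c * a Q + F P x))"
  \<comment> \<open>If one input vanishes on the ball, the averages cannot serve as heights for the
    maximal sets. In that case the operator gives 0 almost everywhere and an empty family of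
    children suffices.\<close>
  proof (cases "\<exists>k. mass p0 f k (cube_ball L Q) = 0")
   case True
   then obtain k where k: "mass p0 f k (cube_ball L Q) = 0" by blast
   have "(\<integral>\<^sup>+x. ennreal (norm (localize L f Q k x) powr p0) \<partial>lebesgue) = 0"
    using localize_nn_integral[of f k p0 L Q] f p0_pos k by simp
   then have zero: "lp_norm p0 (localize L f Q k) \<le> ennreal (0 powr (1 / p0))"
    using p0_pos by (intro wlp_norm_le) auto
   obtain D where D: "0 \<le> D" "\<And>f c t. (\<And>j. f j \<in> bounded_compact_support) \<Longrightarrow> (\<And>j. 0 \<le> c j) \<Longrightarrow>
     (\<And>j. lp_norm p0 (f j) \<le> ennreal (c j)) \<Longrightarrow> 0 < t \<Longrightarrow>
     emeasure lebesgue {x. norm (U f x) > t} \<le> ennreal ((D * (\<Prod>j\<in>UNIV. c j) / t) powr q)"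
    by (rule weak_extension_bound[OF U p0_pos q(1)]) blast
   define cc where "cc j = (if j = k then 0 else enn2real (lp_norm p0 (localize L f Q j)))" for j
   have lpc: "lp_norm p0 (localize L f Q j) \<le> ennreal (cc j)" for j
   proof (cases "j = k")
    case True
    then show ?thesis
     using zero p0_pos by (simp add: cc_def)
   next
    case False
    have "lp_norm p0 (localize L f Q j) < top"
     using bounded_compact_support_lp[OF loc[of Q j] p0_pos] by (simp add: wlp_def)
    then show ?thesis
     using False by (simp add: cc_def)
   qed
   have "emeasure lebesgue {x. norm (U (localize L f Q) x) > t} = 0" if "0 < t" for t
   proof -
    have z: "(\<Prod>j\<in>UNIV. cc j) = 0"
     by (intro prod_zero bexI[of _ k]) (auto simp: cc_def)
    have cc0: "0 \<le> cc j" for j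
     by (simp add: cc_def)
    have "emeasure lebesgue {x. norm (U (localize L f Q) x) > t} \<le> ennreal ((D * (\<Prod>j\<in>UNIV. cc j) / t) powr q)"
     by (rule D(2)[OF loc cc0 lpc that])
    then show ?thesis
     unfolding z by simp
   qed
   then have "AE x in lebesgue. norm (U (localize L f Q) x) \<le> 1 / real (Suc i)" for i
    by (subst AE_iff_measurable[OF sets_superlevel[OF locU, of "1 / real (Suc i)" Q]]) (auto simp: not_le)
   then have "AE x in lebesgue. \<forall>i. norm (U (localize L f Q) x) \<le> 1 / real (Suc i)"
    unfolding AE_all_countable by (rule allI)
   then have "AE x in lebesgue. F Q x \<le> c * a Q"
   proof eventually_elim
    case (elim x)
    have "F Q x \<le> 0"
    proof (rule ccontr)
     assume "\<not> F Q x \<le> 0"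
     then have "0 < F Q x" by simp
     then obtain i where "inverse (real (Suc i)) < F Q x"
      using reals_Archimedean by blast
     then show False
      using elim[rule_format, of i] by (simp add: inverse_eq_divide F_def)
    qed
    also have "0 \<le> c * a Q"
     using c cube_avg_nonneg[of L p0 f Q] by (simp add: a_def)
    finally show ?case .
   qed
   then show ?thesis
    by (intro exI[of _ "{}"]) (auto simp: disjoint_family_on_def elim: eventually_mono)
  next
   case False
   define A where "A k = mass p0 f k (cube_ball L Q) / measure lebesgue (cube_ball L Q)" for k
   have massp: "0 < mass p0 f k (cube_ball L Q)" for k
    using False measure_nonneg unfolding mass_def by (metis less_eq_real_def)
   have A: "0 < A k" for k
    unfolding A_def using massp Bpos by simp
   have aQ: "a Q = (\<Prod>k\<in>UNIV. A k powr (1 / p0))"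
    by (simp add: a_def cube_avg_def A_def)
   have aQ0: "0 \<le> a Q"
    by (simp add: a_def cube_avg_nonneg)
   define g where "g k x = norm (localize L f Q k x) powr p0" for k x
   have gm: "g k \<in> borel_measurable lebesgue" for k
   proof -
    have "localize L f Q k \<in> borel_measurable lebesgue"
     using loc[of Q k] by (simp add: bounded_compact_support_def)
    then show ?thesis
     unfolding g_def[abs_def] by measurable
   qed
   have gint: "(\<integral>\<^sup>+x. ennreal (g k x) \<partial>lebesgue) = ennreal (mass p0 f k (cube_ball L Q))" for k
    unfolding g_def using localize_nn_integral[of f k p0 L Q] f p0_pos by simp
   define O1 where "O1 k = \<Union>{ball z r | z r. 0 < r \<and> ennreal (\<Lambda> * A k * measure lebesgue (ball z r)) < (\<integral>\<^sup>+x. ennreal (g k x) * indicator (ball z r) x \<partial>lebesgue)}" for k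
   have O1: "open (O1 k)" "emeasure lebesgue (O1 k) \<le> ennreal (s / 32 / m)" for k
   proof -
    have sp: "0 < \<Lambda> * A k"
     using \<Lambda> A by simp
    note * = open_maximal_set[OF gm[of k] eq_refl[OF gint[of k]] less_imp_le[OF massp[of k]] sp]
    show "open (O1 k)"
     using *(1) by (simp add: O1_def)
    have "5 ^ CARD('n) * mass p0 f k (cube_ball L Q) / (\<Lambda> * A k) = 5 ^ CARD('n) * measure lebesgue (cube_ball L Q) / \<Lambda>"
     using massp[of k] Bpos[of Q] unfolding A_def by (simp del: measure_completion)
    also have "\<dots> = s / 32 / m"
     unfolding Bm \<Lambda>_def s_def using \<beta> m by simp
    finally show "emeasure lebesgue (O1 k) \<le> ennreal (s / 32 / m)"
     using *(2) unfolding O1_def by simp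
   qed
   define E0 where "E0 = {x. F Q x > C1 * a Q}"
   have E0: "E0 \<in> sets lebesgue" "emeasure lebesgue E0 \<le> ennreal (s / 32)"
    unfolding E0_def s_def by (rule badm, rule weak)
   have "0 < s / 32"
    using s by simp
   \<comment> \<open>The set where the value for Q is large is merely measurable. It is enlarged to
     an open set because the stopping cubes are to cover W.\<close>
   then obtain O0 where O0: "open O0" "E0 \<subseteq> O0" "O0 - E0 \<in> lmeasurable" "emeasure lebesgue (O0 - E0) < ennreal (s / 32)"
    by (rule sets_lebesgue_outer_open[OF E0(1)])
   define W where "W = O0 \<union> (\<Union>k. O1 k)"
   have W: "open W"
    unfolding W_def using O0 O1 by blast
   have Wm: "W \<in> sets lebesgue"
    using W by (intro sets_completionI_sets) simp
   \<comment> \<open>Three parts of measure |Q|/32 each: the set of large values, its open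
     enlargement, and the maximal sets together. Doubled by the stopping rule this is 6/32, below
     the required quarter.\<close>
   have eW: "emeasure lebesgue W \<le> ennreal (s * 3 / 32)"
   proof -
    have "emeasure lebesgue O0 \<le> emeasure lebesgue (E0 \<union> (O0 - E0))"
     using E0 O0 by (intro emeasure_mono) (auto simp: fmeasurable_def)
    also have "\<dots> \<le> emeasure lebesgue E0 + emeasure lebesgue (O0 - E0)"
     using E0 O0 by (intro emeasure_subadditive) (auto simp: fmeasurable_def)
    also have "\<dots> \<le> ennreal (s / 32) + ennreal (s / 32)"
     using E0(2) O0(4) by (intro add_mono) auto
    finally have 1: "emeasure lebesgue O0 \<le> ennreal (s / 32) + ennreal (s / 32)" .
    have O1m: "O1 k \<in> sets lebesgue" for k
     using O1(1)[of k] by (intro sets_completionI_sets) simp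
    have "emeasure lebesgue (\<Union>k. O1 k) \<le> (\<Sum>k\<in>UNIV. emeasure lebesgue (O1 k))"
     using O1m by (intro emeasure_subadditive_finite) auto
    also have "\<dots> \<le> (\<Sum>k\<in>(UNIV :: 'm set). ennreal (s / 32 / m))"
     by (intro sum_mono O1(2))
    also have "\<dots> = ennreal (s / 32)"
     using s m by (simp add: m_def ennreal_of_nat_eq_real_of_nat flip: ennreal_mult)
    finally have 2: "emeasure lebesgue (\<Union>k. O1 k) \<le> ennreal (s / 32)" .
    have "emeasure lebesgue W \<le> emeasure lebesgue O0 + emeasure lebesgue (\<Union>k. O1 k)"
     unfolding W_def using O0(1) O1m by (intro emeasure_subadditive) (auto intro!: sets_completionI_sets sets.countable_UN)
    also have "\<dots> \<le> (ennreal (s / 32) + ennreal (s / 32)) + ennreal (s / 32)"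
     by (intro add_mono 1 2)
    also have "\<dots> = ennreal (s * 3 / 32)"
     using s by (simp flip: ennreal_plus)
    finally show ?thesis .
   qed
   have Wfin: "emeasure lebesgue W < \<infinity>"
    using eW by (rule le_less_trans) simp
   define ch where "ch = stopping_cubes L W Q"
   have chd: "fst Q < fst P" "dyadic_cube L P \<subseteq> dyadic_cube L Q" if "P \<in> ch" for P
    using that by (auto simp: ch_def stopping_cubes_def dense_subcube_def)
   have chm: "emeasure lebesgue (\<Union>P\<in>ch. dyadic_cube L P) \<le> ennreal (1/4) * emeasure lebesgue (dyadic_cube L Q)"
   proof -
    have "emeasure lebesgue (\<Union>P\<in>ch. dyadic_cube L P) \<le> 2 * emeasure lebesgue W"
     unfolding ch_def by (rule stopping_cubes_measure[OF L Wm Wfin])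
    also have "\<dots> \<le> 2 * ennreal (s * 3 / 32)"
     by (intro mult_left_mono eW) simp
    also have "\<dots> = ennreal (2 * (s * 3 / 32))"
     using s by (subst ennreal_mult) auto
    also have "\<dots> \<le> ennreal (1/4 * s)"
     using s by (intro ennreal_leI) simp
    also have "\<dots> = ennreal (1/4) * emeasure lebesgue (dyadic_cube L Q)"
     unfolding emeasure_dyadic_cube[OF L] s_def[symmetric] using s by (intro ennreal_mult) auto
    finally show ?thesis .
   qed
   have Qhalf: "measure lebesgue (dyadic_cube L Q \<inter> W) \<le> cube_side L Q ^ CARD('n) / 2"
   proof -
    have "emeasure lebesgue (dyadic_cube L Q \<inter> W) \<le> ennreal (s * 3 / 32)"
     using emeasure_mono[of "dyadic_cube L Q \<inter> W" W lebesgue] Wm eW by (auto intro: order_trans)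
    then have "measure lebesgue (dyadic_cube L Q \<inter> W) \<le> s * 3 / 32"
     using s unfolding measure_def by (intro enn2real_leI) auto
    then show ?thesis
     using s by (simp add: s_def)
   qed
   have off: "AE x in lebesgue. x \<in> dyadic_cube L Q \<longrightarrow> (\<forall>P\<in>ch. x \<notin> dyadic_cube L P) \<longrightarrow> F Q x \<le> c * a Q"
   proof (intro AE_I2 impI)
    fix x assume x: "x \<in> dyadic_cube L Q" "\<forall>P\<in>ch. x \<notin> dyadic_cube L P"
    then have "x \<notin> W"
     using stopping_cubes_cover[OF L W _ x(1)] by (auto simp: ch_def)
    then have "x \<notin> E0"
     using O0(2) by (auto simp: W_def)
    then have "F Q x \<le> C1 * a Q"
     by (simp add: E0_def not_less)
    also have "\<dots> \<le> c * a Q"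
     using c(2) aQ0 by (rule mult_right_mono)
    finally show "F Q x \<le> c * a Q" .
   qed
   have on: "AE x in lebesgue. x \<in> dyadic_cube L P \<longrightarrow> F Q x \<le> c * a Q + F P x" if P: "P \<in> ch" for P
   proof -
    have fstP: "0 < fst P"
     using chd[OF P] by simp
    define R where "R = cube_parent P"
    define \<rho> where "\<rho> = cube_radius L P"
    define z where "z = cube_center L P"
    have \<rho>: "0 < \<rho>"
     by (simp add: \<rho>_def cube_radius_pos[OF L])
    define Z where "Z = {x. F P x > C1 * a P}"
    have Z: "Z \<in> sets lebesgue" "emeasure lebesgue Z \<le> ennreal (cube_side L P ^ CARD('n) / 32)"
     unfolding Z_def by (rule badm, rule weak)
    have Rhalf: "measure lebesgue (dyadic_cube L R \<inter> W) \<le> cube_side L R ^ CARD('n) / 2"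
     unfolding R_def by (rule stopping_cube_parent[OF L P[unfolded ch_def] Qhalf])
    have Rball: "dyadic_cube L R \<subseteq> ball z (\<rho> / 2)"
     unfolding R_def z_def \<rho>_def by (rule cube_parent_subset_ball[OF L fstP])
    \<comment> \<open>W takes at most half of the parent R, the bad set of P at most |P|/32, which
      is at most |R|/32, and N nothing. A point of R avoiding all three is left over.\<close>
    have exists: "\<exists>x'\<in>dyadic_cube L R. x' \<notin> W \<and> x' \<notin> Z \<and> x' \<notin> N" if N: "N \<in> null_sets lebesgue" for N
    proof (rule ccontr)
     assume "\<not> ?thesis"
     then have sub: "dyadic_cube L R \<subseteq> (dyadic_cube L R \<inter> W) \<union> (Z \<union> N)"
      by blast
     have Nm: "N \<in> sets lebesgue" "emeasure lebesgue N = 0"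
      using N by auto
     have fin: "emeasure lebesgue (dyadic_cube L R \<inter> W) = ennreal (measure lebesgue (dyadic_cube L R \<inter> W))"
      using emeasure_mono[of "dyadic_cube L R \<inter> W" W lebesgue] Wm Wfin
      by (intro emeasure_eq_ennreal_measure) (auto simp: top_unique)
     have "emeasure lebesgue (dyadic_cube L R) \<le> emeasure lebesgue ((dyadic_cube L R \<inter> W) \<union> (Z \<union> N))"
      using sub cubem[of R] Wm Z Nm by (intro emeasure_mono) auto
     also have "\<dots> \<le> emeasure lebesgue (dyadic_cube L R \<inter> W) + (emeasure lebesgue Z + emeasure lebesgue N)"
      using cubem[of R] Wm Z Nm by (intro order_trans[OF emeasure_subadditive] add_mono order_refl) auto
     also have "\<dots> \<le> ennreal (cube_side L R ^ CARD('n) / 2) + (ennreal (cube_side L P ^ CARD('n) / 32) + 0)"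
      unfolding fin using Rhalf Z(2) Nm(2) by (intro add_mono ennreal_leI) auto
     also have "\<dots> = ennreal (cube_side L R ^ CARD('n) / 2 + cube_side L P ^ CARD('n) / 32)"
      using side[of R] side[of P] by simp
     finally have "cube_side L R ^ CARD('n) \<le> cube_side L R ^ CARD('n) / 2 + cube_side L P ^ CARD('n) / 32"
      unfolding emeasure_dyadic_cube[OF L] using side[of R] side[of P] by (subst (asm) ennreal_le_iff) auto
     moreover have "cube_side L P ^ CARD('n) \<le> cube_side L R ^ CARD('n)"
      unfolding R_def cube_side_parent[OF fstP] using cube_side_pos[OF L, of P] by (intro power_mono) auto
     ultimately show False
      using side[of R] by linarith
    qed
    \<comment> \<open>Every ball around the centre of P with radius at least \<rho> contains x', and
      x' lies outside the maximal sets; so none of these balls has a large average.\<close>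
    have key: "(\<integral>\<^sup>+x. ennreal (norm (localize L f Q k x) powr p0) * indicator (ball z r) x \<partial>lebesgue) \<le> ennreal (\<Lambda> * A k * measure lebesgue (ball z r))"
     if x': "x' \<in> dyadic_cube L R" "x' \<notin> W" and r: "\<rho> \<le> r" for x' k r
    proof (rule ccontr)
     assume "\<not> ?thesis"
     then have lt: "ennreal (\<Lambda> * A k * measure lebesgue (ball z r)) < (\<integral>\<^sup>+x. ennreal (g k x) * indicator (ball z r) x \<partial>lebesgue)"
      by (simp add: not_le g_def)
     have "x' \<in> ball z (\<rho> / 2)"
      using x' Rball by blast
     then have "x' \<in> ball z r"
      using r \<rho> by simp
     moreover have "0 < r"
      using r \<rho> by simp
     ultimately have "x' \<in> O1 k"
      unfolding O1_def using lt by blast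
     then show False
      using x'(2) by (auto simp: W_def)
    qed
    have "\<exists>x'\<in>dyadic_cube L R. x' \<notin> W"
     using exists[of "{}"] by auto
    then obtain x0 where x0: "x0 \<in> dyadic_cube L R" "x0 \<notin> W" by blast
    have bsub: "cube_cball L P \<subseteq> cube_ball L Q"
     by (rule cube_ball_mono[OF L chd[OF P]])
    have aP: "a P \<le> c3 * a Q"
    proof -
     have "mass p0 f k (cube_ball L P) / measure lebesgue (cube_ball L P) \<le> \<Lambda> * A k" for k
     proof -
      have "ennreal (mass p0 f k (cube_ball L P)) = (\<integral>\<^sup>+x. ennreal (norm (f k x) powr p0) * indicator (cube_ball L P) x \<partial>lebesgue)"
       using f p0_pos by (intro emeasure_weighted_eq_mass[symmetric]) auto
      also have "\<dots> = (\<integral>\<^sup>+x. ennreal (norm (localize L f Q k x) powr p0) * indicator (ball z \<rho>) x \<partial>lebesgue)"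
      proof (intro nn_integral_cong)
       fix x
       show "ennreal (norm (f k x) powr p0) * indicator (cube_ball L P) x = ennreal (norm (localize L f Q k x) powr p0) * indicator (ball z \<rho>) x"
       proof (cases "x \<in> cube_ball L P")
        case True
        then have "x \<in> cube_cball L P"
         by (rule subsetD[OF ball_subset_cball])
        then have "x \<in> cube_ball L Q"
         using bsub by blast
        then have "x \<in> cube_cball L Q"
         by (rule subsetD[OF ball_subset_cball])
        then show ?thesis
         using True by (simp add: localize_def z_def \<rho>_def)
       qed (simp add: z_def \<rho>_def)
      qed
      also have "\<dots> \<le> ennreal (\<Lambda> * A k * measure lebesgue (ball z \<rho>))"
       by (rule key[OF x0 order_refl])
      finally have "mass p0 f k (cube_ball L P) \<le> \<Lambda> * A k * measure lebesgue (cube_ball L P)"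
       using \<Lambda> A[of k] by (subst (asm) ennreal_le_iff) (auto simp: z_def \<rho>_def)
      then show ?thesis
       using Bpos[of P] by (simp only: pos_divide_le_eq)
     qed
     then have "a P \<le> (\<Prod>k\<in>UNIV. (\<Lambda> * A k) powr (1 / p0))"
      unfolding a_def cube_avg_def using p0_pos
      by (intro prod_mono conjI powr_mono2) (auto simp: mass_def)
     also have "\<dots> = c3 * a Q"
      using \<Lambda> A by (simp add: aQ c3_def powr_mult prod.distrib less_imp_le)
     finally show ?thesis .
    qed
    \<comment> \<open>The ball of P lies inside the ball of Q, so truncating the inputs of Q to the
      ball of P yields the inputs of P.\<close>
    have loceq: "(\<lambda>k y. localize L f Q k y * indicator (cball z \<rho>) y) = localize L f P"
    proof (intro ext)
     fix k y
     show "localize L f Q k y * indicator (cball z \<rho>) y = localize L f P k y"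
     proof (cases "y \<in> cube_cball L P")
      case True
      then have "y \<in> cube_cball L Q"
       using bsub by auto
      then show ?thesis
       using True by (simp add: localize_def z_def \<rho>_def)
     qed (simp add: localize_def z_def \<rho>_def)
    qed
    have A\<Lambda>: "0 < \<Lambda> * A k" for k
     using \<Lambda> A[of k] by simp
    have "\<exists>N\<in>null_sets lebesgue. \<forall>x\<in>ball z (\<rho> / 2) - N. \<forall>x'\<in>ball z (\<rho> / 2) - N.
      norm ((U (localize L f Q) x - U (\<lambda>k y. localize L f Q k y * indicator (cball z \<rho>) y) x) - (U (localize L f Q) x' - U (\<lambda>k y. localize L f Q k y * indicator (cball z \<rho>) y) x'))
      \<le> real CARD('m) * (oscillation_const CARD('m) CARD('n) p0 \<delta> C * (\<Prod>k\<in>UNIV. (2 powr (p0 + 1) * (\<Lambda> * A k)) powr (1 / p0)))"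
     by (rule truncation_oscillation[where f = "localize L f Q" and A = "\<lambda>k. \<Lambda> * A k", OF p0 K reg C \<delta> \<rho> U q(1) loc A\<Lambda> key[OF x0]])
    moreover have "real CARD('m) * (oscillation_const CARD('m) CARD('n) p0 \<delta> C * (\<Prod>k\<in>UNIV. (2 powr (p0 + 1) * (\<Lambda> * A k)) powr (1 / p0))) = c2 * a Q"
    proof -
     have "(2 powr (p0 + 1) * (\<Lambda> * A k)) powr (1 / p0) = (2 powr (p0 + 1) * \<Lambda>) powr (1 / p0) * A k powr (1 / p0)" for k
     proof -
      have "2 powr (p0 + 1) * (\<Lambda> * A k) = (2 powr (p0 + 1) * \<Lambda>) * A k"
       by simp
      then show ?thesis
       using \<Lambda> A[of k] by (simp only:) (intro powr_mult; simp)
     qed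
     then show ?thesis
      by (simp add: c2_def m_def aQ prod.distrib)
    qed
    ultimately obtain N where N: "N \<in> null_sets lebesgue" "\<forall>x\<in>ball z (\<rho> / 2) - N. \<forall>x'\<in>ball z (\<rho> / 2) - N.
      norm ((U (localize L f Q) x - U (localize L f P) x) - (U (localize L f Q) x' - U (localize L f P) x')) \<le> c2 * a Q"
     unfolding loceq by (elim bexE) (rule that, assumption, simp only:)
    obtain x' where x': "x' \<in> dyadic_cube L R" "x' \<notin> W" "x' \<notin> Z" "x' \<notin> N"
     using exists[OF N(1)] by blast
    have FQ: "F Q x' \<le> C1 * a Q"
    proof -
     have "x' \<notin> E0"
      using x'(2) O0(2) by (auto simp: W_def)
     then show ?thesis
      by (simp add: E0_def not_less)
    qed
    have FP: "F P x' \<le> C1 * (c3 * a Q)"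
    proof -
     have "F P x' \<le> C1 * a P"
      using x'(3) by (simp add: Z_def not_less)
     also have "\<dots> \<le> C1 * (c3 * a Q)"
      using aP C1(1) by (intro mult_left_mono) auto
     finally show ?thesis .
    qed
    have "AE x in lebesgue. x \<notin> N"
     by (rule AE_not_in[OF N(1)])
    then show ?thesis
    proof (eventually_elim, intro impI)
     fix x assume xN: "x \<notin> N" and x: "x \<in> dyadic_cube L P"
     have xb: "x \<in> ball z (\<rho> / 2) - N" "x' \<in> ball z (\<rho> / 2) - N"
      using xN x x' Rball dyadic_cube_subset_parent[OF fstP, of L] by (auto simp: R_def)
     \<comment> \<open>Unprimed values are taken at x, primed ones at the good point x'; u belongs
       to Q and v to P. The identity u = ((u - v) - (u' - v')) + v + u' - v' reduces u to an
       oscillation, the value v, and two controlled values.\<close>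
     define u v u' v' where "u = U (localize L f Q) x" and "v = U (localize L f P) x"
      and "u' = U (localize L f Q) x'" and "v' = U (localize L f P) x'"
     have "norm ((u - v) - (u' - v')) \<le> c2 * a Q"
      using N(2) xb unfolding u_def v_def u'_def v'_def by blast
     moreover have "c2 * a Q \<le> \<bar>c2\<bar> * a Q"
      using aQ0 by (intro mult_right_mono) auto
     moreover have "norm u \<le> norm ((u - v) - (u' - v')) + norm v + norm u' + norm v'"
     proof -
      have "u = ((u - v) - (u' - v')) + v + u' - v'"
       by simp
      then have "norm u = norm (((u - v) - (u' - v')) + v + u' - v')"
       by (rule arg_cong)
      also have "\<dots> \<le> norm (((u - v) - (u' - v')) + v + u') + norm v'"
       by (rule norm_triangle_ineq4)
      also have "\<dots> \<le> norm ((u - v) - (u' - v')) + norm v + norm u' + norm v'"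
       by (intro add_right_mono order_trans[OF norm_triangle_ineq] norm_triangle_ineq)
      finally show ?thesis .
     qed
     moreover have "norm u' \<le> C1 * a Q" "norm v' \<le> C1 * (c3 * a Q)"
      using FQ FP by (simp_all add: F_def u'_def v'_def)
     ultimately have "norm u \<le> (C1 * a Q + C1 * (c3 * a Q) + \<bar>c2\<bar> * a Q) + norm v"
      by linarith
     also have "C1 * a Q + C1 * (c3 * a Q) + \<bar>c2\<bar> * a Q = c * a Q"
      by (simp add: c_def algebra_simps)
     finally show "F Q x \<le> c * a Q + F P x"
      by (simp add: F_def u_def v_def)
    qed
   qed
   have "AE x in lebesgue. \<forall>P\<in>ch. x \<in> dyadic_cube L P \<longrightarrow> F Q x \<le> c * a Q + F P x"
    by (subst AE_ball_countable) (use on in auto)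
   with off have "AE x in lebesgue. (x \<in> dyadic_cube L Q \<longrightarrow> (\<forall>P\<in>ch. x \<notin> dyadic_cube L P) \<longrightarrow> F Q x \<le> c * a Q) \<and>
     (\<forall>P\<in>ch. x \<in> dyadic_cube L P \<longrightarrow> F Q x \<le> c * a Q + F P x)"
    by eventually_elim blast
   moreover have "disjoint_family_on (dyadic_cube L) ch"
    unfolding ch_def by (rule stopping_cubes_disjoint)
   ultimately show ?thesis
    using chd chm by (intro exI[of _ ch]) blast
  qed
  then show "\<exists>ch. stopping_family c L f Q ch"
   unfolding F_def a_def .
 qed
qed

end

section \<open>Multiple weights\<close>

lemma prod_option:
 fixes y :: "'m::finite option \<Rightarrow> 'b::comm_monoid_mult"
 shows "(\<Prod>i\<in>UNIV. y i) = y None * (\<Prod>j\<in>UNIV. y (Some j))"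
 by (simp add: UNIV_option_conv prod.reindex)

lemma sum_option:
 fixes y :: "'m::finite option \<Rightarrow> 'b::comm_monoid_add"
 shows "(\<Sum>i\<in>UNIV. y i) = y None + (\<Sum>j\<in>UNIV. y (Some j))"
 by (simp add: UNIV_option_conv sum.reindex)

lemma prod_ennreal_nonzero:
 fixes y :: "'i \<Rightarrow> ennreal"
 shows "finite I \<Longrightarrow> (\<And>i. i \<in> I \<Longrightarrow> y i \<noteq> 0) \<Longrightarrow> (\<Prod>i\<in>I. y i) \<noteq> 0"
 by (induction I rule: finite_induct) auto

text \<open>Since 0 times infinity is 0, a finite product says nothing about its factors until all
  of them are known to be non-zero.\<close>

lemma prod_ennreal_less_top_imp:
 fixes y :: "'i \<Rightarrow> ennreal"
 assumes I: "finite I" "k \<in> I" and pos: "\<And>i. i \<in> I \<Longrightarrow> y i \<noteq> 0" and fin: "(\<Prod>i\<in>I. y i) < top"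
 shows "y k < top"
proof (rule ccontr)
 assume "\<not> y k < top"
 then have "y k = top"
  by (simp add: not_less top_unique)
 moreover have "(\<Prod>i\<in>I - {k}. y i) \<noteq> 0"
  using pos I(1) by (intro prod_ennreal_nonzero) auto
 ultimately have "(\<Prod>i\<in>I. y i) = top"
  using I by (simp add: prod.remove[of I k] ennreal_top_mult)
 then show False
  using fin by simp
qed

locale multiple_weights =
 fixes p0 p :: real and ps :: "'m::finite \<Rightarrow> real" and \<omega> :: "'m \<Rightarrow> real^'n::finite \<Rightarrow> real" and v :: "real^'n \<Rightarrow> real"
 assumes p0_ge: "1 \<le> p0" and ps: "\<And>j. p0 < ps j" and p: "1 / p = (\<Sum>j\<in>UNIV. 1 / ps j)"
  and weights: "multi_weight (\<lambda>j. ps j / p0) \<omega>"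
  and v: "v = (\<lambda>x. \<Prod>j\<in>UNIV. \<omega> j x powr (p / ps j))"
begin

definition ratio :: "'m \<Rightarrow> real" where
 "ratio j = ps j / p0"

text \<open>The dual measure \<sigma>_j = \<omega>_j^(1 - r_j') with r_j = ps j / p0 and r_j' = r_j
  / (r_j - 1).\<close>

definition dual :: "'m \<Rightarrow> real^'n \<Rightarrow> real" where
 "dual j x = \<omega> j x powr (1 - ratio j / (ratio j - 1))"

text \<open>The index \<open>None\<close> stands for the output weight v and \<open>Some j\<close>
  for the dual weights. With this the multiple weight condition is symmetric in m + 1 measures and a
  single comparison lemma covers all of them.\<close>

definition wgt :: "'m option \<Rightarrow> real^'n \<Rightarrow> real" where
 "wgt i = (case i of None \<Rightarrow> v | Some j \<Rightarrow> dual j)"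

text \<open>The exponents with which the averages enter the condition: 1/r = p0/p for v and 1/r_j'
  for the dual weights. They add up to m.\<close>

definition wexp :: "'m option \<Rightarrow> real" where
 "wexp i = (case i of None \<Rightarrow> p0 / p | Some j \<Rightarrow> 1 - 1 / ratio j)"

lemma p0p: "0 < p0"
 using p0_ge by simp

lemma ps_pos: "0 < ps j"
 using ps[of j] p0p by simp

lemma p_pos: "0 < p"
proof -
 have "0 < (\<Sum>j\<in>UNIV. 1 / ps j)"
  using ps_pos by (intro sum_pos) auto
 then have "0 < 1 / p"
  by (simp only: p)
 then show ?thesis
  by simp
qed

lemma ratio: "1 < ratio j"
 using ps[of j] p0p by (simp add: ratio_def)

lemma sum_ratio: "(\<Sum>j\<in>UNIV. 1 / ratio j) = p0 / p"
proof -
 have "(\<Sum>j\<in>UNIV. 1 / ratio j) = p0 * (\<Sum>j\<in>UNIV. 1 / ps j)"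
  by (simp add: ratio_def sum_distrib_left)
 also have "\<dots> = p0 * (1 / p)"
  by (simp only: p)
 finally show ?thesis
  by simp
qed

lemma sum_p_ps: "(\<Sum>j\<in>UNIV. p / ps j) = 1"
proof -
 have "(\<Sum>j\<in>UNIV. p / ps j) = p * (\<Sum>j\<in>UNIV. 1 / ps j)"
  by (simp add: sum_distrib_left)
 also have "\<dots> = p * (1 / p)"
  by (simp only: p)
 finally show ?thesis
  using p_pos by simp
qed

lemma weight_measurable: "\<omega> j \<in> borel_measurable lebesgue"
 using weights by (simp add: multi_weight_def weight_def)

lemma weight_pos: "AE x in lebesgue. \<forall>j. 0 < \<omega> j x"
proof -
 have "AE x in lebesgue. 0 < \<omega> j x" for j
  using weights by (simp add: multi_weight_def weight_def)
 then have "AE x in lebesgue. \<forall>j\<in>UNIV. 0 < \<omega> j x"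
  by (intro AE_finite_allI) auto
 then show ?thesis
  by simp
qed

lemma v_apply: "v x = (\<Prod>j\<in>UNIV. \<omega> j x powr (p / ps j))"
 by (simp only: v)

lemma wgt_None [simp]: "wgt None = v"
 by (simp add: wgt_def)

lemma wgt_Some [simp]: "wgt (Some j) = dual j"
 by (simp add: wgt_def)

lemma wgt_measurable: "wgt i \<in> borel_measurable lebesgue"
proof (cases i)
 case None
 have "(\<lambda>x. \<omega> j x powr (p / ps j)) \<in> borel_measurable lebesgue" for j
  using weight_measurable[of j] by measurable
 then have "v \<in> borel_measurable lebesgue"
  by (subst v) (rule borel_measurable_prod)
 then show ?thesis
  by (simp add: None)
next
 case (Some j)
 have "(\<lambda>x. \<omega> j x powr (1 - ratio j / (ratio j - 1))) \<in> borel_measurable lebesgue"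
  using weight_measurable[of j] by measurable
 then show ?thesis
  unfolding Some wgt_Some dual_def[abs_def] .
qed

lemma wgt_nonneg: "0 \<le> wgt i x"
 by (cases i) (simp_all add: v_apply dual_def prod_nonneg)

lemma wgt_pos: "AE x in lebesgue. \<forall>i. 0 < wgt i x"
 using weight_pos
proof eventually_elim
 case (elim x)
 show ?case
 proof
  fix i
  show "0 < wgt i x"
  proof (cases i)
   case None
   then show ?thesis
    using elim by (simp add: v_apply prod_pos less_imp_neq[THEN not_sym])
  next
   case (Some j)
   then show ?thesis
    using elim[rule_format, of j] by (simp add: dual_def)
  qed
 qed
qed

lemma wexp_pos: "0 < wexp i"
proof (cases i)
 case (Some j)
 then show ?thesis
  using ratio[of j] by (simp add: wexp_def field_simps)
qed (simp add: wexp_def p0p p_pos)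

lemma sum_wexp: "(\<Sum>i\<in>UNIV. wexp i) = real CARD('m)"
 unfolding sum_option by (simp add: wexp_def sum_subtractf sum_ratio)

text \<open>v contributes \<omega>_j to the power 1/r_j for every j, and \<sigma>_j contributes the
  power (1 - r_j') / r_j' = -1/r_j, which cancels it.\<close>

lemma wgt_prod: "AE x in lebesgue. (\<Prod>i\<in>UNIV. wgt i x powr wexp i) = 1"
 using weight_pos
proof eventually_elim
 case (elim x)
 have a: "v x powr (p0 / p) = (\<Prod>j\<in>UNIV. \<omega> j x powr (1 / ratio j))"
  unfolding v_apply using p_pos by (simp add: prod_powr_distrib powr_powr ratio_def)
 have b: "dual j x powr (1 - 1 / ratio j) = \<omega> j x powr (- (1 / ratio j))" for j
 proof -
  have "(1 - ratio j / (ratio j - 1)) * (1 - 1 / ratio j) = - (1 / ratio j)"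
   using ratio[of j] by (simp add: field_simps)
  then show ?thesis
   by (simp only: dual_def powr_powr)
 qed
 have "(\<Prod>i\<in>UNIV. wgt i x powr wexp i) = (\<Prod>j\<in>UNIV. \<omega> j x powr (1 / ratio j)) * (\<Prod>j\<in>UNIV. \<omega> j x powr (- (1 / ratio j)))"
  unfolding prod_option wexp_def by (simp only: wgt_None wgt_Some option.case a b)
 also have "\<dots> = (\<Prod>j\<in>UNIV. \<omega> j x powr (1 / ratio j) * \<omega> j x powr (- (1 / ratio j)))"
  by (rule prod.distrib[symmetric])
 also have "\<dots> = 1"
 proof (rule prod.neutral, rule ballI)
  fix j
  show "\<omega> j x powr (1 / ratio j) * \<omega> j x powr (- (1 / ratio j)) = 1"
   using elim[rule_format, of j] by (simp flip: powr_add)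
 qed
 finally show ?case .
qed

lemma emeasure_wgt: "S \<in> sets lebesgue \<Longrightarrow> emeasure (weighted (wgt i)) S = (\<integral>\<^sup>+x. ennreal (wgt i x) * indicator S x \<partial>lebesgue)"
 using wgt_measurable by (intro emeasure_density) auto

lemma ball_lebesgue_pos: "0 < \<rho> \<Longrightarrow> 0 < measure lebesgue (ball c \<rho> :: (real^'n) set)"
 by (subst measure_ball_vec) auto

lemma emeasure_ball_eq: "0 < \<rho> \<Longrightarrow> emeasure lebesgue (ball c \<rho> :: (real^'n) set) = ennreal (measure lebesgue (ball c \<rho>))"
 by (intro emeasure_eq_ennreal_measure) (simp add: emeasure_ball)

abbreviation muckenhoupt_le :: "real \<Rightarrow> real^'n \<Rightarrow> real \<Rightarrow> bool" where
 "muckenhoupt_le A c \<rho> \<equiv>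
  (\<Prod>i\<in>UNIV. measure (weighted (wgt i)) (ball c \<rho>) powr wexp i) \<le> A * measure lebesgue (ball c \<rho>) powr real CARD('m)"

text \<open>The supremum is unpacked into real inequalities. Finiteness of the single averages is
  part of the gain: the weights are positive a.e., so no factor vanishes and a finite product has
  finite factors.\<close>

lemma muckenhoupt:
 obtains A where "0 < A" "\<And>c \<rho> i. 0 < \<rho> \<Longrightarrow> emeasure (weighted (wgt i)) (ball c \<rho>) < \<infinity>"
  "\<And>c \<rho>. 0 < \<rho> \<Longrightarrow> muckenhoupt_le A c \<rho>"
proof -
 define S where "S = (SUP (c, \<rho>)\<in>UNIV \<times> {0<..}.
   ball_average c \<rho> (\<lambda>x. \<Prod>j\<in>UNIV. \<omega> j x powr ((1 / (\<Sum>j\<in>UNIV. 1 / (ps j / p0))) / (ps j / p0))) ennpowr (1 / (1 / (\<Sum>j\<in>UNIV. 1 / (ps j / p0))))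
     * (\<Prod>j\<in>UNIV. dual_weight_factor c \<rho> (ps j / p0) (\<omega> j)))"
 have S: "S < \<infinity>"
  using weights by (simp add: multi_weight_def Let_def S_def)
 have sr: "(\<Sum>j\<in>UNIV. 1 / (ps j / p0)) = p0 / p"
  using sum_ratio by (simp add: ratio_def)
 have veq: "(\<lambda>x. \<Prod>j\<in>UNIV. \<omega> j x powr ((1 / (p0 / p)) / (ps j / p0))) = v"
  by (subst v) (use p0p p_pos in simp)
 define y where "y c \<rho> i = ball_average c \<rho> (wgt i) ennpowr wexp i" for c :: "real^'n" and \<rho> i
 have dual: "dual_weight_factor c \<rho> (ps j / p0) (\<omega> j) = y c \<rho> (Some j)" for c \<rho> j
 proof -
  have R: "ratio j \<noteq> 1" "1 / (ratio j / (ratio j - 1)) = 1 - 1 / ratio j"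
   using ratio[of j] by (auto simp: field_simps)
  show ?thesis
   unfolding ratio_def[symmetric] dual_weight_factor_def y_def Let_def if_not_P[OF R(1)] R(2) wgt_Some dual_def[abs_def]
   by (simp add: wexp_def)
 qed
 have yS: "(\<Prod>i\<in>UNIV. y c \<rho> i) \<le> S" if "0 < \<rho>" for c \<rho>
 proof -
  have "(\<Prod>i\<in>UNIV. y c \<rho> i) = (case (c, \<rho>) of (c, \<rho>) \<Rightarrow> ball_average c \<rho> v ennpowr (p0 / p) * (\<Prod>j\<in>UNIV. dual_weight_factor c \<rho> (ps j / p0) (\<omega> j)))"
   unfolding prod_option dual by (simp add: y_def wexp_def)
  also have "\<dots> \<le> S"
   unfolding S_def sr veq using that by (intro SUP_upper2[of "(c, \<rho>)"]) auto
  finally show ?thesis .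
 qed
 obtain A0 where A0: "0 \<le> A0" "S = ennreal A0"
  using S by (cases S) auto
 \<comment> \<open>One is added so that the constant is positive even if the supremum is 0.\<close>
 define A where "A = A0 + 1"
 have A: "0 < A" "S \<le> ennreal A"
  using A0 by (auto simp: A_def intro: ennreal_leI)
 have wpos: "0 < emeasure (weighted (wgt i)) (ball c \<rho>)" if "0 < \<rho>" for c \<rho> i
 proof (rule measure_weighted_pos[OF wgt_measurable])
  show "AE x in lebesgue. 0 < wgt i x"
   using wgt_pos by eventually_elim simp
  show "0 < emeasure lebesgue (ball c \<rho>)"
   unfolding emeasure_ball_eq[OF that] using ball_lebesgue_pos[OF that, of c] by simp
 qed simp
 have yeq: "y c \<rho> i = (emeasure (weighted (wgt i)) (ball c \<rho>) / emeasure lebesgue (ball c \<rho>)) ennpowr wexp i" for c \<rho> i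
  unfolding y_def ball_average_def by (subst emeasure_wgt) auto
 have fin: "emeasure (weighted (wgt i)) (ball c \<rho>) < \<infinity>" if "0 < \<rho>" for c \<rho> i
 proof -
  have b: "emeasure lebesgue (ball c \<rho>) \<noteq> 0" "emeasure lebesgue (ball c \<rho>) \<noteq> top"
   unfolding emeasure_ball_eq[OF that] using ball_lebesgue_pos[OF that, of c] by auto
  have nz: "y c \<rho> i \<noteq> 0" for i
  proof
   assume "y c \<rho> i = 0"
   then have z: "emeasure (weighted (wgt i)) (ball c \<rho>) / emeasure lebesgue (ball c \<rho>) = 0"
    using wexp_pos[of i] unfolding yeq ennpowr_def by (auto split: if_splits simp: enn2real_eq_0_iff)
   then show False
    using wpos[OF that, of i c] b by (simp add: ennreal_divide_eq_0_iff)
  qed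
  have "(\<Prod>i\<in>UNIV. y c \<rho> i) < top"
   using yS[OF that, of c] A by (meson ennreal_less_top le_less_trans order_trans)
  then have "y c \<rho> i < top"
   using nz by (intro prod_ennreal_less_top_imp[of UNIV i "y c \<rho>"]) auto
  then have "emeasure (weighted (wgt i)) (ball c \<rho>) / emeasure lebesgue (ball c \<rho>) < \<infinity>"
   unfolding yeq using ennpowr_less_top by (simp add: infinity_ennreal_def)
  then have "emeasure (weighted (wgt i)) (ball c \<rho>) / emeasure lebesgue (ball c \<rho>) \<noteq> top"
   by simp
  then have "emeasure (weighted (wgt i)) (ball c \<rho>) \<noteq> top"
   using b by (auto simp: ennreal_divide_eq_top_iff)
  then show ?thesis
   by (simp add: less_top)
 qed
 show ?thesis
 proof (rule that[OF A(1) fin])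
  fix c :: "real^'n" and \<rho> :: real assume \<rho>: "0 < \<rho>"
  define B where "B = measure lebesgue (ball c \<rho>)"
  have B: "0 < B"
   unfolding B_def by (rule ball_lebesgue_pos[OF \<rho>])
  have "y c \<rho> i = ennreal ((measure (weighted (wgt i)) (ball c \<rho>) / B) powr wexp i)" for i
  proof -
   have "emeasure (weighted (wgt i)) (ball c \<rho>) = ennreal (measure (weighted (wgt i)) (ball c \<rho>))"
    using fin[OF \<rho>, of i c] by (intro emeasure_eq_ennreal_measure) (simp add: less_top)
   then have "emeasure (weighted (wgt i)) (ball c \<rho>) / emeasure lebesgue (ball c \<rho>) = ennreal (measure (weighted (wgt i)) (ball c \<rho>) / B)"
    unfolding emeasure_ball_eq[OF \<rho>] B_def[symmetric] using B by (simp only: divide_ennreal measure_nonneg)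
   then show ?thesis
    unfolding yeq using B by (simp only: ennpowr_ennreal divide_nonneg_pos measure_nonneg)
  qed
  then have "ennreal (\<Prod>i\<in>UNIV. (measure (weighted (wgt i)) (ball c \<rho>) / B) powr wexp i) \<le> ennreal A"
   using yS[OF \<rho>, of c] A(2) by (simp add: prod_ennreal)
  then have "(\<Prod>i\<in>UNIV. (measure (weighted (wgt i)) (ball c \<rho>) / B) powr wexp i) \<le> A"
   using A(1) by (subst (asm) ennreal_le_iff) auto
  moreover have "(\<Prod>i\<in>UNIV. (measure (weighted (wgt i)) (ball c \<rho>) / B) powr wexp i) = (\<Prod>i\<in>UNIV. measure (weighted (wgt i)) (ball c \<rho>) powr wexp i) / B powr real CARD('m)"
  proof -
   have "(\<Prod>i\<in>(UNIV :: 'm option set). B powr wexp i) = B powr real CARD('m)"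
    using B by (subst sum_wexp[symmetric]) (simp add: powr_sum)
   then show ?thesis
    using B by (simp add: powr_divide prod_dividef)
  qed
  ultimately show "muckenhoupt_le A c \<rho>"
   using B by (simp add: B_def[symmetric] divide_le_eq)
 qed
qed

text \<open>One constant for all m + 1 weights. It yields the doubling property when E is a smaller
  ball, and the comparability of a cube with its remainder when E is what the children leave
  over.\<close>

lemma wgt_comparison:
 assumes \<kappa>: "0 < \<kappa>"
 obtains \<Gamma> where "1 < \<Gamma>" "\<And>c \<rho> E i. 0 < \<rho> \<Longrightarrow> E \<in> sets lebesgue \<Longrightarrow> E \<subseteq> ball c \<rho> \<Longrightarrow> \<kappa> * measure lebesgue (ball c \<rho>) \<le> measure lebesgue E \<Longrightarrow>
   emeasure (weighted (wgt i)) (ball c \<rho>) \<le> ennreal \<Gamma> * emeasure (weighted (wgt i)) E"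
proof -
 obtain A where A: "0 < A" "\<And>c \<rho> i. 0 < \<rho> \<Longrightarrow> emeasure (weighted (wgt i)) (ball c \<rho>) < \<infinity>"
  "\<And>c \<rho>. 0 < \<rho> \<Longrightarrow> muckenhoupt_le A c \<rho>"
  by (rule muckenhoupt) (rule that; assumption)
 define g where "g i = (A * (1 / \<kappa>) powr real CARD('m)) powr (1 / wexp i)" for i
 \<comment> \<open>The sum dominates each single constant. The summand 2 makes \<Gamma> exceed 1, so
   that 1 - 1/\<Gamma> is a genuine contraction factor.\<close>
 define \<Gamma> where "\<Gamma> = 2 + (\<Sum>i\<in>UNIV. g i)"
 have g0: "0 \<le> g i" for i
  by (simp add: g_def)
 have \<Gamma>: "1 < \<Gamma>" "g i \<le> \<Gamma>" for i
 proof -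
  have "0 \<le> (\<Sum>i\<in>UNIV. g i)"
   by (intro sum_nonneg g0)
  then show "1 < \<Gamma>"
   by (simp add: \<Gamma>_def)
  have "g i \<le> (\<Sum>i\<in>UNIV. g i)"
   by (rule member_le_sum) (auto simp: g0)
  then show "g i \<le> \<Gamma>"
   by (simp add: \<Gamma>_def)
 qed
 show ?thesis
 proof (rule that[OF \<Gamma>(1)])
  fix c :: "real^'n" and \<rho> :: real and E i
  assume \<rho>: "0 < \<rho>" and E: "E \<in> sets lebesgue" "E \<subseteq> ball c \<rho>" "\<kappa> * measure lebesgue (ball c \<rho>) \<le> measure lebesgue E"
  have "measure (weighted (wgt i)) (ball c \<rho>) \<le> g i * measure (weighted (wgt i)) E"
   unfolding g_def
  proof (rule muckenhoupt_comparison[where I = UNIV and u = wgt and e = wexp and m = "real CARD('m)"])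
   show "0 < measure lebesgue (ball c \<rho>)"
    by (rule ball_lebesgue_pos[OF \<rho>])
   show "emeasure lebesgue (ball c \<rho>) < \<infinity>"
    unfolding emeasure_ball_eq[OF \<rho>] by simp
   show "muckenhoupt_le A c \<rho>"
    by (rule A(3)[OF \<rho>])
  qed (use A \<rho> E \<kappa> wexp_pos sum_wexp wgt_measurable wgt_nonneg wgt_prod in auto)
  also have "\<dots> \<le> \<Gamma> * measure (weighted (wgt i)) E"
   by (intro mult_right_mono \<Gamma>) simp
  finally have le: "measure (weighted (wgt i)) (ball c \<rho>) \<le> \<Gamma> * measure (weighted (wgt i)) E" .
  have finE: "emeasure (weighted (wgt i)) E \<noteq> top"
   using emeasure_mono[OF E(2), of "weighted (wgt i)"] A(2)[OF \<rho>, of i c] by (auto simp: top_unique)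
  have "emeasure (weighted (wgt i)) (ball c \<rho>) = ennreal (measure (weighted (wgt i)) (ball c \<rho>))"
   using A(2)[OF \<rho>, of i c] by (intro emeasure_eq_ennreal_measure) (simp add: less_top)
  also have "\<dots> \<le> ennreal (\<Gamma> * measure (weighted (wgt i)) E)"
   by (rule ennreal_leI[OF le])
  also have "\<dots> = ennreal \<Gamma> * emeasure (weighted (wgt i)) E"
   using \<Gamma>(1) by (simp add: ennreal_mult' emeasure_eq_ennreal_measure[OF finE])
  finally show "emeasure (weighted (wgt i)) (ball c \<rho>) \<le> ennreal \<Gamma> * emeasure (weighted (wgt i)) E" .
 qed
qed

end

text \<open>The sum over generations becomes one integral over pairs (generation, cell), so that
  Carleson embedding and Hoelder's inequality can be applied on a single countable index
  set.\<close>

lemma nn_integral_Sigma_count_space: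
 fixes F :: "'b \<Rightarrow> ennreal"
 shows "(\<Sum>i. \<integral>\<^sup>+q. F q \<partial>count_space (G i)) = (\<integral>\<^sup>+z. F (snd z) \<partial>count_space {z. snd z \<in> G (fst z)})"
proof -
 have "(\<Sum>i. \<integral>\<^sup>+q. F q \<partial>count_space (G i)) = (\<integral>\<^sup>+i. (\<integral>\<^sup>+q. F q \<partial>count_space (G i)) \<partial>count_space UNIV)"
  by (rule nn_integral_count_space_nat[symmetric])
 also have "\<dots> = (\<integral>\<^sup>+i. (\<integral>\<^sup>+q. F q * indicator {z. snd z \<in> G (fst z)} (i, q) \<partial>count_space UNIV) \<partial>count_space UNIV)"
  by (intro nn_integral_cong) (simp add: nn_integral_count_space_indicator indicator_def)
 also have "\<dots> = (\<integral>\<^sup>+z. F (snd z) * indicator {z. snd z \<in> G (fst z)} z \<partial>count_space UNIV)"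
  using nn_integral_fst_count_space[of "\<lambda>z. F (snd z) * indicator {z. snd z \<in> G (fst z)} z"] by simp
 also have "\<dots> = (\<integral>\<^sup>+z. F (snd z) \<partial>count_space {z. snd z \<in> G (fst z)})"
  by (simp add: nn_integral_count_space_indicator)
 finally show ?thesis .
qed

text \<open>A cell of a later generation lies in a child of some cell of the earlier one: if that is
  the given cell, the child has been removed from its remainder; otherwise the two cells are
  disjoint.\<close>

lemma disjoint_generation_remainders:
 assumes sub: "\<And>q q'. q' \<in> ch q \<Longrightarrow> X q' \<subseteq> X q" and disj: "\<And>q. disjoint_family_on X (ch q)"
 shows "disjoint_family_on (\<lambda>z. X (snd z) - (\<Union>q\<in>ch (snd z). X q)) {z. snd z \<in> generation ch q\<^sub>0 (fst z)}"
proof -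
 define E where "E q = X q - (\<Union>q'\<in>ch q. X q')" for q
 have dis: "disjoint_family_on X (generation ch q\<^sub>0 i)" for i
  by (rule disjoint_generation[OF sub disj])
 have less: "E q \<inter> E q' = {}" if q: "q \<in> generation ch q\<^sub>0 i" "q' \<in> generation ch q\<^sub>0 i'" and i: "i < i'" for q q' i i'
 proof -
  obtain d where d: "i' = i + Suc d"
   using i less_iff_Suc_add by auto
  have "q' \<in> (\<Union>a\<in>generation ch q\<^sub>0 i. generation ch a (Suc d))"
   using q(2) unfolding d generation_add .
  then obtain a b where a: "a \<in> generation ch q\<^sub>0 i" "b \<in> ch a" "q' \<in> generation ch b d"
   unfolding generation_Suc' by auto
  have Xb: "X q' \<subseteq> X b"
   by (rule generation_subset[OF sub a(3)])
  show ?thesis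
  proof (cases "a = q")
   case True
   then show ?thesis
    using Xb a(2) by (auto simp: E_def)
  next
   case False
   then have "X a \<inter> X q = {}"
    using dis[of i] a(1) q(1) unfolding disjoint_family_on_def by simp
   then show ?thesis
    using Xb sub[OF a(2)] by (auto simp: E_def)
  qed
 qed
 have "disjoint_family_on (\<lambda>z. E (snd z)) {z. snd z \<in> generation ch q\<^sub>0 (fst z)}"
  unfolding disjoint_family_on_def
 proof (intro ballI impI)
  fix z z' assume z: "z \<in> {z. snd z \<in> generation ch q\<^sub>0 (fst z)}" "z' \<in> {z. snd z \<in> generation ch q\<^sub>0 (fst z)}" "z \<noteq> z'"
  then have m: "snd z \<in> generation ch q\<^sub>0 (fst z)" "snd z' \<in> generation ch q\<^sub>0 (fst z')"
   by auto
  consider "fst z < fst z'" | "fst z' < fst z" | "fst z = fst z'"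
   by linarith
  then show "E (snd z) \<inter> E (snd z') = {}"
  proof cases
   case 1
   then show ?thesis by (rule less[OF m])
  next
   case 2
   then have "E (snd z') \<inter> E (snd z) = {}" by (rule less[OF m(2,1)])
   then show ?thesis by (simp add: Int_commute)
  next
   case 3
   then have "snd z \<noteq> snd z'" "snd z' \<in> generation ch q\<^sub>0 (fst z)"
    using z m by (auto simp: prod_eq_iff)
   then have "X (snd z) \<inter> X (snd z') = {}"
    using dis[of "fst z"] m(1) unfolding disjoint_family_on_def by simp
   then show ?thesis
    by (auto simp: E_def)
  qed
 qed
 then show ?thesis
  by (simp only: E_def)
qed

context multiple_weights
begin

lemma AE_wgt_pos: "AE x in lebesgue. 0 < wgt i x"
 using wgt_pos by eventually_elim (rule spec)

lemma AE_dual_pos: "AE x in lebesgue. 0 < dual j x"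
 using AE_wgt_pos[of "Some j"] by (simp only: wgt_Some)

abbreviation input_norms :: "('m \<Rightarrow> real^'n \<Rightarrow> complex) \<Rightarrow> ('m \<Rightarrow> real) \<Rightarrow> bool" where
 "input_norms f N \<equiv> \<forall>k. 0 \<le> N k \<and> (\<integral>\<^sup>+x. ennreal (norm (f k x) powr ps k) * ennreal (\<omega> k x) \<partial>lebesgue) \<le> ennreal (N k powr ps k)"

abbreviation sparse_sum :: "real \<Rightarrow> ('m \<Rightarrow> real^'n \<Rightarrow> complex) \<Rightarrow> ('n cube_index \<Rightarrow> 'n cube_index set) \<Rightarrow> 'n cube_index \<Rightarrow> ennreal" where
 "sparse_sum L f ch R \<equiv>
  (\<Sum>i. \<integral>\<^sup>+Q. ennreal (cube_avg L p0 f Q powr p) * emeasure (weighted v) (dyadic_cube L Q) \<partial>count_space (generation ch R i))"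

text \<open>Raised to the power p/p0, the weight condition bounds v(B) by |B|^(m p/p0) over powers
  of the \<sigma>_j(B). The same power of |B| is the denominator of the p-th power of the product of
  averages, so Lebesgue measure disappears and only averages with respect to the \<sigma>_j
  remain.\<close>

lemma cube_avg_weight_le:
 assumes A: "0 < A" "\<And>c \<rho> i. 0 < \<rho> \<Longrightarrow> emeasure (weighted (wgt i)) (ball c \<rho>) < \<infinity>"
  "\<And>c \<rho>. 0 < \<rho> \<Longrightarrow> muckenhoupt_le A c \<rho>"
  and L: "0 < L"
 shows "cube_avg L p0 f Q powr p * measure (weighted v) (cube_ball L Q) \<le>
  A powr (p / p0) * (\<Prod>j\<in>UNIV. ((mass p0 f j (cube_ball L Q) / measure (weighted (dual j)) (cube_ball L Q)) powr ratio j
    * measure (weighted (dual j)) (cube_ball L Q)) powr (p / ps j))"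
proof -
 define b where "b = measure lebesgue (cube_ball L Q)"
 define V where "V = measure (weighted v) (cube_ball L Q)"
 define S where "S j = measure (weighted (dual j)) (cube_ball L Q)" for j
 define M where "M j = mass p0 f j (cube_ball L Q)" for j
 note \<rho> = cube_radius_pos[OF L, of Q]
 have b: "0 < b"
  unfolding b_def by (rule ball_lebesgue_pos[OF \<rho>])
 have V: "0 \<le> V" and M: "0 \<le> M j" for j
  by (simp_all add: V_def M_def mass_def)
 have S: "0 < S j" for j
 proof -
  have "0 < emeasure (weighted (wgt (Some j))) (cube_ball L Q)"
  proof (rule measure_weighted_pos[OF wgt_measurable AE_wgt_pos])
   show "0 < emeasure lebesgue (cube_ball L Q)"
    unfolding emeasure_ball_eq[OF \<rho>] using b by (simp add: b_def)
  qed simp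
  then show ?thesis
   using A(2)[OF \<rho>, of "Some j"] unfolding S_def measure_def by (simp add: enn2real_positive_iff less_top)
 qed
 have s0: "0 < p / p0"
  using p_pos p0p by simp
 \<comment> \<open>Equal to p/p0 - p/ps j, which is how the powers of \<sigma>_j(B) regroup into
   (M/S)^(r_j) S raised to p/ps j.\<close>
 define e where "e j = (1 - 1 / ratio j) * (p / p0)" for j
 have "V powr (p0 / p) * (\<Prod>j\<in>UNIV. S j powr (1 - 1 / ratio j)) \<le> A * b powr real CARD('m)"
  using A(3)[OF \<rho>, of "cube_center L Q"] unfolding prod_option by (simp add: wexp_def V_def S_def b_def)
 then have "(V powr (p0 / p) * (\<Prod>j\<in>UNIV. S j powr (1 - 1 / ratio j))) powr (p / p0) \<le> (A * b powr real CARD('m)) powr (p / p0)"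
  using V S s0 by (intro powr_mono2) (auto intro!: mult_nonneg_nonneg prod_nonneg)
 also have "(V powr (p0 / p) * (\<Prod>j\<in>UNIV. S j powr (1 - 1 / ratio j))) powr (p / p0) = V * (\<Prod>j\<in>UNIV. S j powr e j)"
 proof -
  have "(V powr (p0 / p)) powr (p / p0) = V"
   using V p_pos p0p by (simp add: powr_powr)
  moreover have "(\<Prod>j\<in>UNIV. S j powr (1 - 1 / ratio j)) powr (p / p0) = (\<Prod>j\<in>UNIV. S j powr e j)"
   by (simp add: prod_powr_distrib powr_powr e_def)
  ultimately show ?thesis
   by (simp add: powr_mult prod_nonneg)
 qed
 also have "(A * b powr real CARD('m)) powr (p / p0) = A powr (p / p0) * b powr (real CARD('m) * (p / p0))"
  using A(1) b by (simp only: powr_mult powr_powr)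
 finally have muck: "V * (\<Prod>j\<in>UNIV. S j powr e j) \<le> A powr (p / p0) * b powr (real CARD('m) * (p / p0))" .
 have Se: "0 < (\<Prod>j\<in>UNIV. S j powr e j)"
  using S by (intro prod_pos) (simp add: less_imp_neq[THEN not_sym])
 have bp: "0 < b powr (real CARD('m) * (p / p0))"
  using b by simp
 have VV: "V / b powr (real CARD('m) * (p / p0)) \<le> A powr (p / p0) / (\<Prod>j\<in>UNIV. S j powr e j)"
  using muck Se bp by (simp add: field_simps)
 have avg: "cube_avg L p0 f Q powr p = (\<Prod>j\<in>UNIV. M j powr (p / p0)) / b powr (real CARD('m) * (p / p0))"
 proof -
  have "cube_avg L p0 f Q powr p = (\<Prod>j\<in>UNIV. ((M j / b) powr (1 / p0)) powr p)"
   unfolding cube_avg_def M_def b_def by (rule prod_powr_distrib)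
  also have "\<dots> = (\<Prod>j\<in>UNIV. M j powr (p / p0) / b powr (p / p0))"
   using M b by (intro prod.cong refl) (simp add: powr_powr powr_divide)
  also have "\<dots> = (\<Prod>j\<in>UNIV. M j powr (p / p0)) / (b powr (p / p0)) ^ CARD('m)"
   by (simp add: prod_dividef)
  also have "(b powr (p / p0)) ^ CARD('m) = b powr (real CARD('m) * (p / p0))"
   using b by (simp add: powr_realpow[symmetric] powr_powr mult.commute)
  finally show ?thesis .
 qed
 have fac: "((M j / S j) powr ratio j * S j) powr (p / ps j) = M j powr (p / p0) / S j powr e j" for j
 proof -
  have e1: "ratio j * (p / ps j) = p / p0" "p / ps j - p / p0 = - e j"
   using ps_pos[of j] p0p by (simp_all add: ratio_def e_def field_simps)
  have "((M j / S j) powr ratio j * S j) powr (p / ps j) = (M j / S j) powr (ratio j * (p / ps j)) * S j powr (p / ps j)"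
   using S[of j] M[of j] by (simp only: powr_mult powr_powr)
  also have "\<dots> = M j powr (p / p0) * (S j powr (p / ps j) / S j powr (p / p0))"
   unfolding e1 using S[of j] M[of j] by (simp add: powr_divide)
  also have "S j powr (p / ps j) / S j powr (p / p0) = S j powr (- e j)"
   by (simp only: powr_diff[symmetric] e1)
  finally show ?thesis
   by (simp add: powr_minus divide_inverse)
 qed
 have "cube_avg L p0 f Q powr p * V = (\<Prod>j\<in>UNIV. M j powr (p / p0)) * (V / b powr (real CARD('m) * (p / p0)))"
  unfolding avg by simp
 also have "\<dots> \<le> (\<Prod>j\<in>UNIV. M j powr (p / p0)) * (A powr (p / p0) / (\<Prod>j\<in>UNIV. S j powr e j))"
  by (intro mult_left_mono VV prod_nonneg) auto
 also have "\<dots> = A powr (p / p0) * (\<Prod>j\<in>UNIV. ((M j / S j) powr ratio j * S j) powr (p / ps j))"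
  unfolding fac by (simp add: prod_dividef)
 finally show ?thesis
  unfolding V_def M_def S_def .
qed

text \<open>For each j the averages of h_j with respect to \<sigma>_j are summed by Carleson
  embedding over the disjoint remainders, whose \<sigma>_j-measure is comparable to that of the
  balls. The m sums are combined by Hoelder's inequality on the index set with exponents p/ps j,
  which add up to 1.\<close>

proposition sparse_sum_bound:
 "\<exists>C\<ge>0. \<forall>f N L ch root. (\<forall>k. f k \<in> bounded_compact_support) \<longrightarrow>
   input_norms f N \<longrightarrow> 0 < L \<longrightarrow>
   (\<forall>Q. \<forall>P\<in>ch Q. dyadic_cube L P \<subseteq> dyadic_cube L Q) \<longrightarrow>
   (\<forall>Q. disjoint_family_on (dyadic_cube L) (ch Q)) \<longrightarrow>
   (\<forall>Q. 3/4 * cube_side L Q ^ CARD('n) \<le> measure lebesgue (dyadic_cube L Q - (\<Union>P\<in>ch Q. dyadic_cube L P))) \<longrightarrow>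
   sparse_sum L f ch root
    \<le> ennreal (C * (\<Prod>k\<in>UNIV. N k powr p))"
proof -
 obtain A where A: "0 < A" "\<And>c \<rho> i. 0 < \<rho> \<Longrightarrow> emeasure (weighted (wgt i)) (ball c \<rho>) < \<infinity>"
  "\<And>c \<rho>. 0 < \<rho> \<Longrightarrow> muckenhoupt_le A c \<rho>"
  by (rule muckenhoupt) (rule that; assumption)
 define \<beta> where "\<beta> = unit_ball_vol CARD('n) * (5 * sqrt CARD('n)) ^ CARD('n)"
 have \<beta>: "0 < \<beta>"
  by (simp add: \<beta>_def unit_ball_vol_pos)
 \<comment> \<open>A ball is the fraction 5^(-n) of its fivefold dilate; comparison at this ratio is
   the doubling property.\<close>
 have "(0::real) < 1 / 5 ^ CARD('n)"
  by simp
 then obtain \<Gamma>1 where \<Gamma>1: "1 < \<Gamma>1" "\<And>c \<rho> E i. 0 < \<rho> \<Longrightarrow> E \<in> sets lebesgue \<Longrightarrow> E \<subseteq> ball c \<rho> \<Longrightarrow> 1 / 5 ^ CARD('n) * measure lebesgue (ball c \<rho>) \<le> measure lebesgue E \<Longrightarrow>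
   emeasure (weighted (wgt i)) (ball c \<rho>) \<le> ennreal \<Gamma>1 * emeasure (weighted (wgt i)) E"
  by (rule wgt_comparison) (rule that; assumption)
 \<comment> \<open>The remainder holds three quarters of the cube, and the ball is \<beta> times as
   large as the cube.\<close>
 have "0 < 3 / (4 * \<beta>)"
  using \<beta> by simp
 then obtain \<Gamma>2 where \<Gamma>2: "1 < \<Gamma>2" "\<And>c \<rho> E i. 0 < \<rho> \<Longrightarrow> E \<in> sets lebesgue \<Longrightarrow> E \<subseteq> ball c \<rho> \<Longrightarrow> 3 / (4 * \<beta>) * measure lebesgue (ball c \<rho>) \<le> measure lebesgue E \<Longrightarrow>
   emeasure (weighted (wgt i)) (ball c \<rho>) \<le> ennreal \<Gamma>2 * emeasure (weighted (wgt i)) E"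
  by (rule wgt_comparison) (rule that; assumption)
 define cc where "cc j = 4 powr ratio j / (1 - 2 powr (1 - ratio j))" for j
 have cc: "0 < cc j" for j
 proof -
  have "2 powr (1 - ratio j) < 2 powr (0::real)"
   using ratio[of j] by (intro powr_less_mono) auto
  then show ?thesis
   by (simp add: cc_def)
 qed
 define H where "H j = \<Gamma>2 * (cc j * \<Gamma>1)" for j
 have H: "0 < H j" for j
  using \<Gamma>1(1) \<Gamma>2(1) cc[of j] by (simp add: H_def)
 define C where "C = A powr (p / p0) * (\<Prod>j\<in>UNIV. H j powr (p / ps j))"
 have doubling: "emeasure (weighted (dual j)) (ball c (5 * \<rho>)) \<le> ennreal \<Gamma>1 * emeasure (weighted (dual j)) (ball c \<rho>)" if "0 < \<rho>" for j c \<rho>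
 proof -
  have "emeasure (weighted (wgt (Some j))) (ball c (5 * \<rho>)) \<le> ennreal \<Gamma>1 * emeasure (weighted (wgt (Some j))) (ball c \<rho>)"
  proof (rule \<Gamma>1(2))
   show "1 / 5 ^ CARD('n) * measure lebesgue (ball c (5 * \<rho>)) \<le> measure lebesgue (ball c \<rho>)"
    using that by (simp add: measure_ball_vec power_mult_distrib del: measure_completion)
  qed (use that in auto)
  then show ?thesis
   by simp
 qed
 show ?thesis
 proof (intro exI[of _ C] conjI allI impI)
  show "0 \<le> C"
   unfolding C_def by (intro mult_nonneg_nonneg prod_nonneg) auto
 next
  fix f :: "'m \<Rightarrow> real^'n \<Rightarrow> complex" and N :: "'m \<Rightarrow> real" and L :: real
   and ch :: "'n cube_index \<Rightarrow> 'n cube_index set" and root :: "'n cube_index"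
  assume f: "\<forall>k. f k \<in> bounded_compact_support"
   and N: "input_norms f N"
   and L: "0 < L" and sub: "\<forall>Q. \<forall>P\<in>ch Q. dyadic_cube L P \<subseteq> dyadic_cube L Q"
   and disj: "\<forall>Q. disjoint_family_on (dyadic_cube L) (ch Q)"
   and big: "\<forall>Q. 3/4 * cube_side L Q ^ CARD('n) \<le> measure lebesgue (dyadic_cube L Q - (\<Union>P\<in>ch Q. dyadic_cube L P))"
  define J where "J = {z. snd z \<in> generation ch root (fst z)}"
  have J: "countable J"
   by simp
  define E where "E Q = dyadic_cube L Q - (\<Union>P\<in>ch Q. dyadic_cube L P)" for Q
  have Em: "E Q \<in> sets lebesgue" for Q
   unfolding E_def by (intro sets.Diff sets.countable_UN' sets_lebesgue_dyadic_cube[OF L] countableI_type image_subsetI)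
  have EB: "E Q \<subseteq> cube_ball L Q" for Q
   using dyadic_cube_subset_ball[OF L, of Q] by (auto simp: E_def)
  have Ecmp: "emeasure (weighted (dual j)) (cube_ball L Q) \<le> ennreal \<Gamma>2 * emeasure (weighted (dual j)) (E Q)" for j Q
  proof -
   have "emeasure (weighted (wgt (Some j))) (cube_ball L Q) \<le> ennreal \<Gamma>2 * emeasure (weighted (wgt (Some j))) (E Q)"
   proof (rule \<Gamma>2(2)[OF cube_radius_pos[OF L] Em EB])
    show "3 / (4 * \<beta>) * measure lebesgue (cube_ball L Q) \<le> measure lebesgue (E Q)"
     using big[rule_format, of Q] \<beta> unfolding measure_cube_ball[OF L] \<beta>_def[symmetric] E_def by simp
   qed
   then show ?thesis by simp
  qed
  define S where "S j Q = measure (weighted (dual j)) (cube_ball L Q)" for j Q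
  have Sfin: "emeasure (weighted (dual j)) (cube_ball L Q) = ennreal (S j Q)" for j Q
   using A(2)[OF cube_radius_pos[OF L], of "Some j" "cube_center L Q"] unfolding S_def
   by (intro emeasure_eq_ennreal_measure) (simp add: less_top)
  \<comment> \<open>The density of |f_j|^p0 with respect to \<sigma>_j, so that \<alpha> j Q is the
    average of h j over the ball of Q for the measure \<sigma>_j.\<close>
  define h where "h j x = norm (f j x) powr p0 / dual j x" for j x
  define \<alpha> where "\<alpha> j Q = mass p0 f j (cube_ball L Q) / S j Q" for j Q
  have \<alpha>0: "0 \<le> \<alpha> j Q" for j Q
   by (simp add: \<alpha>_def S_def mass_def)
  have fm: "f j \<in> borel_measurable lebesgue" for j
   using f by (simp add: bounded_compact_support_def)
  have dm: "dual j \<in> borel_measurable lebesgue" for j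
   using wgt_measurable[of "Some j"] by simp
  have hm: "h j \<in> borel_measurable lebesgue" for j
   unfolding h_def[abs_def] using fm[of j] dm[of j] by measurable
  have h0: "0 \<le> h j x" for j x
   using wgt_nonneg[of "Some j" x] by (simp add: h_def)
  note dpos = AE_dual_pos
  have massle: "ennreal (\<alpha> j Q) * emeasure (weighted (dual j)) (cube_ball L Q) \<le> (\<integral>\<^sup>+x\<in>cube_ball L Q. ennreal (h j x) \<partial>weighted (dual j))" for j Q
  proof -
   have "ennreal (\<alpha> j Q) * emeasure (weighted (dual j)) (cube_ball L Q) = ennreal (\<alpha> j Q * S j Q)"
    unfolding Sfin using \<alpha>0 by (simp add: ennreal_mult')
   also have "\<dots> \<le> ennreal (mass p0 f j (cube_ball L Q))"
    by (intro ennreal_leI) (simp add: \<alpha>_def mass_def)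
   also have "\<dots> = (\<integral>\<^sup>+x. ennreal (norm (f j x) powr p0) * indicator (cube_ball L Q) x \<partial>lebesgue)"
    using f p0p by (intro emeasure_weighted_eq_mass[symmetric]) auto
   also have "\<dots> = (\<integral>\<^sup>+x. ennreal (dual j x) * (ennreal (h j x) * indicator (cube_ball L Q) x) \<partial>lebesgue)"
    using dpos[of j] by (intro nn_integral_cong_AE, eventually_elim)
     (auto simp: h_def indicator_def simp flip: ennreal_mult)
   also have "\<dots> = (\<integral>\<^sup>+x\<in>cube_ball L Q. ennreal (h j x) \<partial>weighted (dual j))"
    by (intro nn_integral_density[symmetric] measurable_compose[OF dm measurable_ennreal]
      borel_measurable_times_ennreal measurable_compose[OF hm measurable_ennreal] borel_measurable_indicator) simp
   finally show ?thesis .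
  qed
  \<comment> \<open>The choice of the dual weight pays off: \<sigma>_j^(1 - r_j) = \<omega>_j
    because (1 - r_j')(1 - r_j) = 1, so the L^(r_j)(\<sigma>_j) norm of h_j returns the weighted
    norm of f_j.\<close>
  have hint: "(\<integral>\<^sup>+x. ennreal (h j x powr ratio j) \<partial>weighted (dual j)) \<le> ennreal (N j powr ps j)" for j
  proof -
   have R: "ratio j \<noteq> 0" "ratio j - 1 \<noteq> 0" "p0 * ratio j = ps j"
    using ratio[of j] p0p by (auto simp: ratio_def)
   have "(\<integral>\<^sup>+x. ennreal (h j x powr ratio j) \<partial>weighted (dual j)) = (\<integral>\<^sup>+x. ennreal (dual j x) * ennreal (h j x powr ratio j) \<partial>lebesgue)"
    using dm[of j] hm[of j] by (intro nn_integral_density) auto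
   also have "\<dots> = (\<integral>\<^sup>+x. ennreal (norm (f j x) powr ps j) * ennreal (\<omega> j x) \<partial>lebesgue)"
   proof (intro nn_integral_cong_AE)
    show "AE x in lebesgue. ennreal (dual j x) * ennreal (h j x powr ratio j) = ennreal (norm (f j x) powr ps j) * ennreal (\<omega> j x)"
     using dpos[of j] weight_pos
    proof eventually_elim
     case (elim x)
     have w: "0 < \<omega> j x"
      using elim by simp
     have "dual j x * h j x powr ratio j = norm (f j x) powr ps j * (dual j x powr 1 / dual j x powr ratio j)"
      using elim(1) by (simp add: h_def powr_divide powr_powr R)
     also have "dual j x powr 1 / dual j x powr ratio j = dual j x powr (1 - ratio j)"
      by (rule powr_diff[symmetric])
     also have "dual j x powr (1 - ratio j) = \<omega> j x powr ((1 - ratio j / (ratio j - 1)) * (1 - ratio j))"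
      by (simp only: dual_def powr_powr)
     also have "(1 - ratio j / (ratio j - 1)) * (1 - ratio j) = 1"
      using R by (simp add: field_simps)
     also have "\<omega> j x powr 1 = \<omega> j x"
      using w by simp
     finally show ?case
      using elim(1) w by (simp flip: ennreal_mult)
    qed
   qed
   also have "\<dots> \<le> ennreal (N j powr ps j)"
    using N by simp
   finally show ?thesis .
  qed
  have car: "(\<integral>\<^sup>+z. ennreal (\<alpha> j (snd z) powr ratio j * S j (snd z)) \<partial>count_space J) \<le> ennreal (H j * N j powr ps j)" for j
  proof -
   have "(\<integral>\<^sup>+z. ennreal (\<alpha> j (snd z) powr ratio j * S j (snd z)) \<partial>count_space J) \<le>
    (\<integral>\<^sup>+z. ennreal \<Gamma>2 * (ennreal (\<alpha> j (snd z) powr ratio j) * emeasure (weighted (dual j)) (E (snd z))) \<partial>count_space J)"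
   proof (intro nn_integral_mono)
    fix z
    have "ennreal (\<alpha> j (snd z) powr ratio j * S j (snd z)) = ennreal (\<alpha> j (snd z) powr ratio j) * emeasure (weighted (dual j)) (cube_ball L (snd z))"
     unfolding Sfin by (simp add: ennreal_mult')
    also have "\<dots> \<le> ennreal (\<alpha> j (snd z) powr ratio j) * (ennreal \<Gamma>2 * emeasure (weighted (dual j)) (E (snd z)))"
     by (intro mult_left_mono Ecmp) simp
    finally show "ennreal (\<alpha> j (snd z) powr ratio j * S j (snd z)) \<le> ennreal \<Gamma>2 * (ennreal (\<alpha> j (snd z) powr ratio j) * emeasure (weighted (dual j)) (E (snd z)))"
     by (simp add: mult.left_commute)
   qed
   also have "\<dots> = ennreal \<Gamma>2 * (\<integral>\<^sup>+z. ennreal (\<alpha> j (snd z) powr ratio j) * emeasure (weighted (dual j)) (E (snd z)) \<partial>count_space J)"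
    by (rule nn_integral_cmult) simp
   also have "\<dots> \<le> ennreal \<Gamma>2 * (ennreal (cc j) * ennreal \<Gamma>1 * (\<integral>\<^sup>+x. ennreal (h j x powr ratio j) \<partial>weighted (dual j)))"
   proof (intro mult_left_mono)
    show "(\<integral>\<^sup>+z. ennreal (\<alpha> j (snd z) powr ratio j) * emeasure (weighted (dual j)) (E (snd z)) \<partial>count_space J)
     \<le> ennreal (cc j) * ennreal \<Gamma>1 * (\<integral>\<^sup>+x. ennreal (h j x powr ratio j) \<partial>weighted (dual j))"
     unfolding cc_def
    \<comment> \<open>The value for B is the radius belonging to generation 0, where the cubes are
      largest.\<close>
    proof (rule carleson_embedding[where E = "\<lambda>z. E (snd z)" and a = "\<lambda>z. cube_center L (snd z)" and \<rho> = "\<lambda>z. cube_radius L (snd z)"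
       and \<alpha> = "\<lambda>z. \<alpha> j (snd z)" and B = "5 * sqrt CARD('n) * (2 * L)"])
     show "emeasure (weighted (dual j)) (ball c \<rho>) < \<infinity>" for c \<rho>
     proof (cases "0 < \<rho>")
      case True
      then show ?thesis
       using A(2)[of \<rho> "Some j" c] by simp
     next
      case False
      then have "ball c \<rho> = {}"
       by simp
      then show ?thesis
       by (simp only: emeasure_empty infinity_ennreal_def top_greatest ennreal_zero_less_top)
     qed
     show "disjoint_family_on (\<lambda>z. E (snd z)) J"
      unfolding E_def J_def by (rule disjoint_generation_remainders[where X = "dyadic_cube L" and ch = ch and q\<^sub>0 = root]) (use sub disj in blast)+
     show "0 < cube_radius L (snd z) \<and> cube_radius L (snd z) \<le> 5 * sqrt CARD('n) * (2 * L)" for z :: "nat \<times> 'n cube_index"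
     proof
      show "0 < cube_radius L (snd z)"
       by (rule cube_radius_pos[OF L])
      have "2 * L / 2 ^ fst (snd z) \<le> 2 * L / 1"
       using L by (intro divide_left_mono) auto
      then show "cube_radius L (snd z) \<le> 5 * sqrt CARD('n) * (2 * L)"
       unfolding cube_radius_def cube_side_def by (intro mult_left_mono) auto
     qed
    qed (use doubling hm h0 J Em EB \<alpha>0 massle ratio in auto)
   qed simp
   also have "\<dots> \<le> ennreal \<Gamma>2 * (ennreal (cc j) * ennreal \<Gamma>1 * ennreal (N j powr ps j))"
    by (intro mult_left_mono hint) auto
   also have "\<dots> = ennreal (H j * N j powr ps j)"
    unfolding H_def using cc[of j] \<Gamma>1(1) \<Gamma>2(1) by (simp add: ennreal_mult' mult.assoc)
   finally show ?thesis .
  qed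
  have "sparse_sum L f ch root
   = (\<integral>\<^sup>+z. ennreal (cube_avg L p0 f (snd z) powr p) * emeasure (weighted v) (dyadic_cube L (snd z)) \<partial>count_space J)"
   unfolding J_def by (rule nn_integral_Sigma_count_space)
  also have "\<dots> \<le> (\<integral>\<^sup>+z. ennreal (A powr (p / p0)) * ennreal (\<Prod>j\<in>UNIV. (\<alpha> j (snd z) powr ratio j * S j (snd z)) powr (p / ps j)) \<partial>count_space J)"
  proof (intro nn_integral_mono)
   fix z :: "nat \<times> 'n cube_index"
   define Q where "Q = snd z"
   have "emeasure (weighted v) (dyadic_cube L Q) \<le> emeasure (weighted v) (cube_ball L Q)"
    by (intro emeasure_mono dyadic_cube_subset_ball[OF L]) simp
   also have "\<dots> = ennreal (measure (weighted v) (cube_ball L Q))"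
    using A(2)[OF cube_radius_pos[OF L], of None "cube_center L Q"] by (intro emeasure_eq_ennreal_measure) (simp add: less_top)
   finally have "ennreal (cube_avg L p0 f Q powr p) * emeasure (weighted v) (dyadic_cube L Q)
     \<le> ennreal (cube_avg L p0 f Q powr p) * ennreal (measure (weighted v) (cube_ball L Q))"
    by (intro mult_left_mono) auto
   also have "\<dots> = ennreal (cube_avg L p0 f Q powr p * measure (weighted v) (cube_ball L Q))"
    by (simp add: ennreal_mult')
   also have "\<dots> \<le> ennreal (A powr (p / p0) * (\<Prod>j\<in>UNIV. (\<alpha> j Q powr ratio j * S j Q) powr (p / ps j)))"
    unfolding \<alpha>_def S_def by (intro ennreal_leI cube_avg_weight_le A L)
   also have "\<dots> = ennreal (A powr (p / p0)) * ennreal (\<Prod>j\<in>UNIV. (\<alpha> j Q powr ratio j * S j Q) powr (p / ps j))"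
    by (simp add: ennreal_mult')
   finally show "ennreal (cube_avg L p0 f (snd z) powr p) * emeasure (weighted v) (dyadic_cube L (snd z)) \<le>
    ennreal (A powr (p / p0)) * ennreal (\<Prod>j\<in>UNIV. (\<alpha> j (snd z) powr ratio j * S j (snd z)) powr (p / ps j))"
    unfolding Q_def .
  qed
  also have "\<dots> = ennreal (A powr (p / p0)) * (\<integral>\<^sup>+z. ennreal (\<Prod>j\<in>UNIV. (\<alpha> j (snd z) powr ratio j * S j (snd z)) powr (p / ps j)) \<partial>count_space J)"
   by (rule nn_integral_cmult) simp
  also have "\<dots> \<le> ennreal (A powr (p / p0)) * ennreal (\<Prod>j\<in>UNIV. (H j * N j powr ps j) powr (p / ps j))"
  proof (intro mult_left_mono)
   show "(\<integral>\<^sup>+z. ennreal (\<Prod>j\<in>UNIV. (\<alpha> j (snd z) powr ratio j * S j (snd z)) powr (p / ps j)) \<partial>count_space J)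
    \<le> ennreal (\<Prod>j\<in>UNIV. (H j * N j powr ps j) powr (p / ps j))"
    using p_pos ps_pos sum_p_ps H car
    by (intro Holder_prod) (auto simp: S_def less_imp_le)
  qed simp
  also have "(\<Prod>j\<in>UNIV. (H j * N j powr ps j) powr (p / ps j)) = (\<Prod>j\<in>UNIV. H j powr (p / ps j)) * (\<Prod>j\<in>UNIV. N j powr p)"
  proof -
   have "(H j * N j powr ps j) powr (p / ps j) = H j powr (p / ps j) * N j powr p" for j
    using H[of j] ps_pos[of j] by (simp add: powr_mult powr_powr)
   then show ?thesis
    by (simp add: prod.distrib)
  qed
  also have "ennreal (A powr (p / p0)) * ennreal ((\<Prod>j\<in>UNIV. H j powr (p / ps j)) * (\<Prod>j\<in>UNIV. N j powr p)) = ennreal (C * (\<Prod>j\<in>UNIV. N j powr p))"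
   unfolding C_def by (simp add: ennreal_mult'[symmetric] mult.assoc)
  finally show "sparse_sum L f ch root
    \<le> ennreal (C * (\<Prod>k\<in>UNIV. N k powr p))" .
 qed
qed

end

section \<open>The weighted bound for bounded inputs of compact support\<close>

lemma AE_eventually_not_mem:
 fixes \<epsilon> :: "nat \<Rightarrow> ennreal"
 assumes Y: "\<And>d. Y d \<in> sets M" "\<And>d. emeasure M (Y d) \<le> \<epsilon> d" and \<epsilon>: "\<epsilon> \<longlonglongrightarrow> 0"
 shows "AE x in M. \<exists>d. x \<notin> Y d"
proof -
 have "emeasure M (\<Inter>d. Y d) \<le> \<epsilon> d" for d
  using Y by (intro order_trans[OF emeasure_mono Y(2)]) auto
 then have "emeasure M (\<Inter>d. Y d) \<le> 0"
  by (intro tendsto_lowerbound[OF \<epsilon>]) auto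
 then have "(\<Inter>d. Y d) \<in> null_sets M"
  using Y(1) by (intro null_setsI sets.countable_INT') auto
 then have "AE x in M. x \<notin> (\<Inter>d. Y d)"
  by (rule AE_not_in)
 then show ?thesis
  by eventually_elim auto
qed

lemma localize_eq_large:
 fixes f :: "'m \<Rightarrow> real^'n::finite \<Rightarrow> complex"
 assumes L: "0 < L" and f: "\<And>k x. L < norm x \<Longrightarrow> f k x = 0"
 shows "localize L f (0, 0) = f"
proof (intro ext)
 fix k x
 have c: "cube_center L (0, 0 :: (int, 'n) vec) = 0"
  by (simp add: cube_center_def cube_side_def vec_eq_iff)
 have "L \<le> cube_radius L (0, 0 :: (int, 'n) vec)"
 proof -
  have "1 \<le> CARD('n)"
   by (simp add: Suc_le_eq)
  then have "1 \<le> sqrt CARD('n)"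
   by simp
  then have "1 * L \<le> (10 * sqrt CARD('n)) * L"
   using L by (intro mult_right_mono) linarith+
  then show ?thesis
   by (simp add: cube_radius_def cube_side_def)
 qed
 then show "localize L f (0, 0) k x = f k x"
  using f[of x k] by (cases "norm x \<le> L") (auto simp: localize_def c indicator_def)
qed

lemma ball_subset_root_cube:
 assumes L: "0 < L"
 shows "ball 0 L \<subseteq> dyadic_cube L (0, 0 :: (int, 'n::finite) vec)"
proof
 fix x :: "real^'n" assume "x \<in> ball 0 L"
 then have "\<bar>x $ i\<bar> < L" for i
  using component_le_norm_cart[of x i] by simp
 then have "- L < x $ i \<and> x $ i < L" for i
  by (simp add: abs_less_iff minus_less_iff)
 then show "x \<in> dyadic_cube L (0, 0)"
  unfolding mem_dyadic_cube_box[OF L] by (simp add: cube_center_def cube_side_def less_imp_le)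
qed

lemma nn_integral_le_of_balls:
 fixes F :: "'a::euclidean_space \<Rightarrow> ennreal"
 assumes F: "F \<in> borel_measurable lebesgue" and le: "\<And>L. R \<le> L \<Longrightarrow> 0 < L \<Longrightarrow> (\<integral>\<^sup>+x. F x * indicator (ball 0 L) x \<partial>lebesgue) \<le> B"
 shows "(\<integral>\<^sup>+x. F x \<partial>lebesgue) \<le> B"
proof -
 define r where "r k = \<bar>R\<bar> + 1 + real k" for k
 have "(\<integral>\<^sup>+x. F x \<partial>lebesgue) = emeasure (density lebesgue F) (\<Union>k. ball 0 (r k))"
 proof -
  have "(\<Union>k. ball 0 (r k)) = (UNIV :: 'a set)"
  proof (intro set_eqI iffI UNIV_I)
   fix x :: 'a
   obtain k where "norm x < real k"
    using reals_Archimedean2 by blast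
   then show "x \<in> (\<Union>k. ball 0 (r k))"
    by (intro UN_I[of k]) (auto simp: r_def)
  qed
  then show ?thesis
   using F by (simp add: emeasure_density)
 qed
 also have "\<dots> = (SUP k. emeasure (density lebesgue F) (ball 0 (r k)))"
  by (intro SUP_emeasure_incseq[symmetric]) (auto simp: incseq_def r_def)
 also have "\<dots> \<le> B"
 proof (intro SUP_least)
  fix k
  have "emeasure (density lebesgue F) (ball 0 (r k)) = (\<integral>\<^sup>+x. F x * indicator (ball 0 (r k)) x \<partial>lebesgue)"
   using F by (intro emeasure_density) auto
  also have "\<dots> \<le> B"
   by (rule le) (auto simp: r_def)
  finally show "emeasure (density lebesgue F) (ball 0 (r k)) \<le> B" .
 qed
 finally show ?thesis .
qed

locale weighted_operator = kernel_operator T K U p0 \<delta> C q + multiple_weights p0 p ps \<omega> v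
 for T :: "('m::finite \<Rightarrow> real^'n::finite \<Rightarrow> complex) \<Rightarrow> (real^'n \<Rightarrow> complex) \<Rightarrow> complex"
  and K :: "real^'n \<Rightarrow> ('m \<Rightarrow> real^'n) \<Rightarrow> complex" and U p0 \<delta> C q p
  and ps :: "'m \<Rightarrow> real" and \<omega> :: "'m \<Rightarrow> real^'n \<Rightarrow> real" and v
begin

text \<open>A stopping family is chosen for every cube, which turns the single step into a tree.
  Chain domination, the tree estimate for the measure v and the sparse sum bound are then chained.
  The constant depends neither on L nor on the root.\<close>

lemma localized_bound:
 "\<exists>C'\<ge>0. \<forall>f N L root. (\<forall>k. f k \<in> bounded_compact_support) \<longrightarrow>
   input_norms f N \<longrightarrow> 0 < L \<longrightarrow>
   (\<integral>\<^sup>+x. ennreal (norm (U (localize L f root) x) powr p) * indicator (dyadic_cube L root) x \<partial>weighted v)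
    \<le> ennreal (C' * (\<Prod>k\<in>UNIV. N k powr p))"
proof -
 obtain c where c: "0 < c" "\<forall>f L Q. (\<forall>k. f k \<in> bounded_compact_support) \<longrightarrow> 0 < L \<longrightarrow>
  (\<exists>ch. stopping_family c L f Q ch)"
  using sparse_step by (elim exE conjE) (rule that; assumption)
 obtain Cs where Cs: "0 \<le> Cs" "\<forall>f N L ch root. (\<forall>k. f k \<in> bounded_compact_support) \<longrightarrow>
   input_norms f N \<longrightarrow> 0 < L \<longrightarrow>
   (\<forall>Q. \<forall>P\<in>ch Q. dyadic_cube L P \<subseteq> dyadic_cube L Q) \<longrightarrow>
   (\<forall>Q. disjoint_family_on (dyadic_cube L) (ch Q)) \<longrightarrow>
   (\<forall>Q. 3/4 * cube_side L Q ^ CARD('n) \<le> measure lebesgue (dyadic_cube L Q - (\<Union>P\<in>ch Q. dyadic_cube L P))) \<longrightarrow>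
   sparse_sum L f ch root
    \<le> ennreal (Cs * (\<Prod>k\<in>UNIV. N k powr p))"
  using sparse_sum_bound by (elim exE conjE) (rule that; assumption)
 define \<beta> where "\<beta> = unit_ball_vol CARD('n) * (5 * sqrt CARD('n)) ^ CARD('n)"
 have \<beta>: "0 < \<beta>"
  by (simp add: \<beta>_def unit_ball_vol_pos)
 obtain A where A: "0 < A" "\<And>c \<rho> i. 0 < \<rho> \<Longrightarrow> emeasure (weighted (wgt i)) (ball c \<rho>) < \<infinity>"
  "\<And>c \<rho>. 0 < \<rho> \<Longrightarrow> muckenhoupt_le A c \<rho>"
  by (rule muckenhoupt) (rule that; assumption)
 have "0 < 3 / (4 * \<beta>)"
  using \<beta> by simp
 then obtain \<Gamma> where \<Gamma>: "1 < \<Gamma>" "\<And>c \<rho> E i. 0 < \<rho> \<Longrightarrow> E \<in> sets lebesgue \<Longrightarrow> E \<subseteq> ball c \<rho> \<Longrightarrow> 3 / (4 * \<beta>) * measure lebesgue (ball c \<rho>) \<le> measure lebesgue E \<Longrightarrow>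
   emeasure (weighted (wgt i)) (ball c \<rho>) \<le> ennreal \<Gamma> * emeasure (weighted (wgt i)) E"
  by (rule wgt_comparison) (rule that; assumption)
 \<comment> \<open>The remainder of a cube carries at least the fraction 1/\<Gamma> of its
   v-measure, so the children carry at most 1 - 1/\<Gamma>.\<close>
 define \<theta> where "\<theta> = 1 - 1 / \<Gamma>"
 have \<theta>: "0 < \<theta>" "\<theta> < 1"
  using \<Gamma>(1) by (auto simp: \<theta>_def)
 define Ct where "Ct = (1 / (1 - ((1 + 1 / \<theta>) / 2) powr (- 1 / p))) powr p * (2 / (1 - \<theta>))"
 have Ct: "0 \<le> Ct"
  using \<theta> by (simp add: Ct_def)
 define C' where "C' = Ct * (c powr p * Cs)"
 show ?thesis
 proof (intro exI[of _ C'] conjI allI impI)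
  show "0 \<le> C'"
   using Ct Cs(1) by (simp add: C'_def)
 next
  fix f :: "'m \<Rightarrow> real^'n \<Rightarrow> complex" and N :: "'m \<Rightarrow> real" and L :: real and root :: "'n cube_index"
  assume f': "\<forall>k. f k \<in> bounded_compact_support"
   and N: "input_norms f N"
   and L: "0 < L"
  note f = f'[rule_format]
  define X where "X = (dyadic_cube L :: 'n cube_index \<Rightarrow> _)"
  have Xm: "X Q \<in> sets lebesgue" for Q
   unfolding X_def by (rule sets_lebesgue_dyadic_cube[OF L])
  define F where "F Q x = norm (U (localize L f Q) x)" for Q x
  define a where "a Q = c * cube_avg L p0 f Q" for Q
  have "\<forall>Q. \<exists>ch. (\<forall>P\<in>ch. fst Q < fst P \<and> X P \<subseteq> X Q) \<and> disjoint_family_on X ch \<and>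
   emeasure lebesgue (\<Union>P\<in>ch. X P) \<le> ennreal (1/4) * emeasure lebesgue (X Q) \<and>
   (AE x in lebesgue. (x \<in> X Q \<longrightarrow> (\<forall>P\<in>ch. x \<notin> X P) \<longrightarrow> F Q x \<le> a Q) \<and>
     (\<forall>P\<in>ch. x \<in> X P \<longrightarrow> F Q x \<le> a Q + F P x))"
   unfolding X_def F_def a_def using c(2)[THEN spec[of _ f], THEN spec[of _ L]] f L
   by (simp del: split_paired_All split_paired_Ex)
  from choice[OF this] obtain ch where ch: "\<forall>Q. (\<forall>P\<in>ch Q. fst Q < fst P \<and> X P \<subseteq> X Q) \<and> disjoint_family_on X (ch Q) \<and>
   emeasure lebesgue (\<Union>P\<in>ch Q. X P) \<le> ennreal (1/4) * emeasure lebesgue (X Q) \<and>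
   (AE x in lebesgue. (x \<in> X Q \<longrightarrow> (\<forall>P\<in>ch Q. x \<notin> X P) \<longrightarrow> F Q x \<le> a Q) \<and>
     (\<forall>P\<in>ch Q. x \<in> X P \<longrightarrow> F Q x \<le> a Q + F P x))" ..
  have sub: "X P \<subseteq> X Q" if "P \<in> ch Q" for P Q
   using ch that by blast
  have disj: "disjoint_family_on X (ch Q)" for Q
   using ch by (elim allE conjE)
  have quarter: "emeasure lebesgue (\<Union>P\<in>ch Q. X P) \<le> ennreal (1/4) * emeasure lebesgue (X Q)" for Q
   using ch by (elim allE conjE)
  have aest: "AE x in lebesgue. (x \<in> X Q \<longrightarrow> (\<forall>P\<in>ch Q. x \<notin> X P) \<longrightarrow> F Q x \<le> a Q) \<and>
     (\<forall>P\<in>ch Q. x \<in> X P \<longrightarrow> F Q x \<le> a Q + F P x)" for Q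
   using ch by (elim allE conjE)
  have cnt: "countable (ch Q)" for Q
   by (rule countableI_type)
  have Um: "(\<Union>P\<in>ch Q. X P) \<in> sets lebesgue" for Q
   by (intro sets.countable_UN' cnt image_subsetI Xm)
  have Usub: "(\<Union>P\<in>ch Q. X P) \<subseteq> X Q" for Q
   using sub by blast
  have big: "3/4 * cube_side L Q ^ CARD('n) \<le> measure lebesgue (X Q - (\<Union>P\<in>ch Q. X P))" for Q
  proof -
   have eX: "emeasure lebesgue (X Q) = ennreal (cube_side L Q ^ CARD('n))" "measure lebesgue (X Q) = cube_side L Q ^ CARD('n)"
    unfolding X_def by (rule emeasure_dyadic_cube[OF L], rule measure_dyadic_cube[OF L])
   have s: "0 < cube_side L Q ^ CARD('n)"
    using cube_side_pos[OF L] by (rule zero_less_power)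
   have "emeasure lebesgue (\<Union>P\<in>ch Q. X P) \<le> ennreal (1/4 * cube_side L Q ^ CARD('n))"
    using quarter[of Q] unfolding eX(1) using s by (subst ennreal_mult) auto
   then have "measure lebesgue (\<Union>P\<in>ch Q. X P) \<le> 1/4 * cube_side L Q ^ CARD('n)"
    using s unfolding measure_def by (intro enn2real_leI) auto
   moreover have "measure lebesgue (X Q - (\<Union>P\<in>ch Q. X P)) = measure lebesgue (X Q) - measure lebesgue (\<Union>P\<in>ch Q. X P)"
    by (rule measure_Diff[OF _ Xm Um Usub]) (simp only: eX(1) ennreal_neq_top not_False_eq_True infinity_ennreal_def)
   ultimately show ?thesis
    unfolding eX(2) by linarith
  qed
  define V where "V = weighted v"
  have setsV: "sets V = sets lebesgue"
   by (simp add: V_def)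
  have Vfin: "emeasure V (X Q) \<noteq> top" for Q
  proof -
   have "emeasure V (X Q) \<le> emeasure V (cube_ball L Q)"
    unfolding X_def by (intro emeasure_mono dyadic_cube_subset_ball[OF L]) (simp add: setsV)
   also have "\<dots> < \<infinity>"
    using A(2)[OF cube_radius_pos[OF L], of None "cube_center L Q"] by (simp add: V_def)
   finally show ?thesis by simp
  qed
  have shrink: "emeasure V (\<Union>P\<in>ch Q. X P) \<le> ennreal \<theta> * emeasure V (X Q)" for Q
  proof -
   define D where "D = X Q - (\<Union>P\<in>ch Q. X P)"
   have Dm: "D \<in> sets lebesgue"
    unfolding D_def by (intro sets.Diff Xm Um)
   have DB: "D \<subseteq> cube_ball L Q"
    using dyadic_cube_subset_ball[OF L, of Q] by (auto simp: D_def X_def)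
   have "emeasure (weighted (wgt None)) (cube_ball L Q) \<le> ennreal \<Gamma> * emeasure (weighted (wgt None)) D"
   proof (rule \<Gamma>(2)[OF cube_radius_pos[OF L] Dm DB])
    show "3 / (4 * \<beta>) * measure lebesgue (cube_ball L Q) \<le> measure lebesgue D"
     using big[of Q] \<beta> unfolding measure_cube_ball[OF L] \<beta>_def[symmetric] D_def by simp
   qed
   moreover have "emeasure V (X Q) \<le> emeasure V (cube_ball L Q)"
    unfolding X_def by (intro emeasure_mono dyadic_cube_subset_ball[OF L]) (simp add: setsV)
   ultimately have xd: "emeasure V (X Q) \<le> ennreal \<Gamma> * emeasure V D"
    unfolding V_def by (simp add: order_trans)
   have sum: "emeasure V (\<Union>P\<in>ch Q. X P) + emeasure V D = emeasure V (X Q)"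
    using plus_emeasure[of "\<Union>P\<in>ch Q. X P" V D] Um[of Q] Dm Usub[of Q] by (simp add: setsV D_def Un_absorb1)
   obtain r s where rs: "0 \<le> r" "0 \<le> s" "emeasure V (\<Union>P\<in>ch Q. X P) = ennreal r" "emeasure V D = ennreal s"
   proof (cases "emeasure V (\<Union>P\<in>ch Q. X P)" rule: ennreal_cases)
    case (real r)
    note r = this
    show ?thesis
    proof (cases "emeasure V D" rule: ennreal_cases)
     case (real s)
     show ?thesis by (rule that[OF r(1) real(1) r(2) real(2)])
    next
     case top
     then show ?thesis using sum Vfin[of Q] by simp
    qed
   next
    case top
    then show ?thesis using sum Vfin[of Q] by simp
   qed
   have t: "emeasure V (X Q) = ennreal (r + s)"
    unfolding sum[symmetric] rs using rs by simp
   have "ennreal (r + s) \<le> ennreal (\<Gamma> * s)"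
    using xd rs \<Gamma>(1) unfolding t rs by (simp add: ennreal_mult)
   then have "r + s \<le> \<Gamma> * s"
    using rs \<Gamma>(1) by (subst (asm) ennreal_le_iff) auto
   then have "r \<le> \<theta> * (r + s)"
    using \<Gamma>(1) by (simp add: \<theta>_def field_simps)
   then have "ennreal r \<le> ennreal (\<theta> * (r + s))"
    by (rule ennreal_leI)
   then show ?thesis
    unfolding t rs using \<theta> rs by (simp add: ennreal_mult)
  qed
  have "AE x in lebesgue. \<forall>Q. (x \<in> X Q \<longrightarrow> (\<forall>P\<in>ch Q. x \<notin> X P) \<longrightarrow> F Q x \<le> a Q) \<and>
     (\<forall>P\<in>ch Q. x \<in> X P \<longrightarrow> F Q x \<le> a Q + F P x)"
   unfolding AE_all_countable using aest by (intro allI)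
  \<comment> \<open>The generations shrink by the factor 1/4 in Lebesgue measure, so almost every
    point leaves the tree after finitely many steps and its chain is finite.\<close>
  moreover have "AE x in lebesgue. \<exists>d. x \<notin> (\<Union>b\<in>generation ch root (Suc d). X b)"
  proof (rule AE_eventually_not_mem)
   show "(\<Union>b\<in>generation ch root (Suc d). X b) \<in> sets lebesgue" for d
    by (intro sets_UN_generation cnt Xm)
   show "emeasure lebesgue (\<Union>b\<in>generation ch root (Suc d). X b) \<le> ennreal ((1/4) ^ Suc d * cube_side L root ^ CARD('n))" for d
   proof -
    have "emeasure lebesgue (\<Union>b\<in>generation ch root (Suc d). X b) \<le> ennreal (1/4) ^ Suc d * emeasure lebesgue (X root)"
     by (intro emeasure_generation_le cnt Xm disj quarter)
    also have "\<dots> = ennreal ((1/4) ^ Suc d * cube_side L root ^ CARD('n))"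
     unfolding X_def emeasure_dyadic_cube[OF L] ennreal_power[OF divide_nonneg_nonneg[OF zero_le_one zero_le_numeral]]
     using less_imp_le[OF cube_side_pos[OF L, of root]] by (intro ennreal_mult[symmetric]) auto
    finally show ?thesis .
   qed
   have "(\<lambda>d. (1/4) ^ Suc d * cube_side L root ^ CARD('n)) \<longlonglongrightarrow> 0 * cube_side L root ^ CARD('n)"
    by (intro tendsto_mult tendsto_const LIMSEQ_Suc[OF LIMSEQ_realpow_zero]) auto
   then show "(\<lambda>d. ennreal ((1/4) ^ Suc d * cube_side L root ^ CARD('n))) \<longlonglongrightarrow> 0"
    using tendsto_ennrealI by fastforce
  qed
  ultimately have "AE x in lebesgue. x \<in> X root \<longrightarrow> (\<exists>M qs. (\<forall>i\<le>M. qs i \<in> generation ch root i \<and> x \<in> X (qs i)) \<and> F root x \<le> (\<Sum>i\<le>M. a (qs i)))"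
  proof (eventually_elim, intro impI)
   fix x assume 1: "\<forall>Q. (x \<in> X Q \<longrightarrow> (\<forall>P\<in>ch Q. x \<notin> X P) \<longrightarrow> F Q x \<le> a Q) \<and> (\<forall>P\<in>ch Q. x \<in> X P \<longrightarrow> F Q x \<le> a Q + F P x)"
    and 2: "\<exists>d. x \<notin> (\<Union>b\<in>generation ch root (Suc d). X b)" and 3: "x \<in> X root"
   from 2 obtain d where d: "x \<notin> (\<Union>b\<in>generation ch root (Suc d). X b)" ..
   show "\<exists>M qs. (\<forall>i\<le>M. qs i \<in> generation ch root i \<and> x \<in> X (qs i)) \<and> F root x \<le> (\<Sum>i\<le>M. a (qs i))"
    by (rule tree_chain_domination[OF _ _ 3 d]) (use 1 in blast)+
  qed
  \<comment> \<open>The domination is proved for Lebesgue measure and transferred to v by absolute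
    continuity.\<close>
  then have dom: "AE x in V. x \<in> X root \<longrightarrow> (\<exists>M qs. (\<forall>i\<le>M. qs i \<in> generation ch root i \<and> x \<in> X (qs i)) \<and> F root x \<le> (\<Sum>i\<le>M. a (qs i)))"
   unfolding V_def using wgt_measurable[of None] by (intro AE_weighted) simp_all
  have "(\<integral>\<^sup>+x. ennreal (F root x powr p) * indicator (X root) x \<partial>V) \<le> ennreal Ct *
    (\<Sum>i. (\<integral>\<^sup>+Q. ennreal (a Q powr p) * emeasure V (X Q) \<partial>count_space (generation ch root i)))"
   unfolding Ct_def
  proof (rule tree_sum_bound[where ch = ch])
   show "0 \<le> a Q" for Q
    using c(1) cube_avg_nonneg[of L p0 f Q] by (simp add: a_def)
  qed (use cnt Xm setsV sub disj shrink \<theta> p_pos dom in \<open>simp_all add: F_def\<close>)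
  also have "(\<Sum>i. (\<integral>\<^sup>+Q. ennreal (a Q powr p) * emeasure V (X Q) \<partial>count_space (generation ch root i)))
   = ennreal (c powr p) * (\<Sum>i. (\<integral>\<^sup>+Q. ennreal (cube_avg L p0 f Q powr p) * emeasure V (X Q) \<partial>count_space (generation ch root i)))"
  proof -
   have "ennreal (a Q powr p) * emeasure V (X Q) = ennreal (c powr p) * (ennreal (cube_avg L p0 f Q powr p) * emeasure V (X Q))" for Q
    unfolding a_def using c(1) cube_avg_nonneg[of L p0 f Q] by (simp add: powr_mult ennreal_mult' mult.assoc)
   then show ?thesis
    by (simp add: nn_integral_cmult)
  qed
  also have "\<dots> \<le> ennreal (c powr p) * ennreal (Cs * (\<Prod>k\<in>UNIV. N k powr p))"
  proof (intro mult_left_mono)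
   show "(\<Sum>i. (\<integral>\<^sup>+Q. ennreal (cube_avg L p0 f Q powr p) * emeasure V (X Q) \<partial>count_space (generation ch root i))) \<le> ennreal (Cs * (\<Prod>k\<in>UNIV. N k powr p))"
    unfolding V_def X_def by (rule Cs(2)[rule_format]) (use f N L sub disj big in \<open>simp_all add: X_def\<close>)
  qed simp
  also have "ennreal Ct * (ennreal (c powr p) * ennreal (Cs * (\<Prod>k\<in>UNIV. N k powr p))) = ennreal (C' * (\<Prod>k\<in>UNIV. N k powr p))"
   unfolding C'_def using Ct by (simp add: ennreal_mult'[symmetric] mult.assoc)
  finally show "(\<integral>\<^sup>+x. ennreal (norm (U (localize L f root) x) powr p) * indicator (dyadic_cube L root) x \<partial>weighted v)
    \<le> ennreal (C' * (\<Prod>k\<in>UNIV. N k powr p))"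
   by (auto simp: F_def X_def V_def mult_left_mono)
 qed
qed

text \<open>For L beyond the supports the cut-off to the ball of the root cube changes nothing, and
  the root cube contains the ball of radius L. The bound is uniform in L, so L may tend to
  infinity.\<close>

proposition weighted_bound:
 "\<exists>C'\<ge>0. \<forall>f N. (\<forall>k. f k \<in> bounded_compact_support) \<longrightarrow>
   input_norms f N \<longrightarrow>
   (\<integral>\<^sup>+x. ennreal (norm (U f x) powr p) * ennreal (v x) \<partial>lebesgue) \<le> ennreal (C' * (\<Prod>k\<in>UNIV. N k powr p))"
proof -
 obtain C' where C': "0 \<le> C'" "\<forall>f N L root. (\<forall>k. f k \<in> bounded_compact_support) \<longrightarrow>
   input_norms f N \<longrightarrow> 0 < L \<longrightarrow>
   (\<integral>\<^sup>+x. ennreal (norm (U (localize L f root) x) powr p) * indicator (dyadic_cube L root) x \<partial>weighted v)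
    \<le> ennreal (C' * (\<Prod>k\<in>UNIV. N k powr p))"
  using localized_bound by (elim exE conjE) (rule that; assumption)
 show ?thesis
 proof (intro exI[of _ C'] conjI allI impI C'(1))
  fix f :: "'m \<Rightarrow> real^'n \<Rightarrow> complex" and N :: "'m \<Rightarrow> real"
  assume f': "\<forall>k. f k \<in> bounded_compact_support"
   and N: "input_norms f N"
  note f = f'[rule_format]
  have "\<exists>r. \<forall>x. r < norm x \<longrightarrow> f k x = 0" for k
  proof -
   obtain S where S: "compact S" "\<And>x. x \<notin> S \<Longrightarrow> f k x = 0"
    using f[of k] by (rule bounded_compact_supportE) (rule that; assumption)
   obtain r where "\<And>x. x \<in> S \<Longrightarrow> norm x \<le> r"
    using compact_imp_bounded[OF S(1)] by (auto simp: bounded_iff)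
   then show ?thesis
    using S(2) by (intro exI[of _ r]) fastforce
  qed
  then have "\<forall>k. \<exists>r. \<forall>x. r < norm x \<longrightarrow> f k x = 0" ..
  from choice[OF this] obtain r where r: "\<forall>k. \<forall>x. r k < norm x \<longrightarrow> f k x = 0" ..
  define R where "R = Max (range r)"
  have R: "r k \<le> R" for k
   unfolding R_def by (intro Max_ge) auto
  have Um: "U f \<in> borel_measurable lebesgue"
   using p0p by (intro weak_extension_measurable[OF U] f) simp
  have vm: "v \<in> borel_measurable lebesgue"
   using wgt_measurable[of None] by simp
  show "(\<integral>\<^sup>+x. ennreal (norm (U f x) powr p) * ennreal (v x) \<partial>lebesgue) \<le> ennreal (C' * (\<Prod>k\<in>UNIV. N k powr p))"
  proof (rule nn_integral_le_of_balls[where R = R])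
   show "(\<lambda>x. ennreal (norm (U f x) powr p) * ennreal (v x)) \<in> borel_measurable lebesgue"
    using Um vm by measurable
   fix L assume L: "R \<le> L" "0 < L"
   define root where "root = (0 :: nat, 0 :: (int, 'n) vec)"
   have loc: "localize L f root = f"
    unfolding root_def
   proof (rule localize_eq_large[OF L(2)])
    fix k x assume "L < norm (x :: real^'n)"
    then have "r k < norm x"
     using L(1) R[of k] by linarith
    then show "f k x = 0"
     using r by simp
   qed
   have "(\<integral>\<^sup>+x. ennreal (norm (U f x) powr p) * ennreal (v x) * indicator (ball 0 L) x \<partial>lebesgue) \<le>
    (\<integral>\<^sup>+x. ennreal (v x) * (ennreal (norm (U f x) powr p) * indicator (dyadic_cube L root) x) \<partial>lebesgue)"
    using ball_subset_root_cube[OF L(2), where 'n = 'n] by (intro nn_integral_mono) (auto simp: indicator_def root_def mult.commute)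
   also have "\<dots> = (\<integral>\<^sup>+x. ennreal (norm (U (localize L f root) x) powr p) * indicator (dyadic_cube L root) x \<partial>weighted v)"
    unfolding loc using sets_lebesgue_dyadic_cube[OF L(2), of root] Um
    by (intro nn_integral_density[symmetric] measurable_compose[OF vm measurable_ennreal]
      borel_measurable_times_ennreal borel_measurable_indicator) simp_all
   also have "\<dots> \<le> ennreal (C' * (\<Prod>k\<in>UNIV. N k powr p))"
    using C'(2)[THEN spec[of _ f], THEN spec[of _ N], THEN spec[of _ L], THEN spec[of _ root]] f' N L(2)
    by (elim impE)
   finally show "(\<integral>\<^sup>+x. ennreal (norm (U f x) powr p) * ennreal (v x) * indicator (ball 0 L) x \<partial>lebesgue) \<le> ennreal (C' * (\<Prod>k\<in>UNIV. N k powr p))" .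
  qed
 qed
qed

end

section \<open>Extension by density\<close>

text \<open>The p-th power of the weighted norm. Taking no root keeps the quasi-triangle inequality,
  with constant 2^p, uniform over all p > 0.\<close>

definition power_integral :: "real \<Rightarrow> ('a::euclidean_space \<Rightarrow> real) \<Rightarrow> ('a \<Rightarrow> complex) \<Rightarrow> ennreal" where
 "power_integral p w u = (\<integral>\<^sup>+x. ennreal (norm (u x) powr p) * ennreal (w x) \<partial>lebesgue)"

lemma power_integrand_measurable:
 assumes "u \<in> borel_measurable lebesgue" "w \<in> borel_measurable lebesgue"
 shows "(\<lambda>x. ennreal (norm (u x) powr p) * ennreal (w x)) \<in> borel_measurable lebesgue"
proof -
 have "(\<lambda>x. norm (u x) powr p) \<in> borel_measurable lebesgue"
  using assms(1) by simp
 then show ?thesis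
  using assms(2) by (intro borel_measurable_times_ennreal measurable_compose[OF _ measurable_ennreal])
qed

lemma wlp_iff: "0 < p \<Longrightarrow> u \<in> wlp p w \<longleftrightarrow> u \<in> borel_measurable lebesgue \<and> power_integral p w u < top"
 unfolding wlp_def wlp_norm_def power_integral_def[symmetric] using ennpowr_less_top by simp

lemma power_integral_mono:
 assumes "AE x in lebesgue. norm (u x) \<le> norm (u' x)" "0 \<le> p"
 shows "power_integral p w u \<le> power_integral p w u'"
 unfolding power_integral_def using assms(1)
 by (intro nn_integral_mono_AE, eventually_elim) (auto intro!: mult_right_mono ennreal_leI powr_mono2 assms)

lemma power_integral_cong:
 assumes "AE x in lebesgue. norm (u x) = norm (u' x)"
 shows "power_integral p w u = power_integral p w u'"
 unfolding power_integral_def using assms by (intro nn_integral_cong_AE, eventually_elim) simp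

lemma power_integral_triangle:
 assumes "u \<in> borel_measurable lebesgue" "u' \<in> borel_measurable lebesgue" "w \<in> borel_measurable lebesgue" "0 \<le> p"
  and "AE x in lebesgue. norm (h x) \<le> norm (u x) + norm (u' x)"
 shows "power_integral p w h \<le> ennreal (2 powr p) * (power_integral p w u + power_integral p w u')"
proof -
 have "power_integral p w h \<le> (\<integral>\<^sup>+x. ennreal (2 powr p) * (ennreal (norm (u x) powr p) * ennreal (w x) + ennreal (norm (u' x) powr p) * ennreal (w x)) \<partial>lebesgue)"
  unfolding power_integral_def using assms(5)
 proof (intro nn_integral_mono_AE, eventually_elim)
  case (elim x)
  have "norm (h x) powr p \<le> (norm (u x) + norm (u' x)) powr p"
   using elim assms(4) by (intro powr_mono2) auto
  also have "\<dots> \<le> 2 powr p * (norm (u x) powr p + norm (u' x) powr p)"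
   using assms(4) by (intro powr_add_le) auto
  finally have "ennreal (norm (h x) powr p) \<le> ennreal (2 powr p * (norm (u x) powr p + norm (u' x) powr p))"
   by (rule ennreal_leI)
  also have "\<dots> = ennreal (2 powr p) * (ennreal (norm (u x) powr p) + ennreal (norm (u' x) powr p))"
   by (simp add: ennreal_mult)
  finally have "ennreal (norm (h x) powr p) * ennreal (w x) \<le> ennreal (2 powr p) * (ennreal (norm (u x) powr p) + ennreal (norm (u' x) powr p)) * ennreal (w x)"
   by (rule mult_right_mono) simp
  then show ?case
   by (simp add: algebra_simps)
 qed
 also have "\<dots> = ennreal (2 powr p) * (power_integral p w u + power_integral p w u')"
  unfolding power_integral_def using assms(1-3) by (simp add: nn_integral_cmult nn_integral_add)
 finally show ?thesis .
qed

lemma power_integral_scale: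
 assumes "u \<in> borel_measurable lebesgue" "w \<in> borel_measurable lebesgue"
 shows "power_integral p w (\<lambda>x. a * u x) = ennreal (norm a powr p) * power_integral p w u"
 unfolding power_integral_def using assms
 by (subst nn_integral_cmult[symmetric]) (auto simp: norm_mult powr_mult ennreal_mult mult.assoc)

lemma AE_eq_0_of_power_integral:
 assumes "u \<in> borel_measurable lebesgue" "w \<in> borel_measurable lebesgue" "AE x in lebesgue. 0 < w x"
  and "power_integral p w u = 0"
 shows "AE x in lebesgue. u x = 0"
proof -
 have "AE x in lebesgue. ennreal (norm (u x) powr p) * ennreal (w x) = 0"
  using assms(4) unfolding power_integral_def using assms(1,2) by (subst (asm) nn_integral_0_iff_AE) auto
 with assms(3) show ?thesis
  by eventually_elim auto
qed

lemma tendsto_0_ennreal_iff: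
 fixes e :: "nat \<Rightarrow> ennreal"
 shows "e \<longlonglongrightarrow> 0 \<longleftrightarrow> (\<forall>\<epsilon>>0. \<forall>\<^sub>F k in sequentially. e k \<le> ennreal \<epsilon>)"
proof
 assume e: "e \<longlonglongrightarrow> 0"
 show "\<forall>\<epsilon>>0. \<forall>\<^sub>F k in sequentially. e k \<le> ennreal \<epsilon>"
 proof (intro allI impI)
  fix \<epsilon> :: real assume "0 < \<epsilon>"
  then have "\<forall>\<^sub>F k in sequentially. e k < ennreal \<epsilon>"
   by (intro order_tendstoD(2)[OF e]) simp
  then show "\<forall>\<^sub>F k in sequentially. e k \<le> ennreal \<epsilon>"
   by eventually_elim simp
 qed
next
 assume e: "\<forall>\<epsilon>>0. \<forall>\<^sub>F k in sequentially. e k \<le> ennreal \<epsilon>"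
 show "e \<longlonglongrightarrow> 0"
 proof (rule order_tendstoI)
  fix a :: ennreal assume "0 < a"
  then obtain b where b: "0 < b" "b < a"
   using dense by blast
  then obtain r where r: "b = ennreal r" "0 < r"
   by (cases b) auto
  have "\<forall>\<^sub>F k in sequentially. e k \<le> ennreal r"
   using e r(2) by simp
  then show "\<forall>\<^sub>F k in sequentially. e k < a"
   by eventually_elim (use b r in auto)
 qed simp
qed

text \<open>Riesz-Fischer for every p > 0: a rapidly convergent subsequence converges a.e., and
  Fatou's lemma turns the Cauchy condition into convergence of the whole sequence to its
  limit.\<close>

lemma power_integral_complete:
 fixes G :: "nat \<Rightarrow> 'a::euclidean_space \<Rightarrow> complex"
 assumes G: "\<And>k. G k \<in> borel_measurable lebesgue" and w: "w \<in> borel_measurable lebesgue" "AE x in lebesgue. 0 < w x"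
  and p: "0 < p"
  and Cauchy: "\<And>\<epsilon>. 0 < \<epsilon> \<Longrightarrow> \<exists>n. \<forall>k\<ge>n. \<forall>l\<ge>n. power_integral p w (\<lambda>x. G k x - G l x) \<le> ennreal \<epsilon>"
 shows "\<exists>g. g \<in> borel_measurable lebesgue \<and> (\<lambda>k. power_integral p w (\<lambda>x. G k x - g x)) \<longlonglongrightarrow> 0"
proof -
 define \<epsilon> where "\<epsilon> i = (1/2) ^ i * 2 powr (- (real i * p))" for i
 have "\<forall>i. \<exists>n. \<forall>k\<ge>n. \<forall>l\<ge>n. power_integral p w (\<lambda>x. G k x - G l x) \<le> ennreal (\<epsilon> i)"
  by (intro allI Cauchy) (simp add: \<epsilon>_def)
 from choice[OF this] obtain n where n: "\<forall>i. \<forall>k\<ge>n i. \<forall>l\<ge>n i. power_integral p w (\<lambda>x. G k x - G l x) \<le> ennreal (\<epsilon> i)" ..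
 \<comment> \<open>Dominates n i at i and at i + 1, so consecutive terms of the subsequence are
   \<epsilon>_i-close, and tends to infinity by the summand i.\<close>
 define s where "s i = (\<Sum>j\<le>i. n j) + i" for i
 have s: "n i \<le> s i" "n i \<le> s (Suc i)" "i \<le> s i" for i
  using member_le_sum[of i "{..i}" n] by (auto simp: s_def)
 define d where "d i x = norm (G (s (Suc i)) x - G (s i) x)" for i x
 define D where "D i x = ennreal (2 powr (real i * p)) * (ennreal (d i x powr p) * ennreal (w x))" for i x
 have Dm: "D i \<in> borel_measurable lebesgue" for i
  unfolding D_def[abs_def] d_def[abs_def]
  by (intro borel_measurable_times_ennreal power_integrand_measurable borel_measurable_diff G w) simp
 have "(\<integral>\<^sup>+x. (\<Sum>i. D i x) \<partial>lebesgue) = (\<Sum>i. \<integral>\<^sup>+x. D i x \<partial>lebesgue)"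
  by (rule nn_integral_suminf[OF Dm])
 also have "\<dots> \<le> (\<Sum>i. ennreal ((1/2) ^ i))"
 proof (intro suminf_le)
  fix i
  have "(\<integral>\<^sup>+x. D i x \<partial>lebesgue) = ennreal (2 powr (real i * p)) * power_integral p w (\<lambda>x. G (s (Suc i)) x - G (s i) x)"
   unfolding D_def d_def power_integral_def 
   by (intro nn_integral_cmult power_integrand_measurable borel_measurable_diff G w)
  also have "\<dots> \<le> ennreal (2 powr (real i * p)) * ennreal (\<epsilon> i)"
   using n s by (intro mult_left_mono) auto
  also have "\<dots> = ennreal ((1/2) ^ i)"
   by (simp add: \<epsilon>_def powr_minus flip: ennreal_mult)
  finally show "(\<integral>\<^sup>+x. D i x \<partial>lebesgue) \<le> ennreal ((1/2) ^ i)" .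
 qed simp_all
 also have "\<dots> = ennreal (\<Sum>i. (1/2) ^ i)"
  by (intro suminf_ennreal2) (simp_all add: summable_geometric)
 finally have "(\<integral>\<^sup>+x. (\<Sum>i. D i x) \<partial>lebesgue) < \<infinity>"
  by (rule le_less_trans) simp
 then have fin: "(\<integral>\<^sup>+x. (\<Sum>i. D i x) \<partial>lebesgue) \<noteq> \<infinity>"
  by (rule less_imp_neq)
 have "AE x in lebesgue. (\<Sum>i. D i x) \<noteq> \<infinity>"
  by (intro nn_integral_noteq_infinite fin borel_measurable_suminf_order Dm)
 with w(2) have conv: "AE x in lebesgue. convergent (\<lambda>i. G (s i) x)"
 proof eventually_elim
  case (elim x)
  then obtain B where B: "0 \<le> B" "(\<Sum>i. D i x) = ennreal B"
   by (cases "\<Sum>i. D i x") auto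
  define c where "c = (B / w x) powr (1 / p)"
  have d: "d i x \<le> c * (1/2) ^ i" for i
  proof -
   have "D i x \<le> ennreal B"
    unfolding B(2)[symmetric] using sum_le_suminf[of "\<lambda>i. D i x" "{i}"] by simp
   then have "ennreal (2 powr (real i * p) * (d i x powr p * w x)) \<le> ennreal B"
    using elim by (simp add: D_def ennreal_mult)
   then have "2 powr (real i * p) * (d i x powr p * w x) \<le> B"
    using B(1) by (subst (asm) ennreal_le_iff) auto
   moreover have "2 powr (real i * p) * d i x powr p = (2 ^ i * d i x) powr p"
    by (simp add: powr_mult powr_powr d_def flip: powr_realpow)
   ultimately have "(2 ^ i * d i x) powr p \<le> B / w x"
    using elim by (simp add: field_simps)
   then have "((2 ^ i * d i x) powr p) powr (1 / p) \<le> c"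
    unfolding c_def using p by (intro powr_mono2) auto
   then have "2 ^ i * d i x \<le> c"
    using p by (simp add: powr_powr d_def)
   then show ?thesis
    by (simp add: power_one_over field_simps)
  qed
  have "summable (\<lambda>i. G (s (Suc i)) x - G (s i) x)"
  proof (rule summable_comparison_test')
   show "summable (\<lambda>i. c * (1/2) ^ i)"
    by (intro summable_mult summable_geometric) simp
   show "norm (G (s (Suc i)) x - G (s i) x) \<le> c * (1/2) ^ i" for i
    using d[of i] by (simp add: d_def)
  qed
  then obtain L where "(\<lambda>i. G (s (Suc i)) x - G (s i) x) sums L"
   by (auto simp: summable_def)
  then have "(\<lambda>k. \<Sum>i<k. G (s (Suc i)) x - G (s i) x) \<longlonglongrightarrow> L"
   by (simp only: sums_def)
  then have "(\<lambda>k. G (s k) x - G (s 0) x) \<longlonglongrightarrow> L"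
   unfolding sum_lessThan_telescope[of "\<lambda>i. G (s i) x"] .
  then have "(\<lambda>k. (G (s k) x - G (s 0) x) + G (s 0) x) \<longlonglongrightarrow> L + G (s 0) x"
   by (intro tendsto_add tendsto_const)
  then show ?case
   by (auto simp: convergent_def)
 qed
 define g where "g x = lim (\<lambda>i. G (s i) x)" for x
 have gm: "g \<in> borel_measurable lebesgue"
  unfolding g_def[abs_def] using G by (intro borel_measurable_lim_metric)
 have "\<forall>\<^sub>F k in sequentially. power_integral p w (\<lambda>x. G k x - g x) \<le> ennreal e" if e: "0 < e" for e
 proof -
  obtain N where N: "\<forall>k\<ge>N. \<forall>l\<ge>N. power_integral p w (\<lambda>x. G k x - G l x) \<le> ennreal e"
   using Cauchy[OF e] ..
  have "power_integral p w (\<lambda>x. G k x - g x) \<le> ennreal e" if k: "N \<le> k" for k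
  proof -
   \<comment> \<open>Fatou's lemma along the a.e. convergent subsequence.\<close>
   have "power_integral p w (\<lambda>x. G k x - g x) = (\<integral>\<^sup>+x. liminf (\<lambda>i. ennreal (norm (G k x - G (s i) x) powr p) * ennreal (w x)) \<partial>lebesgue)"
    unfolding power_integral_def using conv
   proof (intro nn_integral_cong_AE, eventually_elim)
    case (elim x)
    then have "(\<lambda>i. G (s i) x) \<longlonglongrightarrow> g x"
     unfolding g_def by (simp add: convergent_LIMSEQ_iff)
    then have "(\<lambda>i. norm (G k x - G (s i) x) powr p) \<longlonglongrightarrow> norm (G k x - g x) powr p"
     using p by (intro tendsto_powr' tendsto_norm tendsto_diff tendsto_const) auto
    then have "(\<lambda>i. ennreal (norm (G k x - G (s i) x) powr p) * ennreal (w x)) \<longlonglongrightarrow> ennreal (norm (G k x - g x) powr p) * ennreal (w x)"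
     by (intro tendsto_mult_ennreal tendsto_ennrealI tendsto_const) auto
    then show ?case
     by (intro lim_imp_Liminf[symmetric]) auto
   qed
   also have "\<dots> \<le> liminf (\<lambda>i. power_integral p w (\<lambda>x. G k x - G (s i) x))"
    unfolding power_integral_def 
    by (intro nn_integral_liminf power_integrand_measurable borel_measurable_diff G w)
   also have "\<dots> \<le> liminf (\<lambda>i. ennreal e)"
   proof (intro Liminf_mono)
    show "\<forall>\<^sub>F i in sequentially. power_integral p w (\<lambda>x. G k x - G (s i) x) \<le> ennreal e"
     using eventually_ge_at_top[of N]
    proof eventually_elim
     case (elim i)
     then have "N \<le> s i"
      using s(3)[of i] by linarith
     then show ?case
      using N k by simp
    qed
   qed
   also have "\<dots> = ennreal e"
    by (simp add: Liminf_const)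
   finally show ?thesis .
  qed
  then show ?thesis
   by (auto simp: eventually_sequentially)
 qed
 then show ?thesis
  using gm unfolding tendsto_0_ennreal_iff by (intro exI[of _ g]) simp
qed

text \<open>Cutting both in the value and in the argument gives a bounded function of compact
  support. The truncation is dominated by u, so it stays in the weighted space.\<close>

definition truncate :: "nat \<Rightarrow> ('a::euclidean_space \<Rightarrow> complex) \<Rightarrow> 'a \<Rightarrow> complex" where
 "truncate k u x = (if norm (u x) \<le> real k \<and> norm x \<le> real k then u x else 0)"

lemma norm_truncate_le: "norm (truncate k u x) \<le> norm (u x)"
 by (simp add: truncate_def)

lemma truncate_measurable:
 assumes "u \<in> borel_measurable lebesgue"
 shows "truncate k u \<in> borel_measurable lebesgue"
proof -
 have "{x. norm (u x) \<le> real k} \<in> sets lebesgue"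
  using borel_measurable_le[of "\<lambda>x. norm (u x)" lebesgue "\<lambda>_. real k"] assms by simp
 moreover have "cball 0 (real k) \<in> sets (lebesgue :: 'a measure)"
  by simp
 ultimately have "{x. norm (u x) \<le> real k} \<inter> cball 0 (real k) \<in> sets lebesgue"
  by (rule sets.Int)
 then have "(\<lambda>x. if x \<in> {x. norm (u x) \<le> real k} \<inter> cball 0 (real k) then u x else 0) \<in> borel_measurable lebesgue"
  using assms by (intro measurable_If_set) auto
 then show ?thesis
  unfolding truncate_def[abs_def] by simp
qed

lemma truncate_bounded_compact_support:
 assumes "u \<in> borel_measurable lebesgue"
 shows "truncate k u \<in> bounded_compact_support"
 by (rule bounded_compact_supportI[where B = "real k" and S = "cball 0 (real k)"])
  (auto simp: truncate_def intro: truncate_measurable[OF assms])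

lemma truncate_tendsto:
 assumes u: "u \<in> borel_measurable lebesgue" "power_integral p w u < top" and w: "w \<in> borel_measurable lebesgue" and p: "0 < p"
 shows "(\<lambda>k. power_integral p w (\<lambda>x. u x - truncate k u x)) \<longlonglongrightarrow> 0"
proof -
 have "(\<lambda>k. \<integral>\<^sup>+x. ennreal (norm (u x - truncate k u x) powr p) * ennreal (w x) \<partial>lebesgue) \<longlonglongrightarrow> (\<integral>\<^sup>+x. 0 \<partial>(lebesgue :: 'a measure))"
 proof (rule nn_integral_dominated_convergence[where w = "\<lambda>x. ennreal (norm (u x) powr p) * ennreal (w x)"])
  show "(\<lambda>x. ennreal (norm (u x - truncate k u x) powr p) * ennreal (w x)) \<in> borel_measurable lebesgue" for k
   by (intro power_integrand_measurable borel_measurable_diff truncate_measurable u(1) w)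
  show "(\<lambda>x. ennreal (norm (u x) powr p) * ennreal (w x)) \<in> borel_measurable lebesgue"
   by (rule power_integrand_measurable[OF u(1) w])
  show "AE x in lebesgue. ennreal (norm (u x - truncate k u x) powr p) * ennreal (w x) \<le> ennreal (norm (u x) powr p) * ennreal (w x)" for k
   using p by (intro AE_I2 mult_right_mono ennreal_leI powr_mono2) (auto simp: truncate_def)
  show "(\<integral>\<^sup>+x. ennreal (norm (u x) powr p) * ennreal (w x) \<partial>lebesgue) < \<infinity>"
   using u(2) by (simp add: power_integral_def)
  show "AE x in lebesgue. (\<lambda>k. ennreal (norm (u x - truncate k u x) powr p) * ennreal (w x)) \<longlonglongrightarrow> 0"
  proof (intro AE_I2 tendsto_eventually)
   fix x
   obtain n where n: "norm (u x) + norm x \<le> real n"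
    using real_arch_simple by blast
   show "\<forall>\<^sub>F k in sequentially. ennreal (norm (u x - truncate k u x) powr p) * ennreal (w x) = 0"
    using eventually_ge_at_top[of n]
   proof eventually_elim
    case (elim k)
    then have "norm (u x) + norm x \<le> real k"
     using n by linarith
    then have "norm (u x) \<le> real k" "norm x \<le> real k"
     using norm_ge_zero[of "u x"] norm_ge_zero[of x] by linarith+
    then show ?case
     by (simp add: truncate_def)
   qed
  qed
 qed simp
 then show ?thesis
  by (simp add: power_integral_def)
qed

context weighted_operator
begin

abbreviation norm_in :: "'m \<Rightarrow> (real^'n \<Rightarrow> complex) \<Rightarrow> ennreal" where
 "norm_in j \<equiv> power_integral (ps j) (\<omega> j)"

abbreviation norm_out :: "(real^'n \<Rightarrow> complex) \<Rightarrow> ennreal" where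
 "norm_out \<equiv> power_integral p v"

abbreviation dense_class :: "'m \<Rightarrow> (real^'n \<Rightarrow> complex) set" where
 "dense_class j \<equiv> bounded_compact_support \<inter> wlp (ps j) (\<omega> j)"

lemma v_measurable: "v \<in> borel_measurable lebesgue"
 using wgt_measurable[of None] by (simp only: wgt_None)

lemma v_pos: "AE x in lebesgue. 0 < v x"
 using AE_wgt_pos[of None] by (simp only: wgt_None)

lemma wlp_weightD:
 assumes "u \<in> wlp (ps j) (\<omega> j)"
 shows "u \<in> borel_measurable lebesgue" "norm_in j u < top"
 using assms wlp_iff[OF ps_pos[of j]] by auto

lemma dense_classD:
 assumes "u \<in> dense_class j"
 shows "u \<in> bounded_compact_support" "u \<in> borel_measurable lebesgue" "norm_in j u < top"
 using assms wlp_weightD by auto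

lemma norm_in_triangle:
 assumes "u \<in> borel_measurable lebesgue" "u' \<in> borel_measurable lebesgue" "\<And>x. norm (h x) \<le> norm (u x) + norm (u' x)"
 shows "norm_in j h \<le> ennreal (2 powr ps j) * (norm_in j u + norm_in j u')"
 using assms ps_pos[of j] weight_measurable by (intro power_integral_triangle) auto

lemma norm_in_lincomb:
 assumes "u \<in> borel_measurable lebesgue" "u' \<in> borel_measurable lebesgue"
 shows "norm_in j (\<lambda>x. a * u x + b * u' x) \<le> ennreal (2 powr ps j) * (ennreal (norm a powr ps j) * norm_in j u + ennreal (norm b powr ps j) * norm_in j u')"
proof -
 have "norm_in j (\<lambda>x. a * u x + b * u' x) \<le> ennreal (2 powr ps j) * (norm_in j (\<lambda>x. a * u x) + norm_in j (\<lambda>x. b * u' x))"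
  using assms by (intro norm_in_triangle norm_triangle_ineq) auto
 then show ?thesis
  using assms weight_measurable by (simp add: power_integral_scale)
qed

lemma wlp_lincomb:
 assumes "u \<in> wlp (ps j) (\<omega> j)" "u' \<in> wlp (ps j) (\<omega> j)"
 shows "(\<lambda>x. a * u x + b * u' x) \<in> wlp (ps j) (\<omega> j)"
proof -
 note u = wlp_weightD[OF assms(1)] wlp_weightD[OF assms(2)]
 have "norm_in j (\<lambda>x. a * u x + b * u' x) \<le> ennreal (2 powr ps j) * (ennreal (norm a powr ps j) * norm_in j u + ennreal (norm b powr ps j) * norm_in j u')"
  by (rule norm_in_lincomb[OF u(1,3)])
 also have "\<dots> < top"
  using u(2,4) by (simp add: ennreal_mult_less_top ennreal_add_less_top)
 finally show ?thesis
  using u(1,3) by (simp add: wlp_iff[OF ps_pos])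
qed

lemma dense_class_lincomb:
 assumes "u \<in> dense_class j" "u' \<in> dense_class j"
 shows "(\<lambda>x. a * u x + b * u' x) \<in> dense_class j"
 using assms by (intro IntI bounded_compact_support_lincomb wlp_lincomb) auto

lemma dense_class_diff:
 assumes "u \<in> dense_class j" "u' \<in> dense_class j"
 shows "(\<lambda>x. u x - u' x) \<in> dense_class j"
 using dense_class_lincomb[OF assms, of 1 "-1"] by simp

lemma U_measurable: "(\<And>j. f j \<in> dense_class j) \<Longrightarrow> U f \<in> borel_measurable lebesgue"
 using p0p by (intro weak_extension_measurable[OF U]) auto

lemma norm_out_triangle:
 assumes "u \<in> borel_measurable lebesgue" "u' \<in> borel_measurable lebesgue" "AE x in lebesgue. norm (h x) \<le> norm (u x) + norm (u' x)"
 shows "norm_out h \<le> ennreal (2 powr p) * (norm_out u + norm_out u')"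
 using assms p_pos v_measurable by (intro power_integral_triangle) auto

abbreviation close_inputs :: "real \<Rightarrow> real \<Rightarrow> ('m \<Rightarrow> real^'n \<Rightarrow> complex) \<Rightarrow> ('m \<Rightarrow> real^'n \<Rightarrow> complex) \<Rightarrow> bool" where
 "close_inputs B \<eta> g h \<equiv>
  \<forall>j. g j \<in> dense_class j \<and> h j \<in> dense_class j \<and> norm_in j (g j) \<le> ennreal B \<and> norm_in j (h j) \<le> ennreal B \<and> norm_in j (\<lambda>x. g j x - h j x) \<le> ennreal \<eta>"

text \<open>The entries in S are exchanged one at a time. Each exchange applies the weighted bound
  to a tuple with one small entry and the others bounded by B, and the p-th powers are added with
  the quasi-triangle constant.\<close>

lemma stable_on:
 fixes S :: "'m set"
 assumes "0 \<le> B" "0 < \<epsilon>"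
 shows "\<exists>\<eta>>0. \<forall>g h. close_inputs B \<eta> g h \<longrightarrow>
  norm_out (\<lambda>x. U (\<lambda>j. if j \<in> S then g j else h j) x - U h x) \<le> ennreal \<epsilon>"
 using finite[of S] assms(2)
proof (induction S arbitrary: \<epsilon> rule: finite_induct)
 case empty
 have "norm_out (\<lambda>x. U h x - U h x) = 0" for h
  using p_pos by (simp add: power_integral_def)
 then show ?case
  by (intro exI[of _ 1]) simp
next
 case (insert k S)
 obtain C' where C': "0 \<le> C'" "\<forall>f N. (\<forall>k. f k \<in> bounded_compact_support) \<longrightarrow>
   input_norms f N \<longrightarrow>
   (\<integral>\<^sup>+x. ennreal (norm (U f x) powr p) * ennreal (v x) \<partial>lebesgue) \<le> ennreal (C' * (\<Prod>k\<in>UNIV. N k powr p))"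
  using weighted_bound by (elim exE conjE) (rule that; assumption)
 define \<epsilon>' where "\<epsilon>' = \<epsilon> / (2 * 2 powr p)"
 have \<epsilon>': "0 < \<epsilon>'"
  using insert.prems by (simp add: \<epsilon>'_def)
 obtain \<eta>1 where \<eta>1: "0 < \<eta>1" "\<forall>g h. close_inputs B \<eta>1 g h \<longrightarrow>
  norm_out (\<lambda>x. U (\<lambda>j. if j \<in> S then g j else h j) x - U h x) \<le> ennreal \<epsilon>'"
  using insert.IH[OF \<epsilon>'] by (elim exE conjE) (rule that; assumption)
 define P where "P = (\<Prod>j\<in>UNIV - {k}. (B powr (1 / ps j)) powr p)"
 have P: "0 \<le> P"
  unfolding P_def by (intro prod_nonneg) auto
 \<comment> \<open>The exponent ps k / p converts the small entry, given by a ps k-th power, into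
   the p-th power in the bound: the product becomes \<epsilon>' C' P / (C' P + 1), at most
   \<epsilon>'.\<close>
 define \<eta>2 where "\<eta>2 = (\<epsilon>' / (C' * P + 1)) powr (ps k / p)"
 have CP: "0 < C' * P + 1"
  using C'(1) P by (simp add: add_nonneg_pos)
 have \<eta>2: "0 < \<eta>2"
  using \<epsilon>' CP by (simp add: \<eta>2_def)
 show ?case
 proof (intro exI[of _ "min \<eta>1 \<eta>2"] conjI allI impI)
  show "0 < min \<eta>1 \<eta>2"
   using \<eta>1(1) \<eta>2 by simp
  fix g h :: "'m \<Rightarrow> real^'n \<Rightarrow> complex"
  assume gh: "close_inputs B (min \<eta>1 \<eta>2) g h"
  have g: "g j \<in> dense_class j" "h j \<in> dense_class j" "norm_in j (g j) \<le> ennreal B" "norm_in j (h j) \<le> ennreal B"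
   "norm_in j (\<lambda>x. g j x - h j x) \<le> ennreal (min \<eta>1 \<eta>2)" for j
   using gh[THEN spec[of _ j]] by simp_all
  have le1: "norm_in j (\<lambda>x. g j x - h j x) \<le> ennreal \<eta>1" "norm_in j (\<lambda>x. g j x - h j x) \<le> ennreal \<eta>2" for j
   using g(5)[of j] by (auto elim!: order_trans intro!: ennreal_leI)
  define F where "F = (\<lambda>j. if j \<in> S then g j else h j)"
  have FD: "F j \<in> dense_class j" "norm_in j (F j) \<le> ennreal B" for j
   using g(1,2)[of j] g(3,4)[of j] by (simp_all add: F_def)
  have F: "F j \<in> bounded_compact_support" for j
   using FD(1)[of j] by simp
  have ins: "(\<lambda>j. if j \<in> insert k S then g j else h j) = F(k := g k)" "F = F(k := h k)"
   using insert.hyps by (auto simp: F_def fun_eq_iff)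
  define E where "E = F(k := \<lambda>x. g k x - h k x)"
  have ED: "E j \<in> dense_class j" for j
   using FD(1)[of j] dense_class_diff[OF g(1,2)[of k]] by (simp add: E_def)
  have diff: "AE x in lebesgue. U (F(k := g k)) x - U F x = U E x"
   using weak_extension_diff[OF U, where f = F and u = "g k" and v = "h k" and k = k] F p0p g(1)[of k] g(2)[of k] unfolding E_def ins(2)[symmetric] by simp
  have 1: "norm_out (U E) \<le> ennreal \<epsilon>'"
  proof -
   define N where "N j = (if j = k then \<eta>2 powr (1 / ps k) else B powr (1 / ps j))" for j
   have "0 \<le> N j \<and> norm_in j (E j) \<le> ennreal (N j powr ps j)" for j
    using \<eta>2 assms(1) ps_pos[of j] FD(2)[of j] le1(2)[of k] by (auto simp: N_def E_def powr_powr)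
   then have "norm_out (U E) \<le> ennreal (C' * (\<Prod>j\<in>UNIV. N j powr p))"
    using C'(2)[THEN spec[of _ E], THEN spec[of _ N]] ED unfolding power_integral_def by simp
   also have "(\<Prod>j\<in>UNIV. N j powr p) = (\<eta>2 powr (1 / ps k)) powr p * P"
    by (subst prod.remove[of _ k]) (auto simp: N_def P_def)
   also have "(\<eta>2 powr (1 / ps k)) powr p = \<epsilon>' / (C' * P + 1)"
    using \<epsilon>' CP p_pos ps_pos[of k] by (simp add: \<eta>2_def powr_powr)
   also have "C' * (\<epsilon>' / (C' * P + 1) * P) = \<epsilon>' * ((C' * P) / (C' * P + 1))"
    by simp
   also have "\<dots> \<le> \<epsilon>' * 1"
    using CP \<epsilon>' by (intro mult_left_mono) (simp_all add: divide_le_eq)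
   finally show ?thesis
    by (simp add: ennreal_leI)
  qed
  have 2: "norm_out (\<lambda>x. U F x - U h x) \<le> ennreal \<epsilon>'"
   using \<eta>1(2)[THEN spec[of _ g], THEN spec[of _ h]] g(1-4) le1(1) unfolding F_def by simp
  have hm: "U h \<in> borel_measurable lebesgue"
   by (rule U_measurable[OF g(2)])
  have "norm_out (\<lambda>x. U (F(k := g k)) x - U h x) \<le> ennreal (2 powr p) * (norm_out (U E) + norm_out (\<lambda>x. U F x - U h x))"
  proof (rule norm_out_triangle)
   show "U E \<in> borel_measurable lebesgue"
    by (rule U_measurable[OF ED])
   show "(\<lambda>x. U F x - U h x) \<in> borel_measurable lebesgue"
    by (intro borel_measurable_diff hm U_measurable[OF FD(1)])
   show "AE x in lebesgue. norm (U (F(k := g k)) x - U h x) \<le> norm (U E x) + norm (U F x - U h x)"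
    using diff
   proof eventually_elim
    case (elim x)
    have "U (F(k := g k)) x - U h x = U E x + (U F x - U h x)"
     unfolding elim[symmetric] by simp
    then show ?case
     by (simp only: norm_triangle_ineq)
   qed
  qed
  also have "\<dots> \<le> ennreal (2 powr p) * (ennreal \<epsilon>' + ennreal \<epsilon>')"
   by (intro mult_left_mono add_mono 1 2) simp
  also have "\<dots> = ennreal (2 powr p * (\<epsilon>' + \<epsilon>'))"
   using \<epsilon>' by (simp only: ennreal_plus ennreal_mult' powr_ge_zero less_imp_le)
  also have "2 powr p * (\<epsilon>' + \<epsilon>') = \<epsilon>"
   by (simp add: \<epsilon>'_def)
  finally show "norm_out (\<lambda>x. U (\<lambda>j. if j \<in> insert k S then g j else h j) x - U h x) \<le> ennreal \<epsilon>"
   unfolding ins(1) .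
 qed
qed

end

lemma tendsto_0_ennreal_cmult_add:
 fixes A B :: "nat \<Rightarrow> ennreal"
 assumes "A \<longlonglongrightarrow> 0" "B \<longlonglongrightarrow> 0"
 shows "(\<lambda>k. ennreal c * (A k + B k)) \<longlonglongrightarrow> 0"
proof -
 have "(\<lambda>k. ennreal c * (A k + B k)) \<longlonglongrightarrow> ennreal c * (0 + 0)"
  by (intro ennreal_tendsto_cmult tendsto_add assms) simp
 then show ?thesis
  by simp
qed

lemma tendsto_0_ennreal_cmult:
 fixes A :: "nat \<Rightarrow> ennreal"
 shows "A \<longlonglongrightarrow> 0 \<Longrightarrow> (\<lambda>k. ennreal c * A k) \<longlonglongrightarrow> 0"
 using tendsto_0_ennreal_cmult_add[of A "\<lambda>_. 0" c] by simp

lemma tendsto_0_ennreal_le: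
 fixes A B :: "nat \<Rightarrow> ennreal"
 assumes "\<And>k. A k \<le> B k" "B \<longlonglongrightarrow> 0"
 shows "A \<longlonglongrightarrow> 0"
 unfolding tendsto_0_ennreal_iff
proof (intro allI impI)
 fix \<epsilon> :: real assume "0 < \<epsilon>"
 then have "\<forall>\<^sub>F k in sequentially. B k \<le> ennreal \<epsilon>"
  using assms(2) unfolding tendsto_0_ennreal_iff by simp
 then show "\<forall>\<^sub>F k in sequentially. A k \<le> ennreal \<epsilon>"
  by eventually_elim (rule order_trans[OF assms(1)])
qed

lemma ennreal_eq_0_of_tendsto:
 fixes a :: ennreal
 assumes "\<And>k. a \<le> A k" "A \<longlonglongrightarrow> 0"
 shows "a = 0"
 using tendsto_lowerbound[OF assms(2), of a] assms(1) by simp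

context weighted_operator
begin

abbreviation near_inputs :: "real \<Rightarrow> ('m \<Rightarrow> real^'n \<Rightarrow> complex) \<Rightarrow> ('m \<Rightarrow> real^'n \<Rightarrow> complex) \<Rightarrow> ('m \<Rightarrow> real^'n \<Rightarrow> complex) \<Rightarrow> bool" where
 "near_inputs \<eta> f g h \<equiv>
  \<forall>j. g j \<in> dense_class j \<and> h j \<in> dense_class j \<and> norm_in j (\<lambda>x. f j x - g j x) \<le> ennreal \<eta> \<and> norm_in j (\<lambda>x. f j x - h j x) \<le> ennreal \<eta>"

text \<open>Closeness to a common f is turned into the two requirements of the previous estimate:
  bounded entries and small differences.\<close>

lemma stable_near:
 assumes f: "\<And>j. f j \<in> wlp (ps j) (\<omega> j)" and \<epsilon>: "0 < \<epsilon>"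
 shows "\<exists>\<eta>>0. \<forall>g h. near_inputs \<eta> f g h \<longrightarrow> norm_out (\<lambda>x. U g x - U h x) \<le> ennreal \<epsilon>"
proof -
 note fm = wlp_weightD(1)[OF f]
 define b where "b j = enn2real (norm_in j (f j))" for j
 have b: "norm_in j (f j) = ennreal (b j)" "0 \<le> b j" for j
  using wlp_weightD(2)[OF f[of j]] by (simp_all add: b_def)
 define B where "B = (\<Sum>j\<in>UNIV. 2 powr ps j * (b j + 1))"
 have B: "0 \<le> B" "2 powr ps j * (b j + 1) \<le> B" for j
 proof -
  show "0 \<le> B"
   unfolding B_def using b(2) by (intro sum_nonneg mult_nonneg_nonneg) auto
  show "2 powr ps j * (b j + 1) \<le> B"
   unfolding B_def using b(2) by (intro member_le_sum[where f = "\<lambda>j. 2 powr ps j * (b j + 1)"]) auto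
 qed
 obtain \<eta>0 where \<eta>0: "0 < \<eta>0" "\<forall>g h. close_inputs B \<eta>0 g h \<longrightarrow>
  norm_out (\<lambda>x. U (\<lambda>j. if j \<in> UNIV then g j else h j) x - U h x) \<le> ennreal \<epsilon>"
  using stable_on[OF B(1) \<epsilon>, of UNIV] by (elim exE conjE) (rule that; assumption)
 define c where "c = (\<Sum>j\<in>UNIV. 2 * 2 powr ps j)"
 have c: "2 * 2 powr ps j \<le> c" for j
  unfolding c_def by (intro member_le_sum[where f = "\<lambda>j. 2 * 2 powr ps j"]) auto
 have cpos: "0 < c"
  unfolding c_def by (intro sum_pos) auto
 \<comment> \<open>At most 1, so that the entries obey the bound B; and at most \<eta>0 / c, because
   passing through f doubles the error and costs the quasi-triangle constant.\<close>
 define \<eta> where "\<eta> = min 1 (\<eta>0 / c)"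
 have \<eta>: "0 < \<eta>" "\<eta> \<le> 1" "c * \<eta> \<le> \<eta>0"
  using \<eta>0(1) cpos by (auto simp: \<eta>_def min_def field_simps)
 have bound: "norm_in j u \<le> ennreal B" if "u \<in> dense_class j" "norm_in j (\<lambda>x. f j x - u x) \<le> ennreal \<eta>" for j u
 proof -
  note um = dense_classD(2)[OF that(1)]
  have "norm_in j u \<le> ennreal (2 powr ps j) * (norm_in j (f j) + norm_in j (\<lambda>x. f j x - u x))"
  proof (rule norm_in_triangle[OF fm])
   show "(\<lambda>x. f j x - u x) \<in> borel_measurable lebesgue"
    by (intro borel_measurable_diff fm um)
   show "norm (u x) \<le> norm (f j x) + norm (f j x - u x)" for x
    using norm_triangle_ineq4[of "f j x" "f j x - u x"] by simp
  qed
  also have "\<dots> \<le> ennreal (2 powr ps j) * (ennreal (b j) + ennreal 1)"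
   unfolding b(1) using that(2) \<eta>(2) by (intro mult_left_mono add_mono order_refl order_trans[OF that(2)] ennreal_leI) auto
  also have "\<dots> = ennreal (2 powr ps j * (b j + 1))"
   using b(2)[of j] by (simp only: ennreal_plus ennreal_mult' powr_ge_zero zero_le_one)
  also have "\<dots> \<le> ennreal B"
   by (intro ennreal_leI B(2))
  finally show ?thesis .
 qed
 show ?thesis
 proof (intro exI[of _ \<eta>] conjI allI impI \<eta>(1))
  fix g h :: "'m \<Rightarrow> real^'n \<Rightarrow> complex"
  assume gh: "near_inputs \<eta> f g h"
  have g: "g j \<in> dense_class j" "h j \<in> dense_class j" "norm_in j (\<lambda>x. f j x - g j x) \<le> ennreal \<eta>" "norm_in j (\<lambda>x. f j x - h j x) \<le> ennreal \<eta>" for j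
   using gh[THEN spec[of _ j]] by simp_all
  have gh0: "norm_in j (\<lambda>x. g j x - h j x) \<le> ennreal \<eta>0" for j
  proof -
   have "norm_in j (\<lambda>x. g j x - h j x) \<le> ennreal (2 powr ps j) * (norm_in j (\<lambda>x. f j x - g j x) + norm_in j (\<lambda>x. f j x - h j x))"
   proof (rule norm_in_triangle)
    show "(\<lambda>x. f j x - g j x) \<in> borel_measurable lebesgue" "(\<lambda>x. f j x - h j x) \<in> borel_measurable lebesgue"
     by (intro borel_measurable_diff fm dense_classD(2)[OF g(1)] dense_classD(2)[OF g(2)])+
    show "norm (g j x - h j x) \<le> norm (f j x - g j x) + norm (f j x - h j x)" for x
     using norm_triangle_ineq4[of "f j x - h j x" "f j x - g j x"] by simp
   qed
   also have "\<dots> \<le> ennreal (2 powr ps j) * (ennreal \<eta> + ennreal \<eta>)"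
    by (intro mult_left_mono add_mono g) simp
   also have "\<dots> = ennreal (2 powr ps j * (\<eta> + \<eta>))"
    using \<eta>(1) by (simp only: ennreal_plus ennreal_mult' powr_ge_zero less_imp_le)
   also have "\<dots> \<le> ennreal \<eta>0"
   proof (intro ennreal_leI)
    have "2 powr ps j * (\<eta> + \<eta>) = (2 * 2 powr ps j) * \<eta>"
     by simp
    also have "\<dots> \<le> c * \<eta>"
     using \<eta>(1) by (intro mult_right_mono c) simp
    finally show "2 powr ps j * (\<eta> + \<eta>) \<le> \<eta>0"
     using \<eta>(3) by linarith
   qed
   finally show ?thesis .
  qed
  show "norm_out (\<lambda>x. U g x - U h x) \<le> ennreal \<epsilon>"
   using \<eta>0(2)[THEN spec[of _ g], THEN spec[of _ h]] g(1,2) bound[OF g(1,3)] bound[OF g(2,4)] gh0 by simp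
 qed
qed

lemma truncate_dense_class:
 assumes "u \<in> wlp (ps j) (\<omega> j)"
 shows "truncate k u \<in> dense_class j" "norm_in j (truncate k u) \<le> norm_in j u"
  "(\<lambda>k. norm_in j (\<lambda>x. u x - truncate k u x)) \<longlonglongrightarrow> 0"
proof -
 note u = wlp_weightD[OF assms]
 show le: "norm_in j (truncate k u) \<le> norm_in j u"
  using ps_pos[of j] by (intro power_integral_mono AE_I2 norm_truncate_le) simp
 show "truncate k u \<in> dense_class j"
  using truncate_bounded_compact_support[OF u(1), of k] truncate_measurable[OF u(1), of k] le_less_trans[OF le u(2)]
  by (simp add: wlp_iff[OF ps_pos])
 show "(\<lambda>k. norm_in j (\<lambda>x. u x - truncate k u x)) \<longlonglongrightarrow> 0"
  by (rule truncate_tendsto[OF u weight_measurable ps_pos])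
qed

text \<open>The limit is required along all approximating sequences. Multilinearity and agreement
  with U use sequences other than the truncations.\<close>

definition limit_at :: "('m \<Rightarrow> real^'n \<Rightarrow> complex) \<Rightarrow> (real^'n \<Rightarrow> complex) \<Rightarrow> bool" where
 "limit_at f g \<longleftrightarrow> g \<in> borel_measurable lebesgue \<and>
   (\<forall>h. (\<forall>k j. h k j \<in> dense_class j) \<longrightarrow> (\<forall>j. (\<lambda>k. norm_in j (\<lambda>x. f j x - h k j x)) \<longlonglongrightarrow> 0) \<longrightarrow>
    (\<lambda>k. norm_out (\<lambda>x. U (h k) x - g x)) \<longlonglongrightarrow> 0)"

lemma limit_atD:
 assumes "limit_at f g" "\<And>k j. h k j \<in> dense_class j" "\<And>j. (\<lambda>k. norm_in j (\<lambda>x. f j x - h k j x)) \<longlonglongrightarrow> 0"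
 shows "(\<lambda>k. norm_out (\<lambda>x. U (h k) x - g x)) \<longlonglongrightarrow> 0"
 using assms(1)[unfolded limit_at_def, THEN conjunct2, THEN spec[of _ h]] assms(2,3) by simp

text \<open>The truncations give a Cauchy sequence by stability near f, and any other approximating
  sequence is asymptotically equal to it by the same stability.\<close>

lemma limit_at_exists:
 assumes f: "\<And>j. f j \<in> wlp (ps j) (\<omega> j)"
 shows "\<exists>g. limit_at f g"
proof -
 define t where "t k j = truncate k (f j)" for k j
 have t: "t k j \<in> dense_class j" "(\<lambda>k. norm_in j (\<lambda>x. f j x - t k j x)) \<longlonglongrightarrow> 0" for k j
  unfolding t_def by (rule truncate_dense_class[OF f])+
 have Ut: "U (t k) \<in> borel_measurable lebesgue" for k
  by (rule U_measurable[OF t(1)])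
 have ev: "\<forall>\<^sub>F k in sequentially. \<forall>j. norm_in j (\<lambda>x. f j x - h k j x) \<le> ennreal \<eta>"
  if "\<And>j. (\<lambda>k. norm_in j (\<lambda>x. f j x - h k j x)) \<longlonglongrightarrow> 0" "0 < \<eta>" for h \<eta>
  using that unfolding tendsto_0_ennreal_iff by (intro eventually_all_finite) simp
 have near: "\<forall>\<^sub>F k in sequentially. \<forall>\<^sub>F l in sequentially. norm_out (\<lambda>x. U (h k) x - U (t l) x) \<le> ennreal \<epsilon>"
  if h: "\<And>k j. h k j \<in> dense_class j" "\<And>j. (\<lambda>k. norm_in j (\<lambda>x. f j x - h k j x)) \<longlonglongrightarrow> 0" and \<epsilon>: "0 < \<epsilon>" for h \<epsilon>
 proof -
  obtain \<eta> where \<eta>: "0 < \<eta>" "\<forall>g h. near_inputs \<eta> f g h \<longrightarrow> norm_out (\<lambda>x. U g x - U h x) \<le> ennreal \<epsilon>"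
   using stable_near[OF f \<epsilon>] by (elim exE conjE) (rule that; assumption)
  show ?thesis
   using ev[OF h(2) \<eta>(1)]
  proof eventually_elim
   case (elim k)
   show ?case
    using ev[OF t(2) \<eta>(1)]
   proof eventually_elim
    case (elim l)
    then show ?case
     using \<eta>(2)[THEN spec[of _ "h k"], THEN spec[of _ "t l"]] h(1) t(1) \<open>\<forall>j. norm_in j (\<lambda>x. f j x - h k j x) \<le> ennreal \<eta>\<close> by simp
   qed
  qed
 qed
 have "\<exists>g. g \<in> borel_measurable lebesgue \<and> (\<lambda>k. norm_out (\<lambda>x. U (t k) x - g x)) \<longlonglongrightarrow> 0"
 proof (rule power_integral_complete[OF Ut v_measurable v_pos p_pos])
  fix \<epsilon> :: real assume \<epsilon>: "0 < \<epsilon>"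
  obtain \<eta> where \<eta>: "0 < \<eta>" "\<forall>g h. near_inputs \<eta> f g h \<longrightarrow> norm_out (\<lambda>x. U g x - U h x) \<le> ennreal \<epsilon>"
   using stable_near[OF f \<epsilon>] by (elim exE conjE) (rule that; assumption)
  obtain n where n: "\<forall>k\<ge>n. \<forall>j. norm_in j (\<lambda>x. f j x - t k j x) \<le> ennreal \<eta>"
   using ev[OF t(2) \<eta>(1)] unfolding eventually_sequentially ..
  show "\<exists>n. \<forall>k\<ge>n. \<forall>l\<ge>n. norm_out (\<lambda>x. U (t k) x - U (t l) x) \<le> ennreal \<epsilon>"
  proof (intro exI[of _ n] allI impI)
   fix k l assume "n \<le> k" "n \<le> l"
   then show "norm_out (\<lambda>x. U (t k) x - U (t l) x) \<le> ennreal \<epsilon>"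
    using \<eta>(2)[THEN spec[of _ "t k"], THEN spec[of _ "t l"]] t(1) n by simp
  qed
 qed
 then obtain g where g: "g \<in> borel_measurable lebesgue" "(\<lambda>k. norm_out (\<lambda>x. U (t k) x - g x)) \<longlonglongrightarrow> 0"
  by (elim exE conjE) (rule that; assumption)
 have "(\<lambda>k. norm_out (\<lambda>x. U (h k) x - g x)) \<longlonglongrightarrow> 0"
  if h: "\<And>k j. h k j \<in> dense_class j" "\<And>j. (\<lambda>k. norm_in j (\<lambda>x. f j x - h k j x)) \<longlonglongrightarrow> 0" for h
  unfolding tendsto_0_ennreal_iff
 proof (intro allI impI)
  fix \<epsilon> :: real assume \<epsilon>: "0 < \<epsilon>"
  define \<epsilon>' where "\<epsilon>' = \<epsilon> / (2 * 2 powr p)"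
  have \<epsilon>': "0 < \<epsilon>'"
   using \<epsilon> by (simp add: \<epsilon>'_def)
  have Uh: "U (h k) \<in> borel_measurable lebesgue" for k
   by (rule U_measurable[OF h(1)])
  have gev: "\<forall>\<^sub>F l in sequentially. norm_out (\<lambda>x. U (t l) x - g x) \<le> ennreal \<epsilon>'"
   using g(2) \<epsilon>' unfolding tendsto_0_ennreal_iff by simp
  show "\<forall>\<^sub>F k in sequentially. norm_out (\<lambda>x. U (h k) x - g x) \<le> ennreal \<epsilon>"
   using near[OF h \<epsilon>']
  proof eventually_elim
   case (elim k)
   have "\<forall>\<^sub>F l in sequentially. norm_out (\<lambda>x. U (h k) x - U (t l) x) \<le> ennreal \<epsilon>' \<and> norm_out (\<lambda>x. U (t l) x - g x) \<le> ennreal \<epsilon>'"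
    using elim gev by (rule eventually_conj)
   then obtain l where l: "norm_out (\<lambda>x. U (h k) x - U (t l) x) \<le> ennreal \<epsilon>'" "norm_out (\<lambda>x. U (t l) x - g x) \<le> ennreal \<epsilon>'"
    by (auto simp: eventually_sequentially)
   have "norm_out (\<lambda>x. U (h k) x - g x) \<le> ennreal (2 powr p) * (norm_out (\<lambda>x. U (h k) x - U (t l) x) + norm_out (\<lambda>x. U (t l) x - g x))"
   proof (rule norm_out_triangle)
    show "(\<lambda>x. U (h k) x - U (t l) x) \<in> borel_measurable lebesgue" "(\<lambda>x. U (t l) x - g x) \<in> borel_measurable lebesgue"
     by (intro borel_measurable_diff Uh Ut g(1))+
    show "AE x in lebesgue. norm (U (h k) x - g x) \<le> norm (U (h k) x - U (t l) x) + norm (U (t l) x - g x)"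
     by (intro AE_I2 order_trans[OF eq_refl norm_triangle_ineq]) simp
   qed
   also have "\<dots> \<le> ennreal (2 powr p) * (ennreal \<epsilon>' + ennreal \<epsilon>')"
    by (intro mult_left_mono add_mono l) simp
   also have "\<dots> = ennreal (2 powr p * (\<epsilon>' + \<epsilon>'))"
    using \<epsilon>' by (simp only: ennreal_plus ennreal_mult' powr_ge_zero less_imp_le)
   also have "2 powr p * (\<epsilon>' + \<epsilon>') = \<epsilon>"
    by (simp add: \<epsilon>'_def)
   finally show ?case .
  qed
 qed
 then show ?thesis
  using g(1) unfolding limit_at_def by (intro exI[of _ g]) simp
qed

text \<open>The limit is determined only up to null sets, so a representative is chosen.\<close>

definition extension :: "('m \<Rightarrow> real^'n \<Rightarrow> complex) \<Rightarrow> real^'n \<Rightarrow> complex" where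
 "extension f = (SOME g. limit_at f g)"

lemma limit_at_extension: "(\<And>j. f j \<in> wlp (ps j) (\<omega> j)) \<Longrightarrow> limit_at f (extension f)"
 unfolding extension_def by (rule someI_ex[OF limit_at_exists])

lemma extension_measurable: "(\<And>j. f j \<in> wlp (ps j) (\<omega> j)) \<Longrightarrow> extension f \<in> borel_measurable lebesgue"
 using limit_at_extension[of f] by (simp add: limit_at_def)

text \<open>A constant sequence approximates, so the distance from \<open>U f\<close> to the
  extension is a constant that tends to 0.\<close>

lemma extension_eq:
 assumes f: "\<And>j. f j \<in> dense_class j"
 shows "AE x in lebesgue. extension f x = U f x"
proof -
 have fw: "f j \<in> wlp (ps j) (\<omega> j)" for j
  using f[of j] by simp
 have "(\<lambda>k::nat. norm_out (\<lambda>x. U f x - extension f x)) \<longlonglongrightarrow> 0"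
 proof (rule limit_atD[OF limit_at_extension[OF fw], where h = "\<lambda>_. f"])
  show "(\<lambda>k::nat. norm_in j (\<lambda>x. f j x - f j x)) \<longlonglongrightarrow> 0" for j
   using ps_pos[of j] by (simp add: power_integral_def)
 qed (rule f)
 then have "norm_out (\<lambda>x. U f x - extension f x) = 0"
  by (rule ennreal_eq_0_of_tendsto[OF order_refl])
 then have "AE x in lebesgue. U f x - extension f x = 0"
  by (intro AE_eq_0_of_power_integral[OF _ v_measurable v_pos] borel_measurable_diff U_measurable f extension_measurable fw)
 then show ?thesis
  by eventually_elim simp
qed

lemma extension_multilinear: "multilinear_on (ae_filter lebesgue) (\<lambda>j. wlp (ps j) (\<omega> j)) extension"
 unfolding multilinear_on_def
proof (intro allI impI)
 fix f k u u' a b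
 assume f': "\<forall>j. f j \<in> wlp (ps j) (\<omega> j)" and u: "u \<in> wlp (ps k) (\<omega> k)" and u': "u' \<in> wlp (ps k) (\<omega> k)"
 have f: "f j \<in> wlp (ps j) (\<omega> j)" for j
  using f' by simp
 define s where "s x = a * u x + b * u' x" for x
 have s: "s \<in> wlp (ps k) (\<omega> k)"
  unfolding s_def[abs_def] by (rule wlp_lincomb[OF u u'])
 have upd: "(f(k := y)) j \<in> wlp (ps j) (\<omega> j)" if "y \<in> wlp (ps k) (\<omega> k)" for y j
  using f[of j] that by simp
 define t where "t i j = truncate i (f j)" for i j
 \<comment> \<open>Truncation is not linear, so the combination of u and u' is approximated by the
   combination of their truncations, to which multilinearity of U applies.\<close>
 define st where "st i x = a * truncate i u x + b * truncate i u' x" for i x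
 have st: "st i \<in> dense_class k" for i
  unfolding st_def[abs_def] by (intro dense_class_lincomb truncate_dense_class u u')
 note tm = truncate_dense_class[OF u] truncate_dense_class[OF u']
 have conv: "(\<lambda>i. norm_out (\<lambda>x. U ((t i)(k := y' i)) x - extension (f(k := y)) x)) \<longlonglongrightarrow> 0"
  if y: "y \<in> wlp (ps k) (\<omega> k)" "\<And>i. y' i \<in> dense_class k" "(\<lambda>i. norm_in k (\<lambda>x. y x - y' i x)) \<longlonglongrightarrow> 0" for y y'
 proof (rule limit_atD[OF limit_at_extension[OF upd[OF y(1)]]])
  show "((t i)(k := y' i)) j \<in> dense_class j" for i j
   using y(2)[of i] truncate_dense_class(1)[OF f[of j], of i] by (simp add: t_def)
  show "(\<lambda>i. norm_in j (\<lambda>x. (f(k := y)) j x - ((t i)(k := y' i)) j x)) \<longlonglongrightarrow> 0" for j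
   using y(3) truncate_dense_class(3)[OF f[of j]] by (cases "j = k") (simp_all add: t_def)
 qed
 define e1 where "e1 i = norm_out (\<lambda>x. U ((t i)(k := truncate i u)) x - extension (f(k := u)) x)" for i
 define e2 where "e2 i = norm_out (\<lambda>x. U ((t i)(k := truncate i u')) x - extension (f(k := u')) x)" for i
 define e3 where "e3 i = norm_out (\<lambda>x. U ((t i)(k := st i)) x - extension (f(k := s)) x)" for i
 have e1: "e1 \<longlonglongrightarrow> 0"
  unfolding e1_def[abs_def] by (rule conv[OF u tm(1,3)])
 have e2: "e2 \<longlonglongrightarrow> 0"
  unfolding e2_def[abs_def] by (rule conv[OF u' tm(4,6)])
 have e3: "e3 \<longlonglongrightarrow> 0"
  unfolding e3_def[abs_def]
 proof (rule conv[OF s st])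
  have meas: "(\<lambda>x. u x - truncate i u x) \<in> borel_measurable lebesgue" "(\<lambda>x. u' x - truncate i u' x) \<in> borel_measurable lebesgue" for i
   by (rule borel_measurable_diff[OF wlp_weightD(1)[OF u] truncate_measurable[OF wlp_weightD(1)[OF u]]],
     rule borel_measurable_diff[OF wlp_weightD(1)[OF u'] truncate_measurable[OF wlp_weightD(1)[OF u']]])
  have "norm_in k (\<lambda>x. s x - st i x) \<le> ennreal (2 powr ps k) * (ennreal (norm a powr ps k) * norm_in k (\<lambda>x. u x - truncate i u x) + ennreal (norm b powr ps k) * norm_in k (\<lambda>x. u' x - truncate i u' x))" for i
  proof -
   have "(\<lambda>x. s x - st i x) = (\<lambda>x. a * (u x - truncate i u x) + b * (u' x - truncate i u' x))"
    by (simp add: s_def st_def fun_eq_iff algebra_simps)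
   then show ?thesis
    using norm_in_lincomb[OF meas[of i], of k a b] by simp
  qed
  moreover have "(\<lambda>i. ennreal (2 powr ps k) * (ennreal (norm a powr ps k) * norm_in k (\<lambda>x. u x - truncate i u x) + ennreal (norm b powr ps k) * norm_in k (\<lambda>x. u' x - truncate i u' x))) \<longlonglongrightarrow> 0"
   by (intro tendsto_0_ennreal_cmult_add tendsto_0_ennreal_cmult tm)
  ultimately show "(\<lambda>i. norm_in k (\<lambda>x. s x - st i x)) \<longlonglongrightarrow> 0"
   by (rule tendsto_0_ennreal_le)
 qed
 define w1 w2 w3 where "w1 = extension (f(k := u))" and "w2 = extension (f(k := u'))" and "w3 = extension (f(k := s))"
 have wm: "w1 \<in> borel_measurable lebesgue" "w2 \<in> borel_measurable lebesgue" "w3 \<in> borel_measurable lebesgue"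
  unfolding w1_def w2_def w3_def by (intro extension_measurable upd u u' s)+
 have le: "norm_out (\<lambda>x. w3 x - (a * w1 x + b * w2 x)) \<le>
   ennreal (2 powr p) * (e3 i + ennreal (2 powr p) * (ennreal (norm a powr p) * e1 i + ennreal (norm b powr p) * e2 i))" for i
 proof -
  define u1 u2 u3 where "u1 = U ((t i)(k := truncate i u))" and "u2 = U ((t i)(k := truncate i u'))" and "u3 = U ((t i)(k := st i))"
  have D: "((t i)(k := y)) j \<in> dense_class j" if "y \<in> dense_class k" for y j
   using truncate_dense_class(1)[OF f[of j], of i] that by (simp add: t_def)
  have um: "u1 \<in> borel_measurable lebesgue" "u2 \<in> borel_measurable lebesgue" "u3 \<in> borel_measurable lebesgue"
   unfolding u1_def u2_def u3_def by (intro U_measurable D tm(1,4) st)+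
  have lin: "AE x in lebesgue. u3 x = a * u1 x + b * u2 x"
  proof -
   have m: "multilinear_on (ae_filter lebesgue) (\<lambda>j::'m. lp p0) U"
    using U by (simp add: weak_extension_def)
   have "t i j \<in> lp p0" "truncate i u \<in> lp p0" "truncate i u' \<in> lp p0" for j
    unfolding t_def
    by (intro bounded_compact_support_lp p0p truncate_bounded_compact_support wlp_weightD(1)[OF f] wlp_weightD(1)[OF u] wlp_weightD(1)[OF u'])+
   then show ?thesis
    using m[unfolded multilinear_on_def, THEN spec[of _ "t i"], THEN spec[of _ k], THEN spec[of _ "truncate i u"], THEN spec[of _ "truncate i u'"], THEN spec[of _ a], THEN spec[of _ b]]
    unfolding u1_def u2_def u3_def st_def[abs_def] by simp
  qed
  have lm: "(\<lambda>x. a * (u1 x - w1 x) + b * (u2 x - w2 x)) \<in> borel_measurable lebesgue"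
   by (intro borel_measurable_add borel_measurable_times borel_measurable_diff borel_measurable_const um wm)
  have "norm_out (\<lambda>x. w3 x - (a * w1 x + b * w2 x)) \<le> ennreal (2 powr p) * (norm_out (\<lambda>x. u3 x - w3 x) + norm_out (\<lambda>x. a * (u1 x - w1 x) + b * (u2 x - w2 x)))"
  proof (rule norm_out_triangle[OF _ lm])
   show "(\<lambda>x. u3 x - w3 x) \<in> borel_measurable lebesgue"
    by (intro borel_measurable_diff um wm)
   show "AE x in lebesgue. norm (w3 x - (a * w1 x + b * w2 x)) \<le> norm (u3 x - w3 x) + norm (a * (u1 x - w1 x) + b * (u2 x - w2 x))"
    using lin
   proof eventually_elim
    case (elim x)
    have eq: "w3 x - (a * w1 x + b * w2 x) = (a * (u1 x - w1 x) + b * (u2 x - w2 x)) - (u3 x - w3 x)"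
     unfolding elim by (simp add: algebra_simps)
    show ?case
     unfolding eq by (rule order_trans[OF norm_triangle_ineq4]) (simp only: add.commute order_refl)
   qed
  qed
  also have "\<dots> \<le> ennreal (2 powr p) * (e3 i + ennreal (2 powr p) * (norm_out (\<lambda>x. a * (u1 x - w1 x)) + norm_out (\<lambda>x. b * (u2 x - w2 x))))"
  proof (intro mult_left_mono add_mono)
   show "norm_out (\<lambda>x. u3 x - w3 x) \<le> e3 i"
    by (simp add: e3_def u3_def w3_def)
   show "norm_out (\<lambda>x. a * (u1 x - w1 x) + b * (u2 x - w2 x)) \<le> ennreal (2 powr p) * (norm_out (\<lambda>x. a * (u1 x - w1 x)) + norm_out (\<lambda>x. b * (u2 x - w2 x)))"
    by (intro norm_out_triangle AE_I2 norm_triangle_ineq borel_measurable_times borel_measurable_diff borel_measurable_const um wm)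
  qed simp
  also have "norm_out (\<lambda>x. a * (u1 x - w1 x)) = ennreal (norm a powr p) * e1 i"
   unfolding e1_def u1_def[symmetric] w1_def[symmetric] by (intro power_integral_scale borel_measurable_diff um wm v_measurable)
  also have "norm_out (\<lambda>x. b * (u2 x - w2 x)) = ennreal (norm b powr p) * e2 i"
   unfolding e2_def u2_def[symmetric] w2_def[symmetric] by (intro power_integral_scale borel_measurable_diff um wm v_measurable)
  finally show ?thesis .
 qed
 have "norm_out (\<lambda>x. w3 x - (a * w1 x + b * w2 x)) = 0"
  by (rule ennreal_eq_0_of_tendsto[where A = "\<lambda>i. ennreal (2 powr p) * (e3 i + ennreal (2 powr p) * (ennreal (norm a powr p) * e1 i + ennreal (norm b powr p) * e2 i))", OF le])
   (intro tendsto_0_ennreal_cmult_add tendsto_0_ennreal_cmult e1 e2 e3)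
 then have "AE x in lebesgue. w3 x - (a * w1 x + b * w2 x) = 0"
  by (intro AE_eq_0_of_power_integral[OF _ v_measurable v_pos] borel_measurable_diff borel_measurable_add borel_measurable_times borel_measurable_const wm)
 then show "AE x in lebesgue. extension (f(k := \<lambda>x. a * u x + b * u' x)) x = a * extension (f(k := u)) x + b * extension (f(k := u')) x"
  unfolding w1_def w2_def w3_def s_def[abs_def] by eventually_elim simp
qed

text \<open>Passage from p-th powers to norms. The integral bound is assumed only for the exact
  norms N_j, and its p-th root turns the product of N_j^p into the product of norms.\<close>

lemma wlp_norm_out_le:
 assumes D: "0 \<le> D" and f: "\<And>j. f j \<in> wlp (ps j) (\<omega> j)"
  and le: "\<And>N. (\<And>j. 0 \<le> N j) \<Longrightarrow> (\<And>j. norm_in j (f j) = ennreal (N j powr ps j)) \<Longrightarrow> norm_out g \<le> ennreal (D * (\<Prod>j\<in>UNIV. N j powr p))"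
 shows "wlp_norm p v g \<le> ennreal (D powr (1 / p)) * (\<Prod>j\<in>UNIV. wlp_norm (ps j) (\<omega> j) (f j))"
proof -
 have "\<exists>c. 0 \<le> c \<and> wlp_norm (ps j) (\<omega> j) (f j) = ennreal c \<and> norm_in j (f j) = ennreal (c powr ps j)" for j
 proof -
  have "wlp_norm (ps j) (\<omega> j) (f j) < \<infinity>"
   using f[of j] by (simp add: wlp_def)
  then obtain c where "0 \<le> c" "wlp_norm (ps j) (\<omega> j) (f j) = ennreal c"
   "(\<integral>\<^sup>+x. ennreal (norm (f j x) powr ps j) * ennreal (\<omega> j x) \<partial>lebesgue) = ennreal (c powr ps j)"
   by (rule wlp_norm_eq_real[OF _ ps_pos])
  then show ?thesis
   by (intro exI[of _ c]) (simp add: power_integral_def)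
 qed
 then have "\<forall>j. \<exists>c. 0 \<le> c \<and> wlp_norm (ps j) (\<omega> j) (f j) = ennreal c \<and> norm_in j (f j) = ennreal (c powr ps j)" ..
 from choice[OF this] obtain N where N: "\<forall>j. 0 \<le> N j \<and> wlp_norm (ps j) (\<omega> j) (f j) = ennreal (N j) \<and> norm_in j (f j) = ennreal (N j powr ps j)" ..
 have "norm_out g \<le> ennreal (D * (\<Prod>j\<in>UNIV. N j powr p))"
  using N by (intro le) auto
 then have "wlp_norm p v g \<le> ennreal ((D * (\<Prod>j\<in>UNIV. N j powr p)) powr (1 / p))"
  unfolding power_integral_def using D p_pos by (intro wlp_norm_le) (auto intro!: mult_nonneg_nonneg prod_nonneg)
 also have "(D * (\<Prod>j\<in>UNIV. N j powr p)) powr (1 / p) = D powr (1 / p) * (\<Prod>j\<in>UNIV. N j)"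
 proof -
  have "(D * (\<Prod>j\<in>UNIV. N j powr p)) powr (1 / p) = D powr (1 / p) * (\<Prod>j\<in>UNIV. (N j powr p) powr (1 / p))"
   using D by (subst powr_mult) (auto simp: prod_powr_distrib intro!: prod_nonneg)
  also have "(\<Prod>j\<in>UNIV. (N j powr p) powr (1 / p)) = (\<Prod>j\<in>UNIV. N j)"
   using N p_pos by (intro prod.cong refl) (simp add: powr_powr)
  finally show ?thesis .
 qed
 also have "ennreal (D powr (1 / p) * (\<Prod>j\<in>UNIV. N j)) = ennreal (D powr (1 / p)) * (\<Prod>j\<in>UNIV. wlp_norm (ps j) (\<omega> j) (f j))"
  using N by (simp add: ennreal_mult' prod_ennreal)
 finally show ?thesis .
qed

text \<open>The bound for f follows from the bound for its truncations and the convergence of their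
  images, at the price of the quasi-triangle constant.\<close>

proposition weighted_extension:
 "\<exists>C'. (\<forall>f. (\<forall>j. f j \<in> dense_class j) \<longrightarrow> wlp_norm p v (U f) \<le> ennreal C' * (\<Prod>j\<in>UNIV. wlp_norm (ps j) (\<omega> j) (f j))) \<and>
   (\<forall>f. (\<forall>j. f j \<in> wlp (ps j) (\<omega> j)) \<longrightarrow> wlp_norm p v (extension f) \<le> ennreal C' * (\<Prod>j\<in>UNIV. wlp_norm (ps j) (\<omega> j) (f j)))"
proof -
 obtain D where D: "0 \<le> D" "\<forall>f N. (\<forall>k. f k \<in> bounded_compact_support) \<longrightarrow>
   input_norms f N \<longrightarrow>
   (\<integral>\<^sup>+x. ennreal (norm (U f x) powr p) * ennreal (v x) \<partial>lebesgue) \<le> ennreal (D * (\<Prod>k\<in>UNIV. N k powr p))"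
  using weighted_bound by (elim exE conjE) (rule that; assumption)
 have bound: "norm_out (U f) \<le> ennreal (D * (\<Prod>k\<in>UNIV. N k powr p))"
  if "\<And>k. f k \<in> bounded_compact_support" "\<And>k. 0 \<le> N k" "\<And>k. norm_in k (f k) \<le> ennreal (N k powr ps k)" for f N
  using D(2)[THEN spec[of _ f], THEN spec[of _ N]] that unfolding power_integral_def by simp
 \<comment> \<open>The factor 2^p arises in the limit; since it is at least 1, the enlarged constant
   also covers the dense class.\<close>
 define D2 where "D2 = 2 powr p * D"
 have D2: "0 \<le> D2" "D \<le> D2"
 proof -
  show "0 \<le> D2"
   using D(1) by (simp add: D2_def)
  have "1 \<le> 2 powr p"
   using p_pos by (intro ge_one_powr_ge_zero) auto
  then show "D \<le> D2"
   using mult_right_mono[of 1 "2 powr p" D] D(1) by (simp add: D2_def)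
 qed
 show ?thesis
 proof (intro exI[of _ "D2 powr (1 / p)"] conjI allI impI)
  fix f :: "'m \<Rightarrow> real^'n \<Rightarrow> complex"
  assume f': "\<forall>j. f j \<in> dense_class j"
  show "wlp_norm p v (U f) \<le> ennreal (D2 powr (1 / p)) * (\<Prod>j\<in>UNIV. wlp_norm (ps j) (\<omega> j) (f j))"
  proof (rule wlp_norm_out_le[OF D2(1)])
   show "f j \<in> wlp (ps j) (\<omega> j)" for j
    using f' by simp
   fix N :: "'m \<Rightarrow> real"
   assume N: "\<And>j. 0 \<le> N j" "\<And>j. norm_in j (f j) = ennreal (N j powr ps j)"
   have "norm_out (U f) \<le> ennreal (D * (\<Prod>j\<in>UNIV. N j powr p))"
    by (rule bound) (use f' N in simp_all)
   also have "\<dots> \<le> ennreal (D2 * (\<Prod>j\<in>UNIV. N j powr p))"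
    by (intro ennreal_leI mult_right_mono D2 prod_nonneg) simp
   finally show "norm_out (U f) \<le> ennreal (D2 * (\<Prod>j\<in>UNIV. N j powr p))" .
  qed
 next
  fix f :: "'m \<Rightarrow> real^'n \<Rightarrow> complex"
  assume f': "\<forall>j. f j \<in> wlp (ps j) (\<omega> j)"
  have f: "f j \<in> wlp (ps j) (\<omega> j)" for j
   using f' by simp
  define t where "t k j = truncate k (f j)" for k j
  have t: "t k j \<in> dense_class j" "norm_in j (t k j) \<le> norm_in j (f j)" "(\<lambda>k. norm_in j (\<lambda>x. f j x - t k j x)) \<longlonglongrightarrow> 0" for k j
   unfolding t_def by (rule truncate_dense_class[OF f])+
  show "wlp_norm p v (extension f) \<le> ennreal (D2 powr (1 / p)) * (\<Prod>j\<in>UNIV. wlp_norm (ps j) (\<omega> j) (f j))"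
  proof (rule wlp_norm_out_le[OF D2(1) f])
   fix N :: "'m \<Rightarrow> real"
   assume N: "\<And>j. 0 \<le> N j" "\<And>j. norm_in j (f j) = ennreal (N j powr ps j)"
   define P where "P = (\<Prod>j\<in>UNIV. N j powr p)"
   have P: "0 \<le> P"
    unfolding P_def by (intro prod_nonneg) simp
   define e where "e k = norm_out (\<lambda>x. U (t k) x - extension f x)" for k
   have e: "e \<longlonglongrightarrow> 0"
    unfolding e_def[abs_def] by (rule limit_atD[OF limit_at_extension[OF f] t(1,3)])
   have le: "norm_out (extension f) \<le> ennreal (2 powr p) * (ennreal (D * P) + e k)" for k
   proof -
    have Ut: "U (t k) \<in> borel_measurable lebesgue"
     by (rule U_measurable[OF t(1)])
    have "norm_out (extension f) \<le> ennreal (2 powr p) * (norm_out (U (t k)) + e k)"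
     unfolding e_def
    proof (rule norm_out_triangle[OF Ut])
     show "(\<lambda>x. U (t k) x - extension f x) \<in> borel_measurable lebesgue"
      by (intro borel_measurable_diff Ut extension_measurable f)
     show "AE x in lebesgue. norm (extension f x) \<le> norm (U (t k) x) + norm (U (t k) x - extension f x)"
     proof (rule AE_I2)
      fix x
      show "norm (extension f x) \<le> norm (U (t k) x) + norm (U (t k) x - extension f x)"
       using norm_triangle_ineq4[of "U (t k) x" "U (t k) x - extension f x"] by simp
     qed
    qed
    also have "\<dots> \<le> ennreal (2 powr p) * (ennreal (D * P) + e k)"
    proof (intro mult_left_mono add_right_mono)
     show "norm_out (U (t k)) \<le> ennreal (D * P)"
      unfolding P_def
     proof (rule bound[OF dense_classD(1)[OF t(1)] N(1)])
      show "norm_in j (t k j) \<le> ennreal (N j powr ps j)" for j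
       using t(2)[where k = k and j = j] N(2)[of j] by simp
     qed
    qed simp
    finally show ?thesis .
   qed
   have "(\<lambda>k. ennreal (2 powr p) * (ennreal (D * P) + e k)) \<longlonglongrightarrow> ennreal (2 powr p) * (ennreal (D * P) + 0)"
    by (intro ennreal_tendsto_cmult tendsto_add tendsto_const e) simp
   then have "norm_out (extension f) \<le> ennreal (2 powr p) * (ennreal (D * P) + 0)"
    by (rule LIMSEQ_le_const) (use le in auto)
   also have "\<dots> = ennreal (D2 * P)"
    by (simp add: D2_def ennreal_mult'[symmetric] mult.assoc)
   finally show "norm_out (extension f) \<le> ennreal (D2 * (\<Prod>j\<in>UNIV. N j powr p))"
    unfolding P_def .
  qed
 qed
qed

end

theorem theorem3p2:
 fixes T :: "('m::finite \<Rightarrow> real^'n::finite \<Rightarrow> complex) \<Rightarrow> (real^'n \<Rightarrow> complex) \<Rightarrow> complex"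
  and K :: "real^'n \<Rightarrow> ('m \<Rightarrow> real^'n) \<Rightarrow> complex"
  and p0 \<delta>0 C0 p :: real
  and ps :: "'m \<Rightarrow> real"
  and \<omega> :: "'m \<Rightarrow> real^'n \<Rightarrow> real"
  and v :: "real^'n \<Rightarrow> real"
 assumes p0: "1 \<le> p0"
  and T: "multilinear_schwartz_operator T"
  and kernel: "has_kernel T K"
  and boundedness: "\<And>qs q. admissible_exponents p0 qs q \<Longrightarrow> \<exists>U. weak_extension T qs q U"
  and delta0: "\<delta>0 > CARD('n) / p0"
  and C0: "C0 > 0"
  and regularity: "kernel_regularity p0 \<delta>0 C0 K"
  and ps: "\<And>j. p0 < ps j"
  and p: "1 / p = (\<Sum>j\<in>UNIV. 1 / ps j)"
  and weights: "multi_weight (\<lambda>j. ps j / p0) \<omega>"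
  and v: "v = (\<lambda>x. \<Prod>j\<in>UNIV. \<omega> j x powr (p / ps j))"
 shows "\<exists>C::real.
  (\<forall>qs q U f. admissible_exponents p0 qs q \<longrightarrow> weak_extension T qs q U \<longrightarrow>
    (\<forall>j. f j \<in> bounded_compact_support \<inter> wlp (ps j) (\<omega> j)) \<longrightarrow>
    wlp_norm p v (U f) \<le> ennreal C * (\<Prod>j\<in>UNIV. wlp_norm (ps j) (\<omega> j) (f j))) \<and>
  (\<exists>W. multilinear_on (ae_filter lebesgue) (\<lambda>j. wlp (ps j) (\<omega> j)) W \<and>
    (\<forall>f. (\<forall>j. f j \<in> wlp (ps j) (\<omega> j)) \<longrightarrow>
     W f \<in> borel_measurable lebesgue \<and>
     wlp_norm p v (W f) \<le> ennreal C * (\<Prod>j\<in>UNIV. wlp_norm (ps j) (\<omega> j) (f j))) \<and>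
    (\<forall>qs q U f. admissible_exponents p0 qs q \<longrightarrow> weak_extension T qs q U \<longrightarrow>
     (\<forall>j. f j \<in> bounded_compact_support \<inter> wlp (ps j) (\<omega> j)) \<longrightarrow>
     (AE x in lebesgue. W f x = U f x)))"
proof -
 \<comment> \<open>The target exponent for m equal exponents p0, from m/p0 = 1/q0.\<close>
 define q0 where "q0 = p0 / real CARD('m)"
 have q0: "0 < q0" "(\<Sum>k\<in>(UNIV :: 'm set). 1 / p0) = 1 / q0"
  using p0 by (simp_all add: q0_def)
 have adm: "admissible_exponents p0 (\<lambda>_::'m. p0) q0"
  unfolding admissible_exponents_def using q0 by simp
 obtain U0 where U0: "weak_extension T (\<lambda>_. p0) q0 U0"
  using boundedness[OF adm] ..
 interpret weighted_operator T K U0 p0 \<delta>0 C0 q0 p ps \<omega> v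
 proof
  show "1 \<le> p0" "has_kernel T K" "kernel_regularity p0 \<delta>0 C0 K" "0 < C0" "real CARD('n) / p0 < \<delta>0"
   "weak_extension T (\<lambda>_. p0) q0 U0" "0 < q0" "(\<Sum>k\<in>(UNIV :: 'm set). 1 / p0) = 1 / q0"
   "\<And>j. p0 < ps j" "1 / p = (\<Sum>j\<in>UNIV. 1 / ps j)" "multi_weight (\<lambda>j. ps j / p0) \<omega>"
   "v = (\<lambda>x. \<Prod>j\<in>UNIV. \<omega> j x powr (p / ps j))"
   by (rule p0 kernel regularity C0 delta0 U0 q0 ps p weights v)+
 qed
 obtain C where C: "\<forall>f. (\<forall>j. f j \<in> dense_class j) \<longrightarrow> wlp_norm p v (U0 f) \<le> ennreal C * (\<Prod>j\<in>UNIV. wlp_norm (ps j) (\<omega> j) (f j))"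
   "\<forall>f. (\<forall>j. f j \<in> wlp (ps j) (\<omega> j)) \<longrightarrow> wlp_norm p v (extension f) \<le> ennreal C * (\<Prod>j\<in>UNIV. wlp_norm (ps j) (\<omega> j) (f j))"
  using weighted_extension by (elim exE conjE) (rule that; assumption)
 \<comment> \<open>Every other extension agrees a.e. with the one fixed above on bounded inputs of
   compact support, so one constant and one operator serve all of them.\<close>
 have unique: "AE x in lebesgue. U f x = U0 f x"
  if "admissible_exponents p0 qs q" "weak_extension T qs q U" "\<forall>j. f j \<in> dense_class j" for qs q U f
  using that(3) by (intro weak_extension_unique[OF p0 that(2,1) U0 adm]) simp
 show ?thesis
 proof (intro exI[of _ C] conjI allI impI)
  fix qs q U and f :: "'m \<Rightarrow> real^'n \<Rightarrow> complex"
  assume *: "admissible_exponents p0 qs q" "weak_extension T qs q U" "\<forall>j. f j \<in> dense_class j"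
  have "AE x in lebesgue. norm (U f x) = norm (U0 f x)"
   using unique[OF *] by eventually_elim simp
  then have "wlp_norm p v (U f) = wlp_norm p v (U0 f)"
   unfolding wlp_norm_def power_integral_def[symmetric] by (simp only: power_integral_cong)
  then show "wlp_norm p v (U f) \<le> ennreal C * (\<Prod>j\<in>UNIV. wlp_norm (ps j) (\<omega> j) (f j))"
   using C(1)[THEN spec[of _ f]] *(3) by (simp only:) simp
 next
  show "\<exists>W. multilinear_on (ae_filter lebesgue) (\<lambda>j. wlp (ps j) (\<omega> j)) W \<and>
    (\<forall>f. (\<forall>j. f j \<in> wlp (ps j) (\<omega> j)) \<longrightarrow>
     W f \<in> borel_measurable lebesgue \<and>
     wlp_norm p v (W f) \<le> ennreal C * (\<Prod>j\<in>UNIV. wlp_norm (ps j) (\<omega> j) (f j))) \<and>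
    (\<forall>qs q U f. admissible_exponents p0 qs q \<longrightarrow> weak_extension T qs q U \<longrightarrow>
     (\<forall>j. f j \<in> bounded_compact_support \<inter> wlp (ps j) (\<omega> j)) \<longrightarrow>
     (AE x in lebesgue. W f x = U f x))"
  proof (intro exI[of _ extension] conjI allI impI extension_multilinear)
   fix f :: "'m \<Rightarrow> real^'n \<Rightarrow> complex"
   assume f: "\<forall>j. f j \<in> wlp (ps j) (\<omega> j)"
   show "extension f \<in> borel_measurable lebesgue"
    by (rule extension_measurable) (use f in simp)
   show "wlp_norm p v (extension f) \<le> ennreal C * (\<Prod>j\<in>UNIV. wlp_norm (ps j) (\<omega> j) (f j))"
    using C(2)[THEN spec[of _ f]] f by (elim impE)
  next
   fix qs q U and f :: "'m \<Rightarrow> real^'n \<Rightarrow> complex"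
   assume *: "admissible_exponents p0 qs q" "weak_extension T qs q U" "\<forall>j. f j \<in> dense_class j"
   have "AE x in lebesgue. extension f x = U0 f x"
    by (rule extension_eq) (use *(3) in simp)
   with unique[OF *] show "AE x in lebesgue. extension f x = U f x"
    by eventually_elim simp
  qed
 qed
qed

end
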